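(* Let $k\ge0$ and let $F=\{F_E\}$ be a functorial vector bundle morphism $\widetilde{\mathrm{T}}^{k,k}E\to E$, i.e. a family, parameterized by vector bundles $\sigma:E\to M$, of vector bundle morphisms $F_E:\widetilde{\mathrm{T}}^{k,k}E\to E$ from $\widetilde{\mathrm{T}}^{k,k}\sigma:\widetilde{\mathrm{T}}^{k,k}E\to\mathrm{T}^{2k}M$ to $\sigma:E\to M$ (covering some maps $\underline{F_E}:\mathrm{T}^{2k}M\to M$) such that for any vector bundle morphism $f:E_1\to E_2$ between vector bundles $\sigma_i:E_i\to M_i$, $i=1,2$, one has $F_{E_2}\circ\widetilde{\mathrm{T}}^{k,k}f=f\circ F_{E_1}$. Then, for every vector bundle $\sigma:E\to M$ over a connected manifold $M$, $F_E$ is a linear combination (with real coefficients) of the morphisms $\Upsilon_{l,\sigma}\circ\tau^{(k)}_{(l),E}$, $0\le l\le k$, where $\tau^{(k)}_{(l),E}:\widetilde{\mathrm{T}}^{k,k}E\to\widetilde{\mathrm{T}}^{l,l}E$ is the canonical projection induced by $\tau^{(k,k)}_{(l,l),E}:\mathrm{T}^k\mathrm{T}^kE\to\mathrm{T}^l\mathrm{T}^lE$.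
   Context: All manifolds and maps are smooth. $\mathrm{T}^kN$ is the bundle of $k$-velocities ($k$-jets at $0$) $\mathbf{t}^k_{t=0}\gamma(t)$ of curves in $N$. Elements of $\mathrm{T}^k\mathrm{T}^kN$ are written $\mathbf{t}^k_{s}\mathbf{t}^k_{t}\phi(s,t)$, and $\tau^{(k,k)}_{(m,n)}:\mathrm{T}^k\mathrm{T}^kN\to\mathrm{T}^m\mathrm{T}^nN$ ($m,n\le k$) is the truncation $\mathbf{t}^k_s\mathbf{t}^k_t\phi\mapsto\mathbf{t}^m_s\mathbf{t}^n_t\phi$. $\mathrm{T}^{2k}M\subset\mathrm{T}^k\mathrm{T}^kM$ via $\mathbf{t}^{2k}_{t=0}\gamma(t)\mapsto\mathbf{t}^k_{s=0}\mathbf{t}^k_{t=0}\gamma(s+t)$. For a vector bundle $\sigma:E\to M$, $\mathrm{T}^k\mathrm{T}^k\sigma:\mathrm{T}^k\mathrm{T}^kE\to\mathrm{T}^k\mathrm{T}^kM$ is a vector bundle. The bundle of semi-holonomic vectors is $$\widetilde{\mathrm{T}}^{k,k}E=\{X\in\mathrm{T}^k\mathrm{T}^kE:\mathrm{T}^k\mathrm{T}^k\sigma(X)\in\mathrm{T}^{2k}M\subset\mathrm{T}^k\mathrm{T}^kM\},$$ a vector bundle over $\mathrm{T}^{2k}M$ with projection $\widetilde{\mathrm{T}}^{k,k}\sigma$. For a vector bundle morphism $f:E_1\to E_2$, $\widetilde{\mathrm{T}}^{k,k}f$ is the restriction of $\mathrm{T}^k\mathrm{T}^kf$. $\Upsilon_{l,\sigma}:\widetilde{\mathrm{T}}^{l,l}E\to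 E$ is the canonical vector bundle morphism covering the projection $\mathrm{T}^{2l}M\to M$ defined as follows. For $\Phi\in\widetilde{\mathrm{T}}^{l,l}E$ over $v^{2l}\in\mathrm{T}^{2l}M$ let $\Phi^{(m,n)}:=\tau^{(l,l)}_{(m,n)}(\Phi)$. For $\xi\in E^*$ over the base point of $v^{2l}$, $$\langle\Upsilon_{l,\sigma}(\Phi),\xi\rangle_\sigma=\Big\langle\sum_{j=0}^l(-1)^j\binom lj\Phi^{(j,l-j)},\mathbf{t}^l\xi\Big\rangle_{\mathrm{T}^{(l)}\sigma},$$ where $\mathbf{t}^l\xi\in\mathrm{T}^lE^*$ is any element over $\xi$ projecting to the $l$-velocity in $\mathrm{T}^lM$ underlying $v^{2l}$ (the result is independent of the choice). The sum is taken in a fibre of the $l$-fold iterated tangent bundle $\mathrm{T}^{(l)}E\to\mathrm{T}^{(l)}M$, which contains all $\mathrm{T}^j\mathrm{T}^{l-j}E$ and $\mathrm{T}^lE$ canonically, and $\langle\cdot,\cdot\rangle_{\mathrm{T}^{(l)}\sigma}$ is the $l$-fold tangent lift of the natural pairing $\langle\cdot,\cdot\rangle_\sigma$ of $E^*$ with $E$. In local coordinates $(x^a,y^i)$ on $E$ ($y^i$ linear on fibres), with lifted coordinates $x^{a,(\alpha)}$, $y^{i,(\beta,\gamma)}$ ($y^{i,(\beta,\gamma)}(\mathbf{t}^l_s\mathbf{t}^l_t\phi)=\partial_s^\beta\partial_t^\gamma|_{0}\,y^i(\phi(s,t))$), $$\Upsilon_{l,\sigma}(x^{a,(\alpha)},y^{i,(\beta,\gamma)})=\Big(x^a,\sum_{\alpha=0}^l(-1)^\alpha\binom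 l\alpha y^{i,(\alpha,l-\alpha)}\Big).$$ Since each $\Upsilon_{l,\sigma}\circ\tau^{(k)}_{(l),E}$ covers the projection $\mathrm{T}^{2k}M\to M$, linear combinations are taken fibrewise in $E$. *)

theory Defs
  imports "HOL-Analysis.Analysis"
begin

section \<open>Smooth functions on open subsets of coordinate spaces\<close>

text \<open>
  The space of n-tuples of reals is the library's \<^term>\<open>Euclidean_space n\<close>: functions
  \<^typ>\<open>nat \<Rightarrow> real\<close> that vanish at all indices \<open>\<ge> n\<close>, with the product topology.  This allows
  all (finite) dimensions to occur within one statement.
\<close>

primrec Ck_on :: "nat \<Rightarrow> (nat \<Rightarrow> real) set \<Rightarrow> nat \<Rightarrow> ((nat \<Rightarrow> real) \<Rightarrow> real) \<Rightarrow> bool" where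
  "Ck_on n U 0 f \<longleftrightarrow> continuous_on U f"
| "Ck_on n U (Suc m) f \<longleftrightarrow> continuous_on U f \<and>
     (\<forall>i<n. \<exists>g. (\<forall>x\<in>U. ((\<lambda>h. f (x(i := h))) has_real_derivative g x) (at (x i))) \<and> Ck_on n U m g)"

definition Cinf_on :: "nat \<Rightarrow> (nat \<Rightarrow> real) set \<Rightarrow> ((nat \<Rightarrow> real) \<Rightarrow> real) \<Rightarrow> bool" where
  "Cinf_on n U f \<longleftrightarrow> (\<forall>m. Ck_on n U m f)"


section \<open>Smooth manifolds and smooth maps\<close>

text \<open>
  A manifold is given by its dimension and an atlas (not necessarily maximal) of charts \<open>(U, \<psi>)\<close>;
  its underlying set is the union of the chart domains, and its topology is the one determined by
  the charts.
\<close>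

type_synonym 'a chart = "'a set \<times> ('a \<Rightarrow> nat \<Rightarrow> real)"

record 'a mfd =
  mdim :: nat
  atlas :: "'a chart set"

definition pts :: "'a mfd \<Rightarrow> 'a set" where
  "pts N = (\<Union>(U, \<psi>) \<in> atlas N. U)"

definition open_in :: "'a mfd \<Rightarrow> 'a set \<Rightarrow> bool" where
  "open_in N W \<longleftrightarrow> W \<subseteq> pts N \<and>
     (\<forall>(U, \<psi>) \<in> atlas N. openin (Euclidean_space (mdim N)) (\<psi> ` (W \<inter> U)))"

definition mtop :: "'a mfd \<Rightarrow> 'a topology" where
  "mtop N = topology (open_in N)"

definition compatible :: "nat \<Rightarrow> 'a chart \<Rightarrow> 'a chart \<Rightarrow> bool" where
  "compatible n = (\<lambda>(U, \<phi>) (V, \<psi>).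
     openin (Euclidean_space n) (\<phi> ` (U \<inter> V)) \<and>
     openin (Euclidean_space n) (\<psi> ` (U \<inter> V)) \<and>
     (\<forall>i<n. Cinf_on n (\<phi> ` (U \<inter> V)) (\<lambda>z. \<psi> (inv_into U \<phi> z) i)) \<and>
     (\<forall>i<n. Cinf_on n (\<psi> ` (U \<inter> V)) (\<lambda>z. \<phi> (inv_into V \<psi> z) i)))"

text \<open>Membership in the maximal atlas.\<close>

definition smooth_chart :: "'a mfd \<Rightarrow> 'a chart \<Rightarrow> bool" where
  "smooth_chart N = (\<lambda>(U, \<phi>). U \<subseteq> pts N \<and> inj_on \<phi> U \<and>
     openin (Euclidean_space (mdim N)) (\<phi> ` U) \<and>
     (\<forall>c \<in> atlas N. compatible (mdim N) (U, \<phi>) c))"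

definition manifold :: "'a mfd \<Rightarrow> bool" where
  "manifold N \<longleftrightarrow> (\<forall>c \<in> atlas N. smooth_chart N c) \<and>
     Hausdorff_space (mtop N) \<and> second_countable (mtop N)"

definition smooth_on :: "'a mfd \<Rightarrow> 'a set \<Rightarrow> 'b mfd \<Rightarrow> ('a \<Rightarrow> 'b) \<Rightarrow> bool" where
  "smooth_on N W P f \<longleftrightarrow> open_in N W \<and>
     (\<forall>p \<in> W. \<exists>(U, \<phi>) \<in> atlas N. \<exists>(V, \<psi>) \<in> atlas P. \<exists>W'.
        open_in N W' \<and> p \<in> W' \<and> W' \<subseteq> U \<inter> W \<and> f ` W' \<subseteq> V \<and>
        (\<forall>j < mdim P. Cinf_on (mdim N) (\<phi> ` W') (\<lambda>z. \<psi> (f (inv_into U \<phi> z)) j)))"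

definition smooth_map :: "'a mfd \<Rightarrow> 'b mfd \<Rightarrow> ('a \<Rightarrow> 'b) \<Rightarrow> bool" where
  "smooth_map N P f \<longleftrightarrow> smooth_on N (pts N) P f"

definition smooth_near :: "'a mfd \<Rightarrow> 'a \<Rightarrow> 'b mfd \<Rightarrow> ('a \<Rightarrow> 'b) \<Rightarrow> bool" where
  "smooth_near N p P f \<longleftrightarrow> (\<exists>W. p \<in> W \<and> smooth_on N W P f)"

definition line :: "real mfd" where
  "line = \<lparr>mdim = 1, atlas = {(UNIV, \<lambda>t i. if i = 0 then t else 0)}\<rparr>"

definition plane :: "(real \<times> real) mfd" where
  "plane = \<lparr>mdim = 2,
     atlas = {(UNIV, \<lambda>(s, t) i. if i = 0 then s else if i = 1 then t else 0)}\<rparr>"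


section \<open>Vector bundles\<close>

text \<open>
  Fibrewise addition and scalar multiplication are total functions whose values matter only on
  points of the total space (in a common fibre).
\<close>

record ('m, 'e) vbundle =
  total :: "'e mfd"
  base :: "'m mfd"
  vproj :: "'e \<Rightarrow> 'm"
  vadd :: "'e \<Rightarrow> 'e \<Rightarrow> 'e"
  vscale :: "real \<Rightarrow> 'e \<Rightarrow> 'e"

definition over :: "('m, 'e) vbundle \<Rightarrow> 'm set \<Rightarrow> 'e set" where
  "over B U = {e \<in> pts (total B). vproj B e \<in> U}"

text \<open>
  A local trivialization over a coordinate neighbourhood \<open>(U, x)\<close> of the base, written as a chart
  \<open>\<psi> = (x\<^sup>a, y\<^sup>i)\<close> of the total space: the first \<open>mdim (base B)\<close> coordinates are those of the base
  point, the remaining ones are linear on fibres, and the image is the full cylinder.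
\<close>

definition vb_chart ::
  "('m, 'e) vbundle \<Rightarrow> 'm set \<Rightarrow> ('m \<Rightarrow> nat \<Rightarrow> real) \<Rightarrow> ('e \<Rightarrow> nat \<Rightarrow> real) \<Rightarrow> bool" where
  "vb_chart B U x \<psi> \<longleftrightarrow>
     smooth_chart (base B) (U, x) \<and> smooth_chart (total B) (over B U, \<psi>) \<and>
     (\<forall>e \<in> over B U. \<forall>i < mdim (base B). \<psi> e i = x (vproj B e) i) \<and>
     (\<forall>e \<in> over B U. \<forall>e' \<in> over B U. vproj B e = vproj B e' \<longrightarrow>
        (\<forall>i. mdim (base B) \<le> i \<longrightarrow> \<psi> (vadd B e e') i = \<psi> e i + \<psi> e' i)) \<and>
     (\<forall>e \<in> over B U. \<forall>c. \<forall>i. mdim (base B) \<le> i \<longrightarrow> \<psi> (vscale B c e) i = c * \<psi> e i) \<and>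
     \<psi> ` over B U = {z \<in> topspace (Euclidean_space (mdim (total B))).
        \<exists>p \<in> U. \<forall>i < mdim (base B). z i = x p i}"

text \<open>The vector space axioms in the fibres follow from the existence of the adapted charts.\<close>

definition vector_bundle :: "('m, 'e) vbundle \<Rightarrow> bool" where
  "vector_bundle B \<longleftrightarrow>
     manifold (total B) \<and> manifold (base B) \<and> mdim (base B) \<le> mdim (total B) \<and>
     smooth_map (total B) (base B) (vproj B) \<and>
     (\<forall>e \<in> pts (total B). \<forall>e' \<in> pts (total B). vproj B e = vproj B e' \<longrightarrow>
        vadd B e e' \<in> pts (total B) \<and> vproj B (vadd B e e') = vproj B e) \<and>
     (\<forall>e \<in> pts (total B). \<forall>c.
        vscale B c e \<in> pts (total B) \<and> vproj B (vscale B c e) = vproj B e) \<and>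
     (\<forall>p \<in> pts (base B). \<exists>U x \<psi>. p \<in> U \<and> vb_chart B U x \<psi>)"

definition vb_morphism ::
  "('m1, 'e1) vbundle \<Rightarrow> ('m2, 'e2) vbundle \<Rightarrow> ('e1 \<Rightarrow> 'e2) \<Rightarrow> bool" where
  "vb_morphism B1 B2 f \<longleftrightarrow>
     smooth_map (total B1) (total B2) f \<and>
     (\<exists>g. smooth_map (base B1) (base B2) g \<and>
        (\<forall>e \<in> pts (total B1). vproj B2 (f e) = g (vproj B1 e))) \<and>
     (\<forall>e \<in> pts (total B1). \<forall>e' \<in> pts (total B1). vproj B1 e = vproj B1 e' \<longrightarrow>
        f (vadd B1 e e') = vadd B2 (f e) (f e')) \<and>
     (\<forall>e \<in> pts (total B1). \<forall>c. f (vscale B1 c e) = vscale B2 c (f e))"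

text \<open>The sum \<open>a 0 + \<dots> + a n\<close> of elements of one fibre.\<close>

primrec fibre_sum :: "('m, 'e) vbundle \<Rightarrow> (nat \<Rightarrow> 'e) \<Rightarrow> nat \<Rightarrow> 'e" where
  "fibre_sum B a 0 = a 0"
| "fibre_sum B a (Suc n) = vadd B (fibre_sum B a n) (a (Suc n))"


section \<open>Higher velocities\<close>

text \<open>The k-velocity at 0 of a curve, as the class of all curve germs with the same k-jet.\<close>

definition vel :: "nat \<Rightarrow> 'a mfd \<Rightarrow> (real \<Rightarrow> 'a) \<Rightarrow> (real \<Rightarrow> 'a) set" where
  "vel k N \<gamma> = {\<delta>. smooth_near line 0 N \<delta> \<and> \<delta> 0 = \<gamma> 0 \<and>
     (\<forall>(U, \<psi>) \<in> atlas N. \<gamma> 0 \<in> U \<longrightarrow> (\<forall>i < mdim N. \<forall>\<alpha> \<le> k.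
        (deriv ^^ \<alpha>) (\<lambda>t. \<psi> (\<delta> t) i) 0 = (deriv ^^ \<alpha>) (\<lambda>t. \<psi> (\<gamma> t) i) 0))}"

definition rep :: "(real \<Rightarrow> 'a) set \<Rightarrow> real \<Rightarrow> 'a" where
  "rep J = (SOME \<gamma>. \<gamma> \<in> J)"

text \<open>
  The lifted coordinates \<open>x\<^sup>i\<^sup>,\<^sup>(\<^sup>\<alpha>\<^sup>)\<close> on the k-velocities, where \<open>x\<^sup>i\<^sup>,\<^sup>(\<^sup>\<alpha>\<^sup>)\<close> has index \<open>\<alpha> * n + i\<close>.
\<close>

definition lift_coords :: "nat \<Rightarrow> nat \<Rightarrow> ('a \<Rightarrow> nat \<Rightarrow> real) \<Rightarrow> (real \<Rightarrow> 'a) set \<Rightarrow> nat \<Rightarrow> real" where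
  "lift_coords k n \<psi> J j =
     (if j < n * (k + 1) then (deriv ^^ (j div n)) (\<lambda>t. \<psi> (rep J t) (j mod n)) 0 else 0)"

definition T_mfd :: "nat \<Rightarrow> 'a mfd \<Rightarrow> (real \<Rightarrow> 'a) set mfd" where
  "T_mfd k N = \<lparr>mdim = mdim N * (k + 1),
     atlas = (\<lambda>(U, \<psi>). ({vel k N \<gamma> |\<gamma>. smooth_near line 0 N \<gamma> \<and> \<gamma> 0 \<in> U},
                         lift_coords k (mdim N) \<psi>)) ` atlas N\<rparr>"

text \<open>The map on k-velocities induced by a smooth map \<open>f\<close> into \<open>P\<close>.\<close>

definition T_map :: "nat \<Rightarrow> 'b mfd \<Rightarrow> ('a \<Rightarrow> 'b) \<Rightarrow> (real \<Rightarrow> 'a) set \<Rightarrow> (real \<Rightarrow> 'b) set" where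
  "T_map k P f J = vel k P (\<lambda>t. f (rep J t))"

text \<open>
  The functor of k-velocities applied to a vector bundle.  Two velocities over the same velocity
  in the base have representatives over the same curve; these are added pointwise.
\<close>

definition T_vb :: "nat \<Rightarrow> ('m, 'e) vbundle \<Rightarrow> ((real \<Rightarrow> 'm) set, (real \<Rightarrow> 'e) set) vbundle" where
  "T_vb k B = \<lparr>total = T_mfd k (total B), base = T_mfd k (base B),
     vproj = T_map k (base B) (vproj B),
     vadd = (\<lambda>J1 J2. THE J. \<exists>\<gamma>1 \<in> J1. \<exists>\<gamma>2 \<in> J2.
        (\<forall>\<^sub>F t in nhds 0. vproj B (\<gamma>1 t) = vproj B (\<gamma>2 t)) \<and>
        J = vel k (total B) (\<lambda>t. vadd B (\<gamma>1 t) (\<gamma>2 t))),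
     vscale = (\<lambda>c. T_map k (total B) (vscale B c))\<rparr>"


section \<open>Iterated velocities and semi-holonomic vectors\<close>

type_synonym 'a vv = "(real \<Rightarrow> (real \<Rightarrow> 'a) set) set"

text \<open>The element of \<open>T\<^sup>mT\<^sup>nN\<close> given by \<open>\<phi>(s, t)\<close>: order \<open>m\<close> in \<open>s\<close>, order \<open>n\<close> in \<open>t\<close>.\<close>

definition vel2 :: "nat \<Rightarrow> nat \<Rightarrow> 'a mfd \<Rightarrow> (real \<times> real \<Rightarrow> 'a) \<Rightarrow> 'a vv" where
  "vel2 m n N \<phi> = vel m (T_mfd n N) (\<lambda>s. vel n N (\<lambda>t. \<phi> (s, t)))"

text \<open>
  Truncation from \<open>T\<^sup>kT\<^sup>kN\<close> to \<open>T\<^sup>mT\<^sup>nN\<close> for \<open>m, n \<le> k\<close>.  The source order \<open>k\<close> does not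
  enter the formula.
\<close>

definition trunc2 :: "nat \<Rightarrow> nat \<Rightarrow> 'a mfd \<Rightarrow> 'a vv \<Rightarrow> 'a vv" where
  "trunc2 m n N X = vel2 m n N (\<lambda>(s, t). rep (rep X s) t)"

definition holonomic :: "nat \<Rightarrow> 'm mfd \<Rightarrow> (real \<Rightarrow> 'm) set \<Rightarrow> 'm vv" where
  "holonomic k M v = vel2 k k M (\<lambda>(s, t). rep v (s + t))"

definition semihol_set :: "nat \<Rightarrow> ('m, 'e) vbundle \<Rightarrow> 'e vv set" where
  "semihol_set k B = {X \<in> pts (total (T_vb k (T_vb k B))).
     vproj (T_vb k (T_vb k B)) X \<in> holonomic k (base B) ` pts (T_mfd (2 * k) (base B))}"

definition semihol_proj :: "nat \<Rightarrow> ('m, 'e) vbundle \<Rightarrow> 'e vv \<Rightarrow> (real \<Rightarrow> 'm) set" where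
  "semihol_proj k B X = (THE v. v \<in> pts (T_mfd (2 * k) (base B)) \<and>
     holonomic k (base B) v = vproj (T_vb k (T_vb k B)) X)"

text \<open>
  The lifted coordinates \<open>(x\<^sup>a\<^sup>,\<^sup>(\<^sup>\<alpha>\<^sup>), y\<^sup>i\<^sup>,\<^sup>(\<^sup>\<beta>\<^sup>,\<^sup>\<gamma>\<^sup>))\<close>, with \<open>\<alpha> \<le> 2k\<close> and \<open>\<beta>, \<gamma> \<le> k\<close>, induced by a vector bundle
  chart; they define the smooth structure of the bundle of semi-holonomic vectors.
\<close>

definition semihol_coords ::
  "nat \<Rightarrow> ('m, 'e) vbundle \<Rightarrow> ('m \<Rightarrow> nat \<Rightarrow> real) \<Rightarrow> ('e \<Rightarrow> nat \<Rightarrow> real) \<Rightarrow> 'e vv \<Rightarrow> nat \<Rightarrow> real" where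
  "semihol_coords k B x \<psi> X j =
     (let n = mdim (base B); r = mdim (total B) - n; q = j - n * (2 * k + 1);
          i = q mod r; \<beta> = (q div r) div (k + 1); \<gamma> = (q div r) mod (k + 1)
      in if j < n * (2 * k + 1) then lift_coords (2 * k) n x (semihol_proj k B X) j
         else if q < r * (k + 1)\<^sup>2 then
           (deriv ^^ \<beta>) (\<lambda>s. (deriv ^^ \<gamma>) (\<lambda>t. \<psi> (rep (rep X s) t) (n + i)) 0) 0
         else 0)"

definition semihol :: "nat \<Rightarrow> ('m, 'e) vbundle \<Rightarrow> ((real \<Rightarrow> 'm) set, 'e vv) vbundle" where
  "semihol k B = \<lparr>
     total = \<lparr>mdim = mdim (base B) * (2 * k + 1) + (mdim (total B) - mdim (base B)) * (k + 1)\<^sup>2,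
       atlas = {({X \<in> semihol_set k B. rep (semihol_proj k B X) 0 \<in> U}, semihol_coords k B x \<psi>)
                | U x \<psi>. vb_chart B U x \<psi>}\<rparr>,
     base = T_mfd (2 * k) (base B),
     vproj = semihol_proj k B,
     vadd = vadd (T_vb k (T_vb k B)),
     vscale = vscale (T_vb k (T_vb k B))\<rparr>"

text \<open>The restriction to semi-holonomic vectors of \<open>T\<^sup>kT\<^sup>kf\<close>, for a morphism \<open>f\<close> into \<open>B\<close>.\<close>

definition semihol_map :: "nat \<Rightarrow> ('m, 'e) vbundle \<Rightarrow> ('d \<Rightarrow> 'e) \<Rightarrow> 'd vv \<Rightarrow> 'e vv" where
  "semihol_map k B f = T_map k (T_mfd k (total B)) (T_map k (total B) f)"


section \<open>The dual bundle and the canonical morphisms\<close>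

text \<open>
  A point of the dual bundle over \<open>p\<close> is a pair \<open>(p, \<xi>)\<close> with \<open>\<xi>\<close> linear on the fibre over \<open>p\<close> and
  extended by 0 to all other points.  A vector bundle chart induces the coordinates
  \<open>(x\<^sup>a, \<xi>\<^sub>i)\<close>, where \<open>\<xi>\<^sub>i\<close> is the value of \<open>\<xi>\<close> on the i-th element of the local frame.
\<close>

definition covectors :: "('m, 'e) vbundle \<Rightarrow> 'm \<Rightarrow> ('e \<Rightarrow> real) set" where
  "covectors B p = {\<xi>. (\<forall>e. e \<notin> over B {p} \<longrightarrow> \<xi> e = 0) \<and>
     (\<forall>e \<in> over B {p}. \<forall>e' \<in> over B {p}. \<xi> (vadd B e e') = \<xi> e + \<xi> e') \<and>
     (\<forall>e \<in> over B {p}. \<forall>c. \<xi> (vscale B c e) = c * \<xi> e)}"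

definition dual_coords ::
  "('m, 'e) vbundle \<Rightarrow> 'm set \<Rightarrow> ('m \<Rightarrow> nat \<Rightarrow> real) \<Rightarrow> ('e \<Rightarrow> nat \<Rightarrow> real)
     \<Rightarrow> 'm \<times> ('e \<Rightarrow> real) \<Rightarrow> nat \<Rightarrow> real" where
  "dual_coords B U x \<psi> = (\<lambda>(p, \<xi>) j.
     if j < mdim (base B) then x p j
     else if j < mdim (total B) then
       \<xi> (inv_into (over B U) \<psi> (\<lambda>i. if i < mdim (base B) then x p i else if i = j then 1 else 0))
     else 0)"

definition dual_mfd :: "('m, 'e) vbundle \<Rightarrow> ('m \<times> ('e \<Rightarrow> real)) mfd" where
  "dual_mfd B = \<lparr>mdim = mdim (total B),
     atlas = {({(p, \<xi>). p \<in> U \<and> \<xi> \<in> covectors B p}, dual_coords B U x \<psi>)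
              | U x \<psi>. vb_chart B U x \<psi>}\<rparr>"

definition pairing :: "'e \<Rightarrow> 'm \<times> ('e \<Rightarrow> real) \<Rightarrow> real" where
  "pairing e \<xi> = snd \<xi> e"

text \<open>\<open>mixed_deriv l g\<close> is the mixed partial derivative of \<open>g\<close> in the variables \<open>s\<^sub>0, \<dots>, s\<^sub>l\<^sub>-\<^sub>1\<close>.\<close>

primrec mixed_deriv :: "nat \<Rightarrow> ((nat \<Rightarrow> real) \<Rightarrow> real) \<Rightarrow> (nat \<Rightarrow> real) \<Rightarrow> real" where
  "mixed_deriv 0 g = g"
| "mixed_deriv (Suc m) g = (\<lambda>s. deriv (\<lambda>h. mixed_deriv m g (s(m := h))) (s m))"

text \<open>
  Elements of the l-fold iterated tangent bundles of \<open>E\<close> and \<open>E\<^sup>*\<close> are represented by families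
  \<open>A\<close> and \<open>Z\<close> depending on \<open>s\<^sub>0, \<dots>, s\<^sub>l\<^sub>-\<^sub>1\<close> and lying over the same family in the base.  The l-fold
  tangent lift of the pairing evaluates to the top mixed derivative at 0 of the pointwise pairing.
\<close>

definition lifted_pairing ::
  "nat \<Rightarrow> ((nat \<Rightarrow> real) \<Rightarrow> 'e) \<Rightarrow> ((nat \<Rightarrow> real) \<Rightarrow> 'm \<times> ('e \<Rightarrow> real)) \<Rightarrow> real" where
  "lifted_pairing l A Z = mixed_deriv l (\<lambda>s. pairing (A s) (Z s)) (\<lambda>_. 0)"

text \<open>
  The inclusions of \<open>T\<^sup>jT\<^sup>l\<^sup>-\<^sup>j\<close> and of \<open>T\<^sup>l\<close> into the l-fold iterated tangent bundle, on
  representatives.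
\<close>

definition incl2 :: "nat \<Rightarrow> nat \<Rightarrow> (real \<times> real \<Rightarrow> 'e) \<Rightarrow> (nat \<Rightarrow> real) \<Rightarrow> 'e" where
  "incl2 l j \<phi> = (\<lambda>s. \<phi> (\<Sum>i<j. s i, \<Sum>i = j..<l. s i))"

definition incl1 :: "nat \<Rightarrow> (real \<Rightarrow> 'd) \<Rightarrow> (nat \<Rightarrow> real) \<Rightarrow> 'd" where
  "incl1 l \<zeta> = (\<lambda>s. \<zeta> (\<Sum>i<l. s i))"

text \<open>
  Here \<open>\<gamma>\<close> represents the 2l-velocity \<open>v\<close> under \<open>\<Phi>\<close>, \<open>\<phi> j\<close> represents the truncation
  \<open>\<Phi>\<^sup>(\<^sup>j\<^sup>,\<^sup>l\<^sup>-\<^sup>j\<^sup>)\<close>, and \<open>\<zeta>\<close> represents an element of \<open>T\<^sup>lE\<^sup>*\<close> over the covector \<open>\<zeta> 0\<close> and over the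
  l-velocity underlying \<open>v\<close>.  Representatives are taken over exactly the same family in
  the base, so that the sum in the fibre of the iterated tangent bundle is a pointwise sum.
\<close>

definition Upsilon :: "nat \<Rightarrow> ('m, 'e) vbundle \<Rightarrow> 'e vv \<Rightarrow> 'e" where
  "Upsilon l B \<Phi> = (THE e. e \<in> over B {rep (semihol_proj l B \<Phi>) 0} \<and>
     (\<forall>\<gamma> \<phi> \<zeta>.
        \<gamma> \<in> semihol_proj l B \<Phi> \<and>
        (\<forall>j\<le>l. smooth_near plane (0, 0) (total B) (\<phi> j) \<and>
           vel2 j (l - j) (total B) (\<phi> j) = trunc2 j (l - j) (total B) \<Phi> \<and>
           (\<forall>\<^sub>F (s, t) in nhds (0, 0). vproj B (\<phi> j (s, t)) = \<gamma> (s + t))) \<and>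
        smooth_near line 0 (dual_mfd B) \<zeta> \<and>
        (\<forall>\<^sub>F t in nhds 0. fst (\<zeta> t) = \<gamma> t) \<longrightarrow>
        pairing e (\<zeta> 0) =
          lifted_pairing l
            (\<lambda>s. fibre_sum B (\<lambda>j. vscale B ((-1) ^ j * real (l choose j)) (incl2 l j (\<phi> j) s)) l)
            (incl1 l \<zeta>)))"


section \<open>Functorial morphisms\<close>

text \<open>
  HOL cannot quantify over all types inside a formula, so total spaces and bases are subsets of one
  arbitrary ambient type \<^typ>\<open>'a\<close>.  Every vector bundle is isomorphic to one of this kind as soon as
  \<^typ>\<open>'a\<close> has at least the cardinality of the continuum.
\<close>

definition functorial_morphism ::
  "nat \<Rightarrow> (('a, 'a) vbundle \<Rightarrow> 'a vv \<Rightarrow> 'a) \<Rightarrow> bool" where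
  "functorial_morphism k F \<longleftrightarrow>
     (\<forall>B. vector_bundle B \<longrightarrow> vb_morphism (semihol k B) B (F B)) \<and>
     (\<forall>B1 B2 f. vector_bundle B1 \<longrightarrow> vector_bundle B2 \<longrightarrow> vb_morphism B1 B2 f \<longrightarrow>
        (\<forall>X \<in> pts (total (semihol k B1)). F B2 (semihol_map k B2 f X) = f (F B1 X)))"

end

theory Submission
  imports Defs
begin

text \<open>
  Take \<open>B = \<real> \<times> \<real>\<^sup>m \<rightarrow> \<real>\<close> with fibre coordinates \<open>w\<^sub>\<beta>\<^sub>\<gamma>\<close>, \<open>\<beta>, \<gamma> \<le> k\<close>, and the semi-holonomic vector \<open>X\<^sub>0\<close>
  of \<open>(s, t) \<mapsto> (s + t, w\<^sub>\<beta>\<^sub>\<gamma> = s\<^sup>\<beta> t\<^sup>\<gamma> / \<beta>! \<gamma>!)\<close>.  It is universal: every semi-holonomic vector \<open>X\<close> of a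
  bundle \<open>E\<close> is the image of \<open>X\<^sub>0\<close> under a morphism \<open>B \<rightarrow> E\<close> covering a curve in the base, whose
  fibre components are linear with the lifted coordinates of \<open>X\<close> as coefficients.  By naturality
  \<open>F X\<close> is therefore the linear expression in the lifted coordinates of \<open>X\<close> given by the components
  \<open>C\<^sub>\<beta>\<^sub>\<gamma>\<close> of \<open>F X\<^sub>0\<close>.

  The base point \<open>u\<close> of \<open>F X\<^sub>0\<close> is \<open>0\<close>, because \<open>u \<mapsto> u + u\<^sup>2\<^sup>k\<^sup>+\<^sup>1\<close> induces a morphism with the same effect
  on \<open>X\<^sub>0\<close> as the identity of \<open>\<real>\<close>.  The function \<open>s + t\<close> times \<open>w\<^sub>\<beta>\<^sub>\<gamma>\<close> has the same jet as
  \<open>(\<beta> + 1) w\<^sub>\<beta>\<^sub>+\<^sub>1\<^sub>,\<^sub>\<gamma> + (\<gamma> + 1) w\<^sub>\<beta>\<^sub>,\<^sub>\<gamma>\<^sub>+\<^sub>1\<close>, so naturality under the corresponding endomorphisms of \<open>B\<close> gives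
  \<open>(\<beta> + 1) C\<^sub>\<beta>\<^sub>+\<^sub>1\<^sub>,\<^sub>\<gamma> + (\<gamma> + 1) C\<^sub>\<beta>\<^sub>,\<^sub>\<gamma>\<^sub>+\<^sub>1 = u C\<^sub>\<beta>\<^sub>\<gamma> = 0\<close>, that is
  \<open>C\<^sub>\<beta>\<^sub>\<gamma> = (-1)\<^sup>\<beta> (\<beta> + \<gamma> choose \<beta>) C\<^sub>0\<^sub>,\<^sub>\<beta>\<^sub>+\<^sub>\<gamma>\<close>, which is the coordinate form of the morphism
  with \<open>l = \<beta> + \<gamma>\<close>.

  If the ambient type is too small to carry \<open>B\<close>, then all manifolds in it have dimension \<open>0\<close> and
  the constant maps are morphisms.
\<close>

section \<open>Calculus on open subsets of coordinate spaces and on the real line\<close>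

subsection \<open>Boxes in coordinate spaces\<close>

text \<open>Two obstacles shape the construction. A 2k-velocity has a representative curve only near
  0, whereas the base of the model is the whole real line; the curve is therefore precomposed with u
  / (1 + (u/e)^(2k+2)), which stays in (-e, e) and has the same derivatives at 0 as u up to order 2k
  + 2. And \<open>F\<close> can be tested only on globally defined morphisms, so every relation
  between the numbers C comes from two such morphisms that act alike on one jet. The recursion holds
  up to the border of the square of indices because jets of order k in each variable do not see
  exponents above k: C is extended by 0 outside the square. The closed formula then forces C to
  vanish for beta + gamma > k as well, so that no order l > k survives. \<open>Upsilon\<close> is a
  definite description over all representatives. Its coordinate formula needs both the cancellation
  of every derivative of the covector curve (the value fits all choices) and explicit polynomial
  representatives paired with coordinate covectors (nothing else fits).\<close>

lemma openin_Euclidean_space_boxD: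
  assumes "openin (Euclidean_space n) U" "x \<in> U"
  shows "\<exists>e>0. \<forall>y \<in> topspace (Euclidean_space n). (\<forall>i<n. \<bar>y i - x i\<bar> < e) \<longrightarrow> y \<in> U"
proof -
  obtain V where V: "openin (powertop_real UNIV) V" "U = V \<inter> {x. \<forall>i\<ge>n. x i = 0}"
    using assms(1) by (auto simp: Euclidean_space_def openin_subtopology)
  obtain X where X: "x \<in> (\<Pi>\<^sub>E i\<in>UNIV. X i)" "\<And>i. open (X i)" "(\<Pi>\<^sub>E i\<in>UNIV. X i) \<subseteq> V"
    using product_topology_open_contains_basis[OF V(1), of x] assms(2) V(2) by auto
  have "\<exists>e>0. \<forall>y. \<bar>y - x i\<bar> < e \<longrightarrow> y \<in> X i" for i
    using X(1) X(2)[of i] unfolding open_dist by (auto simp: dist_real_def PiE_iff)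
  then obtain e where e: "\<And>i. e i > 0" "\<And>i y. \<bar>y - x i\<bar> < e i \<Longrightarrow> y \<in> X i"
    by metis
  \<comment> \<open>The extra element 1 keeps the set nonempty when \<open>n = 0\<close>.\<close>
  define d where "d = Min (insert 1 (e ` {..<n}))"
  have d: "d > 0" "\<And>i. i < n \<Longrightarrow> d \<le> e i"
    using e(1) by (auto simp: d_def)
  have "y \<in> U" if y: "y \<in> topspace (Euclidean_space n)" "\<forall>i<n. \<bar>y i - x i\<bar> < d" for y
  proof -
    have "y i \<in> X i" for i
    proof (cases "i < n")
      case True
      then show ?thesis using y(2) d(2) e(2) by (meson less_le_trans)
    next
      case False
      then have "y i = 0" "x i = 0" using y(1) assms(2) V(2) by (auto simp: topspace_Euclidean_space)
      then show ?thesis using X(1) by (auto simp: PiE_iff dest: spec[of _ i])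
    qed
    then show ?thesis using X(3) V(2) y(1) by (auto simp: topspace_Euclidean_space PiE_iff)
  qed
  then show ?thesis using d(1) by blast
qed

lemma openin_Euclidean_space_coord:
  assumes "i < n" "open S"
  shows "openin (Euclidean_space n) {y \<in> topspace (Euclidean_space n). y i \<in> S}"
proof -
  have "continuous_map (Euclidean_space n) euclideanreal (\<lambda>x. x i)"
    unfolding Euclidean_space_def
    by (intro continuous_map_from_subtopology continuous_map_product_coordinates) auto
  then show ?thesis
    using openin_continuous_map_preimage assms(2) by fastforce
qed

lemma openin_Euclidean_space_box:
  "openin (Euclidean_space n)
     {y \<in> topspace (Euclidean_space n). \<forall>i<n. \<bar>y i - x i\<bar> < e}"
proof -
  have "openin (Euclidean_space n)
     (topspace (Euclidean_space n) \<inter> (\<Inter>i\<in>{..<n}. {y \<in> topspace (Euclidean_space n). y i \<in> ball (x i) e}))"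
  proof (cases "n = 0")
    case True then show ?thesis by simp
  next
    case False
    then show ?thesis
      by (intro openin_Int openin_topspace openin_INT2 openin_Euclidean_space_coord) auto
  qed
  moreover have "topspace (Euclidean_space n) \<inter> (\<Inter>i\<in>{..<n}. {y \<in> topspace (Euclidean_space n). y i \<in> ball (x i) e})
     = {y \<in> topspace (Euclidean_space n). \<forall>i<n. \<bar>y i - x i\<bar> < e}"
    by (auto simp: dist_real_def abs_minus_commute)
  ultimately show ?thesis by simp
qed

lemma openin_Euclidean_space_iff_box:
  "openin (Euclidean_space n) U \<longleftrightarrow> U \<subseteq> topspace (Euclidean_space n) \<and>
     (\<forall>x\<in>U. \<exists>e>0. \<forall>y \<in> topspace (Euclidean_space n). (\<forall>i<n. \<bar>y i - x i\<bar> < e) \<longrightarrow> y \<in> U)"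
    (is "?L \<longleftrightarrow> ?R")
proof
  assume ?L then show ?R
    using openin_Euclidean_space_boxD openin_subset by meson
next
  assume R: ?R
  show ?L
  proof (subst openin_subopen, intro ballI)
    fix x assume "x \<in> U"
    then obtain e where e: "e > 0"
      "\<forall>y \<in> topspace (Euclidean_space n). (\<forall>i<n. \<bar>y i - x i\<bar> < e) \<longrightarrow> y \<in> U"
      using R by blast
    then show "\<exists>T. openin (Euclidean_space n) T \<and> x \<in> T \<and> T \<subseteq> U"
      using \<open>x \<in> U\<close> R
      by (intro exI[of _ "{y \<in> topspace (Euclidean_space n). \<forall>i<n. \<bar>y i - x i\<bar> < e}"])
        (auto simp: openin_Euclidean_space_box)
  qed
qed

lemma topspace_Euclidean_space_update:
  "x \<in> topspace (Euclidean_space n) \<Longrightarrow> i < n \<Longrightarrow> x(i := h) \<in> topspace (Euclidean_space n)"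
  by (auto simp: topspace_Euclidean_space)

lemma eventually_in_openin_Euclidean_space:
  assumes U: "openin (Euclidean_space n) U" "x \<in> U"
    and y: "\<forall>\<^sub>F t in F. y t \<in> topspace (Euclidean_space n)" "\<And>i. i < n \<Longrightarrow> ((\<lambda>t. y t i) \<longlongrightarrow> x i) F"
  shows "\<forall>\<^sub>F t in F. y t \<in> U"
proof -
  obtain e where e: "e > 0"
      "\<forall>y \<in> topspace (Euclidean_space n). (\<forall>i<n. \<bar>y i - x i\<bar> < e) \<longrightarrow> y \<in> U"
    using openin_Euclidean_space_boxD[OF U] by blast
  have "\<forall>\<^sub>F t in F. \<forall>i\<in>{..<n}. \<bar>y t i - x i\<bar> < e"
  proof (rule eventually_ball_finite)
    show "\<forall>i\<in>{..<n}. \<forall>\<^sub>F t in F. \<bar>y t i - x i\<bar> < e"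
      using y(2) e(1) by (auto simp: tendsto_iff dist_real_def)
  qed auto
  with y(1) show ?thesis
    by eventually_elim (use e in auto)
qed

lemma eventually_update_in:
  assumes U: "openin (Euclidean_space n) U" "x \<in> U" "i < n"
  shows "\<forall>\<^sub>F h in nhds (x i). x(i := h) \<in> U"
proof (rule eventually_in_openin_Euclidean_space[OF U(1,2)])
  show "\<forall>\<^sub>F h in nhds (x i). x(i := h) \<in> topspace (Euclidean_space n)"
    by (intro always_eventually allI topspace_Euclidean_space_update subsetD[OF openin_subset[OF U(1)]] U)
  fix j show "((\<lambda>h. (x(i := h)) j) \<longlongrightarrow> x j) (nhds (x i))"
    by (cases "j = i") (auto simp: filterlim_ident tendsto_const)
qed

text \<open>Convergence of the first \<open>n\<close> coordinates is enough, since \<open>y\<close>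
  runs in the coordinate space, where all others vanish.\<close>

lemma continuous_on_Euclidean_tendsto:
  assumes g: "continuous_on V g" "openin (Euclidean_space n) V" "x \<in> V"
    and y: "\<forall>\<^sub>F t in F. y t \<in> topspace (Euclidean_space n)" "\<And>i. i < n \<Longrightarrow> ((\<lambda>t. y t i) \<longlongrightarrow> x i) F"
  shows "((\<lambda>t. g (y t)) \<longlongrightarrow> (g x :: real)) F"
proof (rule topological_tendstoI)
  fix S assume S: "open S" "g x \<in> S"
  have "openin (top_of_set V) (V \<inter> g -` S)"
    using g(1) S(1) by (simp add: continuous_on_open_gen[where T = UNIV] continuous_openin_preimage_gen)
  then have "openin (top_of_set {x. \<forall>i\<ge>n. x i = 0}) (V \<inter> g -` S)"
    using g(2) by (auto simp: Euclidean_space_def euclidean_product_topology intro: openin_trans)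
  then have "openin (Euclidean_space n) (V \<inter> g -` S)"
    by (simp add: Euclidean_space_def euclidean_product_topology)
  then have "\<forall>\<^sub>F t in F. y t \<in> V \<inter> g -` S"
    using S(2) g(3) y by (intro eventually_in_openin_Euclidean_space) auto
  then show "\<forall>\<^sub>F t in F. g (y t) \<in> S"
    by eventually_elim auto
qed

lemma openin_Euclidean_space_vimage:
  assumes U: "openin (Euclidean_space d) U" and V: "openin (Euclidean_space n) V"
    and a: "\<And>z. z \<in> U \<Longrightarrow> a z \<in> topspace (Euclidean_space n)"
      "\<And>i. i < n \<Longrightarrow> continuous_on U (\<lambda>z. a z i)"
  shows "openin (Euclidean_space d) {z \<in> U. a z \<in> V}"
  unfolding openin_Euclidean_space_iff_box
proof (intro conjI ballI)
  show "{z \<in> U. a z \<in> V} \<subseteq> topspace (Euclidean_space d)" using U openin_subset by blast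
  fix x assume x: "x \<in> {z \<in> U. a z \<in> V}"
  have "openin (Euclidean_space d) {z \<in> U. a z \<in> V}"
  proof -
    have E: "Euclidean_space m = top_of_set {x. \<forall>i\<ge>m. x i = 0}" for m
      by (simp add: Euclidean_space_def euclidean_product_topology)
    have "continuous_on U (\<lambda>z i. a z i)"
    proof (rule continuous_on_coordinatewise_then_product)
      fix i show "continuous_on U (\<lambda>z. a z i)"
      proof (cases "i < n")
        case False
        then have "\<And>z. z \<in> U \<Longrightarrow> a z i = 0" using a(1) by (auto simp: topspace_Euclidean_space)
        then show ?thesis by (auto intro: continuous_on_eq[OF continuous_on_const])
      qed (use a in auto)
    qed
    then have "openin (top_of_set U) (U \<inter> a -` V)"
      using continuous_openin_preimage[of U a "{x. \<forall>i\<ge>n. x i = 0}" V] V a(1)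
      by (auto simp: E topspace_Euclidean_space)
    then have "openin (Euclidean_space d) (U \<inter> a -` V)"
      using U openin_trans unfolding E by blast
    moreover have "U \<inter> a -` V = {z \<in> U. a z \<in> V}" by auto
    ultimately show ?thesis by simp
  qed
  then show "\<exists>e>0. \<forall>y\<in>topspace (Euclidean_space d). (\<forall>i<d. \<bar>y i - x i\<bar> < e) \<longrightarrow> y \<in> {z \<in> U. a z \<in> V}"
    using openin_Euclidean_space_boxD x by blast
qed

subsection \<open>Partial derivatives and the classes \<open>C\<^sup>m\<close>\<close>

text \<open>A canonical choice of the derivative functions that \<open>Ck_on\<close> only asserts to
  exist. It does not refer to the set \<open>U\<close>, which makes it suitable for gluing and for
  iteration.\<close>

definition pd :: "nat \<Rightarrow> ((nat \<Rightarrow> real) \<Rightarrow> real) \<Rightarrow> (nat \<Rightarrow> real) \<Rightarrow> real" where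
  "pd i f x = deriv (\<lambda>h. f (x(i := h))) (x i)"

lemma Ck_on_continuous: "Ck_on n U m f \<Longrightarrow> continuous_on U f"
  by (cases m) auto

text \<open>Openness provides a whole coordinate segment around each point on which the two
  functions agree, so that their difference quotients can be compared.\<close>

lemma Ck_on_cong:
  assumes "openin (Euclidean_space n) U" "\<And>x. x \<in> U \<Longrightarrow> f x = g x"
  shows "Ck_on n U m f \<longleftrightarrow> Ck_on n U m g"
proof -
  have der: "((\<lambda>h. f (x(i := h))) has_real_derivative D) (at (x i)) \<longleftrightarrow>
      ((\<lambda>h. g (x(i := h))) has_real_derivative D) (at (x i))" if "x \<in> U" "i < n" for x i D
    by (intro DERIV_cong_ev refl eventually_mono[OF eventually_update_in[OF assms(1) that]])
      (use assms(2) in auto)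
  show ?thesis
  proof (cases m)
    case 0 then show ?thesis using assms(2) by (simp cong: continuous_on_cong)
  next
    case (Suc m')
    have "continuous_on U f \<longleftrightarrow> continuous_on U g" using assms(2) by (simp cong: continuous_on_cong)
    then show ?thesis using der by (simp add: Suc)
  qed
qed

lemma Ck_on_SucE:
  assumes "Ck_on n U (Suc m) f"
  obtains g where "\<And>i x. i < n \<Longrightarrow> x \<in> U \<Longrightarrow> ((\<lambda>h. f (x(i := h))) has_real_derivative g i x) (at (x i))"
    and "\<And>i. i < n \<Longrightarrow> Ck_on n U m (g i)"
proof -
  have "\<forall>i. \<exists>g. i < n \<longrightarrow> (\<forall>x\<in>U. ((\<lambda>h. f (x(i := h))) has_real_derivative g x) (at (x i))) \<and> Ck_on n U m g"
    using conjunct2[OF assms[unfolded Ck_on.simps(2)]] by blast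
  from choice[OF this] show ?thesis
    using that by blast
qed

lemma Ck_on_SucI:
  assumes "continuous_on U f"
    and "\<And>i x. i < n \<Longrightarrow> x \<in> U \<Longrightarrow> ((\<lambda>h. f (x(i := h))) has_real_derivative g i x) (at (x i))"
    and "\<And>i. i < n \<Longrightarrow> Ck_on n U m (g i)"
  shows "Ck_on n U (Suc m) f"
  unfolding Ck_on.simps(2) using assms by blast

text \<open>Derivatives are unique, so any witness in \<open>Ck_on\<close> equals
  \<open>pd i f\<close> on \<open>U\<close>.\<close>

lemma Ck_on_Suc_pd:
  assumes U: "openin (Euclidean_space n) U"
  shows "Ck_on n U (Suc m) f \<longleftrightarrow> continuous_on U f \<and>
    (\<forall>i<n. (\<forall>x\<in>U. ((\<lambda>h. f (x(i := h))) has_real_derivative pd i f x) (at (x i))) \<and> Ck_on n U m (pd i f))"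
    (is "?L \<longleftrightarrow> ?R")
proof
  assume L: ?L
  then obtain g where g: "\<And>i x. i < n \<Longrightarrow> x \<in> U \<Longrightarrow> ((\<lambda>h. f (x(i := h))) has_real_derivative g i x) (at (x i))"
     "\<And>i. i < n \<Longrightarrow> Ck_on n U m (g i)"
    by (rule Ck_on_SucE) (rule that)
  have eq: "pd i f x = g i x" if "i < n" "x \<in> U" for x i
    using DERIV_imp_deriv[OF g(1)[OF that]] by (simp add: pd_def)
  then have "Ck_on n U m (pd i f)" if "i < n" for i
    using Ck_on_cong[OF U, of "pd i f" "g i" m] g(2) that by blast
  then show ?R using Ck_on_continuous[OF L] g(1) eq by simp
next
  assume ?R then show ?L by (intro Ck_on_SucI[where g = "\<lambda>i. pd i f"]) blast+
qed

lemma Ck_on_lower: "Ck_on n U (Suc m) f \<Longrightarrow> Ck_on n U m f"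
proof (induction m arbitrary: f)
  case (Suc m)
  have "continuous_on U f" using Suc.prems by (rule Ck_on_continuous)
  with Suc.prems show ?case
    by (elim Ck_on_SucE, intro Ck_on_SucI) (blast intro: Suc.IH)+
qed simp

lemma Ck_on_subset: "Ck_on n U m f \<Longrightarrow> U' \<subseteq> U \<Longrightarrow> Ck_on n U' m f"
proof (induction m arbitrary: f)
  case (Suc m)
  have "continuous_on U' f" using Suc.prems Ck_on_continuous continuous_on_subset by blast
  with Suc.prems show ?case
    by (elim Ck_on_SucE, intro Ck_on_SucI) (blast intro: Suc.IH)+
qed (auto intro: continuous_on_subset)

lemma Ck_on_const: "Ck_on n U m (\<lambda>_. c)"
proof (induction m arbitrary: c)
  case (Suc m)
  show ?case
  proof (rule Ck_on_SucI[where g = "\<lambda>_ _. 0"])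
    show "((\<lambda>h. c) has_real_derivative 0) (at (x i))" for i and x :: "nat \<Rightarrow> real"
      by (rule DERIV_const)
  qed (rule continuous_on_const Suc)+
qed simp

lemma continuous_on_coord: "continuous_on U (\<lambda>z::nat \<Rightarrow> real. z i)"
  by (rule continuous_on_subset[OF continuous_on_product_coordinates subset_UNIV])

lemma Ck_on_coord: "Ck_on n U m (\<lambda>z. z i)"
proof (cases m)
  case (Suc m')
  show ?thesis unfolding Suc
  proof (rule Ck_on_SucI[where g = "\<lambda>j _. if j = i then 1 else 0"])
    fix j x show "((\<lambda>h. (x(j := h)) i) has_real_derivative (if j = i then 1 else 0)) (at (x j))"
      by (cases "j = i") auto
  qed (simp_all add: Ck_on_const continuous_on_coord)
qed (simp add: continuous_on_coord)

lemma Ck_on_add: "Ck_on n U m f \<Longrightarrow> Ck_on n U m g \<Longrightarrow> Ck_on n U m (\<lambda>z. f z + g z)"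
proof (induction m arbitrary: f g)
  case (Suc m)
  have c: "continuous_on U f" "continuous_on U g" using Suc.prems Ck_on_continuous by blast+
  from Suc.prems show ?case
    by (elim Ck_on_SucE, intro Ck_on_SucI[OF continuous_on_add[OF c] DERIV_add Suc.IH])
qed (simp add: continuous_on_add)

lemma Ck_on_mult: "Ck_on n U m f \<Longrightarrow> Ck_on n U m g \<Longrightarrow> Ck_on n U m (\<lambda>z. f z * g z)"
proof (induction m arbitrary: f g)
  case (Suc m)
  obtain f' where f': "\<And>i x. i < n \<Longrightarrow> x \<in> U \<Longrightarrow> ((\<lambda>h. f (x(i := h))) has_real_derivative f' i x) (at (x i))"
      "\<And>i. i < n \<Longrightarrow> Ck_on n U m (f' i)"
    using Suc.prems(1) by (rule Ck_on_SucE) (rule that)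
  obtain g' where g': "\<And>i x. i < n \<Longrightarrow> x \<in> U \<Longrightarrow> ((\<lambda>h. g (x(i := h))) has_real_derivative g' i x) (at (x i))"
      "\<And>i. i < n \<Longrightarrow> Ck_on n U m (g' i)"
    using Suc.prems(2) by (rule Ck_on_SucE) (rule that)
  show ?case
  proof (rule Ck_on_SucI[where g = "\<lambda>i x. f' i x * g x + g' i x * f x"])
    show "continuous_on U (\<lambda>z. f z * g z)"
      by (intro continuous_on_mult Ck_on_continuous[OF Suc.prems(1)] Ck_on_continuous[OF Suc.prems(2)])
    fix i x assume "i < n" "x \<in> U"
    from DERIV_mult[OF f'(1)[OF this] g'(1)[OF this]]
    show "((\<lambda>h. f (x(i := h)) * g (x(i := h))) has_real_derivative f' i x * g x + g' i x * f x) (at (x i))"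
      by simp
  next
    fix i assume "i < n"
    then show "Ck_on n U m (\<lambda>x. f' i x * g x + g' i x * f x)"
      by (intro Ck_on_add Suc.IH f' g' Ck_on_lower[OF Suc.prems(1)] Ck_on_lower[OF Suc.prems(2)])
  qed
qed (simp add: continuous_on_mult)

lemma Ck_on_sum: "finite I \<Longrightarrow> (\<And>i. i \<in> I \<Longrightarrow> Ck_on n U m (f i)) \<Longrightarrow> Ck_on n U m (\<lambda>z. \<Sum>i\<in>I. f i z)"
  by (induction I rule: finite_induct) (auto intro: Ck_on_const Ck_on_add)

text \<open>The derivative is again a product containing \<open>inverse (f z)\<close>, so the
  induction hypothesis for the same \<open>f\<close> closes the argument.\<close>

lemma Ck_on_inverse:
  assumes "\<And>x. x \<in> U \<Longrightarrow> f x \<noteq> 0"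
  shows "Ck_on n U m f \<Longrightarrow> Ck_on n U m (\<lambda>z. inverse (f z))"
proof (induction m)
  case (Suc m)
  obtain f' where f': "\<And>i x. i < n \<Longrightarrow> x \<in> U \<Longrightarrow> ((\<lambda>h. f (x(i := h))) has_real_derivative f' i x) (at (x i))"
      "\<And>i. i < n \<Longrightarrow> Ck_on n U m (f' i)"
    using Suc.prems by (rule Ck_on_SucE) (rule that)
  note low = Ck_on_lower[OF Suc.prems]
  show ?case
  proof (rule Ck_on_SucI[where g = "\<lambda>i x. (-1) * (inverse (f x) * f' i x * inverse (f x))"])
    show "continuous_on U (\<lambda>z. inverse (f z))"
      using assms by (intro continuous_on_inverse Ck_on_continuous[OF Suc.prems]) auto
    fix i x assume "i < n" "x \<in> U"
    from DERIV_inverse'[OF f'(1)[OF this]] assms[OF \<open>x \<in> U\<close>]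
    show "((\<lambda>h. inverse (f (x(i := h)))) has_real_derivative (-1) * (inverse (f x) * f' i x * inverse (f x))) (at (x i))"
      by simp
  next
    fix i assume "i < n"
    then show "Ck_on n U m (\<lambda>x. (-1) * (inverse (f x) * f' i x * inverse (f x)))"
      by (intro Ck_on_mult Ck_on_const f' Suc.IH low)
  qed
qed (use assms in \<open>auto intro: continuous_on_inverse\<close>)

declare Ck_on.simps(2) [simp del]

lemma Ck_on_partial_at:
  assumes U: "openin (Euclidean_space n) U" "x \<in> U" "i < n" and f: "Ck_on n U (Suc m) f"
  shows "((\<lambda>h. f (x(i := h))) has_real_derivative pd i f x) (at (x i))"
  using f U(2,3) unfolding Ck_on_Suc_pd[OF U(1)] by blast

lemma Ck_on_pd:
  assumes "openin (Euclidean_space n) U" "i < n" "Ck_on n U (Suc m) f"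
  shows "Ck_on n U m (pd i f)"
  using assms(2,3) unfolding Ck_on_Suc_pd[OF assms(1)] by blast

lemma Ck_on_mono: "m' \<le> m \<Longrightarrow> Ck_on n U m f \<Longrightarrow> Ck_on n U m' f"
  by (induction m rule: dec_induct) (auto dest: Ck_on_lower)

text \<open>
  Replacing the coordinates one at a time and applying the mean value theorem to each
  replacement reduces the chain rule to the continuity of the partial derivatives.
\<close>

lemma chain_rule_curve:
  assumes V: "openin (Euclidean_space n) V" and h: "Ck_on n V (Suc 0) h"
    and a0: "a t0 \<in> V" and aE: "\<forall>\<^sub>F t in nhds t0. a t \<in> topspace (Euclidean_space n)"
    and a': "\<And>i. i < n \<Longrightarrow> ((\<lambda>t. a t i) has_real_derivative a' i) (at t0)"
  shows "((\<lambda>t. h (a t)) has_real_derivative (\<Sum>i<n. pd i h (a t0) * a' i)) (at t0)"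
proof -
  define x where "x = a t0"
  define mix where "mix t j = (\<lambda>i. if i < j then a t i else x i)" for t j
  have xV: "x \<in> V" using a0 x_def by simp
  have xE: "x \<in> topspace (Euclidean_space n)" using xV openin_subset[OF V] by blast
  obtain e where e: "e > 0"
      "\<And>y. y \<in> topspace (Euclidean_space n) \<Longrightarrow> (\<forall>i<n. \<bar>y i - x i\<bar> < e) \<Longrightarrow> y \<in> V"
    using openin_Euclidean_space_boxD[OF V xV] by blast
  have lim: "((\<lambda>t. a t i) \<longlongrightarrow> x i) (at t0)" if "i < n" for i
    using DERIV_isCont[OF a'[OF that]] by (simp add: isCont_def x_def)
  have "\<forall>\<^sub>F t in at t0. \<forall>i\<in>{..<n}. \<bar>a t i - x i\<bar> < e"
  proof (rule eventually_ball_finite)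
    show "\<forall>i\<in>{..<n}. \<forall>\<^sub>F t in at t0. \<bar>a t i - x i\<bar> < e"
      using lim e(1) by (auto simp: tendsto_iff dist_real_def)
  qed auto
  moreover have "\<forall>\<^sub>F t in at t0. a t \<in> topspace (Euclidean_space n)"
    using aE by (simp add: eventually_nhds_conv_at)
  ultimately have ev: "\<forall>\<^sub>F t in at t0. (\<forall>i<n. \<bar>a t i - x i\<bar> < e) \<and> a t \<in> topspace (Euclidean_space n)"
    by eventually_elim auto
  have step: "\<exists>\<xi>. \<bar>\<xi> - x j\<bar> \<le> \<bar>a t j - x j\<bar> \<and>
      h (mix t (Suc j)) - h (mix t j) = pd j h ((mix t j)(j := \<xi>)) * (a t j - x j)"
    if t: "(\<forall>i<n. \<bar>a t i - x i\<bar> < e) \<and> a t \<in> topspace (Euclidean_space n)" and j: "j < n" for t j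
  proof -
    have mixj: "mix t (Suc j) = (mix t j)(j := a t j)" "mix t j = (mix t j)(j := x j)"
      by (auto simp: mix_def fun_eq_iff less_Suc_eq)
    have inV: "(mix t j)(j := \<xi>) \<in> V" if "\<bar>\<xi> - x j\<bar> \<le> \<bar>a t j - x j\<bar>" for \<xi>
    proof (rule e(2))
      show "(mix t j)(j := \<xi>) \<in> topspace (Euclidean_space n)"
        using t xE j by (auto simp: topspace_Euclidean_space mix_def)
      show "\<forall>i<n. \<bar>((mix t j)(j := \<xi>)) i - x i\<bar> < e"
        using t that j e(1) by (auto simp: mix_def intro: le_less_trans)
    qed
    have der: "((\<lambda>c. h ((mix t j)(j := c))) has_real_derivative pd j h ((mix t j)(j := \<xi>))) (at \<xi>)"
      if "\<bar>\<xi> - x j\<bar> \<le> \<bar>a t j - x j\<bar>" for \<xi>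
      using Ck_on_partial_at[OF V inV[OF that] j h] by simp
    have eq: "h (mix t j) = h ((mix t j)(j := x j))" using mixj(2) by (rule arg_cong)
    show ?thesis
    proof (cases "a t j" "x j" rule: linorder_cases)
      case equal
      then show ?thesis using mixj by (intro exI[of _ "x j"]) auto
    next
      case less
      have "\<exists>z>a t j. z < x j \<and> h ((mix t j)(j := x j)) - h ((mix t j)(j := a t j))
          = (x j - a t j) * pd j h ((mix t j)(j := z))"
        by (rule MVT2[OF less]) (use less in \<open>intro der, simp\<close>)
      then obtain z where z: "a t j < z" "z < x j" "h ((mix t j)(j := x j)) - h ((mix t j)(j := a t j))
          = (x j - a t j) * pd j h ((mix t j)(j := z))" by blast
      have "h (mix t (Suc j)) - h (mix t j) = pd j h ((mix t j)(j := z)) * (a t j - x j)"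
        unfolding mixj(1) eq using z(3) by (simp add: algebra_simps del: fun_upd_apply)
      then show ?thesis using z less by (intro exI[of _ z]) auto
    next
      case greater
      have "\<exists>z>x j. z < a t j \<and> h ((mix t j)(j := a t j)) - h ((mix t j)(j := x j))
          = (a t j - x j) * pd j h ((mix t j)(j := z))"
        by (rule MVT2[OF greater]) (use greater in \<open>intro der, simp\<close>)
      then obtain z where z: "x j < z" "z < a t j" "h ((mix t j)(j := a t j)) - h ((mix t j)(j := x j))
          = (a t j - x j) * pd j h ((mix t j)(j := z))" by blast
      have "h (mix t (Suc j)) - h (mix t j) = pd j h ((mix t j)(j := z)) * (a t j - x j)"
        unfolding mixj(1) eq using z(3) by (simp add: algebra_simps del: fun_upd_apply)
      then show ?thesis using z greater by (intro exI[of _ z]) auto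
    qed
  qed
  have lim_j: "((\<lambda>t. (h (mix t (Suc j)) - h (mix t j)) / (t - t0)) \<longlongrightarrow> pd j h x * a' j) (at t0)"
    if j: "j < n" for j
  proof -
    have "\<forall>t. \<exists>\<xi>. (\<forall>i<n. \<bar>a t i - x i\<bar> < e) \<and> a t \<in> topspace (Euclidean_space n) \<longrightarrow>
      \<bar>\<xi> - x j\<bar> \<le> \<bar>a t j - x j\<bar> \<and>
      h (mix t (Suc j)) - h (mix t j) = pd j h ((mix t j)(j := \<xi>)) * (a t j - x j)"
      using step j by blast
    then obtain \<xi> where \<xi>: "\<And>t. (\<forall>i<n. \<bar>a t i - x i\<bar> < e) \<and> a t \<in> topspace (Euclidean_space n) \<Longrightarrow>
      \<bar>\<xi> t - x j\<bar> \<le> \<bar>a t j - x j\<bar> \<and>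
      h (mix t (Suc j)) - h (mix t j) = pd j h ((mix t j)(j := \<xi> t)) * (a t j - x j)"
      by metis
    have "((\<lambda>t. \<bar>a t j - x j\<bar>) \<longlongrightarrow> 0) (at t0)"
      using tendsto_rabs_zero[OF LIM_zero[OF lim[OF j]]] .
    then have "((\<lambda>t. \<xi> t - x j) \<longlongrightarrow> 0) (at t0)"
      by (rule Lim_null_comparison[rotated]) (use ev \<xi> in \<open>auto elim!: eventually_mono\<close>)
    then have \<xi>lim: "(\<xi> \<longlongrightarrow> x j) (at t0)" by (simp add: LIM_zero_iff)
    have "((\<lambda>t. pd j h ((mix t j)(j := \<xi> t))) \<longlongrightarrow> pd j h x) (at t0)"
    proof (rule continuous_on_Euclidean_tendsto[OF _ V xV])
      show "continuous_on V (pd j h)" using Ck_on_pd[OF V j h] by simp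
      show "\<forall>\<^sub>F t in at t0. (mix t j)(j := \<xi> t) \<in> topspace (Euclidean_space n)"
        using ev by eventually_elim (use xE j in \<open>auto simp: topspace_Euclidean_space mix_def\<close>)
      fix i assume i: "i < n"
      show "((\<lambda>t. ((mix t j)(j := \<xi> t)) i) \<longlongrightarrow> x i) (at t0)"
        using lim[OF i] \<xi>lim by (cases "i = j"; cases "i < j") (auto simp: mix_def tendsto_const)
    qed
    moreover have "((\<lambda>t. (a t j - x j) / (t - t0)) \<longlongrightarrow> a' j) (at t0)"
      using a'[OF j] by (simp add: has_field_derivative_iff x_def)
    ultimately have "((\<lambda>t. pd j h ((mix t j)(j := \<xi> t)) * ((a t j - x j) / (t - t0))) \<longlongrightarrow> pd j h x * a' j) (at t0)"
      by (rule tendsto_mult)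
    moreover have "\<forall>\<^sub>F t in at t0. pd j h ((mix t j)(j := \<xi> t)) * ((a t j - x j) / (t - t0))
        = (h (mix t (Suc j)) - h (mix t j)) / (t - t0)"
      using ev by eventually_elim (use \<xi> in auto)
    ultimately show ?thesis by (rule Lim_transform_eventually)
  qed
  have "((\<lambda>t. \<Sum>j<n. (h (mix t (Suc j)) - h (mix t j)) / (t - t0)) \<longlongrightarrow> (\<Sum>j<n. pd j h x * a' j)) (at t0)"
    by (intro tendsto_sum lim_j) auto
  moreover have "\<forall>\<^sub>F t in at t0. (\<Sum>j<n. (h (mix t (Suc j)) - h (mix t j)) / (t - t0)) = (h (a t) - h (a t0)) / (t - t0)"
    using ev
  proof eventually_elim
    case (elim t)
    have "(\<Sum>j<n. (h (mix t (Suc j)) - h (mix t j))) = h (mix t n) - h (mix t 0)"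
      by (rule sum_lessThan_telescope)
    moreover have "mix t n = a t" using elim xE by (auto simp: mix_def fun_eq_iff topspace_Euclidean_space)
    moreover have "mix t 0 = a t0" by (simp add: mix_def x_def)
    ultimately show ?case by (simp flip: sum_divide_distrib)
  qed
  ultimately have "((\<lambda>t. (h (a t) - h (a t0)) / (t - t0)) \<longlongrightarrow> (\<Sum>j<n. pd j h x * a' j)) (at t0)"
    by (rule Lim_transform_eventually)
  then show ?thesis by (simp add: has_field_derivative_iff x_def)
qed

lemma continuous_on_Euclidean_coordinatewise:
  assumes "\<And>z. z \<in> U \<Longrightarrow> a z \<in> topspace (Euclidean_space n)"
    and "\<And>i. i < n \<Longrightarrow> continuous_on U (\<lambda>z. a z i)"
  shows "continuous_on U a"
proof (rule continuous_on_coordinatewise_then_product)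
  fix i show "continuous_on U (\<lambda>z. a z i)"
  proof (cases "i < n")
    case False
    then have "\<And>z. z \<in> U \<Longrightarrow> 0 = a z i" using assms(1) by (simp add: topspace_Euclidean_space)
    then show ?thesis by (rule continuous_on_eq[OF continuous_on_const])
  qed (use assms in auto)
qed

text \<open>By the chain rule the partial derivatives are sums of products of \<open>pd i h\<close>
  along \<open>a\<close> with partial derivatives of \<open>a\<close>. The induction hypothesis is
  applied to \<open>pd i h\<close>, hence \<open>h\<close> is generalised.\<close>

lemma Ck_on_compose:
  assumes U: "openin (Euclidean_space d) U" and V: "openin (Euclidean_space n) V"
    and a: "\<And>z. z \<in> U \<Longrightarrow> a z \<in> V" 
  shows "(\<And>i. i < n \<Longrightarrow> Ck_on d U m (\<lambda>z. a z i)) \<Longrightarrow> Ck_on n V m h \<Longrightarrow> Ck_on d U m (\<lambda>z. h (a z))"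
proof (induction m arbitrary: h)
  case 0
  have "continuous_on U a"
    using 0(1) by (intro continuous_on_Euclidean_coordinatewise[of U a n] subsetD[OF openin_subset[OF V]] a) auto
  then show ?case using 0(2) a by (auto intro: continuous_on_compose2[of V h U a])
next
  case (Suc m)
  have acont: "continuous_on U a"
    by (intro continuous_on_Euclidean_coordinatewise[of U a n] subsetD[OF openin_subset[OF V]] a
        Ck_on_continuous[OF Suc.prems(1)])
  show ?case
  proof (rule Ck_on_SucI[where g = "\<lambda>j z. \<Sum>i<n. pd i h (a z) * pd j (\<lambda>z. a z i) z"])
    show "continuous_on U (\<lambda>z. h (a z))"
      by (rule continuous_on_compose2[OF Ck_on_continuous[OF Suc.prems(2)] acont]) (use a in auto)
  next
    fix j x assume j: "j < d" and x: "x \<in> U"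
    have h1: "Ck_on n V (Suc 0) h"
      by (rule Ck_on_mono[OF _ Suc.prems(2)]) simp
    have "((\<lambda>c. h (a (x(j := c)))) has_real_derivative
        (\<Sum>i<n. pd i h (a (x(j := x j))) * pd j (\<lambda>z. a z i) x)) (at (x j))"
    proof (rule chain_rule_curve[OF V h1])
      show "a (x(j := x j)) \<in> V" using a[OF x] by simp
      show "\<forall>\<^sub>F c in nhds (x j). a (x(j := c)) \<in> topspace (Euclidean_space n)"
        using eventually_update_in[OF U x j]
        by eventually_elim (use a openin_subset[OF V] in auto)
      show "((\<lambda>c. a (x(j := c)) i) has_real_derivative pd j (\<lambda>z. a z i) x) (at (x j))" if "i < n" for i
        by (rule Ck_on_partial_at[OF U x j Suc.prems(1)[OF that]])
    qed
    then show "((\<lambda>c. h (a (x(j := c)))) has_real_derivative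
        (\<Sum>i<n. pd i h (a x) * pd j (\<lambda>z. a z i) x)) (at (x j))" by simp
  next
    fix j assume j: "j < d"
    show "Ck_on d U m (\<lambda>z. \<Sum>i<n. pd i h (a z) * pd j (\<lambda>z. a z i) z)"
    proof (rule Ck_on_sum)
      fix i assume "i \<in> {..<n}"
      then have i: "i < n" by simp
      have "Ck_on d U m (\<lambda>z. pd i h (a z))"
        by (rule Suc.IH[OF Ck_on_lower[OF Suc.prems(1)] Ck_on_pd[OF V i Suc.prems(2)]])
      then show "Ck_on d U m (\<lambda>z. pd i h (a z) * pd j (\<lambda>z. a z i) z)"
        by (rule Ck_on_mult[OF _ Ck_on_pd[OF U j Suc.prems(1)[OF i]]])
    qed simp
  qed
qed

lemma continuous_on_Euclidean_local:
  assumes U: "openin (Euclidean_space n) U"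
    and W: "\<And>x. x \<in> U \<Longrightarrow> \<exists>W. openin (Euclidean_space n) W \<and> x \<in> W \<and> W \<subseteq> U \<and> continuous_on W f"
  shows "continuous_on U f"
  unfolding continuous_on_eq_continuous_within
proof
  fix x assume x: "x \<in> U"
  obtain W where W: "openin (Euclidean_space n) W" "x \<in> W" "W \<subseteq> U" "continuous_on W f"
    using W[OF x] by blast
  then obtain T where T: "open T" "W = {x. \<forall>i\<ge>n. x i = 0} \<inter> T"
    by (auto simp: Euclidean_space_def euclidean_product_topology openin_open)
  have "U \<inter> T = W" using T W openin_subset[OF U] by (auto simp: topspace_Euclidean_space)
  then have "at x within U = at x within W"
    using T W by (intro at_within_nhd[of x T]) auto
  then show "continuous (at x within U) f"
    using W by (simp add: continuous_on_eq_continuous_within)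
qed

text \<open>Because \<open>pd\<close> is independent of the set, the derivatives found on the
  neighbourhoods fit together without any choice.\<close>

lemma Ck_on_local:
  assumes "openin (Euclidean_space n) U" "\<And>x. x \<in> U \<Longrightarrow> \<exists>W. openin (Euclidean_space n) W \<and> x \<in> W \<and> W \<subseteq> U \<and> Ck_on n W m f"
  shows "Ck_on n U m f"
  using assms(2)
proof (induction m arbitrary: f)
  case 0
  then show ?case using continuous_on_Euclidean_local[OF assms(1), of f] by simp
next
  case (Suc m)
  have "\<forall>x\<in>U. \<exists>W. openin (Euclidean_space n) W \<and> x \<in> W \<and> W \<subseteq> U \<and> Ck_on n W (Suc m) f"
    using Suc.prems by simp
  then obtain W where W: "\<And>x. x \<in> U \<Longrightarrow> openin (Euclidean_space n) (W x)"
     "\<And>x. x \<in> U \<Longrightarrow> x \<in> W x" "\<And>x. x \<in> U \<Longrightarrow> W x \<subseteq> U" "\<And>x. x \<in> U \<Longrightarrow> Ck_on n (W x) (Suc m) f"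
    by metis
  show ?case
  proof (rule Ck_on_SucI[where g = "\<lambda>i. pd i f"])
    show "continuous_on U f"
      by (rule continuous_on_Euclidean_local[OF assms(1)]) (use W Ck_on_continuous in metis)
    show "((\<lambda>h. f (x(i := h))) has_real_derivative pd i f x) (at (x i))" if "i < n" "x \<in> U" for i x
      by (rule Ck_on_partial_at[OF W(1)[OF that(2)] W(2)[OF that(2)] that(1) W(4)[OF that(2)]])
    show "Ck_on n U m (pd i f)" if "i < n" for i
    proof (rule Suc.IH)
      fix x assume x: "x \<in> U"
      show "\<exists>W. openin (Euclidean_space n) W \<and> x \<in> W \<and> W \<subseteq> U \<and> Ck_on n W m (pd i f)"
        using W[OF x] Ck_on_pd[OF W(1)[OF x] that W(4)[OF x]] by (intro exI[of _ "W x"]) simp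
    qed
  qed
qed

subsection \<open>Smooth functions\<close>

lemma Cinf_on_continuous: "Cinf_on n U f \<Longrightarrow> continuous_on U f"
  unfolding Cinf_on_def by (drule spec[of _ 0]) simp

lemma Cinf_on_cong:
  "openin (Euclidean_space n) U \<Longrightarrow> (\<And>x. x \<in> U \<Longrightarrow> f x = g x) \<Longrightarrow> Cinf_on n U f \<longleftrightarrow> Cinf_on n U g"
  unfolding Cinf_on_def using Ck_on_cong[of n U f g] by simp

lemma Cinf_on_subset: "Cinf_on n U f \<Longrightarrow> U' \<subseteq> U \<Longrightarrow> Cinf_on n U' f"
  using Ck_on_subset[of n U _ f U'] by (simp add: Cinf_on_def)

lemma Cinf_on_const: "Cinf_on n U (\<lambda>_. c)"
  by (simp add: Cinf_on_def Ck_on_const)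

lemma Cinf_on_coord: "Cinf_on n U (\<lambda>z. z i)"
  by (simp add: Cinf_on_def Ck_on_coord)

lemma Cinf_on_add: "Cinf_on n U f \<Longrightarrow> Cinf_on n U g \<Longrightarrow> Cinf_on n U (\<lambda>z. f z + g z)"
  by (simp add: Cinf_on_def Ck_on_add)

lemma Cinf_on_mult: "Cinf_on n U f \<Longrightarrow> Cinf_on n U g \<Longrightarrow> Cinf_on n U (\<lambda>z. f z * g z)"
  by (simp add: Cinf_on_def Ck_on_mult)

lemma Cinf_on_sum: "finite I \<Longrightarrow> (\<And>i. i \<in> I \<Longrightarrow> Cinf_on n U (f i)) \<Longrightarrow> Cinf_on n U (\<lambda>z. \<Sum>i\<in>I. f i z)"
  by (simp add: Cinf_on_def Ck_on_sum)

lemma Cinf_on_power: "Cinf_on n U f \<Longrightarrow> Cinf_on n U (\<lambda>z. f z ^ k)"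
  by (induction k) (simp_all add: Cinf_on_const Cinf_on_mult)

lemma Cinf_on_divide:
  "Cinf_on n U f \<Longrightarrow> Cinf_on n U g \<Longrightarrow> (\<And>x. x \<in> U \<Longrightarrow> g x \<noteq> 0) \<Longrightarrow> Cinf_on n U (\<lambda>z. f z / g z)"
  by (simp add: divide_inverse Cinf_on_def Ck_on_mult Ck_on_inverse)

lemma Cinf_on_compose:
  assumes "openin (Euclidean_space d) U" "openin (Euclidean_space n) V"
    and "\<And>z. z \<in> U \<Longrightarrow> a z \<in> V" "\<And>i. i < n \<Longrightarrow> Cinf_on d U (\<lambda>z. a z i)" "Cinf_on n V h"
  shows "Cinf_on d U (\<lambda>z. h (a z))"
  using assms(4,5) Ck_on_compose[OF assms(1,2), of a _ h] assms(3) by (simp add: Cinf_on_def)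

lemma Cinf_on_local:
  assumes "openin (Euclidean_space n) U"
    "\<And>x. x \<in> U \<Longrightarrow> \<exists>W. openin (Euclidean_space n) W \<and> x \<in> W \<and> W \<subseteq> U \<and> Cinf_on n W f"
  shows "Cinf_on n U f"
  unfolding Cinf_on_def
proof
  fix m show "Ck_on n U m f"
  proof (rule Ck_on_local[OF assms(1)])
    fix x assume "x \<in> U"
    then obtain W where "openin (Euclidean_space n) W" "x \<in> W" "W \<subseteq> U" "Cinf_on n W f"
      using assms(2) by blast
    then show "\<exists>W. openin (Euclidean_space n) W \<and> x \<in> W \<and> W \<subseteq> U \<and> Ck_on n W m f"
      by (intro exI[of _ W]) (simp add: Cinf_on_def)
  qed
qed

lemma Cinf_on_pd:
  "openin (Euclidean_space n) U \<Longrightarrow> i < n \<Longrightarrow> Cinf_on n U f \<Longrightarrow> Cinf_on n U (pd i f)"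
  by (simp add: Cinf_on_def Ck_on_pd)

lemma Cinf_on_partial:
  assumes "openin (Euclidean_space n) U" "x \<in> U" "i < n" "Cinf_on n U f"
  shows "((\<lambda>h. f (x(i := h))) has_real_derivative pd i f x) (at (x i))"
  by (rule Ck_on_partial_at[OF assms(1-3), of 0]) (use assms(4) in \<open>simp add: Cinf_on_def\<close>)

lemma Cinf_on_pd_funpow:
  assumes "openin (Euclidean_space n) U" "i < n" "Cinf_on n U f"
  shows "Cinf_on n U ((pd i ^^ m) f)"
  by (induction m) (simp_all add: assms Cinf_on_pd)

lemma pd_cong:
  assumes "openin (Euclidean_space n) U" "x \<in> U" "i < n" "\<And>y. y \<in> U \<Longrightarrow> f y = g y"
  shows "pd i f x = pd i g x"
  unfolding pd_def
  by (intro deriv_cong_ev eventually_mono[OF eventually_update_in[OF assms(1-3)]] refl)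
    (simp add: assms(4))

text \<open>Both mixed partial derivatives are limits of the second difference quotient.\<close>

lemma pd_commute:
  assumes U: "openin (Euclidean_space n) U" "x \<in> U" and ij: "i < n" "j < n" and f: "Cinf_on n U f"
  shows "pd i (pd j f) x = pd j (pd i f) x"
proof (cases "i = j")
  case ne: False
  define p where "p u v = x(i := x i + u, j := x j + v)" for u v
  have xE: "x \<in> topspace (Euclidean_space n)" using U openin_subset by blast
  obtain e where e: "e > 0"
      "\<And>y. y \<in> topspace (Euclidean_space n) \<Longrightarrow> (\<forall>i<n. \<bar>y i - x i\<bar> < e) \<Longrightarrow> y \<in> U"
    using openin_Euclidean_space_boxD[OF U] by blast
  have pU: "p u v \<in> U" if "\<bar>u\<bar> < e" "\<bar>v\<bar> < e" for u v
    by (rule e(2)) (use that xE ij e(1) in \<open>auto simp: p_def topspace_Euclidean_space\<close>)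
  have d1: "((\<lambda>u. g (p u v)) has_real_derivative pd i g (p u v)) (at u)"
    if "\<bar>u\<bar> < e" "\<bar>v\<bar> < e" "Cinf_on n U g" for g u v
  proof -
    have "((\<lambda>h. g ((p u v)(i := h))) has_real_derivative pd i g (p u v)) (at (x i + u))"
      using Cinf_on_partial[OF U(1) pU[OF that(1,2)] ij(1) that(3)] ne by (simp add: p_def)
    moreover have "((\<lambda>u. x i + u) has_real_derivative 1) (at u)" by (auto intro!: derivative_eq_intros)
    ultimately have "((\<lambda>u'. g ((p u v)(i := x i + u'))) has_real_derivative pd i g (p u v) * 1) (at u)"
      by (rule DERIV_chain2)
    moreover have "(p u v)(i := x i + u') = p u' v" for u' using ne by (auto simp: p_def fun_eq_iff)
    ultimately show ?thesis by simp
  qed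
  have d2: "((\<lambda>v. g (p u v)) has_real_derivative pd j g (p u v)) (at v)"
    if "\<bar>u\<bar> < e" "\<bar>v\<bar> < e" "Cinf_on n U g" for g u v
  proof -
    have "((\<lambda>h. g ((p u v)(j := h))) has_real_derivative pd j g (p u v)) (at (x j + v))"
      using Cinf_on_partial[OF U(1) pU[OF that(1,2)] ij(2) that(3)] ne by (simp add: p_def)
    moreover have "((\<lambda>u. x j + u) has_real_derivative 1) (at v)" by (auto intro!: derivative_eq_intros)
    ultimately have "((\<lambda>v'. g ((p u v)(j := x j + v'))) has_real_derivative pd j g (p u v) * 1) (at v)"
      by (rule DERIV_chain2)
    moreover have "(p u v)(j := x j + v') = p u v'" for v' using ne by (auto simp: p_def fun_eq_iff)
    ultimately show ?thesis by simp
  qed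
  define \<Delta> where "\<Delta> h = f (p h h) - f (p h 0) - f (p 0 h) + f (p 0 0)" for h
  have A: "\<exists>u v. 0 < u \<and> u < h \<and> 0 < v \<and> v < h \<and> \<Delta> h = h * h * pd j (pd i f) (p u v)" if h: "0 < h" "h < e" for h
  proof -
    have "\<exists>u>0. u < h \<and> (f (p h h) - f (p h 0)) - (f (p 0 h) - f (p 0 0)) = (h - 0) * (pd i f (p u h) - pd i f (p u 0))"
      by (rule MVT2[OF h(1)]) (intro DERIV_diff d1 f, use h in auto)
    then obtain u where u: "0 < u" "u < h" "\<Delta> h = h * (pd i f (p u h) - pd i f (p u 0))"
      by (auto simp: \<Delta>_def)
    have "\<exists>v>0. v < h \<and> pd i f (p u h) - pd i f (p u 0) = (h - 0) * pd j (pd i f) (p u v)"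
      by (rule MVT2[OF h(1)]) (intro d2 Cinf_on_pd f U ij, use h u in auto)
    then show ?thesis using u by auto
  qed
  have B: "\<exists>u v. 0 < u \<and> u < h \<and> 0 < v \<and> v < h \<and> \<Delta> h = h * h * pd i (pd j f) (p u v)" if h: "0 < h" "h < e" for h
  proof -
    have "\<exists>v>0. v < h \<and> (f (p h h) - f (p 0 h)) - (f (p h 0) - f (p 0 0)) = (h - 0) * (pd j f (p h v) - pd j f (p 0 v))"
      by (rule MVT2[OF h(1)]) (intro DERIV_diff d2 f, use h in auto)
    then obtain v where v: "0 < v" "v < h" "\<Delta> h = h * (pd j f (p h v) - pd j f (p 0 v))"
      by (auto simp: \<Delta>_def)
    have "\<exists>u>0. u < h \<and> pd j f (p h v) - pd j f (p 0 v) = (h - 0) * pd i (pd j f) (p u v)"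
      by (rule MVT2[OF h(1)]) (intro d1 Cinf_on_pd f U ij, use h v in auto)
    then show ?thesis using v by auto
  qed
  have lim: "((\<lambda>h. \<Delta> h / (h * h)) \<longlongrightarrow> g x) (at_right 0)"
    if g: "Cinf_on n U g" and *: "\<And>h. 0 < h \<Longrightarrow> h < e \<Longrightarrow> \<exists>u v. 0 < u \<and> u < h \<and> 0 < v \<and> v < h \<and> \<Delta> h = h * h * g (p u v)" for g
  proof -
    obtain u v where uv: "\<And>h. 0 < h \<Longrightarrow> h < e \<Longrightarrow> 0 < u h \<and> u h < h \<and> 0 < v h \<and> v h < h \<and> \<Delta> h = h * h * g (p (u h) (v h))"
      using * by metis
    have ev: "\<forall>\<^sub>F h in at_right 0. 0 < h \<and> h < e"
      using e(1) by (simp add: eventually_at_right_field) (use e(1) in blast)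
    have id0: "((\<lambda>h::real. h) \<longlongrightarrow> 0) (at_right 0)" by (rule tendsto_ident_at)
    have u0: "(u \<longlongrightarrow> 0) (at_right 0)"
      by (rule Lim_null_comparison[OF _ id0]) (use ev uv in \<open>auto elim!: eventually_mono simp: less_imp_le\<close>)
    have v0: "(v \<longlongrightarrow> 0) (at_right 0)"
      by (rule Lim_null_comparison[OF _ id0]) (use ev uv in \<open>auto elim!: eventually_mono simp: less_imp_le\<close>)
    have "((\<lambda>h. g (p (u h) (v h))) \<longlongrightarrow> g x) (at_right 0)"
    proof (rule continuous_on_Euclidean_tendsto[OF Cinf_on_continuous[OF g] U])
      show "\<forall>\<^sub>F h in at_right 0. p (u h) (v h) \<in> topspace (Euclidean_space n)"
        using xE ij by (auto simp: p_def topspace_Euclidean_space)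
      fix l
      have "((\<lambda>h. x i + u h) \<longlongrightarrow> x i + 0) (at_right 0)" "((\<lambda>h. x j + v h) \<longlongrightarrow> x j + 0) (at_right 0)"
        by (intro tendsto_add tendsto_const u0 v0)+
      then show "((\<lambda>h. p (u h) (v h) l) \<longlongrightarrow> x l) (at_right 0)"
        using ne by (cases "l = j"; cases "l = i") (auto simp: p_def tendsto_const)
    qed
    moreover have "\<forall>\<^sub>F h in at_right 0. g (p (u h) (v h)) = \<Delta> h / (h * h)"
      using ev by eventually_elim (use uv in auto)
    ultimately show ?thesis by (rule Lim_transform_eventually)
  qed
  show ?thesis
    by (rule tendsto_unique[OF _ lim lim]) (intro Cinf_on_pd f U ij A B trivial_limit_at_right_real | assumption)+
qed simp

lemma openin_Euclidean_space_boxE: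
  assumes "openin (Euclidean_space n) U" "x \<in> U"
  obtains e where "e > 0"
    "\<And>y. y \<in> topspace (Euclidean_space n) \<Longrightarrow> (\<And>i. i < n \<Longrightarrow> \<bar>y i - x i\<bar> < e) \<Longrightarrow> y \<in> U"
  using openin_Euclidean_space_boxD[OF assms] by auto

subsection \<open>Smooth functions of one real variable\<close>

text \<open>Phrased with iterated \<open>deriv\<close>, the form in which velocities and lifted
  coordinates use derivatives; the lemmas below translate to and from \<open>Cinf_on\<close> in
  dimension one.\<close>

definition smooth_R :: "real set \<Rightarrow> (real \<Rightarrow> real) \<Rightarrow> bool" where
  "smooth_R S f \<longleftrightarrow> (\<forall>m. \<forall>t\<in>S. (deriv ^^ m) f differentiable (at t))"

definition line_coord :: "real \<Rightarrow> nat \<Rightarrow> real" where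
  "line_coord t = (\<lambda>i. if i = 0 then t else 0)"

lemma line_coord_simps [simp]:
  "line_coord t 0 = t" "(line_coord t)(0 := h) = line_coord h" "line_coord t (Suc i) = 0"
  "line_coord t \<in> topspace (Euclidean_space (Suc 0))" "line_coord s = line_coord t \<longleftrightarrow> s = t"
  by (auto simp: line_coord_def fun_eq_iff topspace_Euclidean_space)

lemma topspace_Euclidean_space_1: "z \<in> topspace (Euclidean_space (Suc 0)) \<longleftrightarrow> z = line_coord (z 0)"
proof
  assume z: "z \<in> topspace (Euclidean_space (Suc 0))"
  show "z = line_coord (z 0)"
  proof
    fix i show "z i = line_coord (z 0) i"
      using z by (cases i) (auto simp: topspace_Euclidean_space)
  qed
next
  assume "z = line_coord (z 0)"
  then show "z \<in> topspace (Euclidean_space (Suc 0))" by (metis line_coord_simps(4))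
qed

lemma openin_line_coord_image: "openin (Euclidean_space (Suc 0)) (line_coord ` S) \<longleftrightarrow> open S"
proof
  assume o: "openin (Euclidean_space (Suc 0)) (line_coord ` S)"
  show "open S" unfolding open_dist
  proof
    fix x assume "x \<in> S"
    then have "line_coord x \<in> line_coord ` S" by (rule imageI)
    from openin_Euclidean_space_boxE[OF o this] obtain e where e: "e > 0"
      "\<And>y. y \<in> topspace (Euclidean_space (Suc 0)) \<Longrightarrow> (\<And>i. i<Suc 0 \<Longrightarrow> \<bar>y i - line_coord x i\<bar> < e) \<Longrightarrow> y \<in> line_coord ` S"
      by metis
    have "y \<in> S" if "\<bar>y - x\<bar> < e" for y
      using e(2)[of "line_coord y"] that by auto
    then show "\<exists>e>0. \<forall>y. dist y x < e \<longrightarrow> y \<in> S" using e(1) by (auto simp: dist_real_def)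
  qed
next
  assume o: "open S"
  show "openin (Euclidean_space (Suc 0)) (line_coord ` S)"
    unfolding openin_Euclidean_space_iff_box
  proof (intro conjI ballI)
    show "line_coord ` S \<subseteq> topspace (Euclidean_space (Suc 0))" by auto
    fix x assume "x \<in> line_coord ` S"
    then obtain t where t: "x = line_coord t" "t \<in> S" by auto
    then obtain e where e: "e > 0" "\<And>y. dist y t < e \<Longrightarrow> y \<in> S" using o unfolding open_dist by blast
    have "y \<in> line_coord ` S" if "y \<in> topspace (Euclidean_space (Suc 0))" "\<forall>i<Suc 0. \<bar>y i - x i\<bar> < e" for y
    proof -
      have "y = line_coord (y 0)" using that(1) by (simp only: topspace_Euclidean_space_1)
      moreover have "y 0 \<in> S" using e(2)[of "y 0"] that t by (auto simp: dist_real_def)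
      ultimately show ?thesis by (metis imageI)
    qed
    then show "\<exists>e>0. \<forall>y\<in>topspace (Euclidean_space (Suc 0)). (\<forall>i<Suc 0. \<bar>y i - x i\<bar> < e) \<longrightarrow> y \<in> line_coord ` S"
      using e(1) by blast
  qed
qed

lemma smooth_R_DERIV:
  "smooth_R S f \<Longrightarrow> t \<in> S \<Longrightarrow> ((deriv ^^ m) f has_real_derivative (deriv ^^ Suc m) f t) (at t)"
  by (simp add: smooth_R_def DERIV_deriv_iff_real_differentiable)

lemma smooth_R_deriv: "smooth_R S f \<Longrightarrow> smooth_R S ((deriv ^^ m) f)"
  by (auto simp: smooth_R_def simp flip: funpow_add[THEN fun_cong, unfolded o_def])

lemma smooth_R_deriv1: "smooth_R S f \<Longrightarrow> smooth_R S (deriv f)"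
  using smooth_R_deriv[of S f 1] by simp

lemma smooth_R_subset: "smooth_R S f \<Longrightarrow> S' \<subseteq> S \<Longrightarrow> smooth_R S' f"
  by (auto simp: smooth_R_def)

lemma smooth_R_cong:
  assumes "open S" "\<And>t. t \<in> S \<Longrightarrow> f t = g t" "smooth_R S f"
  shows "smooth_R S g"
  unfolding smooth_R_def
proof (intro allI ballI)
  fix m t assume t: "t \<in> S"
  have "\<forall>\<^sub>F x in nhds t. (deriv ^^ m) f x = (deriv ^^ m) g x"
    using eventually_nhds_in_open[OF assms(1) t]
  proof eventually_elim
    case (elim x)
    show ?case
      by (intro higher_deriv_cong_ev eventually_mono[OF eventually_nhds_in_open[OF assms(1) elim]] refl)
        (simp add: assms(2))
  qed
  from DERIV_cong_ev[OF refl this refl] show "(deriv ^^ m) g differentiable at t"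
    using assms(3) t unfolding smooth_R_def real_differentiable_def by blast
qed

lemma Cinf_on_slice:
  assumes U: "openin (Euclidean_space n) U" and i: "i < n" and f: "Cinf_on n U f"
  shows "x(i := t) \<in> U \<Longrightarrow> (deriv ^^ m) (\<lambda>t. f (x(i := t))) t = (pd i ^^ m) f (x(i := t))"
proof (induction m arbitrary: t)
  case (Suc m)
  have "\<forall>\<^sub>F h in nhds t. x(i := h) \<in> U"
    using eventually_update_in[OF U Suc.prems i] by (simp only: fun_upd_upd fun_upd_same)
  then have "\<forall>\<^sub>F h in nhds t. (deriv ^^ m) (\<lambda>t. f (x(i := t))) h = (pd i ^^ m) f (x(i := h))"
    by eventually_elim (rule Suc.IH)
  then have "(deriv ^^ Suc m) (\<lambda>t. f (x(i := t))) t = deriv (\<lambda>h. (pd i ^^ m) f (x(i := h))) t"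
    by (simp add: deriv_cong_ev)
  also have "\<dots> = (pd i ^^ Suc m) f (x(i := t))" by (simp add: pd_def)
  finally show ?case .
qed simp

lemma smooth_R_slice:
  assumes U: "openin (Euclidean_space n) U" and i: "i < n" and f: "Cinf_on n U f"
    and S: "\<And>t. t \<in> S \<Longrightarrow> x(i := t) \<in> U"
  shows "smooth_R S (\<lambda>t. f (x(i := t)))"
  unfolding smooth_R_def
proof (intro allI ballI)
  fix m t assume t: "t \<in> S"
  have "\<forall>\<^sub>F h in nhds t. x(i := h) \<in> U"
    using eventually_update_in[OF U S[OF t] i] by (simp only: fun_upd_upd fun_upd_same)
  then have ev: "\<forall>\<^sub>F h in nhds t. (deriv ^^ m) (\<lambda>t. f (x(i := t))) h = (pd i ^^ m) f (x(i := h))"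
    by eventually_elim (rule Cinf_on_slice[OF U i f])
  have "((\<lambda>h. (pd i ^^ m) f (x(i := h))) has_real_derivative pd i ((pd i ^^ m) f) (x(i := t))) (at t)"
    using Cinf_on_partial[OF U S[OF t] i Cinf_on_pd_funpow[OF U i f]] by (simp only: fun_upd_upd fun_upd_same)
  then have "((deriv ^^ m) (\<lambda>t. f (x(i := t))) has_real_derivative pd i ((pd i ^^ m) f) (x(i := t))) (at t)"
    using DERIV_cong_ev[OF refl ev refl] by blast
  then show "(deriv ^^ m) (\<lambda>t. f (x(i := t))) differentiable at t"
    unfolding real_differentiable_def by blast
qed

lemma smooth_R_line_coord:
  assumes "openin (Euclidean_space (Suc 0)) U" "Cinf_on (Suc 0) U f" "\<And>t. t \<in> S \<Longrightarrow> line_coord t \<in> U"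
  shows "smooth_R S (\<lambda>t. f (line_coord t))"
  using smooth_R_slice[OF assms(1) _ assms(2), of 0 S "line_coord 0"] assms(3) by simp

text \<open>Together with \<open>smooth_R_line_coord\<close> this identifies the two notions of
  smoothness, so closure under sums, products and composition is transferred from
  \<open>Cinf_on\<close>.\<close>

lemma Cinf_on_smooth_R:
  assumes "open S" "smooth_R S g"
  shows "Cinf_on (Suc 0) (line_coord ` S) (\<lambda>z. g (z 0))"
proof -
  have "Ck_on (Suc 0) (line_coord ` S) m (\<lambda>z. g (z 0))" if "smooth_R S g" for m g
    using that
  proof (induction m arbitrary: g)
    case 0
    have "continuous_on S g"
      using 0 by (auto simp: smooth_R_def intro!: continuous_at_imp_continuous_on
        differentiable_imp_continuous_within dest!: spec[of _ 0])
    then show ?case by (auto intro: continuous_on_compose2[OF _ continuous_on_coord])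
  next
    case (Suc m)
    have "continuous_on S g"
      using Suc.prems by (auto simp: smooth_R_def intro!: continuous_at_imp_continuous_on
        differentiable_imp_continuous_within dest!: spec[of _ 0])
    then have c: "continuous_on (line_coord ` S) (\<lambda>z. g (z 0))"
      by (auto intro: continuous_on_compose2[OF _ continuous_on_coord])
    show ?case
    proof (rule Ck_on_SucI[OF c, where g = "\<lambda>i z. deriv g (z 0)"])
      fix i :: nat and x assume "i < Suc 0" "x \<in> line_coord ` S"
      then show "((\<lambda>h. g ((x(i := h)) 0)) has_real_derivative deriv g (x 0)) (at (x i))"
        using smooth_R_DERIV[OF Suc.prems, of _ 0] by auto
    qed (rule Suc.IH[OF smooth_R_deriv1[OF Suc.prems]])
  qed
  then show ?thesis using assms(2) by (simp add: Cinf_on_def)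
qed

lemma smooth_R_compose:
  assumes "open S" "openin (Euclidean_space n) V" "Cinf_on n V h"
    and a: "\<And>i. i < n \<Longrightarrow> smooth_R S (\<lambda>t. a t i)" "\<And>t. t \<in> S \<Longrightarrow> a t \<in> V"
  shows "smooth_R S (\<lambda>t. h (a t))"
proof -
  have o: "openin (Euclidean_space (Suc 0)) (line_coord ` S)"
    using assms(1) by (simp add: openin_line_coord_image)
  have "Cinf_on (Suc 0) (line_coord ` S) (\<lambda>z. h (a (z 0)))"
    by (rule Cinf_on_compose[OF o assms(2) _ _ assms(3)]) (use a Cinf_on_smooth_R[OF assms(1)] in auto)
  from smooth_R_line_coord[OF o this, of S] show ?thesis by simp
qed

lemma smooth_R_from_Cinf:
  assumes "open S" "Cinf_on (Suc 0) (line_coord ` S) (\<lambda>z. f (z 0))"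
  shows "smooth_R S f"
  using smooth_R_line_coord[of "line_coord ` S" "\<lambda>z. f (z 0)" S] assms by (simp add: openin_line_coord_image)

lemma smooth_R_add: "open S \<Longrightarrow> smooth_R S f \<Longrightarrow> smooth_R S g \<Longrightarrow> smooth_R S (\<lambda>t. f t + g t)"
  by (rule smooth_R_from_Cinf) (simp_all only: Cinf_on_add Cinf_on_smooth_R)

lemma smooth_R_mult: "open S \<Longrightarrow> smooth_R S f \<Longrightarrow> smooth_R S g \<Longrightarrow> smooth_R S (\<lambda>t. f t * g t)"
  by (rule smooth_R_from_Cinf) (simp_all only: Cinf_on_mult Cinf_on_smooth_R)

lemma smooth_R_const: "smooth_R S (\<lambda>_. c)"
  by (rule smooth_R_subset[OF smooth_R_from_Cinf[OF open_UNIV Cinf_on_const] subset_UNIV])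

lemma smooth_R_sum:
  "finite I \<Longrightarrow> open S \<Longrightarrow> (\<And>i. i \<in> I \<Longrightarrow> smooth_R S (f i)) \<Longrightarrow> smooth_R S (\<lambda>t. \<Sum>i\<in>I. f i t)"
  by (induction I rule: finite_induct) (auto intro: smooth_R_const smooth_R_add)

lemma higher_deriv_add:
  assumes "open S" "smooth_R S f" "smooth_R S g"
  shows "t \<in> S \<Longrightarrow> (deriv ^^ m) (\<lambda>t. f t + g t) t = (deriv ^^ m) f t + (deriv ^^ m) g t"
proof (induction m arbitrary: t)
  case (Suc m)
  have "(deriv ^^ Suc m) (\<lambda>t. f t + g t) t = deriv (\<lambda>t. (deriv ^^ m) f t + (deriv ^^ m) g t) t"
    unfolding funpow.simps o_def
    by (intro deriv_cong_ev eventually_mono[OF eventually_nhds_in_open[OF assms(1) Suc.prems]] refl Suc.IH)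
  also have "\<dots> = (deriv ^^ Suc m) f t + (deriv ^^ Suc m) g t"
    using DERIV_add[OF smooth_R_DERIV[OF assms(2) Suc.prems] smooth_R_DERIV[OF assms(3) Suc.prems]]
    by (rule DERIV_imp_deriv)
  finally show ?case .
qed simp

lemma higher_deriv_const_fun: "(deriv ^^ m) (\<lambda>_. c) = (\<lambda>_. if m = 0 then c else (0::real))"
  by (induction m) auto

lemma higher_deriv_sum:
  assumes "finite I" "open S" "\<And>i. i \<in> I \<Longrightarrow> smooth_R S (f i)" "t \<in> S"
  shows "(deriv ^^ m) (\<lambda>t. \<Sum>i\<in>I. f i t) t = (\<Sum>i\<in>I. (deriv ^^ m) (f i) t)"
  using assms(1,3)
proof (induction I rule: finite_induct)
  case empty
  then show ?case by (simp add: higher_deriv_const_fun)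
next
  case (insert i I)
  have "smooth_R S (\<lambda>t. \<Sum>i\<in>I. f i t)" using insert assms by (intro smooth_R_sum) auto
  from higher_deriv_add[OF assms(2) _ this assms(4), of "f i" m] insert show ?case by simp
qed

text \<open>The innermost derivative is expanded first, so the induction hypothesis applies to the
  pairs (f', g) and (f, g'); Pascal's rule merges the two sums.\<close>

lemma higher_deriv_mult:
  assumes "open S" "smooth_R S f" "smooth_R S g" "t \<in> S"
  shows "(deriv ^^ m) (\<lambda>t. f t * g t) t =
    (\<Sum>j\<le>m. real (m choose j) * (deriv ^^ j) f t * (deriv ^^ (m - j)) g t)"
  using assms(2-4)
proof (induction m arbitrary: f g)
  case (Suc m)
  have f': "smooth_R S (deriv f)" and g': "smooth_R S (deriv g)"
    using Suc.prems smooth_R_deriv1 by auto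
  have "(deriv ^^ Suc m) (\<lambda>t. f t * g t) t = (deriv ^^ m) (\<lambda>t. deriv f t * g t + f t * deriv g t) t"
    unfolding funpow_Suc_right o_def
  proof (intro higher_deriv_cong_ev refl eventually_mono[OF eventually_nhds_in_open[OF assms(1) \<open>t \<in> S\<close>]])
    fix x assume x: "x \<in> S"
    have "((\<lambda>t. f t * g t) has_real_derivative deriv f x * g x + deriv g x * f x) (at x)"
      using DERIV_mult[OF smooth_R_DERIV[OF Suc.prems(1) x, of 0] smooth_R_DERIV[OF Suc.prems(2) x, of 0]] by simp
    then show "deriv (\<lambda>t. f t * g t) x = deriv f x * g x + f x * deriv g x"
      by (simp add: DERIV_imp_deriv)
  qed
  also have "\<dots> = (deriv ^^ m) (\<lambda>t. deriv f t * g t) t + (deriv ^^ m) (\<lambda>t. f t * deriv g t) t"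
    by (intro higher_deriv_add[OF assms(1)] smooth_R_mult assms(1) Suc.prems f' g')
  also have "\<dots> = (\<Sum>j\<le>m. real (m choose j) * (deriv ^^ j) (deriv f) t * (deriv ^^ (m - j)) g t)
      + (\<Sum>j\<le>m. real (m choose j) * (deriv ^^ j) f t * (deriv ^^ (m - j)) (deriv g) t)"
    using Suc.IH f' g' Suc.prems by simp
  also have "\<dots> = (\<Sum>j\<le>m. real (m choose j) * (deriv ^^ Suc j) f t * (deriv ^^ (m - j)) g t)
      + (\<Sum>j\<le>m. real (m choose j) * (deriv ^^ j) f t * (deriv ^^ (Suc m - j)) g t)"
    by (simp add: Suc_diff_le funpow_Suc_right del: funpow.simps)
  also have "(\<Sum>j\<le>m. real (m choose j) * (deriv ^^ j) f t * (deriv ^^ (Suc m - j)) g t)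
     = (\<Sum>j\<le>Suc m. real (m choose j) * (deriv ^^ j) f t * (deriv ^^ (Suc m - j)) g t)"
    by simp
  also have "\<dots> = f t * (deriv ^^ Suc m) g t + (\<Sum>j\<le>m. real (m choose Suc j) * (deriv ^^ Suc j) f t * (deriv ^^ (m - j)) g t)"
    by (simp add: sum.atMost_Suc_shift del: funpow.simps sum.atMost_Suc)
  also have "(\<Sum>j\<le>m. real (m choose j) * (deriv ^^ Suc j) f t * (deriv ^^ (m - j)) g t) + \<dots>
    = f t * (deriv ^^ Suc m) g t + (\<Sum>j\<le>m. real (Suc m choose Suc j) * (deriv ^^ Suc j) f t * (deriv ^^ (m - j)) g t)"
    by (simp add: algebra_simps sum.distrib del: funpow.simps)
  also have "\<dots> = (\<Sum>j\<le>Suc m. real (Suc m choose j) * (deriv ^^ j) f t * (deriv ^^ (Suc m - j)) g t)"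
    by (simp add: sum.atMost_Suc_shift del: funpow.simps sum.atMost_Suc binomial_Suc_Suc)
  finally show ?case .
qed simp

subsection \<open>Taylor polynomials\<close>

text \<open>\<open>k\<close> counts terms: the derivatives at 0 are \<open>w 0\<close> up to
  \<open>w (k - 1)\<close> and then 0. To prescribe derivatives up to order k one takes
  \<open>Suc k\<close>.\<close>

definition taylor :: "nat \<Rightarrow> (nat \<Rightarrow> real) \<Rightarrow> real \<Rightarrow> real" where
  "taylor k w t = (\<Sum>c<k. w c * t ^ c / fact c)"

lemma taylor_at_0: "taylor k w 0 = (if k = 0 then 0 else w 0)"
  by (cases k) (auto simp: taylor_def sum.lessThan_Suc_shift simp del: sum.lessThan_Suc)

lemma DERIV_taylor: "(taylor k w has_real_derivative taylor (k - 1) (\<lambda>c. w (Suc c)) t) (at t)"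
proof (cases k)
  case (Suc k')
  have "((\<lambda>t. w 0 + (\<Sum>c<k'. w (Suc c) * t ^ Suc c / fact (Suc c))) has_real_derivative
      0 + (\<Sum>c<k'. w (Suc c) * t ^ c / fact c)) (at t)"
  proof (intro DERIV_add DERIV_const DERIV_sum)
    fix c
    have "((\<lambda>t. w (Suc c) * t ^ Suc c / fact (Suc c)) has_real_derivative
        w (Suc c) * (real (Suc c) * t ^ c) / fact (Suc c)) (at t)"
      using DERIV_cdivide[OF DERIV_cmult[OF DERIV_pow[of "Suc c" t]], of "w (Suc c)" "fact (Suc c)"]
      by (simp del: power_Suc fact_Suc of_nat_Suc)
    moreover have "w (Suc c) * (real (Suc c) * t ^ c) / fact (Suc c) = w (Suc c) * t ^ c / fact c"
      by (simp add: divide_simps)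
    ultimately show "((\<lambda>t. w (Suc c) * t ^ Suc c / fact (Suc c)) has_real_derivative w (Suc c) * t ^ c / fact c) (at t)"
      by simp
  qed
  moreover have "taylor k w = (\<lambda>t. w 0 + (\<Sum>c<k'. w (Suc c) * t ^ Suc c / fact (Suc c)))"
    by (simp add: taylor_def Suc sum.lessThan_Suc_shift fun_eq_iff del: sum.lessThan_Suc)
  ultimately show ?thesis by (simp add: taylor_def Suc)
qed (simp add: taylor_def[abs_def])

lemma higher_deriv_taylor: "(deriv ^^ b) (taylor k w) = taylor (k - b) (\<lambda>c. w (c + b))"
proof (induction b)
  case (Suc b)
  have "(deriv ^^ Suc b) (taylor k w) = deriv (taylor (k - b) (\<lambda>c. w (c + b)))" by (simp add: Suc)
  also have "\<dots> = taylor (k - b - 1) (\<lambda>c. w (Suc c + b))"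
    by (rule ext) (rule DERIV_imp_deriv[OF DERIV_taylor])
  finally show ?case by simp
qed simp

lemma higher_deriv_taylor_0: "(deriv ^^ b) (taylor k w) 0 = (if b < k then w b else 0)"
  by (simp add: higher_deriv_taylor taylor_at_0)

lemma smooth_R_taylor: "smooth_R S (taylor k w)"
  using DERIV_taylor by (auto simp: smooth_R_def higher_deriv_taylor real_differentiable_def)

subsection \<open>Jets of composed curves\<close>

text \<open>The layout of \<open>lift_coords\<close>, for a curve in a coordinate space. The time
  \<open>t\<close> is variable so that jets can themselves be differentiated along the
  curve.\<close>

definition jet :: "nat \<Rightarrow> nat \<Rightarrow> (real \<Rightarrow> nat \<Rightarrow> real) \<Rightarrow> real \<Rightarrow> nat \<Rightarrow> real" where
  "jet n k a t j = (if j < n * (k + 1) then (deriv ^^ (j div n)) (\<lambda>t. a t (j mod n)) t else 0)"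

text \<open>The entries of order 0 occupy the first \<open>n\<close> indices, so this consists of
  the coordinates of jets based in \<open>V\<close>.\<close>

definition jet_dom :: "nat \<Rightarrow> nat \<Rightarrow> (nat \<Rightarrow> real) set \<Rightarrow> (nat \<Rightarrow> real) set" where
  "jet_dom n k V = {z \<in> topspace (Euclidean_space (n * (k + 1))). (\<lambda>i. if i < n then z i else 0) \<in> V}"

lemma jet_topspace: "jet n k a t \<in> topspace (Euclidean_space (n * (k + 1)))"
  by (simp add: jet_def topspace_Euclidean_space)

lemma jet_low:
  assumes "a t \<in> topspace (Euclidean_space n)"
  shows "(\<lambda>i. if i < n then jet n k a t i else 0) = a t"
proof
  fix i
  show "(if i < n then jet n k a t i else 0) = a t i"
  proof (cases "i < n")
    case True
    then have "i < n * (k + 1)" by (simp add: trans_less_add1)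
    then show ?thesis using True by (simp add: jet_def)
  next
    case False then show ?thesis using assms by (simp add: topspace_Euclidean_space)
  qed
qed

lemma jet_in_jet_dom: "openin (Euclidean_space n) V \<Longrightarrow> a t \<in> V \<Longrightarrow> jet n k a t \<in> jet_dom n k V"
  using jet_low[of a t n k] jet_topspace[of n k a t] openin_subset[of "Euclidean_space n" V]
  by (auto simp: jet_dom_def)

lemma openin_jet_dom:
  assumes "openin (Euclidean_space n) V"
  shows "openin (Euclidean_space (n * (k + 1))) (jet_dom n k V)"
proof -
  have "openin (Euclidean_space (n * (k + 1)))
    {z \<in> topspace (Euclidean_space (n * (k + 1))). (\<lambda>i. if i < n then z i else 0) \<in> V}"
  proof (rule openin_Euclidean_space_vimage[OF openin_topspace assms])
    fix i assume "i < n"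
    then show "continuous_on (topspace (Euclidean_space (n * (k + 1)))) (\<lambda>z. if i < n then z i else 0)"
      by (simp add: continuous_on_coord)
  qed (simp add: topspace_Euclidean_space)
  then show ?thesis by (simp add: jet_dom_def)
qed

text \<open>The witness is the iterated total derivative of \<open>h\<close>.\<close>

lemma total_derivative:
  assumes V: "openin (Euclidean_space n) V" and h: "Cinf_on n V h" and "\<alpha> \<le> k"
  shows "\<exists>G. Cinf_on (n * (k + 1)) (jet_dom n k V) G \<and>
    (\<forall>z\<in>jet_dom n k V. \<forall>z'\<in>jet_dom n k V. (\<forall>j<n * (\<alpha> + 1). z j = z' j) \<longrightarrow> G z = G z') \<and>
    (\<forall>S a. open S \<longrightarrow> (\<forall>i<n. smooth_R S (\<lambda>t. a t i)) \<longrightarrow> (\<forall>t\<in>S. a t \<in> V) \<longrightarrow>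
      (\<forall>t\<in>S. (deriv ^^ \<alpha>) (\<lambda>t. h (a t)) t = G (jet n k a t)))"
  using assms(3)
proof (induction \<alpha>)
  case 0
  define G where "G z = h (\<lambda>i. if i < n then z i else 0)" for z :: "nat \<Rightarrow> real"
  have "Cinf_on (n * (k + 1)) (jet_dom n k V) G"
    unfolding G_def
  proof (rule Cinf_on_compose[OF openin_jet_dom[OF V] V _ _ h])
    show "(\<lambda>i. if i < n then z i else 0) \<in> V" if "z \<in> jet_dom n k V" for z
      using that by (simp add: jet_dom_def)
    show "Cinf_on (n * (k + 1)) (jet_dom n k V) (\<lambda>z. if i < n then z i else 0)" if "i < n" for i
      using that by (simp add: Cinf_on_coord)
  qed
  moreover have "G z = G z'" if "\<forall>j<n * (0 + 1). z j = z' j" for z z'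
    using that by (auto simp: G_def intro!: arg_cong[where f = h])
  moreover have "(deriv ^^ 0) (\<lambda>t. h (a t)) t = G (jet n k a t)" if "a t \<in> V" for a t
    using jet_low[of a t n k] that openin_subset[OF V] by (auto simp: G_def)
  ultimately show ?case by blast
next
  case (Suc \<alpha>)
  let ?N = "n * (k + 1)" and ?J = "jet_dom n k V"
  have oJ: "openin (Euclidean_space ?N) ?J" by (rule openin_jet_dom[OF V])
  obtain G where G: "Cinf_on ?N ?J G"
    and Gdep0: "\<forall>z\<in>?J. \<forall>z'\<in>?J. (\<forall>j<n * (\<alpha> + 1). z j = z' j) \<longrightarrow> G z = G z'"
    and Gder0: "\<forall>S a. open S \<longrightarrow> (\<forall>i<n. smooth_R S (\<lambda>t. a t i)) \<longrightarrow> (\<forall>t\<in>S. a t \<in> V) \<longrightarrow>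
      (\<forall>t\<in>S. (deriv ^^ \<alpha>) (\<lambda>t. h (a t)) t = G (jet n k a t))"
    using Suc.IH[OF Suc_leD[OF Suc.prems]] by (elim exE conjE) (rule that)
  have Gdep: "G z = G z'" if "z \<in> ?J" "z' \<in> ?J" "\<And>j. j<n * (\<alpha> + 1) \<Longrightarrow> z j = z' j" for z z'
    using Gdep0[rule_format, of z z'] that by simp
  have Gder: "(deriv ^^ \<alpha>) (\<lambda>t. h (a t)) t = G (jet n k a t)"
    if "open S" "\<And>i. i < n \<Longrightarrow> smooth_R S (\<lambda>t. a t i)" "\<And>t. t\<in>S \<Longrightarrow> a t \<in> V" "t \<in> S" for S a t
    using Gder0[rule_format, of S a t] that by simp
  have le: "n * (\<alpha> + 1) \<le> ?N" "n * (\<alpha> + 1) + n \<le> ?N"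
    using mult_le_mono2[of "\<alpha> + 2" "k + 1" n] Suc.prems by (auto simp: algebra_simps)
  have pdcong: "pd j G z = pd j G z'"
    if z: "z \<in> ?J" "z' \<in> ?J" "\<And>j. j<n * (\<alpha> + 1) \<Longrightarrow> z j = z' j" and j: "j < n * (\<alpha> + 1)" for z z' j
  proof -
    have jN: "j < ?N" using j le by simp
    have "\<forall>\<^sub>F h in nhds (z j). z(j := h) \<in> ?J" "\<forall>\<^sub>F h in nhds (z j). z'(j := h) \<in> ?J"
      using eventually_update_in[OF oJ z(1) jN] eventually_update_in[OF oJ z(2) jN] z(3)[OF j] by auto
    then have "\<forall>\<^sub>F h in nhds (z j). G (z(j := h)) = G (z'(j := h))"
      by eventually_elim (rule Gdep, use z(3) in auto)
    then show ?thesis unfolding pd_def using z(3)[OF j] by (intro deriv_cong_ev) auto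
  qed
  have pd0: "pd j G z = 0" if z: "z \<in> ?J" and j: "n * (\<alpha> + 1) \<le> j" "j < ?N" for z j
  proof -
    have "\<forall>\<^sub>F h in nhds (z j). z(j := h) \<in> ?J" by (rule eventually_update_in[OF oJ z j(2)])
    then have "\<forall>\<^sub>F h in nhds (z j). G (z(j := h)) = G z"
      by eventually_elim (rule Gdep, use z j in auto)
    then have "pd j G z = deriv (\<lambda>_. G z) (z j)" unfolding pd_def by (intro deriv_cong_ev) auto
    then show ?thesis by simp
  qed
  \<comment> \<open>The total derivative of \<open>G\<close>: a shift of the index by
    \<open>n\<close> raises the order of the entry by one. The sum stops at order
    \<open>\<alpha>\<close> because \<open>G\<close> does not depend on later entries; this keeps
    the orders occurring within \<open>k\<close>.\<close>
  define G' where "G' z = (\<Sum>j<n * (\<alpha> + 1). pd j G z * z (j + n))" for z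
  have "Cinf_on ?N ?J G'"
    unfolding G'_def
    by (intro Cinf_on_sum Cinf_on_mult Cinf_on_coord Cinf_on_pd[OF oJ _ G]) (use le in auto)
  moreover have "G' z = G' z'"
    if z: "z \<in> ?J" "z' \<in> ?J" "\<forall>j<n * (Suc \<alpha> + 1). z j = z' j" for z z'
    unfolding G'_def
    by (intro sum.cong refl arg_cong2[where f = times] pdcong z) (use z(3) in \<open>auto simp: algebra_simps\<close>)
  moreover have "(deriv ^^ Suc \<alpha>) (\<lambda>t. h (a t)) t = G' (jet n k a t)"
    if S: "open S" "\<forall>i<n. smooth_R S (\<lambda>t. a t i)" "\<forall>t\<in>S. a t \<in> V" "t \<in> S" for S a t
  proof -
    have jJ: "jet n k a t \<in> ?J" if "t \<in> S" for t using jet_in_jet_dom[OF V] S(3) that by blast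
    have der: "((\<lambda>t. jet n k a t j) has_real_derivative (deriv ^^ Suc (j div n)) (\<lambda>t. a t (j mod n)) t) (at t)"
      if "j < ?N" for j
    proof -
      have "j mod n < n" using that by (cases n) auto
      then have "smooth_R S (\<lambda>t. a t (j mod n))" using S(2) by blast
      from smooth_R_DERIV[OF this S(4)] show ?thesis using that by (simp add: jet_def)
    qed
    have "(deriv ^^ Suc \<alpha>) (\<lambda>t. h (a t)) t = deriv (\<lambda>t. G (jet n k a t)) t"
      unfolding funpow.simps o_def
      by (intro deriv_cong_ev eventually_mono[OF eventually_nhds_in_open[OF S(1,4)]] refl Gder[OF S(1)])
        (use S in auto)
    also have "\<dots> = (\<Sum>j<?N. pd j G (jet n k a t) * (deriv ^^ Suc (j div n)) (\<lambda>t. a t (j mod n)) t)"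
    proof (rule DERIV_imp_deriv[OF chain_rule_curve[OF oJ]])
      show "Ck_on ?N ?J (Suc 0) G" using G by (simp add: Cinf_on_def)
    qed (use jJ[OF S(4)] jet_topspace der in auto)
    also have "\<dots> = (\<Sum>j<n * (\<alpha> + 1). pd j G (jet n k a t) * (deriv ^^ Suc (j div n)) (\<lambda>t. a t (j mod n)) t)"
      by (rule sum.mono_neutral_right) (use le pd0[OF jJ[OF S(4)]] in auto)
    also have "\<dots> = G' (jet n k a t)"
      unfolding G'_def
    proof (intro sum.cong refl arg_cong2[where f = times])
      fix j assume j: "j \<in> {..<n * (\<alpha> + 1)}"
      then have "n > 0" by (cases n) auto
      then have "(j + n) div n = Suc (j div n)" "(j + n) mod n = j mod n" by auto
      moreover have "j + n < ?N" using j le by auto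
      ultimately show "(deriv ^^ Suc (j div n)) (\<lambda>t. a t (j mod n)) t = jet n k a t (j + n)"
        by (simp add: jet_def)
    qed
    finally show ?thesis .
  qed
  ultimately show ?case by blast
qed

text \<open>\<open>H\<close> depends on \<open>h\<close> and \<open>k\<close> but not on the curve.
  It thus replaces any explicit formula for higher derivatives of composites, both for smoothness
  and for showing that equal jets have equal images.\<close>

lemma jet_transform:
  assumes V: "openin (Euclidean_space n) V" and h: "\<And>i. i < m \<Longrightarrow> Cinf_on n V (\<lambda>z. h z i)"
  obtains H where "\<And>j. j < m * (k + 1) \<Longrightarrow> Cinf_on (n * (k + 1)) (jet_dom n k V) (\<lambda>z. H z j)"
    and "\<And>S a t. open S \<Longrightarrow> (\<And>i. i < n \<Longrightarrow> smooth_R S (\<lambda>t. a t i)) \<Longrightarrow> (\<And>t. t \<in> S \<Longrightarrow> a t \<in> V) \<Longrightarrow> t \<in> S \<Longrightarrow>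
      jet m k (\<lambda>t. h (a t)) t = H (jet n k a t)"
proof -
  have "\<forall>i \<alpha>. \<exists>G. i < m \<and> \<alpha> \<le> k \<longrightarrow> Cinf_on (n * (k + 1)) (jet_dom n k V) G \<and>
    (\<forall>S a. open S \<longrightarrow> (\<forall>i<n. smooth_R S (\<lambda>t. a t i)) \<longrightarrow> (\<forall>t\<in>S. a t \<in> V) \<longrightarrow>
      (\<forall>t\<in>S. (deriv ^^ \<alpha>) (\<lambda>t. h (a t) i) t = G (jet n k a t)))"
  proof (intro allI)
    fix i \<alpha>
    show "\<exists>G. i < m \<and> \<alpha> \<le> k \<longrightarrow> Cinf_on (n * (k + 1)) (jet_dom n k V) G \<and>
      (\<forall>S a. open S \<longrightarrow> (\<forall>i<n. smooth_R S (\<lambda>t. a t i)) \<longrightarrow> (\<forall>t\<in>S. a t \<in> V) \<longrightarrow>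
      (\<forall>t\<in>S. (deriv ^^ \<alpha>) (\<lambda>t. h (a t) i) t = G (jet n k a t)))"
    proof (cases "i < m \<and> \<alpha> \<le> k")
      case True
      then have i: "i < m" "\<alpha> \<le> k" by auto
      from total_derivative[OF V h[OF i(1)] i(2)] show ?thesis
        by (rule ex_forward) (intro impI conjI; elim conjE; assumption)
    qed blast
  qed
  then obtain G where G: "\<And>i \<alpha>. i < m \<Longrightarrow> \<alpha> \<le> k \<Longrightarrow> Cinf_on (n * (k + 1)) (jet_dom n k V) (G i \<alpha>)"
    "\<And>i \<alpha> S a t. i < m \<Longrightarrow> \<alpha> \<le> k \<Longrightarrow> open S \<Longrightarrow> (\<forall>i<n. smooth_R S (\<lambda>t. a t i)) \<Longrightarrow> (\<forall>t\<in>S. a t \<in> V) \<Longrightarrow>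
      t\<in>S \<Longrightarrow> (deriv ^^ \<alpha>) (\<lambda>t. h (a t) i) t = G i \<alpha> (jet n k a t)"
    by metis
  define H where "H z j = (if j < m * (k + 1) then G (j mod m) (j div m) z else 0)" for z j
  have b: "j mod m < m \<and> j div m \<le> k" if "j < m * (k + 1)" for j
    using that by (cases m) (auto simp: less_Suc_eq_le[symmetric] less_mult_imp_div_less mult.commute)
  show thesis
  proof (rule that)
    show "Cinf_on (n * (k + 1)) (jet_dom n k V) (\<lambda>z. H z j)" if "j < m * (k + 1)" for j
      using G(1) b[OF that] that by (simp add: H_def)
    show "jet m k (\<lambda>t. h (a t)) t = H (jet n k a t)"
      if "open S" "\<And>i. i < n \<Longrightarrow> smooth_R S (\<lambda>t. a t i)" "\<And>t. t \<in> S \<Longrightarrow> a t \<in> V" "t \<in> S" for S a t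
    proof
      fix j show "jet m k (\<lambda>t. h (a t)) t j = H (jet n k a t) j"
        using b[of j] G(2)[of "j mod m" "j div m" S a t] that by (auto simp: jet_def[of m] H_def)
    qed
  qed
qed

lemma Cinf_on_eq:
  assumes "openin (Euclidean_space n) U" "Cinf_on n U f" "\<And>x. x \<in> U \<Longrightarrow> f x = g x"
  shows "Cinf_on n U g"
  using Cinf_on_cong[of n U f g] assms by simp

section \<open>Manifolds, smooth maps and velocities in charts\<close>

subsection \<open>Charts\<close>

text \<open>The clause of \<open>manifold\<close> about charts, isolated because it is what passes
  from \<open>N\<close> to \<open>T_mfd k N\<close> and hence to iterated velocities.\<close>

definition smooth_atlas :: "'a mfd \<Rightarrow> bool" where
  "smooth_atlas N \<longleftrightarrow> (\<forall>c \<in> atlas N. smooth_chart N c)"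

lemma manifold_smooth_atlas: "manifold N \<Longrightarrow> smooth_atlas N"
  by (simp add: manifold_def smooth_atlas_def)

lemma smooth_atlasD: "smooth_atlas N \<Longrightarrow> (U, \<phi>) \<in> atlas N \<Longrightarrow> smooth_chart N (U, \<phi>)"
  unfolding smooth_atlas_def by blast

lemma ptsE:
  assumes "p \<in> pts N" obtains U \<phi> where "(U, \<phi>) \<in> atlas N" "p \<in> U"
  using assms unfolding pts_def by auto

lemma smooth_chartD:
  assumes "smooth_chart N (U, \<phi>)"
  shows "U \<subseteq> pts N" "inj_on \<phi> U" "openin (Euclidean_space (mdim N)) (\<phi> ` U)"
  using assms by (auto simp: smooth_chart_def)

lemma smooth_chart_atlas:
  assumes "smooth_chart N (U, \<phi>)" "(V, \<psi>) \<in> atlas N"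
  shows "openin (Euclidean_space (mdim N)) (\<phi> ` (U \<inter> V))"
    "openin (Euclidean_space (mdim N)) (\<psi> ` (U \<inter> V))"
    "\<And>i. i < mdim N \<Longrightarrow> Cinf_on (mdim N) (\<phi> ` (U \<inter> V)) (\<lambda>z. \<psi> (inv_into U \<phi> z) i)"
    "\<And>i. i < mdim N \<Longrightarrow> Cinf_on (mdim N) (\<psi> ` (U \<inter> V)) (\<lambda>z. \<phi> (inv_into V \<psi> z) i)"
proof -
  have "compatible (mdim N) (U, \<phi>) (V, \<psi>)"
    using assms by (auto simp: smooth_chart_def)
  then show "openin (Euclidean_space (mdim N)) (\<phi> ` (U \<inter> V))"
    "openin (Euclidean_space (mdim N)) (\<psi> ` (U \<inter> V))"
    "\<And>i. i < mdim N \<Longrightarrow> Cinf_on (mdim N) (\<phi> ` (U \<inter> V)) (\<lambda>z. \<psi> (inv_into U \<phi> z) i)"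
    "\<And>i. i < mdim N \<Longrightarrow> Cinf_on (mdim N) (\<psi> ` (U \<inter> V)) (\<lambda>z. \<phi> (inv_into V \<psi> z) i)"
    by (simp_all add: compatible_def)
qed

lemma chart_topspace:
  "smooth_chart N (U, \<phi>) \<Longrightarrow> p \<in> U \<Longrightarrow> \<phi> p \<in> topspace (Euclidean_space (mdim N))"
  using smooth_chartD(3) openin_subset by blast

lemma chart_inv: "smooth_chart N (U, \<phi>) \<Longrightarrow> p \<in> U \<Longrightarrow> inv_into U \<phi> (\<phi> p) = p"
  by (simp add: smooth_chartD(2))

text \<open>Openness passes between charts since the transition map is continuous. The hypotheses
  mention bare maps so that the lemma can serve inside the proof of
  \<open>transition\<close>.\<close>

lemma transition_preimage:
  assumes o: "openin (Euclidean_space n) (\<phi> ` (U \<inter> A))" "openin (Euclidean_space n) (\<theta> ` X)"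
    and tr: "\<And>i. i < n \<Longrightarrow> Cinf_on n (\<phi> ` (U \<inter> A)) (\<lambda>z. \<theta> (inv_into U \<phi> z) i)"
    and inj: "inj_on \<phi> U" "inj_on \<theta> A" and X: "X \<subseteq> A"
    and E: "\<theta> ` A \<subseteq> topspace (Euclidean_space n)"
  shows "openin (Euclidean_space n) (\<phi> ` (U \<inter> X))"
proof -
  have "openin (Euclidean_space n) {z \<in> \<phi> ` (U \<inter> A). \<theta> (inv_into U \<phi> z) \<in> \<theta> ` X}"
  proof (rule openin_Euclidean_space_vimage[OF o])
    show "\<theta> (inv_into U \<phi> z) \<in> topspace (Euclidean_space n)" if "z \<in> \<phi> ` (U \<inter> A)" for z
      using that E inj(1) by auto
  qed (rule Cinf_on_continuous[OF tr])
  moreover have "{z \<in> \<phi> ` (U \<inter> A). \<theta> (inv_into U \<phi> z) \<in> \<theta> ` X} = \<phi> ` (U \<inter> X)"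
  proof (intro equalityI subsetI)
    fix z assume "z \<in> {z \<in> \<phi> ` (U \<inter> A). \<theta> (inv_into U \<phi> z) \<in> \<theta> ` X}"
    then obtain p q where "z = \<phi> p" "p \<in> U" "p \<in> A" "\<theta> p = \<theta> q" "q \<in> X"
      using inj(1) by auto
    moreover from this have "p = q" using inj(2) X by (auto dest: inj_onD)
    ultimately show "z \<in> \<phi> ` (U \<inter> X)" by auto
  next
    fix z assume "z \<in> \<phi> ` (U \<inter> X)"
    then show "z \<in> {z \<in> \<phi> ` (U \<inter> A). \<theta> (inv_into U \<phi> z) \<in> \<theta> ` X}"
      using X inj(1) by auto
  qed
  ultimately show ?thesis by simp
qed

text \<open>\<open>smooth_chart\<close> compares a chart with members of the atlas only. Two charts
  of the maximal atlas are compared near each point through an atlas chart \<open>\<theta>\<close>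
  around it, and smoothness is local.\<close>

lemma transition:
  assumes N: "smooth_atlas N" and c: "smooth_chart N (U, \<phi>)" and d: "smooth_chart N (V, \<psi>)"
  shows "openin (Euclidean_space (mdim N)) (\<phi> ` (U \<inter> V))"
    and "\<And>i. i < mdim N \<Longrightarrow> Cinf_on (mdim N) (\<phi> ` (U \<inter> V)) (\<lambda>z. \<psi> (inv_into U \<phi> z) i)"
proof -
  have oA: "openin (Euclidean_space (mdim N)) (\<phi> ` (U \<inter> (V \<inter> A)))" if A: "(A, \<theta>) \<in> atlas N" for A \<theta>
  proof (rule transition_preimage[OF smooth_chart_atlas(1)[OF c A] smooth_chart_atlas(2)[OF d A] smooth_chart_atlas(3)[OF c A]])
    note sA = smooth_atlasD[OF N A]
    show "\<theta> ` A \<subseteq> topspace (Euclidean_space (mdim N))" using chart_topspace[OF sA] by auto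
  qed (use smooth_chartD(2)[OF c] smooth_chartD(2)[OF smooth_atlasD[OF N A]] in auto)
  show o: "openin (Euclidean_space (mdim N)) (\<phi> ` (U \<inter> V))"
  proof (subst openin_subopen, intro ballI)
    fix z assume "z \<in> \<phi> ` (U \<inter> V)"
    then obtain p where p: "z = \<phi> p" "p \<in> U" "p \<in> V" by auto
    obtain A \<theta> where A: "(A, \<theta>) \<in> atlas N" "p \<in> A"
      by (rule ptsE[OF subsetD[OF smooth_chartD(1)[OF c] p(2)]])
    show "\<exists>T. openin (Euclidean_space (mdim N)) T \<and> z \<in> T \<and> T \<subseteq> \<phi> ` (U \<inter> V)"
      by (intro exI[of _ "\<phi> ` (U \<inter> (V \<inter> A))"] conjI oA[OF A(1)]) (use p A in auto)
  qed
  fix i assume i: "i < mdim N"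
  show "Cinf_on (mdim N) (\<phi> ` (U \<inter> V)) (\<lambda>z. \<psi> (inv_into U \<phi> z) i)"
  proof (rule Cinf_on_local[OF o])
    fix z assume "z \<in> \<phi> ` (U \<inter> V)"
    then obtain p where p: "z = \<phi> p" "p \<in> U" "p \<in> V" by auto
    obtain A \<theta> where A: "(A, \<theta>) \<in> atlas N" "p \<in> A"
      by (rule ptsE[OF subsetD[OF smooth_chartD(1)[OF c] p(2)]])
    note sA = smooth_atlasD[OF N A(1)]
    let ?W = "\<phi> ` (U \<inter> (V \<inter> A))"
    have "Cinf_on (mdim N) ?W (\<lambda>z. \<psi> (inv_into A \<theta> (\<theta> (inv_into U \<phi> z))) i)"
    proof (rule Cinf_on_compose[OF oA[OF A(1)] smooth_chart_atlas(2)[OF d A(1)], where a = "\<lambda>z. \<theta> (inv_into U \<phi> z)"])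
      show "\<theta> (inv_into U \<phi> z) \<in> \<theta> ` (V \<inter> A)" if "z \<in> ?W" for z
        using that chart_inv[OF c] by auto
      show "Cinf_on (mdim N) ?W (\<lambda>z. \<theta> (inv_into U \<phi> z) i)" if "i < mdim N" for i
        by (rule Cinf_on_subset[OF smooth_chart_atlas(3)[OF c A(1) that]]) auto
      show "Cinf_on (mdim N) (\<theta> ` (V \<inter> A)) (\<lambda>z. \<psi> (inv_into A \<theta> z) i)"
        by (rule smooth_chart_atlas(4)[OF d A(1) i])
    qed
    moreover have "\<psi> (inv_into A \<theta> (\<theta> (inv_into U \<phi> z))) i = \<psi> (inv_into U \<phi> z) i" if "z \<in> ?W" for z
      using that chart_inv[OF c] chart_inv[OF sA] by auto
    ultimately have "Cinf_on (mdim N) ?W (\<lambda>z. \<psi> (inv_into U \<phi> z) i)"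
      by (rule Cinf_on_eq[OF oA[OF A(1)]])
    moreover have "z \<in> ?W" "?W \<subseteq> \<phi> ` (U \<inter> V)" using p A by auto
    ultimately show "\<exists>W. openin (Euclidean_space (mdim N)) W \<and> z \<in> W \<and> W \<subseteq> \<phi> ` (U \<inter> V) \<and>
      Cinf_on (mdim N) W (\<lambda>z. \<psi> (inv_into U \<phi> z) i)"
      using oA[OF A(1)] by (intro exI[of _ ?W] conjI)
  qed
qed

lemma chart_preimage:
  assumes N: "smooth_atlas N" and c: "smooth_chart N (U, \<phi>)" and d: "smooth_chart N (V, \<psi>)"
    and X: "X \<subseteq> V" "openin (Euclidean_space (mdim N)) (\<psi> ` X)"
  shows "openin (Euclidean_space (mdim N)) (\<phi> ` (U \<inter> X))"
proof (rule transition_preimage[OF transition(1)[OF N c d] X(2) transition(2)[OF N c d]])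
  show "\<psi> ` V \<subseteq> topspace (Euclidean_space (mdim N))" using chart_topspace[OF d] by auto
qed (use smooth_chartD(2)[OF c] smooth_chartD(2)[OF d] X in auto)

lemma open_in_chart:
  assumes N: "smooth_atlas N" and c: "smooth_chart N (U, \<phi>)" and W: "open_in N W"
  shows "openin (Euclidean_space (mdim N)) (\<phi> ` (W \<inter> U))"
proof (subst openin_subopen, intro ballI)
  fix z assume "z \<in> \<phi> ` (W \<inter> U)"
  then obtain p where p: "z = \<phi> p" "p \<in> W" "p \<in> U" by auto
  obtain A \<theta> where A: "(A, \<theta>) \<in> atlas N" "p \<in> A"
    by (rule ptsE[OF subsetD[OF smooth_chartD(1)[OF c] p(3)]])
  have "openin (Euclidean_space (mdim N)) (\<theta> ` (W \<inter> A))"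
    using W A(1) unfolding open_in_def by blast
  then have "openin (Euclidean_space (mdim N)) (\<phi> ` (U \<inter> (W \<inter> A)))"
    by (intro chart_preimage[OF N c smooth_atlasD[OF N A(1)]]) auto
  then show "\<exists>T. openin (Euclidean_space (mdim N)) T \<and> z \<in> T \<and> T \<subseteq> \<phi> ` (W \<inter> U)"
    by (intro exI[of _ "\<phi> ` (U \<inter> (W \<inter> A))"] conjI) (use p A in auto)
qed

lemma open_in_chartI:
  assumes N: "smooth_atlas N" and c: "smooth_chart N (U, \<phi>)"
    and W: "W \<subseteq> U" "openin (Euclidean_space (mdim N)) (\<phi> ` W)"
  shows "open_in N W"
  unfolding open_in_def
proof (intro conjI ballI)
  show "W \<subseteq> pts N" using W(1) smooth_chartD(1)[OF c] by blast
  fix x assume "x \<in> atlas N"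
  then obtain A \<theta> where x: "x = (A, \<theta>)" "(A, \<theta>) \<in> atlas N" by (cases x) auto
  have "openin (Euclidean_space (mdim N)) (\<theta> ` (A \<inter> W))"
    by (rule chart_preimage[OF N smooth_atlasD[OF N x(2)] c W])
  then show "case x of (U, \<psi>) \<Rightarrow> openin (Euclidean_space (mdim N)) (\<psi> ` (W \<inter> U))"
    by (simp add: x(1) Int_commute)
qed

lemma open_in_Int:
  assumes N: "smooth_atlas N" and W: "open_in N W" "open_in N W'"
  shows "open_in N (W \<inter> W')"
  unfolding open_in_def
proof (intro conjI ballI)
  show "W \<inter> W' \<subseteq> pts N" using W(1) by (auto simp: open_in_def)
  fix x assume "x \<in> atlas N"
  then obtain A \<theta> where x: "x = (A, \<theta>)" "(A, \<theta>) \<in> atlas N" by (cases x) auto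
  have "inj_on \<theta> A" using smooth_chartD(2)[OF smooth_atlasD[OF N x(2)]] .
  then have "\<theta> ` (W \<inter> W' \<inter> A) = \<theta> ` (W \<inter> A) \<inter> \<theta> ` (W' \<inter> A)"
    by (auto dest: inj_onD)
  moreover have "openin (Euclidean_space (mdim N)) (\<theta> ` (W \<inter> A))" "openin (Euclidean_space (mdim N)) (\<theta> ` (W' \<inter> A))"
    using W x(2) by (auto simp: open_in_def)
  ultimately show "case x of (U, \<psi>) \<Rightarrow> openin (Euclidean_space (mdim N)) (\<psi> ` (W \<inter> W' \<inter> U))"
    by (simp add: x(1) openin_Int)
qed

lemma open_in_chart_dom: "smooth_atlas N \<Longrightarrow> smooth_chart N (U, \<phi>) \<Longrightarrow> open_in N U"
  using open_in_chartI[of N U \<phi> U] smooth_chartD(3) by blast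

lemma open_in_pts: "smooth_atlas N \<Longrightarrow> open_in N (pts N)"
  unfolding open_in_def
proof (intro conjI ballI order_refl)
  fix x assume N: "smooth_atlas N" and "x \<in> atlas N"
  then obtain A \<theta> where x: "x = (A, \<theta>)" "(A, \<theta>) \<in> atlas N" by (cases x) auto
  note s = smooth_chartD[OF smooth_atlasD[OF N x(2)]]
  have "pts N \<inter> A = A" using s(1) by blast
  then show "case x of (U, \<psi>) \<Rightarrow> openin (Euclidean_space (mdim N)) (\<psi> ` (pts N \<inter> U))"
    using s(3) by (simp add: x)
qed

subsection \<open>Smooth maps in charts\<close>

definition smooth_in_charts ::
  "'a mfd \<Rightarrow> 'b mfd \<Rightarrow> 'a set \<Rightarrow> 'a chart \<Rightarrow> 'b chart \<Rightarrow> ('a \<Rightarrow> 'b) \<Rightarrow> bool" where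
  "smooth_in_charts N P W = (\<lambda>(U, \<phi>) (V, \<psi>) f. open_in N W \<and> W \<subseteq> U \<and> f ` W \<subseteq> V \<and>
     (\<forall>j < mdim P. Cinf_on (mdim N) (\<phi> ` W) (\<lambda>z. \<psi> (f (inv_into U \<phi> z)) j)))"

lemma smooth_on_iff:
  "smooth_on N W P f \<longleftrightarrow> open_in N W \<and> (\<forall>p\<in>W. \<exists>c\<in>atlas N. \<exists>d\<in>atlas P. \<exists>W'\<subseteq>W. p \<in> W' \<and> smooth_in_charts N P W' c d f)"
  unfolding smooth_on_def smooth_in_charts_def split_beta
  by (rule arg_cong2[where f = "(\<and>)"], rule refl, intro refl ball_cong bex_cong iff_exI) (simp add: conj_ac)

text \<open>The local expression is composed with transition maps on both sides. The domain shrinks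
  to the points sent into \<open>V'\<close>, which is open by continuity of the old local
  expression.\<close>

lemma smooth_in_charts_change:
  assumes N: "smooth_atlas N" and P: "smooth_atlas P"
    and c: "smooth_chart N (U, \<phi>)" "smooth_chart N (U', \<phi>')"
    and d: "smooth_chart P (V, \<psi>)" "smooth_chart P (V', \<psi>')"
    and f: "smooth_in_charts N P W (U, \<phi>) (V, \<psi>) f"
  shows "smooth_in_charts N P {q \<in> W \<inter> U'. f q \<in> V'} (U', \<phi>') (V', \<psi>') f"
proof -
  let ?n = "mdim N" and ?m = "mdim P"
  let ?W = "{q \<in> W \<inter> U'. f q \<in> V'}"
  have W: "open_in N W" "W \<subseteq> U" "f ` W \<subseteq> V"
    and C: "\<And>j. j < ?m \<Longrightarrow> Cinf_on ?n (\<phi> ` W) (\<lambda>z. \<psi> (f (inv_into U \<phi> z)) j)"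
    using f by (auto simp: smooth_in_charts_def)
  have oW: "openin (Euclidean_space ?n) (\<phi> ` W)"
    using open_in_chart[OF N c(1) W(1)] W(2) by (simp add: Int_absorb2)
  have oVV: "openin (Euclidean_space ?m) (\<psi> ` (V \<inter> V'))" by (rule transition(1)[OF P d])
  have "openin (Euclidean_space ?n) {z \<in> \<phi> ` W. \<psi> (f (inv_into U \<phi> z)) \<in> \<psi> ` (V \<inter> V')}"
  proof (rule openin_Euclidean_space_vimage[OF oW oVV])
    show "\<psi> (f (inv_into U \<phi> z)) \<in> topspace (Euclidean_space ?m)" if "z \<in> \<phi> ` W" for z
      using that W chart_inv[OF c(1)] chart_topspace[OF d(1)] by (auto simp: subset_iff)
  qed (rule Cinf_on_continuous[OF C])
  moreover have "{z \<in> \<phi> ` W. \<psi> (f (inv_into U \<phi> z)) \<in> \<psi> ` (V \<inter> V')} = \<phi> ` {q \<in> W. f q \<in> V'}"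
  proof (intro equalityI subsetI)
    fix z assume "z \<in> {z \<in> \<phi> ` W. \<psi> (f (inv_into U \<phi> z)) \<in> \<psi> ` (V \<inter> V')}"
    then obtain p q where "z = \<phi> p" "p \<in> W" "\<psi> (f p) = \<psi> q" "q \<in> V" "q \<in> V'"
      using chart_inv[OF c(1)] W(2) by (auto simp: subset_iff)
    moreover from this have "f p = q" using smooth_chartD(2)[OF d(1)] W(3) by (auto dest: inj_onD)
    ultimately show "z \<in> \<phi> ` {q \<in> W. f q \<in> V'}" by auto
  next
    fix z assume "z \<in> \<phi> ` {q \<in> W. f q \<in> V'}"
    then show "z \<in> {z \<in> \<phi> ` W. \<psi> (f (inv_into U \<phi> z)) \<in> \<psi> ` (V \<inter> V')}"
      using chart_inv[OF c(1)] W by (auto simp: subset_iff)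
  qed
  ultimately have "openin (Euclidean_space ?n) (\<phi> ` {q \<in> W. f q \<in> V'})" by simp
  then have "open_in N {q \<in> W. f q \<in> V'}"
    using W(2) by (intro open_in_chartI[OF N c(1)]) auto
  from open_in_Int[OF N this open_in_chart_dom[OF N c(2)]]
  have "open_in N ({q \<in> W. f q \<in> V'} \<inter> U')" .
  moreover have "{q \<in> W. f q \<in> V'} \<inter> U' = ?W" by auto
  ultimately have oi: "open_in N ?W" by simp
  have o': "openin (Euclidean_space ?n) (\<phi>' ` ?W)"
    using open_in_chart[OF N c(2) oi] by (simp add: Int_absorb2 subset_iff)
  have "Cinf_on ?n (\<phi>' ` ?W) (\<lambda>z. \<psi>' (f (inv_into U' \<phi>' z)) j)" if j: "j < ?m" for j
  proof -
    have 1: "Cinf_on ?n (\<phi>' ` ?W) (\<lambda>z. \<psi> (f (inv_into U \<phi> (\<phi> (inv_into U' \<phi>' z)))) i)" if i: "i < ?m" for i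
    proof (rule Cinf_on_compose[OF o' oW _ _ C[OF i]])
      show "\<phi> (inv_into U' \<phi>' z) \<in> \<phi> ` W" if "z \<in> \<phi>' ` ?W" for z
        using that chart_inv[OF c(2)] by auto
      show "Cinf_on ?n (\<phi>' ` ?W) (\<lambda>z. \<phi> (inv_into U' \<phi>' z) l)" if "l < ?n" for l
        by (rule Cinf_on_subset[OF transition(2)[OF N c(2) c(1) that]]) (use W in auto)
    qed
    have "Cinf_on ?n (\<phi>' ` ?W) (\<lambda>z. \<psi>' (inv_into V \<psi> (\<psi> (f (inv_into U \<phi> (\<phi> (inv_into U' \<phi>' z)))))) j)"
    proof (rule Cinf_on_compose[OF o' oVV _ 1 transition(2)[OF P d j]])
      show "\<psi> (f (inv_into U \<phi> (\<phi> (inv_into U' \<phi>' z)))) \<in> \<psi> ` (V \<inter> V')" if "z \<in> \<phi>' ` ?W" for z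
        using that W chart_inv[OF c(1)] chart_inv[OF c(2)] by (auto simp: subset_iff)
    qed
    moreover have "\<psi>' (inv_into V \<psi> (\<psi> (f (inv_into U \<phi> (\<phi> (inv_into U' \<phi>' z)))))) j = \<psi>' (f (inv_into U' \<phi>' z)) j"
      if "z \<in> \<phi>' ` ?W" for z
      using that W chart_inv[OF c(1)] chart_inv[OF c(2)] chart_inv[OF d(1)] by (auto simp: subset_iff)
    ultimately show ?thesis by (rule Cinf_on_eq[OF o'])
  qed
  then show ?thesis using oi by (auto simp: smooth_in_charts_def)
qed

lemma smooth_in_charts_subset:
  "smooth_in_charts N P W c d f \<Longrightarrow> open_in N W' \<Longrightarrow> W' \<subseteq> W \<Longrightarrow> smooth_in_charts N P W' c d f"
proof -
  assume f: "smooth_in_charts N P W c d f" and W': "open_in N W'" "W' \<subseteq> W"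
  obtain U \<phi> V \<psi> where cd: "c = (U, \<phi>)" "d = (V, \<psi>)" by (metis surj_pair)
  have "Cinf_on (mdim N) (\<phi> ` W') (\<lambda>z. \<psi> (f (inv_into U \<phi> z)) j)" if "j < mdim P" for j
    by (rule Cinf_on_subset[OF _ image_mono[OF W'(2)]]) (use f that in \<open>simp add: smooth_in_charts_def cd\<close>)
  moreover have "f ` W' \<subseteq> V" "W' \<subseteq> U"
    using f order_trans[OF image_mono[OF W'(2), of f]] W'(2) by (auto simp: smooth_in_charts_def cd)
  ultimately show ?thesis using W' by (simp add: smooth_in_charts_def cd)
qed

lemma smooth_on_charts:
  assumes N: "smooth_atlas N" and P: "smooth_atlas P" and f: "smooth_on N W P f" "p \<in> W"
    and c: "smooth_chart N (U, \<phi>)" "p \<in> U" and d: "smooth_chart P (V, \<psi>)" "f p \<in> V"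
  obtains W' where "p \<in> W'" "W' \<subseteq> W" "smooth_in_charts N P W' (U, \<phi>) (V, \<psi>) f"
proof -
  from f obtain A \<theta> B \<eta> W' where *: "(A, \<theta>) \<in> atlas N" "(B, \<eta>) \<in> atlas P" "W' \<subseteq> W" "p \<in> W'"
    "smooth_in_charts N P W' (A, \<theta>) (B, \<eta>) f"
    unfolding smooth_on_iff by (metis surj_pair)
  show thesis
    by (rule that[OF _ _ smooth_in_charts_change[OF N P smooth_atlasD[OF N *(1)] c(1) smooth_atlasD[OF P *(2)] d(1) *(5)]])
      (use * c d in auto)
qed

text \<open>\<open>smooth_on\<close> asks for charts from the atlas itself; here any charts of the
  maximal atlas may be used, as they can be exchanged afterwards.\<close>

lemma smooth_onI:
  assumes N: "smooth_atlas N" and P: "smooth_atlas P" and W: "open_in N W"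
    and f: "\<And>p. p \<in> W \<Longrightarrow> \<exists>U \<phi> V \<psi> W'. smooth_chart N (U, \<phi>) \<and> smooth_chart P (V, \<psi>) \<and> p \<in> W' \<and>
      smooth_in_charts N P W' (U, \<phi>) (V, \<psi>) f"
  shows "smooth_on N W P f"
  unfolding smooth_on_iff
proof (intro conjI W ballI)
  fix p assume p: "p \<in> W"
  obtain U \<phi> V \<psi> W' where *: "smooth_chart N (U, \<phi>)" "smooth_chart P (V, \<psi>)" "p \<in> W'"
      "smooth_in_charts N P W' (U, \<phi>) (V, \<psi>) f"
    using f[OF p] by blast
  then have "p \<in> pts N" "f p \<in> pts P"
    using smooth_chartD(1)[OF *(1)] smooth_chartD(1)[OF *(2)] by (auto simp: smooth_in_charts_def)
  then obtain A \<theta> B \<eta> where AB: "(A, \<theta>) \<in> atlas N" "p \<in> A" "(B, \<eta>) \<in> atlas P" "f p \<in> B"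
    by (meson ptsE)
  let ?W = "{q \<in> W' \<inter> A. f q \<in> B}"
  have s: "smooth_in_charts N P ?W (A, \<theta>) (B, \<eta>) f"
    by (rule smooth_in_charts_change[OF N P *(1) smooth_atlasD[OF N AB(1)] *(2) smooth_atlasD[OF P AB(3)] *(4)])
  then have "open_in N ?W" by (simp add: smooth_in_charts_def)
  from open_in_Int[OF N W this] smooth_in_charts_subset[OF s open_in_Int[OF N W this]]
  have "smooth_in_charts N P (W \<inter> ?W) (A, \<theta>) (B, \<eta>) f" by auto
  then show "\<exists>c\<in>atlas N. \<exists>d\<in>atlas P. \<exists>W'\<subseteq>W. p \<in> W' \<and> smooth_in_charts N P W' c d f"
    using AB * p by (intro bexI[of _ "(A, \<theta>)"] bexI[of _ "(B, \<eta>)"] exI[of _ "W \<inter> ?W"]) auto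
qed

lemma smooth_on_image: "smooth_on N W P f \<Longrightarrow> p \<in> W \<Longrightarrow> f p \<in> pts P"
  unfolding smooth_on_def pts_def by (fastforce split: prod.splits)

lemma smooth_map_image: "smooth_map N P f \<Longrightarrow> p \<in> pts N \<Longrightarrow> f p \<in> pts P"
  unfolding smooth_map_def by (rule smooth_on_image)

lemma smooth_on_compose:
  assumes M: "smooth_atlas M" and N: "smooth_atlas N" and P: "smooth_atlas P"
    and g: "smooth_on M W N g" and f: "smooth_map N P f"
  shows "smooth_on M W P (\<lambda>x. f (g x))"
proof (rule smooth_onI[OF M P])
  show "open_in M W" using g by (simp add: smooth_on_def)
  fix p assume p: "p \<in> W"
  then have "p \<in> pts M" "g p \<in> pts N" using g smooth_on_image[OF g] by (auto simp: smooth_on_def open_in_def)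
  moreover from this have "f (g p) \<in> pts P" by (intro smooth_map_image[OF f])
  ultimately obtain A \<theta> B \<eta> C \<zeta> where A: "(A, \<theta>) \<in> atlas M" "p \<in> A" and B: "(B, \<eta>) \<in> atlas N" "g p \<in> B"
    and C: "(C, \<zeta>) \<in> atlas P" "f (g p) \<in> C"
    by (meson ptsE)
  note sA = smooth_atlasD[OF M A(1)] note sB = smooth_atlasD[OF N B(1)] note sC = smooth_atlasD[OF P C(1)]
  obtain W1 where W1: "p \<in> W1" "W1 \<subseteq> W" "smooth_in_charts M N W1 (A, \<theta>) (B, \<eta>) g"
    using smooth_on_charts[OF M N g p sA A(2) sB B(2)] .
  obtain W2 where W2: "g p \<in> W2" "W2 \<subseteq> pts N" "smooth_in_charts N P W2 (B, \<eta>) (C, \<zeta>) f"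
    using smooth_on_charts[OF N P f[unfolded smooth_map_def] \<open>g p \<in> pts N\<close> sB B(2) sC C(2)] .
  have W1': "open_in M W1" "W1 \<subseteq> A" "g ` W1 \<subseteq> B"
      "\<And>j. j < mdim N \<Longrightarrow> Cinf_on (mdim M) (\<theta> ` W1) (\<lambda>z. \<eta> (g (inv_into A \<theta> z)) j)"
    using W1(3) by (auto simp: smooth_in_charts_def)
  have W2': "open_in N W2" "W2 \<subseteq> B" "f ` W2 \<subseteq> C"
      "\<And>j. j < mdim P \<Longrightarrow> Cinf_on (mdim N) (\<eta> ` W2) (\<lambda>z. \<zeta> (f (inv_into B \<eta> z)) j)"
    using W2(3) by (auto simp: smooth_in_charts_def)
  have o1: "openin (Euclidean_space (mdim M)) (\<theta> ` W1)"
    using open_in_chart[OF M sA W1'(1)] W1'(2) by (simp add: Int_absorb2)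
  have o2: "openin (Euclidean_space (mdim N)) (\<eta> ` W2)"
    using open_in_chart[OF N sB W2'(1)] W2'(2) by (simp add: Int_absorb2)
  let ?W = "{q \<in> W1. g q \<in> W2}"
  have "openin (Euclidean_space (mdim M)) {z \<in> \<theta> ` W1. \<eta> (g (inv_into A \<theta> z)) \<in> \<eta> ` W2}"
  proof (rule openin_Euclidean_space_vimage[OF o1 o2])
    show "\<eta> (g (inv_into A \<theta> z)) \<in> topspace (Euclidean_space (mdim N))" if "z \<in> \<theta> ` W1" for z
      using that W1' chart_inv[OF sA] chart_topspace[OF sB] by (auto simp: subset_iff)
  qed (rule Cinf_on_continuous[OF W1'(4)])
  moreover have "{z \<in> \<theta> ` W1. \<eta> (g (inv_into A \<theta> z)) \<in> \<eta> ` W2} = \<theta> ` ?W"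
  proof (intro equalityI subsetI)
    fix z assume "z \<in> {z \<in> \<theta> ` W1. \<eta> (g (inv_into A \<theta> z)) \<in> \<eta> ` W2}"
    then obtain p q where "z = \<theta> p" "p \<in> W1" "\<eta> (g p) = \<eta> q" "q \<in> W2"
      using chart_inv[OF sA] W1'(2) by (auto simp: subset_iff)
    moreover from this have "g p = q" using smooth_chartD(2)[OF sB] W1'(3) W2'(2) by (auto dest: inj_onD)
    ultimately show "z \<in> \<theta> ` ?W" by auto
  next
    fix z assume "z \<in> \<theta> ` ?W"
    then show "z \<in> {z \<in> \<theta> ` W1. \<eta> (g (inv_into A \<theta> z)) \<in> \<eta> ` W2}"
      using chart_inv[OF sA] W1'(2) by (auto simp: subset_iff)
  qed
  ultimately have o3: "openin (Euclidean_space (mdim M)) (\<theta> ` ?W)" by simp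
  then have oi: "open_in M ?W" using W1'(2) by (intro open_in_chartI[OF M sA]) auto
  have "Cinf_on (mdim M) (\<theta> ` ?W) (\<lambda>z. \<zeta> (f (g (inv_into A \<theta> z))) j)" if j: "j < mdim P" for j
  proof -
    have "Cinf_on (mdim M) (\<theta> ` ?W) (\<lambda>z. \<zeta> (f (inv_into B \<eta> (\<eta> (g (inv_into A \<theta> z))))) j)"
    proof (rule Cinf_on_compose[OF o3 o2 _ _ W2'(4)[OF j]])
      show "\<eta> (g (inv_into A \<theta> z)) \<in> \<eta> ` W2" if "z \<in> \<theta> ` ?W" for z
        using that W1' chart_inv[OF sA] by (auto simp: subset_iff)
      show "Cinf_on (mdim M) (\<theta> ` ?W) (\<lambda>z. \<eta> (g (inv_into A \<theta> z)) i)" if "i < mdim N" for i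
        by (rule Cinf_on_subset[OF W1'(4)[OF that]]) auto
    qed
    moreover have "\<zeta> (f (inv_into B \<eta> (\<eta> (g (inv_into A \<theta> z))))) j = \<zeta> (f (g (inv_into A \<theta> z))) j"
      if "z \<in> \<theta> ` ?W" for z
      using that W1' chart_inv[OF sA] chart_inv[OF sB] by (auto simp: subset_iff)
    ultimately show ?thesis by (rule Cinf_on_eq[OF o3])
  qed
  then have "smooth_in_charts M P ?W (A, \<theta>) (C, \<zeta>) (\<lambda>x. f (g x))"
    using oi W1' W2' by (auto simp: smooth_in_charts_def)
  then show "\<exists>U \<phi> V \<psi> W'. smooth_chart M (U, \<phi>) \<and> smooth_chart P (V, \<psi>) \<and> p \<in> W' \<and>
      smooth_in_charts M P W' (U, \<phi>) (V, \<psi>) (\<lambda>x. f (g x))"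
    using sA sC W1(1) W2(1)
    by (intro exI[of _ A] exI[of _ \<theta>] exI[of _ C] exI[of _ \<zeta>] exI[of _ ?W] conjI) simp_all
qed

subsection \<open>Manifolds with a single chart\<close>

lemma single_chart:
  assumes N: "N = \<lparr>mdim = d, atlas = {(A, \<kappa>)}\<rparr>" and inj: "inj_on \<kappa> A"
    and o: "openin (Euclidean_space d) (\<kappa> ` A)"
  shows "smooth_chart N (A, \<kappa>)" "smooth_atlas N" "pts N = A"
    "open_in N W \<longleftrightarrow> W \<subseteq> A \<and> openin (Euclidean_space d) (\<kappa> ` W)"
proof -
  show pts: "pts N = A" by (simp add: pts_def N)
  have "Cinf_on d (\<kappa> ` A) (\<lambda>z. \<kappa> (inv_into A \<kappa> z) i)" for i
    by (rule Cinf_on_eq[OF o Cinf_on_coord[of _ _ i]]) (auto simp: f_inv_into_f)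
  then show c: "smooth_chart N (A, \<kappa>)"
    using inj o by (auto simp: smooth_chart_def pts compatible_def) (auto simp: N)
  then show "smooth_atlas N" by (simp add: smooth_atlas_def N)
  show "open_in N W \<longleftrightarrow> W \<subseteq> A \<and> openin (Euclidean_space d) (\<kappa> ` W)"
    by (auto simp: open_in_def pts) (auto simp: N Int_absorb2)
qed

definition plane_coord :: "real \<times> real \<Rightarrow> nat \<Rightarrow> real" where
  "plane_coord = (\<lambda>(s, t) i. if i = 0 then s else if i = 1 then t else 0)"

lemma plane_coord_simps [simp]:
  "plane_coord (s, t) 0 = s" "plane_coord (s, t) (Suc 0) = t"
  "(plane_coord (s, t))(0 := h) = plane_coord (h, t)" "(plane_coord (s, t))(Suc 0 := h) = plane_coord (s, h)"
  "plane_coord p \<in> topspace (Euclidean_space 2)"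
  by (cases p; auto simp: plane_coord_def fun_eq_iff topspace_Euclidean_space)+

lemma plane_coord_of:
  assumes "z \<in> topspace (Euclidean_space 2)" shows "plane_coord (z 0, z (Suc 0)) = z"
proof
  fix i show "plane_coord (z 0, z (Suc 0)) i = z i"
  proof (cases "i < 2")
    case True then have "i = 0 \<or> i = Suc 0" by auto
    then show ?thesis by auto
  next
    case False then show ?thesis using assms by (simp add: plane_coord_def topspace_Euclidean_space)
  qed
qed

lemma inj_plane_coord: "inj plane_coord"
  by (rule injI) (metis plane_coord_simps(1,2) surj_pair)

lemma inj_line_coord: "inj line_coord"
  by (rule injI) simp

lemma line_chart:
  "smooth_chart line (UNIV, line_coord)" "smooth_atlas line" "pts line = UNIV" "mdim line = Suc 0"
  "open_in line W \<longleftrightarrow> open W"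
proof -
  have l: "line = \<lparr>mdim = Suc 0, atlas = {(UNIV, line_coord)}\<rparr>"
    by (simp add: line_def line_coord_def[abs_def])
  have o: "openin (Euclidean_space (Suc 0)) (line_coord ` UNIV)" by (simp add: openin_line_coord_image)
  note s = single_chart[OF l inj_line_coord o]
  show "smooth_chart line (UNIV, line_coord)" "smooth_atlas line" "pts line = UNIV"
    by (rule s)+
  show "mdim line = Suc 0" by (simp add: l)
  show "open_in line W \<longleftrightarrow> open W" using s(4)[of W] by (simp add: openin_line_coord_image)
qed

lemma plane_chart:
  "smooth_chart plane (UNIV, plane_coord)" "smooth_atlas plane" "pts plane = UNIV" "mdim plane = 2"
  "open_in plane W \<longleftrightarrow> openin (Euclidean_space 2) (plane_coord ` W)"
proof -
  have l: "plane = \<lparr>mdim = 2, atlas = {(UNIV, plane_coord)}\<rparr>"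
    by (simp add: plane_def plane_coord_def)
  have "plane_coord ` UNIV = topspace (Euclidean_space 2)"
  proof (intro equalityI subsetI)
    fix z assume z: "z \<in> topspace (Euclidean_space 2)"
    show "z \<in> range plane_coord"
      by (rule range_eqI[where x = "(z 0, z (Suc 0))"]) (rule plane_coord_of[OF z, symmetric])
  qed auto
  then have o: "openin (Euclidean_space 2) (plane_coord ` UNIV)" by simp
  note s = single_chart[OF l inj_plane_coord o]
  show "smooth_chart plane (UNIV, plane_coord)" "smooth_atlas plane" "pts plane = UNIV"
    by (rule s)+
  show "mdim plane = 2" by (simp add: l)
  show "open_in plane W \<longleftrightarrow> openin (Euclidean_space 2) (plane_coord ` W)" using s(4)[of W] by simp
qed

lemma smooth_near_pts: "smooth_near M p N \<gamma> \<Longrightarrow> \<gamma> p \<in> pts N"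
  unfolding smooth_near_def using smooth_on_image by metis

lemma smooth_near_line_iff:
  assumes N: "smooth_atlas N" and c: "smooth_chart N (U, \<psi>)" "\<gamma> 0 \<in> U"
  shows "smooth_near line 0 N \<gamma> \<longleftrightarrow>
    (\<exists>S. open S \<and> 0 \<in> S \<and> \<gamma> ` S \<subseteq> U \<and> (\<forall>i<mdim N. smooth_R S (\<lambda>t. \<psi> (\<gamma> t) i)))"
proof
  assume "smooth_near line 0 N \<gamma>"
  then obtain W where W: "0 \<in> W" "smooth_on line W N \<gamma>" by (auto simp: smooth_near_def)
  obtain S where S: "0 \<in> S" "S \<subseteq> W" "smooth_in_charts line N S (UNIV, line_coord) (U, \<psi>) \<gamma>"
    using smooth_on_charts[OF line_chart(2) N W(2,1) line_chart(1) UNIV_I c] .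
  have o: "open S" "\<gamma> ` S \<subseteq> U" and C: "\<And>i. i < mdim N \<Longrightarrow> Cinf_on (Suc 0) (line_coord ` S) (\<lambda>z. \<psi> (\<gamma> (inv_into UNIV line_coord z)) i)"
    using S(3) by (auto simp: smooth_in_charts_def line_chart)
  have "smooth_R S (\<lambda>t. \<psi> (\<gamma> t) i)" if "i < mdim N" for i
    using smooth_R_line_coord[OF _ C[OF that], of S] o(1) by (simp add: openin_line_coord_image inj_line_coord)
  then show "\<exists>S. open S \<and> 0 \<in> S \<and> \<gamma> ` S \<subseteq> U \<and> (\<forall>i<mdim N. smooth_R S (\<lambda>t. \<psi> (\<gamma> t) i))"
    using o S(1) by (intro exI[of _ S]) simp
next
  assume "\<exists>S. open S \<and> 0 \<in> S \<and> \<gamma> ` S \<subseteq> U \<and> (\<forall>i<mdim N. smooth_R S (\<lambda>t. \<psi> (\<gamma> t) i))"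
  then obtain S where S: "open S" "0 \<in> S" "\<gamma> ` S \<subseteq> U" "\<And>i. i<mdim N \<Longrightarrow> smooth_R S (\<lambda>t. \<psi> (\<gamma> t) i)" by metis
  have o: "openin (Euclidean_space (Suc 0)) (line_coord ` S)" using S(1) by (simp add: openin_line_coord_image)
  have "Cinf_on (Suc 0) (line_coord ` S) (\<lambda>z. \<psi> (\<gamma> (inv_into UNIV line_coord z)) i)" if "i < mdim N" for i
    by (rule Cinf_on_eq[OF o Cinf_on_smooth_R[OF S(1) S(4)[OF that]]]) (auto simp: inj_line_coord)
  then have "smooth_in_charts line N S (UNIV, line_coord) (U, \<psi>) \<gamma>"
    using S by (simp add: smooth_in_charts_def line_chart)
  then have "smooth_on line S N \<gamma>"
    using S(1) c line_chart
    by (intro smooth_onI[OF line_chart(2) N])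
      (simp, intro exI[of _ UNIV] exI[of _ line_coord] exI[of _ U] exI[of _ \<psi>] exI[of _ S], simp)
  then show "smooth_near line 0 N \<gamma>" using S(2) by (auto simp: smooth_near_def)
qed

lemma smooth_near_plane_iff:
  assumes N: "smooth_atlas N" and c: "smooth_chart N (U, \<psi>)" "\<phi> (0, 0) \<in> U"
  shows "smooth_near plane (0, 0) N \<phi> \<longleftrightarrow>
    (\<exists>W. openin (Euclidean_space 2) W \<and> plane_coord (0, 0) \<in> W \<and>
      (\<forall>z\<in>W. \<phi> (z 0, z (Suc 0)) \<in> U) \<and> (\<forall>i<mdim N. Cinf_on 2 W (\<lambda>z. \<psi> (\<phi> (z 0, z (Suc 0))) i)))"
proof
  assume "smooth_near plane (0, 0) N \<phi>"
  then obtain W where W: "(0, 0) \<in> W" "smooth_on plane W N \<phi>" by (auto simp: smooth_near_def)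
  obtain S where S: "(0, 0) \<in> S" "S \<subseteq> W" "smooth_in_charts plane N S (UNIV, plane_coord) (U, \<psi>) \<phi>"
    using smooth_on_charts[OF plane_chart(2) N W(2,1) plane_chart(1) UNIV_I c] .
  have o: "openin (Euclidean_space 2) (plane_coord ` S)" "\<phi> ` S \<subseteq> U"
    and C: "\<And>i. i < mdim N \<Longrightarrow> Cinf_on 2 (plane_coord ` S) (\<lambda>z. \<psi> (\<phi> (inv_into UNIV plane_coord z)) i)"
    using S(3) by (auto simp: smooth_in_charts_def plane_chart)
  have e: "inv_into UNIV plane_coord z = (z 0, z (Suc 0)) \<and> (z 0, z (Suc 0)) \<in> S" if "z \<in> plane_coord ` S" for z
    using that inj_plane_coord by auto
  have "Cinf_on 2 (plane_coord ` S) (\<lambda>z. \<psi> (\<phi> (z 0, z (Suc 0))) i)" if "i < mdim N" for i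
    by (rule Cinf_on_eq[OF o(1) C[OF that]]) (use e in auto)
  then show "\<exists>W. openin (Euclidean_space 2) W \<and> plane_coord (0, 0) \<in> W \<and>
      (\<forall>z\<in>W. \<phi> (z 0, z (Suc 0)) \<in> U) \<and> (\<forall>i<mdim N. Cinf_on 2 W (\<lambda>z. \<psi> (\<phi> (z 0, z (Suc 0))) i))"
    using o(1)
  proof (intro exI[of _ "plane_coord ` S"] conjI ballI)
    show "plane_coord (0, 0) \<in> plane_coord ` S" using S(1) by (rule imageI)
    show "\<phi> (z 0, z (Suc 0)) \<in> U" if "z \<in> plane_coord ` S" for z
      using e[OF that] o(2) by blast
  qed simp_all
next
  assume "\<exists>W. openin (Euclidean_space 2) W \<and> plane_coord (0, 0) \<in> W \<and>
      (\<forall>z\<in>W. \<phi> (z 0, z (Suc 0)) \<in> U) \<and> (\<forall>i<mdim N. Cinf_on 2 W (\<lambda>z. \<psi> (\<phi> (z 0, z (Suc 0))) i))"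
  then obtain W where W: "openin (Euclidean_space 2) W" "plane_coord (0, 0) \<in> W"
    "\<forall>z\<in>W. \<phi> (z 0, z (Suc 0)) \<in> U" and W4: "\<forall>i<mdim N. Cinf_on 2 W (\<lambda>z. \<psi> (\<phi> (z 0, z (Suc 0))) i)"
    by (elim exE conjE) (rule that)
  define S where "S = plane_coord -` W"
  have SW: "plane_coord ` S = W"
  proof
    show "W \<subseteq> plane_coord ` S"
    proof
      fix z assume "z \<in> W"
      then have "z = plane_coord (z 0, z (Suc 0))" using plane_coord_of openin_subset[OF W(1)] by force
      then show "z \<in> plane_coord ` S" using \<open>z \<in> W\<close> unfolding S_def by (metis imageI vimageI)
    qed
  qed (auto simp: S_def)
  have "Cinf_on 2 W (\<lambda>z. \<psi> (\<phi> (inv_into UNIV plane_coord z)) i)" if "i < mdim N" for i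
  proof (rule Cinf_on_eq[OF W(1) W4[rule_format, OF that]])
    fix z assume "z \<in> W"
    then have "plane_coord (z 0, z (Suc 0)) = z" using plane_coord_of openin_subset[OF W(1)] by blast
    then have "inv_into UNIV plane_coord z = (z 0, z (Suc 0))" using inj_plane_coord by (metis inv_f_f)
    then show "\<psi> (\<phi> (z 0, z (Suc 0))) i = \<psi> (\<phi> (inv_into UNIV plane_coord z)) i" by simp
  qed
  moreover have "\<phi> ` S \<subseteq> U"
  proof
    fix q assume "q \<in> \<phi> ` S"
    then obtain s t where "q = \<phi> (s, t)" "plane_coord (s, t) \<in> W" by (auto simp: S_def)
    then show "q \<in> U" using W(3)[rule_format, of "plane_coord (s, t)"] by simp
  qed
  ultimately have "smooth_in_charts plane N S (UNIV, plane_coord) (U, \<psi>) \<phi>"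
    using W by (simp add: smooth_in_charts_def plane_chart SW)
  then have "smooth_on plane S N \<phi>"
    using W(1) c plane_chart
    by (intro smooth_onI[OF plane_chart(2) N])
      (simp add: SW, intro exI[of _ UNIV] exI[of _ plane_coord] exI[of _ U] exI[of _ \<psi>] exI[of _ S], simp)
  then show "smooth_near plane (0, 0) N \<phi>" using W(2) by (auto simp: smooth_near_def S_def)
qed

lemma smooth_near_line_eventually_in:
  assumes N: "smooth_atlas N" and c: "smooth_chart N (U, \<psi>)" "\<gamma> 0 \<in> U" and "smooth_near line 0 N \<gamma>"
  shows "\<forall>\<^sub>F t in nhds 0. \<gamma> t \<in> U"
proof -
  obtain S where "open S" "0 \<in> S" "\<gamma> ` S \<subseteq> U"
    using assms(4) smooth_near_line_iff[of N U \<psi> \<gamma>, OF N c] by metis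
  then show ?thesis using eventually_nhds_in_open[of S 0] by (auto elim!: eventually_mono simp: image_subset_iff)
qed

lemma smooth_near_line_cong:
  assumes N: "smooth_atlas N" and \<gamma>: "smooth_near line 0 N \<gamma>" and ev: "\<forall>\<^sub>F t in nhds 0. \<gamma> t = \<delta> t"
  shows "smooth_near line 0 N \<delta>"
proof -
  obtain U \<psi> where "(U, \<psi>) \<in> atlas N" "\<gamma> 0 \<in> U" by (rule ptsE[OF smooth_near_pts[OF \<gamma>]])
  then have c: "smooth_chart N (U, \<psi>)" "\<gamma> 0 \<in> U" using smooth_atlasD[OF N] by auto
  have 0: "\<delta> 0 = \<gamma> 0" using eventually_nhds_x_imp_x[OF ev] by simp
  obtain S where S: "open S" "0 \<in> S" "\<gamma> ` S \<subseteq> U" "\<And>i. i<mdim N \<Longrightarrow> smooth_R S (\<lambda>t. \<psi> (\<gamma> t) i)"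
    using \<gamma> smooth_near_line_iff[of N U \<psi> \<gamma>, OF N c] by metis
  obtain S' where S': "open S'" "0 \<in> S'" "\<And>t. t \<in> S' \<Longrightarrow> \<gamma> t = \<delta> t"
    using ev unfolding eventually_nhds by metis
  have "smooth_R (S \<inter> S') (\<lambda>t. \<psi> (\<delta> t) i)" if "i < mdim N" for i
    by (rule smooth_R_cong[OF open_Int[OF S(1) S'(1)] _ smooth_R_subset[OF S(4)[OF that]]]) (use S'(3) in auto)
  moreover have "\<delta> ` (S \<inter> S') \<subseteq> U" using S(3) S'(3) by force
  ultimately have "\<exists>S. open S \<and> 0 \<in> S \<and> \<delta> ` S \<subseteq> U \<and> (\<forall>i<mdim N. smooth_R S (\<lambda>t. \<psi> (\<delta> t) i))"
    using S(1,2) S'(1,2) by (intro exI[of _ "S \<inter> S'"]) auto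
  then show ?thesis using smooth_near_line_iff[of N U \<psi> \<delta>, OF N c(1)] c(2) 0 by simp
qed

lemma smooth_near_compose:
  assumes "smooth_atlas M" "smooth_atlas N" "smooth_atlas P" "smooth_near M p N g" "smooth_map N P f"
  shows "smooth_near M p P (\<lambda>x. f (g x))"
  using smooth_on_compose[OF assms(1-3) _ assms(5)] assms(4) unfolding smooth_near_def by metis

subsection \<open>Velocities\<close>

lemma jet_cong_ev:
  assumes "\<forall>\<^sub>F t in nhds t0. a t = b t"
  shows "jet n k a t0 = jet n k b t0"
proof
  fix j
  have "(deriv ^^ (j div n)) (\<lambda>t. a t (j mod n)) t0 = (deriv ^^ (j div n)) (\<lambda>t. b t (j mod n)) t0"
    by (rule higher_deriv_cong_ev[OF eventually_mono[OF assms] refl]) simp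
  then show "jet n k a t0 j = jet n k b t0 j" by (simp add: jet_def)
qed

lemma jet_index: "i < n \<Longrightarrow> \<alpha> \<le> k \<Longrightarrow> \<alpha> * n + i < n * (k + 1)" for i n \<alpha> k :: nat
proof -
  assume "i < n" "\<alpha> \<le> k"
  then have "\<alpha> * n + i < (\<alpha> + 1) * n" by simp
  also have "\<dots> \<le> (k + 1) * n" using \<open>\<alpha> \<le> k\<close> by (intro mult_le_mono1) simp
  finally show ?thesis by (simp add: mult.commute)
qed

lemma jet_nth: "i < n \<Longrightarrow> \<alpha> \<le> k \<Longrightarrow> jet n k a t (\<alpha> * n + i) = (deriv ^^ \<alpha>) (\<lambda>t. a t i) t"
  using jet_index[of i n \<alpha> k] by (simp add: jet_def)

lemma jet_eq_iff:
  "jet n k a t = jet n k b t' \<longleftrightarrow>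
     (\<forall>i<n. \<forall>\<alpha>\<le>k. (deriv ^^ \<alpha>) (\<lambda>t. a t i) t = (deriv ^^ \<alpha>) (\<lambda>t. b t i) t')"
proof
  assume e: "jet n k a t = jet n k b t'"
  show "\<forall>i<n. \<forall>\<alpha>\<le>k. (deriv ^^ \<alpha>) (\<lambda>t. a t i) t = (deriv ^^ \<alpha>) (\<lambda>t. b t i) t'"
    using jet_nth[of _ n _ k a t] jet_nth[of _ n _ k b t'] e by metis
next
  assume *: "\<forall>i<n. \<forall>\<alpha>\<le>k. (deriv ^^ \<alpha>) (\<lambda>t. a t i) t = (deriv ^^ \<alpha>) (\<lambda>t. b t i) t'"
  show "jet n k a t = jet n k b t'"
  proof
    fix j
    have "j mod n < n \<and> j div n \<le> k" if "j < n * (k + 1)"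
      using that by (cases n) (auto simp: less_Suc_eq_le[symmetric] less_mult_imp_div_less mult.commute)
    then show "jet n k a t j = jet n k b t' j" using * by (simp add: jet_def)
  qed
qed

lemma lift_coords_jet: "lift_coords k n \<psi> J = jet n k (\<lambda>t. \<psi> (rep J t)) 0"
  by (rule ext) (simp add: lift_coords_def jet_def)

text \<open>The common source of three facts: \<open>vel\<close> can be tested in a single chart,
  \<open>T_map\<close> does not depend on the representative, and \<open>T_map\<close> is smooth in
  lifted coordinates.\<close>

lemma jet_smooth_in_charts:
  assumes N: "smooth_atlas N" and P: "smooth_atlas P"
    and c: "smooth_chart N (U, \<phi>)" and d: "smooth_chart P (V, \<psi>)"
    and f: "smooth_in_charts N P W (U, \<phi>) (V, \<psi>) f"
  obtains H where "\<And>j. j < mdim P * (k + 1) \<Longrightarrow>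
      Cinf_on (mdim N * (k + 1)) (jet_dom (mdim N) k (\<phi> ` W)) (\<lambda>z. H z j)"
    and "\<And>\<gamma>. smooth_near line 0 N \<gamma> \<Longrightarrow> \<gamma> 0 \<in> W \<Longrightarrow>
      jet (mdim P) k (\<lambda>t. \<psi> (f (\<gamma> t))) 0 = H (jet (mdim N) k (\<lambda>t. \<phi> (\<gamma> t)) 0)"
proof -
  have W: "open_in N W" "W \<subseteq> U" 
    and C: "\<And>j. j < mdim P \<Longrightarrow> Cinf_on (mdim N) (\<phi> ` W) (\<lambda>z. \<psi> (f (inv_into U \<phi> z)) j)"
    using f by (auto simp: smooth_in_charts_def)
  have oW: "openin (Euclidean_space (mdim N)) (\<phi> ` W)"
    using open_in_chart[OF N c W(1)] W(2) by (simp add: Int_absorb2)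
  show thesis
  proof (rule jet_transform[of "mdim N" "\<phi> ` W" "mdim P" "\<lambda>z. \<psi> (f (inv_into U \<phi> z))" k, OF oW C], assumption)
  fix H assume H: "\<And>j. j < mdim P * (k + 1) \<Longrightarrow>
      Cinf_on (mdim N * (k + 1)) (jet_dom (mdim N) k (\<phi> ` W)) (\<lambda>z. H z j)"
    "\<And>S a t. open S \<Longrightarrow> (\<And>i. i < mdim N \<Longrightarrow> smooth_R S (\<lambda>t. a t i)) \<Longrightarrow> (\<And>t. t \<in> S \<Longrightarrow> a t \<in> \<phi> ` W) \<Longrightarrow> t \<in> S \<Longrightarrow>
      jet (mdim P) k (\<lambda>t. \<psi> (f (inv_into U \<phi> (a t)))) t = H (jet (mdim N) k a t)"
  show thesis
  proof (rule that[OF H(1)])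
    fix \<gamma> assume \<gamma>: "smooth_near line 0 N \<gamma>" "\<gamma> 0 \<in> W"
    have cW: "smooth_chart N (U, \<phi>)" "\<gamma> 0 \<in> U" using c \<gamma>(2) W(2) by auto
    obtain S where S: "open S" "0 \<in> S" "\<gamma> ` S \<subseteq> U" "\<And>i. i<mdim N \<Longrightarrow> smooth_R S (\<lambda>t. \<phi> (\<gamma> t) i)"
      using \<gamma> smooth_near_line_iff[of N U \<phi> \<gamma>, OF N cW] by metis
    have "\<forall>\<^sub>F t in nhds 0. \<phi> (\<gamma> t) \<in> \<phi> ` W"
    proof (rule eventually_in_openin_Euclidean_space[OF oW])
      show "\<phi> (\<gamma> 0) \<in> \<phi> ` W" using \<gamma>(2) by simp
      show "\<forall>\<^sub>F t in nhds 0. \<phi> (\<gamma> t) \<in> topspace (Euclidean_space (mdim N))"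
        using smooth_near_line_eventually_in[OF N cW \<gamma>(1)]
        by eventually_elim (rule chart_topspace[OF c])
      show "((\<lambda>t. \<phi> (\<gamma> t) i) \<longlongrightarrow> \<phi> (\<gamma> 0) i) (nhds 0)" if "i < mdim N" for i
        using DERIV_isCont[OF smooth_R_DERIV[OF S(4)[OF that] S(2), of 0]]
        by (simp add: isCont_def tendsto_nhds_iff)
    qed
    then obtain S' where S': "open S'" "0 \<in> S'" "\<And>t. t \<in> S' \<Longrightarrow> \<phi> (\<gamma> t) \<in> \<phi> ` W"
      unfolding eventually_nhds by metis
    have "jet (mdim P) k (\<lambda>t. \<psi> (f (inv_into U \<phi> (\<phi> (\<gamma> t))))) 0 = H (jet (mdim N) k (\<lambda>t. \<phi> (\<gamma> t)) 0)"
      by (rule H(2)[of "S \<inter> S'"]) (use S S' smooth_R_subset[OF S(4)] in auto)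
    moreover have "jet (mdim P) k (\<lambda>t. \<psi> (f (inv_into U \<phi> (\<phi> (\<gamma> t))))) 0 = jet (mdim P) k (\<lambda>t. \<psi> (f (\<gamma> t))) 0"
      by (rule jet_cong_ev, rule eventually_mono[OF smooth_near_line_eventually_in[OF N cW \<gamma>(1)]])
        (simp add: chart_inv[OF c])
    ultimately show "jet (mdim P) k (\<lambda>t. \<psi> (f (\<gamma> t))) 0 = H (jet (mdim N) k (\<lambda>t. \<phi> (\<gamma> t)) 0)" by simp
  qed
  qed
qed

lemma transition_smooth_in_charts:
  assumes N: "smooth_atlas N" and c: "smooth_chart N (U, \<phi>)" and d: "smooth_chart N (V, \<psi>)"
  shows "smooth_in_charts N N (U \<inter> V) (U, \<phi>) (V, \<psi>) (\<lambda>x. x)"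
  using transition(2)[OF N c d] open_in_Int[OF N open_in_chart_dom[OF N c] open_in_chart_dom[OF N d]]
  by (auto simp: smooth_in_charts_def)

text \<open>\<open>vel\<close> demands equal derivatives in every atlas chart around the point.
  Transition maps act on jets, so equality in one chart of the maximal atlas implies all the
  others.\<close>

lemma vel_mem_iff:
  assumes N: "smooth_atlas N" and c: "smooth_chart N (U, \<psi>)" and \<gamma>: "smooth_near line 0 N \<gamma>" "\<gamma> 0 \<in> U"
  shows "\<delta> \<in> vel k N \<gamma> \<longleftrightarrow> smooth_near line 0 N \<delta> \<and> \<delta> 0 = \<gamma> 0 \<and>
    jet (mdim N) k (\<lambda>t. \<psi> (\<delta> t)) 0 = jet (mdim N) k (\<lambda>t. \<psi> (\<gamma> t)) 0"
proof -
  have change: "jet (mdim N) k (\<lambda>t. \<theta>' (\<delta> t)) 0 = jet (mdim N) k (\<lambda>t. \<theta>' (\<gamma> t)) 0"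
    if t: "smooth_chart N (A, \<theta>)" "smooth_chart N (A', \<theta>')" "\<gamma> 0 \<in> A" "\<gamma> 0 \<in> A'" "smooth_near line 0 N \<delta>" "\<delta> 0 = \<gamma> 0"
      "jet (mdim N) k (\<lambda>t. \<theta> (\<delta> t)) 0 = jet (mdim N) k (\<lambda>t. \<theta> (\<gamma> t)) 0" for A \<theta> A' \<theta>'
  proof -
    obtain H where "\<And>\<gamma>. smooth_near line 0 N \<gamma> \<Longrightarrow> \<gamma> 0 \<in> A \<inter> A' \<Longrightarrow>
      jet (mdim N) k (\<lambda>t. \<theta>' (\<gamma> t)) 0 = H (jet (mdim N) k (\<lambda>t. \<theta> (\<gamma> t)) 0)"
      using jet_smooth_in_charts[OF N N t(1,2) transition_smooth_in_charts[OF N t(1,2)], of k] by metis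
    then show ?thesis using t \<gamma> by simp
  qed
  obtain A \<theta> where A: "(A, \<theta>) \<in> atlas N" "\<gamma> 0 \<in> A" by (rule ptsE[OF smooth_near_pts[OF \<gamma>(1)]])
  show ?thesis (is "_ \<longleftrightarrow> ?R")
  proof
    assume \<delta>: "\<delta> \<in> vel k N \<gamma>"
    then have "jet (mdim N) k (\<lambda>t. \<theta> (\<delta> t)) 0 = jet (mdim N) k (\<lambda>t. \<theta> (\<gamma> t)) 0"
      unfolding jet_eq_iff using A by (auto simp: vel_def)
    moreover have \<delta>': "smooth_near line 0 N \<delta>" "\<delta> 0 = \<gamma> 0" using \<delta> by (auto simp: vel_def)
    ultimately show ?R using change[OF smooth_atlasD[OF N A(1)] c A(2) \<gamma>(2)] by simp
  next
    assume R: ?R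
    have "jet (mdim N) k (\<lambda>t. \<theta>' (\<delta> t)) 0 = jet (mdim N) k (\<lambda>t. \<theta>' (\<gamma> t)) 0" if "(A', \<theta>') \<in> atlas N" "\<gamma> 0 \<in> A'" for A' \<theta>'
      using change[OF c smooth_atlasD[OF N that(1)] \<gamma>(2) that(2)] R by simp
    then show "\<delta> \<in> vel k N \<gamma>" using R unfolding jet_eq_iff vel_def by auto
  qed
qed

lemma vel_self: "smooth_near line 0 N \<gamma> \<Longrightarrow> \<gamma> \<in> vel k N \<gamma>"
  by (simp add: vel_def)

lemma rep_in_vel: "smooth_near line 0 N \<gamma> \<Longrightarrow> rep (vel k N \<gamma>) \<in> vel k N \<gamma>"
  unfolding rep_def by (rule someI[where P = "\<lambda>\<gamma>'. \<gamma>' \<in> vel k N \<gamma>"]) (erule vel_self)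

lemma vel_cong_ev:
  assumes "\<forall>\<^sub>F t in nhds 0. \<gamma> t = \<delta> t"
  shows "vel k N \<gamma> = vel k N \<delta>"
proof -
  have "(deriv ^^ \<alpha>) (\<lambda>t. \<psi> (\<gamma> t) i) 0 = (deriv ^^ \<alpha>) (\<lambda>t. \<psi> (\<delta> t) i) 0" for \<alpha> \<psi> and i :: nat
    by (rule higher_deriv_cong_ev[OF eventually_mono[OF assms] refl]) simp
  moreover have "\<gamma> 0 = \<delta> 0" by (rule eventually_nhds_x_imp_x[OF assms])
  ultimately show ?thesis by (simp add: vel_def)
qed

lemma vel_eq_iff:
  assumes N: "smooth_atlas N" and c: "smooth_chart N (U, \<psi>)" and \<gamma>: "smooth_near line 0 N \<gamma>" "\<gamma> 0 \<in> U"
    and \<delta>: "smooth_near line 0 N \<delta>"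
  shows "vel k N \<gamma> = vel k N \<delta> \<longleftrightarrow> \<delta> 0 = \<gamma> 0 \<and>
    jet (mdim N) k (\<lambda>t. \<psi> (\<delta> t)) 0 = jet (mdim N) k (\<lambda>t. \<psi> (\<gamma> t)) 0" (is "?L \<longleftrightarrow> ?R")
proof
  assume ?L then have "\<delta> \<in> vel k N \<gamma>" using vel_self[OF \<delta>] by simp
  then show ?R using vel_mem_iff[OF N c \<gamma>] by simp
next
  assume R: ?R
  then have "\<delta> 0 \<in> U" using \<gamma> by simp
  then show ?L using vel_mem_iff[OF N c \<gamma>] vel_mem_iff[OF N c \<delta>] R by auto
qed

lemma vel_memD: "\<delta> \<in> vel k N \<gamma> \<Longrightarrow> smooth_near line 0 N \<delta>" "\<delta> \<in> vel k N \<gamma> \<Longrightarrow> \<delta> 0 = \<gamma> 0"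
  by (auto simp: vel_def)

lemma vel_eq_of_mem:
  assumes N: "smooth_atlas N" and \<gamma>: "smooth_near line 0 N \<gamma>" and \<delta>: "\<delta> \<in> vel k N \<gamma>"
  shows "vel k N \<delta> = vel k N \<gamma>"
proof -
  obtain A \<theta> where A: "(A, \<theta>) \<in> atlas N" "\<gamma> 0 \<in> A" by (rule ptsE[OF smooth_near_pts[OF \<gamma>]])
  note c = smooth_atlasD[OF N A(1)]
  show ?thesis
    using vel_mem_iff[OF N c \<gamma> A(2)] vel_eq_iff[OF N c \<gamma> A(2)] \<delta> by metis
qed

lemma vel_rep: "smooth_atlas N \<Longrightarrow> smooth_near line 0 N \<gamma> \<Longrightarrow> vel k N (rep (vel k N \<gamma>)) = vel k N \<gamma>"
  by (intro vel_eq_of_mem rep_in_vel)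

lemma lift_coords_vel:
  assumes "smooth_atlas N" "smooth_chart N (U, \<psi>)" "smooth_near line 0 N \<gamma>" "\<gamma> 0 \<in> U"
  shows "lift_coords k (mdim N) \<psi> (vel k N \<gamma>) = jet (mdim N) k (\<lambda>t. \<psi> (\<gamma> t)) 0"
  using rep_in_vel[OF assms(3), of k] vel_mem_iff[OF assms] by (simp add: lift_coords_jet)

definition T_dom :: "nat \<Rightarrow> 'a mfd \<Rightarrow> 'a set \<Rightarrow> (real \<Rightarrow> 'a) set set" where
  "T_dom k N U = {vel k N \<gamma> |\<gamma>. smooth_near line 0 N \<gamma> \<and> \<gamma> 0 \<in> U}"

lemma T_mfd_simps:
  "mdim (T_mfd k N) = mdim N * (k + 1)"
  "atlas (T_mfd k N) = (\<lambda>(U, \<psi>). (T_dom k N U, lift_coords k (mdim N) \<psi>)) ` atlas N"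
  by (simp_all add: T_mfd_def T_dom_def)

lemma T_domI: "smooth_near line 0 N \<gamma> \<Longrightarrow> \<gamma> 0 \<in> U \<Longrightarrow> vel k N \<gamma> \<in> T_dom k N U"
  by (auto simp: T_dom_def)

lemma T_domE:
  assumes "J \<in> T_dom k N U"
  obtains \<gamma> where "J = vel k N \<gamma>" "smooth_near line 0 N \<gamma>" "\<gamma> 0 \<in> U"
  using assms by (auto simp: T_dom_def)

lemma pts_T_mfd: "pts (T_mfd k N) = T_dom k N (pts N)"
  unfolding pts_def T_mfd_simps by (force simp: T_dom_def split: prod.splits)

lemma rep_vel_0: "smooth_near line 0 N \<gamma> \<Longrightarrow> rep (vel k N \<gamma>) 0 = \<gamma> 0"
  using vel_memD(2)[OF rep_in_vel] .

lemma rep_vel_smooth: "smooth_near line 0 N \<gamma> \<Longrightarrow> smooth_near line 0 N (rep (vel k N \<gamma>))"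
  using vel_memD(1)[OF rep_in_vel] .

lemma T_dom_rep:
  assumes "J \<in> T_dom k N U"
  shows "smooth_near line 0 N (rep J)" "rep J 0 \<in> U" "smooth_atlas N \<Longrightarrow> vel k N (rep J) = J"
  using assms by (auto elim!: T_domE simp: rep_vel_0 rep_vel_smooth vel_rep)

lemma T_dom_mem_iff: "smooth_near line 0 N \<gamma> \<Longrightarrow> vel k N \<gamma> \<in> T_dom k N U \<longleftrightarrow> \<gamma> 0 \<in> U"
  using T_dom_rep(2)[of "vel k N \<gamma>" k N U] by (auto simp: rep_vel_0 intro: T_domI)

lemma T_dom_mono: "U \<subseteq> V \<Longrightarrow> T_dom k N U \<subseteq> T_dom k N V"
  by (auto simp: T_dom_def)

lemma T_dom_Int: "T_dom k N U \<inter> T_dom k N V = T_dom k N (U \<inter> V)"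
proof (intro equalityI subsetI)
  fix J assume J: "J \<in> T_dom k N U \<inter> T_dom k N V"
  then obtain \<gamma> where "J = vel k N \<gamma>" "smooth_near line 0 N \<gamma>" "\<gamma> 0 \<in> U" by (auto elim: T_domE)
  then show "J \<in> T_dom k N (U \<inter> V)" using J by (auto simp: T_dom_mem_iff)
qed (auto simp: T_dom_def)

lemma lift_coords_image:
  assumes N: "smooth_atlas N" and c: "smooth_chart N (U, \<psi>)" and W: "W \<subseteq> U" "openin (Euclidean_space (mdim N)) (\<psi> ` W)"
  shows "lift_coords k (mdim N) \<psi> ` T_dom k N W = jet_dom (mdim N) k (\<psi> ` W)"
proof (intro equalityI subsetI)
  fix z assume "z \<in> lift_coords k (mdim N) \<psi> ` T_dom k N W"
  then obtain \<gamma> where \<gamma>: "smooth_near line 0 N \<gamma>" "\<gamma> 0 \<in> W" "z = lift_coords k (mdim N) \<psi> (vel k N \<gamma>)"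
    by (auto elim: T_domE)
  then have "z = jet (mdim N) k (\<lambda>t. \<psi> (\<gamma> t)) 0"
    using lift_coords_vel[OF N c \<gamma>(1)] W by auto
  then show "z \<in> jet_dom (mdim N) k (\<psi> ` W)"
    using jet_in_jet_dom[OF W(2), of "\<lambda>t. \<psi> (\<gamma> t)" 0] \<gamma>(2) by auto
next
  let ?n = "mdim N"
  fix z assume z: "z \<in> jet_dom ?n k (\<psi> ` W)"
  then have zE: "z \<in> topspace (Euclidean_space (?n * (k + 1)))" and z0: "(\<lambda>i. if i < ?n then z i else 0) \<in> \<psi> ` W"
    by (auto simp: jet_dom_def)
  \<comment> \<open>Taylor polynomials realise any prescribed jet. The curve \<open>\<gamma>\<close>
    built from them lies in the chart only near 0, which is all that a velocity sees.\<close>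
  define a where "a t i = (if i < ?n then taylor (k + 1) (\<lambda>c. z (c * ?n + i)) t else 0)" for t i
  define \<gamma> where "\<gamma> t = inv_into U \<psi> (a t)" for t
  have "a 0 = (\<lambda>i. if i < ?n then z i else 0)" by (rule ext) (simp add: a_def taylor_at_0)
  then have a0: "a 0 \<in> \<psi> ` W" using z0 by simp
  have sm: "smooth_R UNIV (\<lambda>t. a t i)" for i
    using smooth_R_taylor[of UNIV] smooth_R_const[of UNIV] by (cases "i < ?n") (auto simp: a_def)
  have "\<forall>\<^sub>F t in nhds 0. a t \<in> \<psi> ` W"
  proof (rule eventually_in_openin_Euclidean_space[OF W(2) a0])
    show "\<forall>\<^sub>F t in nhds 0. a t \<in> topspace (Euclidean_space ?n)"
      by (simp add: a_def topspace_Euclidean_space)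
    show "((\<lambda>t. a t i) \<longlongrightarrow> a 0 i) (nhds 0)" for i
      using DERIV_isCont[OF smooth_R_DERIV[OF sm[of i] UNIV_I[of 0], of 0]] by (simp add: isCont_def tendsto_nhds_iff)
  qed
  then obtain S where S: "open S" "0 \<in> S" "\<And>t. t \<in> S \<Longrightarrow> a t \<in> \<psi> ` W" unfolding eventually_nhds by metis
  have \<gamma>: "\<gamma> t \<in> W" "\<psi> (\<gamma> t) = a t" if "t \<in> S" for t
    using S(3)[OF that] W(1) chart_inv[OF c] by (auto simp: \<gamma>_def subset_iff)
  have \<gamma>0: "\<gamma> 0 \<in> U" using \<gamma>(1) S(2) W(1) by blast
  have "smooth_R S (\<lambda>t. \<psi> (\<gamma> t) i)" for i
    by (rule smooth_R_cong[OF S(1) _ smooth_R_subset[OF sm subset_UNIV]]) (simp add: \<gamma>(2))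
  then have sn: "smooth_near line 0 N \<gamma>"
    using S(1,2) \<gamma>(1) W(1) by (subst smooth_near_line_iff[of N U \<psi> \<gamma>, OF N c \<gamma>0]) (intro exI[of _ S], auto)
  have "lift_coords k ?n \<psi> (vel k N \<gamma>) = jet ?n k (\<lambda>t. \<psi> (\<gamma> t)) 0" by (rule lift_coords_vel[OF N c sn \<gamma>0])
  also have "\<dots> = jet ?n k a 0"
    by (rule jet_cong_ev, rule eventually_mono[OF eventually_nhds_in_open[OF S(1,2)]]) (rule \<gamma>(2))
  also have "\<dots> = z"
  proof
    fix j show "jet ?n k a 0 j = z j"
    proof (cases "j < ?n * (k + 1)")
      case True
      then have "j mod ?n < ?n" "j div ?n < k + 1"
        by (cases ?n; auto simp: less_mult_imp_div_less mult.commute)+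
      then have "(deriv ^^ (j div ?n)) (\<lambda>t. a t (j mod ?n)) 0 = z (j div ?n * ?n + j mod ?n)"
        by (simp add: a_def higher_deriv_taylor_0)
      then show ?thesis using True by (simp add: jet_def)
    next
      case False then show ?thesis using zE by (simp add: jet_def topspace_Euclidean_space)
    qed
  qed
  finally have "z = lift_coords k ?n \<psi> (vel k N \<gamma>)" by simp
  moreover have "vel k N \<gamma> \<in> T_dom k N W" using sn \<gamma>(1)[OF S(2)] by (rule T_domI)
  ultimately show "z \<in> lift_coords k ?n \<psi> ` T_dom k N W" by blast
qed

lemma inj_on_lift_coords:
  assumes N: "smooth_atlas N" and c: "smooth_chart N (U, \<psi>)"
  shows "inj_on (lift_coords k (mdim N) \<psi>) (T_dom k N U)"
proof (rule inj_onI)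
  fix J J' assume J: "J \<in> T_dom k N U" "J' \<in> T_dom k N U"
    and e: "lift_coords k (mdim N) \<psi> J = lift_coords k (mdim N) \<psi> J'"
  from J obtain \<gamma> \<delta> where \<gamma>: "J = vel k N \<gamma>" "smooth_near line 0 N \<gamma>" "\<gamma> 0 \<in> U"
    and \<delta>: "J' = vel k N \<delta>" "smooth_near line 0 N \<delta>" "\<delta> 0 \<in> U" by (metis T_domE)
  have jet: "jet (mdim N) k (\<lambda>t. \<psi> (\<gamma> t)) 0 = jet (mdim N) k (\<lambda>t. \<psi> (\<delta> t)) 0"
    using e lift_coords_vel[OF N c \<gamma>(2,3)] lift_coords_vel[OF N c \<delta>(2,3)] \<gamma>(1) \<delta>(1) by metis
  have "\<psi> (\<gamma> 0) = \<psi> (\<delta> 0)"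
    using jet_low[of "\<lambda>t. \<psi> (\<gamma> t)" 0 "mdim N" k] jet_low[of "\<lambda>t. \<psi> (\<delta> t)" 0 "mdim N" k] jet
      chart_topspace[OF c \<gamma>(3)] chart_topspace[OF c \<delta>(3)] by metis
  then have "\<gamma> 0 = \<delta> 0" using smooth_chartD(2)[OF c] \<gamma>(3) \<delta>(3) by (auto dest: inj_onD)
  then show "J = J'" using vel_eq_iff[OF N c \<gamma>(2,3) \<delta>(2)] jet \<gamma>(1) \<delta>(1) by simp
qed

lemma smooth_near_line_compose_charts:
  assumes N: "smooth_atlas N" and P: "smooth_atlas P"
    and c: "smooth_chart N (U, \<phi>)" and d: "smooth_chart P (V, \<psi>)"
    and f: "smooth_in_charts N P W (U, \<phi>) (V, \<psi>) f"
    and \<gamma>: "smooth_near line 0 N \<gamma>" "\<gamma> 0 \<in> W"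
  shows "smooth_near line 0 P (\<lambda>t. f (\<gamma> t))" "f (\<gamma> 0) \<in> V"
proof -
  have W: "open_in N W" "W \<subseteq> U" "f ` W \<subseteq> V"
    and C: "\<And>j. j < mdim P \<Longrightarrow> Cinf_on (mdim N) (\<phi> ` W) (\<lambda>z. \<psi> (f (inv_into U \<phi> z)) j)"
    using f by (auto simp: smooth_in_charts_def)
  have oW: "openin (Euclidean_space (mdim N)) (\<phi> ` W)"
    using open_in_chart[OF N c W(1)] W(2) by (simp add: Int_absorb2)
  have \<gamma>U: "\<gamma> 0 \<in> U" using \<gamma> W by blast
  show f0: "f (\<gamma> 0) \<in> V" using \<gamma> W by blast
  obtain S where S: "open S" "0 \<in> S" "\<gamma> ` S \<subseteq> U" "\<And>i. i<mdim N \<Longrightarrow> smooth_R S (\<lambda>t. \<phi> (\<gamma> t) i)"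
    using \<gamma> smooth_near_line_iff[of N U \<phi> \<gamma>, OF N c \<gamma>U] by metis
  have "\<forall>\<^sub>F t in nhds 0. \<phi> (\<gamma> t) \<in> \<phi> ` W"
  proof (rule eventually_in_openin_Euclidean_space[OF oW])
    show "\<phi> (\<gamma> 0) \<in> \<phi> ` W" using \<gamma>(2) by simp
    show "\<forall>\<^sub>F t in nhds 0. \<phi> (\<gamma> t) \<in> topspace (Euclidean_space (mdim N))"
      using smooth_near_line_eventually_in[OF N c \<gamma>U \<gamma>(1)]
      by eventually_elim (rule chart_topspace[OF c])
    show "((\<lambda>t. \<phi> (\<gamma> t) i) \<longlongrightarrow> \<phi> (\<gamma> 0) i) (nhds 0)" if "i < mdim N" for i
      using DERIV_isCont[OF smooth_R_DERIV[OF S(4)[OF that] S(2), of 0]]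
      by (simp add: isCont_def tendsto_nhds_iff)
  qed
  then obtain S' where S': "open S'" "0 \<in> S'" "\<And>t. t \<in> S' \<Longrightarrow> \<phi> (\<gamma> t) \<in> \<phi> ` W"
    unfolding eventually_nhds by metis
  define Q where "Q = S \<inter> S'"
  have Q: "open Q" "0 \<in> Q" using S S' by (auto simp: Q_def)
  have \<gamma>W: "\<gamma> t \<in> W" if "t \<in> Q" for t
  proof -
    obtain q where "q \<in> W" "\<phi> (\<gamma> t) = \<phi> q" using S'(3)[of t] \<open>t \<in> Q\<close> by (auto simp: Q_def)
    moreover have "\<gamma> t \<in> U" using S(3) that by (auto simp: Q_def)
    ultimately have "\<gamma> t = q" using smooth_chartD(2)[OF c] W(2) by (auto dest: inj_onD)
    then show ?thesis using \<open>q \<in> W\<close> by simp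
  qed
  have "smooth_R Q (\<lambda>t. \<psi> (f (\<gamma> t)) j)" if j: "j < mdim P" for j
  proof (rule smooth_R_cong[OF Q(1)])
    show "smooth_R Q (\<lambda>t. \<psi> (f (inv_into U \<phi> (\<phi> (\<gamma> t)))) j)"
    proof (rule smooth_R_compose[OF Q(1) oW C[OF j], where a = "\<lambda>t. \<phi> (\<gamma> t)"])
      show "smooth_R Q (\<lambda>t. \<phi> (\<gamma> t) i)" if "i < mdim N" for i
        by (rule smooth_R_subset[OF S(4)[OF that]]) (simp add: Q_def)
    qed (use \<gamma>W in auto)
    show "\<psi> (f (inv_into U \<phi> (\<phi> (\<gamma> t)))) j = \<psi> (f (\<gamma> t)) j" if "t \<in> Q" for t
      using \<gamma>W[OF that] W(2) chart_inv[OF c] by (auto simp: subset_iff)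
  qed
  moreover have "(\<lambda>t. f (\<gamma> t)) ` Q \<subseteq> V" using \<gamma>W W(3) by auto
  ultimately show "smooth_near line 0 P (\<lambda>t. f (\<gamma> t))"
    using Q by (subst smooth_near_line_iff[of P V \<psi> "\<lambda>t. f (\<gamma> t)", OF P d f0]) (intro exI[of _ Q], simp)
qed

text \<open>\<open>T_map\<close> uses the representative picked by \<open>rep\<close>; the jet of
  the image curve depends only on the jet of the curve, so any representative gives the same
  result.\<close>

lemma T_map_vel_charts:
  assumes N: "smooth_atlas N" and P: "smooth_atlas P"
    and c: "smooth_chart N (U, \<phi>)" and d: "smooth_chart P (V, \<psi>)"
    and f: "smooth_in_charts N P W (U, \<phi>) (V, \<psi>) f"
    and \<gamma>: "smooth_near line 0 N \<gamma>" "\<gamma> 0 \<in> W"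
  shows "T_map k P f (vel k N \<gamma>) = vel k P (\<lambda>t. f (\<gamma> t))"
proof -
  have \<gamma>U: "\<gamma> 0 \<in> U" using f \<gamma> by (auto simp: smooth_in_charts_def)
  define \<delta> where "\<delta> = rep (vel k N \<gamma>)"
  have \<delta>: "\<delta> \<in> vel k N \<gamma>" unfolding \<delta>_def by (rule rep_in_vel[OF \<gamma>(1)])
  then have \<delta>': "smooth_near line 0 N \<delta>" "\<delta> 0 = \<gamma> 0" "jet (mdim N) k (\<lambda>t. \<phi> (\<delta> t)) 0 = jet (mdim N) k (\<lambda>t. \<phi> (\<gamma> t)) 0"
    using vel_mem_iff[OF N c \<gamma>(1) \<gamma>U] by auto
  obtain H where H: "\<And>\<gamma>. smooth_near line 0 N \<gamma> \<Longrightarrow> \<gamma> 0 \<in> W \<Longrightarrow>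
      jet (mdim P) k (\<lambda>t. \<psi> (f (\<gamma> t))) 0 = H (jet (mdim N) k (\<lambda>t. \<phi> (\<gamma> t)) 0)"
    using jet_smooth_in_charts[OF N P c d f, of k] by metis
  note s1 = smooth_near_line_compose_charts[OF N P c d f \<gamma>]
  have s2: "smooth_near line 0 P (\<lambda>t. f (\<delta> t))"
    by (rule smooth_near_line_compose_charts(1)[OF N P c d f \<delta>'(1)]) (simp add: \<delta>'(2) \<gamma>(2))
  have "vel k P (\<lambda>t. f (\<gamma> t)) = vel k P (\<lambda>t. f (\<delta> t))"
    using H[OF \<gamma>] H[OF \<delta>'(1)] \<delta>' \<gamma> by (subst vel_eq_iff[OF P d s1 s2]) simp
  then show ?thesis by (simp add: T_map_def \<delta>_def)
qed

lemma T_map_Cinf: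
  assumes N: "smooth_atlas N" and P: "smooth_atlas P"
    and c: "smooth_chart N (U, \<phi>)" and d: "smooth_chart P (V, \<psi>)"
    and f: "smooth_in_charts N P W (U, \<phi>) (V, \<psi>) f" and j: "j < mdim P * (k + 1)"
  shows "Cinf_on (mdim N * (k + 1)) (lift_coords k (mdim N) \<phi> ` T_dom k N W)
    (\<lambda>z. lift_coords k (mdim P) \<psi> (T_map k P f (inv_into (T_dom k N U) (lift_coords k (mdim N) \<phi>) z)) j)"
proof -
  have W: "open_in N W" "W \<subseteq> U" "f ` W \<subseteq> V" using f by (auto simp: smooth_in_charts_def)
  have oW: "openin (Euclidean_space (mdim N)) (\<phi> ` W)"
    using open_in_chart[OF N c W(1)] W(2) by (simp add: Int_absorb2)
  have im: "lift_coords k (mdim N) \<phi> ` T_dom k N W = jet_dom (mdim N) k (\<phi> ` W)"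
    by (rule lift_coords_image[OF N c W(2) oW])
  have oi: "openin (Euclidean_space (mdim N * (k + 1))) (lift_coords k (mdim N) \<phi> ` T_dom k N W)"
    unfolding im by (rule openin_jet_dom[OF oW])
  show ?thesis
  proof (rule jet_smooth_in_charts[OF N P c d f, of k])
    fix H assume H: "\<And>j. j < mdim P * (k + 1) \<Longrightarrow>
        Cinf_on (mdim N * (k + 1)) (jet_dom (mdim N) k (\<phi> ` W)) (\<lambda>z. H z j)"
      "\<And>\<gamma>. smooth_near line 0 N \<gamma> \<Longrightarrow> \<gamma> 0 \<in> W \<Longrightarrow>
        jet (mdim P) k (\<lambda>t. \<psi> (f (\<gamma> t))) 0 = H (jet (mdim N) k (\<lambda>t. \<phi> (\<gamma> t)) 0)"
    show ?thesis
    proof (rule Cinf_on_eq[OF oi H(1)[OF j, folded im]])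
      fix z assume "z \<in> lift_coords k (mdim N) \<phi> ` T_dom k N W"
      then obtain \<gamma> where \<gamma>: "smooth_near line 0 N \<gamma>" "\<gamma> 0 \<in> W" "z = lift_coords k (mdim N) \<phi> (vel k N \<gamma>)"
        by (auto elim: T_domE)
      have \<gamma>U: "\<gamma> 0 \<in> U" using \<gamma> W by blast
      have "inv_into (T_dom k N U) (lift_coords k (mdim N) \<phi>) z = vel k N \<gamma>"
        unfolding \<gamma>(3) by (rule inv_into_f_f[OF inj_on_lift_coords[OF N c] T_domI[OF \<gamma>(1) \<gamma>U]])
      moreover have "T_map k P f (vel k N \<gamma>) = vel k P (\<lambda>t. f (\<gamma> t))"
        by (rule T_map_vel_charts[OF N P c d f \<gamma>(1,2)])
      moreover have "lift_coords k (mdim P) \<psi> (vel k P (\<lambda>t. f (\<gamma> t))) = jet (mdim P) k (\<lambda>t. \<psi> (f (\<gamma> t))) 0"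
        by (rule lift_coords_vel[OF P d smooth_near_line_compose_charts[OF N P c d f \<gamma>(1,2)]])
      moreover have "z = jet (mdim N) k (\<lambda>t. \<phi> (\<gamma> t)) 0" using lift_coords_vel[OF N c \<gamma>(1) \<gamma>U] \<gamma>(3) by simp
      ultimately show "H z j = lift_coords k (mdim P) \<psi> (T_map k P f (inv_into (T_dom k N U) (lift_coords k (mdim N) \<phi>) z)) j"
        using H(2)[OF \<gamma>(1,2)] by simp
    qed
  qed
qed

lemma T_map_id: "smooth_atlas N \<Longrightarrow> J \<in> T_dom k N U \<Longrightarrow> T_map k N (\<lambda>x. x) J = J"
  by (simp add: T_map_def T_dom_rep(3))

text \<open>The transition between lifted charts is the local expression of \<open>T_map\<close> for
  the identity map, read in two different charts of \<open>N\<close>.\<close>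

lemma lift_transition:
  assumes N: "smooth_atlas N" and c: "smooth_chart N (U, \<phi>)" and d: "smooth_chart N (V, \<psi>)" and j: "j < mdim N * (k + 1)"
  shows "Cinf_on (mdim N * (k + 1)) (lift_coords k (mdim N) \<phi> ` (T_dom k N U \<inter> T_dom k N V))
    (\<lambda>z. lift_coords k (mdim N) \<psi> (inv_into (T_dom k N U) (lift_coords k (mdim N) \<phi>) z) j)"
proof -
  have o: "openin (Euclidean_space (mdim N)) (\<phi> ` (U \<inter> V))" by (rule transition(1)[OF N c d])
  have oi: "openin (Euclidean_space (mdim N * (k + 1))) (lift_coords k (mdim N) \<phi> ` T_dom k N (U \<inter> V))"
    using lift_coords_image[OF N c _ o, of k] openin_jet_dom[OF o, of k] by simp
  show ?thesis
    unfolding T_dom_Int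
  proof (rule Cinf_on_eq[OF oi T_map_Cinf[OF N N c d transition_smooth_in_charts[OF N c d] j]])
    fix z assume "z \<in> lift_coords k (mdim N) \<phi> ` T_dom k N (U \<inter> V)"
    then have "inv_into (T_dom k N U) (lift_coords k (mdim N) \<phi>) z \<in> T_dom k N U"
      using T_dom_mono[of "U \<inter> V" U k N] by (auto intro!: inv_into_into)
    from T_map_id[OF N this]
    show "lift_coords k (mdim N) \<psi> (T_map k N (\<lambda>x. x) (inv_into (T_dom k N U) (lift_coords k (mdim N) \<phi>) z)) j
      = lift_coords k (mdim N) \<psi> (inv_into (T_dom k N U) (lift_coords k (mdim N) \<phi>) z) j" by simp
  qed
qed

lemma smooth_chart_T_mfd:
  assumes N: "smooth_atlas N" and c: "smooth_chart N (U, \<phi>)"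
  shows "smooth_chart (T_mfd k N) (T_dom k N U, lift_coords k (mdim N) \<phi>)"
proof -
  have "T_dom k N U \<subseteq> pts (T_mfd k N)"
    unfolding pts_T_mfd using smooth_chartD(1)[OF c] by (rule T_dom_mono)
  moreover have "inj_on (lift_coords k (mdim N) \<phi>) (T_dom k N U)" by (rule inj_on_lift_coords[OF N c])
  moreover have "openin (Euclidean_space (mdim N * (k + 1))) (lift_coords k (mdim N) \<phi> ` T_dom k N U)"
    using lift_coords_image[OF N c order_refl smooth_chartD(3)[OF c], of k] openin_jet_dom[OF smooth_chartD(3)[OF c], of k]
    by simp
  moreover have "compatible (mdim N * (k + 1)) (T_dom k N U, lift_coords k (mdim N) \<phi>) (T_dom k N V, lift_coords k (mdim N) \<psi>)"
    if V: "(V, \<psi>) \<in> atlas N" for V \<psi>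
  proof -
    note d = smooth_atlasD[OF N V]
    have o: "openin (Euclidean_space (mdim N)) (\<phi> ` (U \<inter> V))" by (rule transition(1)[OF N c d])
    have o': "openin (Euclidean_space (mdim N)) (\<psi> ` (U \<inter> V))" using transition(1)[OF N d c] by (simp add: Int_commute)
    have "openin (Euclidean_space (mdim N * (k + 1))) (lift_coords k (mdim N) \<phi> ` T_dom k N (U \<inter> V))"
      using lift_coords_image[OF N c _ o, of k] openin_jet_dom[OF o, of k] by simp
    moreover have "openin (Euclidean_space (mdim N * (k + 1))) (lift_coords k (mdim N) \<psi> ` T_dom k N (U \<inter> V))"
      using lift_coords_image[OF N d _ o', of k] openin_jet_dom[OF o', of k] by simp
    ultimately show ?thesis
      using lift_transition[OF N c d, of _ k] lift_transition[OF N d c, of _ k]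
      unfolding compatible_def by (simp add: T_dom_Int Int_commute)
  qed
  ultimately show ?thesis
    unfolding smooth_chart_def T_mfd_simps by (auto simp del: add_mult_distrib add_mult_distrib2 mult_Suc_right)
qed

lemma smooth_atlas_T_mfd: "smooth_atlas N \<Longrightarrow> smooth_atlas (T_mfd k N)"
  unfolding smooth_atlas_def[of "T_mfd k N"] T_mfd_simps
  by (auto split: prod.splits intro: smooth_chart_T_mfd dest: smooth_atlasD)

lemma T_map_smooth_in_charts:
  assumes N: "smooth_atlas N" and P: "smooth_atlas P"
    and c: "smooth_chart N (U, \<phi>)" and d: "smooth_chart P (V, \<psi>)"
    and f: "smooth_in_charts N P W (U, \<phi>) (V, \<psi>) f"
  shows "smooth_in_charts (T_mfd k N) (T_mfd k P) (T_dom k N W)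
    (T_dom k N U, lift_coords k (mdim N) \<phi>) (T_dom k P V, lift_coords k (mdim P) \<psi>) (T_map k P f)"
proof -
  have W: "open_in N W" "W \<subseteq> U" "f ` W \<subseteq> V" using f by (auto simp: smooth_in_charts_def)
  have oW: "openin (Euclidean_space (mdim N)) (\<phi> ` W)"
    using open_in_chart[OF N c W(1)] W(2) by (simp add: Int_absorb2)
  have "open_in (T_mfd k N) (T_dom k N W)"
    by (rule open_in_chartI[OF smooth_atlas_T_mfd[OF N] smooth_chart_T_mfd[OF N c] T_dom_mono[OF W(2)]])
      (simp only: lift_coords_image[OF N c W(2) oW] T_mfd_simps openin_jet_dom[OF oW])
  moreover have "T_map k P f ` T_dom k N W \<subseteq> T_dom k P V"
  proof
    fix J assume "J \<in> T_map k P f ` T_dom k N W"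
    then obtain \<gamma> where \<gamma>: "smooth_near line 0 N \<gamma>" "\<gamma> 0 \<in> W" "J = T_map k P f (vel k N \<gamma>)"
      by (auto elim: T_domE)
    then have "J = vel k P (\<lambda>t. f (\<gamma> t))" using T_map_vel_charts[OF N P c d f \<gamma>(1,2)] by simp
    then show "J \<in> T_dom k P V"
      using smooth_near_line_compose_charts[OF N P c d f \<gamma>(1,2)] by (auto intro: T_domI)
  qed
  ultimately show ?thesis
    using T_dom_mono[OF W(2)] T_map_Cinf[OF N P c d f, of _ k]
    unfolding smooth_in_charts_def T_mfd_simps by simp
qed

lemma smooth_map_charts:
  assumes N: "smooth_atlas N" and P: "smooth_atlas P" and f: "smooth_map N P f" and p: "p \<in> pts N"
  obtains U \<phi> V \<psi> W where "(U, \<phi>) \<in> atlas N" "(V, \<psi>) \<in> atlas P" "p \<in> W"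
    "smooth_in_charts N P W (U, \<phi>) (V, \<psi>) f"
  using f p unfolding smooth_map_def smooth_on_iff by (metis surj_pair)

lemma T_map_vel:
  assumes N: "smooth_atlas N" and P: "smooth_atlas P" and f: "smooth_map N P f" and \<gamma>: "smooth_near line 0 N \<gamma>"
  shows "T_map k P f (vel k N \<gamma>) = vel k P (\<lambda>t. f (\<gamma> t))"
proof (rule smooth_map_charts[OF N P f smooth_near_pts[OF \<gamma>]])
  fix U \<phi> V \<psi> W assume *: "(U, \<phi>) \<in> atlas N" "(V, \<psi>) \<in> atlas P" "\<gamma> 0 \<in> W"
    "smooth_in_charts N P W (U, \<phi>) (V, \<psi>) f"
  show ?thesis
    by (rule T_map_vel_charts[OF N P smooth_atlasD[OF N *(1)] smooth_atlasD[OF P *(2)] *(4) \<gamma> *(3)])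
qed

lemma smooth_map_T_map:
  assumes N: "smooth_atlas N" and P: "smooth_atlas P" and f: "smooth_map N P f"
  shows "smooth_map (T_mfd k N) (T_mfd k P) (T_map k P f)"
  unfolding smooth_map_def
proof (rule smooth_onI[OF smooth_atlas_T_mfd[OF N] smooth_atlas_T_mfd[OF P] open_in_pts[OF smooth_atlas_T_mfd[OF N]]])
  fix J assume "J \<in> pts (T_mfd k N)"
  then obtain \<gamma> where \<gamma>: "J = vel k N \<gamma>" "smooth_near line 0 N \<gamma>" by (auto simp: pts_T_mfd elim: T_domE)
  obtain U \<phi> V \<psi> W where *: "(U, \<phi>) \<in> atlas N" "(V, \<psi>) \<in> atlas P" "\<gamma> 0 \<in> W"
    "smooth_in_charts N P W (U, \<phi>) (V, \<psi>) f"
    by (rule smooth_map_charts[OF N P f smooth_near_pts[OF \<gamma>(2)]])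
  note c = smooth_atlasD[OF N *(1)] and d = smooth_atlasD[OF P *(2)]
  show "\<exists>U \<phi> V \<psi> W'. smooth_chart (T_mfd k N) (U, \<phi>) \<and> smooth_chart (T_mfd k P) (V, \<psi>) \<and> J \<in> W' \<and>
      smooth_in_charts (T_mfd k N) (T_mfd k P) W' (U, \<phi>) (V, \<psi>) (T_map k P f)"
    using smooth_chart_T_mfd[OF N c, of k] smooth_chart_T_mfd[OF P d, of k] T_domI[OF \<gamma>(2) *(3), of k]
      T_map_smooth_in_charts[OF N P c d *(4), of k] \<gamma>(1) by metis
qed

lemma smooth_near_T_mfdI:
  assumes N: "smooth_atlas N" and c: "smooth_chart N (U, \<psi>)"
    and S: "open S" "0 \<in> S" and \<Gamma>: "\<And>s. s \<in> S \<Longrightarrow> \<Gamma> s \<in> T_dom k N U"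
    and sm: "\<And>i \<alpha>. i < mdim N \<Longrightarrow> \<alpha> \<le> k \<Longrightarrow> smooth_R S (\<lambda>s. (deriv ^^ \<alpha>) (\<lambda>t. \<psi> (rep (\<Gamma> s) t) i) 0)"
  shows "smooth_near line 0 (T_mfd k N) \<Gamma>"
proof -
  let ?n = "mdim N"
  have "smooth_R S (\<lambda>s. lift_coords k ?n \<psi> (\<Gamma> s) j)" if j: "j < ?n * (k + 1)" for j
  proof -
    have "j mod ?n < ?n" "j div ?n \<le> k"
      using j by (cases ?n; auto simp: less_Suc_eq_le[symmetric] less_mult_imp_div_less mult.commute)+
    from sm[OF this] show ?thesis using j by (simp add: lift_coords_def)
  qed
  then show ?thesis
    using S \<Gamma> by (subst smooth_near_line_iff[of "T_mfd k N" "T_dom k N U" "lift_coords k (mdim N) \<psi>" \<Gamma>, OF smooth_atlas_T_mfd[OF N] smooth_chart_T_mfd[OF N c] \<Gamma>[OF S(2)]])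
      (intro exI[of _ S], auto simp: T_mfd_simps)
qed

section \<open>Iterated velocities and the semi-holonomic vectors among them\<close>

subsection \<open>Iterated velocities\<close>

text \<open>What it takes for \<open>dvel\<close> to be a point of the iterated velocity bundle.
  Joint smoothness in both parameters would be too much to ask: representatives picked twice by
  \<open>rep\<close> satisfy this condition (\<open>pts_TT\<close>), but they are chosen separately
  for each \<open>s\<close>.\<close>

definition smooth_family :: "nat \<Rightarrow> 'a mfd \<Rightarrow> (real \<Rightarrow> real \<Rightarrow> 'a) \<Rightarrow> bool" where
  "smooth_family n N A \<longleftrightarrow> (\<forall>\<^sub>F s in nhds 0. smooth_near line 0 N (A s)) \<and>
     smooth_near line 0 (T_mfd n N) (\<lambda>s. vel n N (A s))"

definition dvel :: "nat \<Rightarrow> nat \<Rightarrow> 'a mfd \<Rightarrow> (real \<Rightarrow> real \<Rightarrow> 'a) \<Rightarrow> 'a vv" where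
  "dvel m n N A = vel m (T_mfd n N) (\<lambda>s. vel n N (A s))"

definition vv_coord :: "('a \<Rightarrow> nat \<Rightarrow> real) \<Rightarrow> 'a vv \<Rightarrow> nat \<Rightarrow> nat \<Rightarrow> nat \<Rightarrow> real" where
  "vv_coord \<psi> X i a b = (deriv ^^ a) (\<lambda>s. (deriv ^^ b) (\<lambda>t. \<psi> (rep (rep X s) t) i) 0) 0"

definition vv_base :: "'a vv \<Rightarrow> 'a" where
  "vv_base X = rep (rep X 0) 0"

lemma smooth_familyD:
  assumes "smooth_family n N A"
  shows "smooth_near line 0 N (A 0)" "\<forall>\<^sub>F s in nhds 0. smooth_near line 0 N (A s)"
    "smooth_near line 0 (T_mfd n N) (\<lambda>s. vel n N (A s))"
  using assms eventually_nhds_x_imp_x unfolding smooth_family_def by metis+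

lemma dvel_pts: "smooth_family n N A \<Longrightarrow> dvel m n N A \<in> pts (T_mfd m (T_mfd n N))"
  unfolding dvel_def pts_T_mfd[of m]
  by (rule T_domI[OF smooth_familyD(3) smooth_near_pts[OF smooth_familyD(3)]])

lemma dvel_base:
  assumes "smooth_family n N A" shows "vv_base (dvel m n N A) = A 0 0"
  unfolding vv_base_def dvel_def rep_vel_0[OF smooth_familyD(3)[OF assms]]
  by (rule rep_vel_0[OF smooth_familyD(1)[OF assms]])

lemma deriv_lift_coords:
  "i < n \<Longrightarrow> \<alpha> \<le> k \<Longrightarrow> (deriv ^^ \<alpha>) (\<lambda>t. \<psi> (rep J t) i) 0 = lift_coords k n \<psi> J (\<alpha> * n + i)"
  unfolding lift_coords_jet by (simp add: jet_nth)

lemma deriv_rep_vel: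
  assumes "smooth_atlas N" "smooth_chart N (U, \<psi>)" "smooth_near line 0 N \<gamma>" "\<gamma> 0 \<in> U" "i < mdim N" "\<alpha> \<le> k"
  shows "(deriv ^^ \<alpha>) (\<lambda>t. \<psi> (rep (vel k N \<gamma>) t) i) 0 = (deriv ^^ \<alpha>) (\<lambda>t. \<psi> (\<gamma> t) i) 0"
  using deriv_lift_coords[OF assms(5,6), of \<psi> "vel k N \<gamma>"] lift_coords_vel[OF assms(1-4), of k] assms(5,6)
  by (simp add: jet_nth)

lemma smooth_family_eventually_in:
  assumes N: "smooth_atlas N" and c: "smooth_chart N (U, \<psi>)" and A: "smooth_family n N A" "A 0 0 \<in> U"
  shows "\<forall>\<^sub>F s in nhds 0. smooth_near line 0 N (A s) \<and> A s 0 \<in> U"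
proof -
  have "vel n N (A 0) \<in> T_dom n N U" by (rule T_domI[OF smooth_familyD(1)[OF A(1)] A(2)])
  from smooth_near_line_eventually_in[OF smooth_atlas_T_mfd[OF N] smooth_chart_T_mfd[OF N c], of "\<lambda>s. vel n N (A s)" n, OF this smooth_familyD(3)[OF A(1)]]
  have "\<forall>\<^sub>F s in nhds 0. vel n N (A s) \<in> T_dom n N U" .
  with smooth_familyD(2)[OF A(1)] show ?thesis
    by eventually_elim (simp add: T_dom_mem_iff)
qed

text \<open>Two choices made by \<open>rep\<close> have to be removed: the outer one by chart
  independence in \<open>T_mfd n N\<close>, the inner one separately for each \<open>s\<close> near
  0.\<close>

lemma vv_coord_dvel:
  assumes N: "smooth_atlas N" and c: "smooth_chart N (U, \<psi>)" and A: "smooth_family n N A" "A 0 0 \<in> U"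
    and i: "i < mdim N" and ab: "a \<le> m" "b \<le> n"
  shows "vv_coord \<psi> (dvel m n N A) i a b = (deriv ^^ a) (\<lambda>s. (deriv ^^ b) (\<lambda>t. \<psi> (A s t) i) 0) 0"
proof -
  let ?j = "b * mdim N + i" and ?L = "lift_coords n (mdim N) \<psi>"
  have j: "?j < mdim (T_mfd n N)" using jet_index[OF i ab(2)] by (simp add: T_mfd_simps)
  have U: "vel n N (A 0) \<in> T_dom n N U" by (rule T_domI[OF smooth_familyD(1)[OF A(1)] A(2)])
  have "vv_coord \<psi> (dvel m n N A) i a b = (deriv ^^ a) (\<lambda>s. ?L (rep (dvel m n N A) s) ?j) 0"
    by (simp add: vv_coord_def deriv_lift_coords[OF i ab(2)])
  also have "\<dots> = (deriv ^^ a) (\<lambda>s. ?L (vel n N (A s)) ?j) 0"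
    unfolding dvel_def
    by (rule deriv_rep_vel[OF smooth_atlas_T_mfd[OF N] smooth_chart_T_mfd[OF N c] smooth_familyD(3)[OF A(1)] U j ab(1)])
  also have "\<dots> = (deriv ^^ a) (\<lambda>s. (deriv ^^ b) (\<lambda>t. \<psi> (A s t) i) 0) 0"
    by (rule higher_deriv_cong_ev[OF eventually_mono[OF smooth_family_eventually_in[OF N c A]] refl])
      (simp add: lift_coords_vel[OF N c] jet_nth i ab(2))
  finally show ?thesis .
qed

lemma pts_TT:
  assumes N: "smooth_atlas N" and X: "X \<in> pts (T_mfd m (T_mfd n N))"
  shows "smooth_family n N (\<lambda>s. rep (rep X s))" "X = dvel m n N (\<lambda>s. rep (rep X s))"
proof -
  have X': "X \<in> T_dom m (T_mfd n N) (pts (T_mfd n N))" using X by (simp add: pts_T_mfd)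
  note r = T_dom_rep[OF X'] 
  have "rep X 0 \<in> pts (T_mfd n N)" by (rule r(2))
  then have "rep (rep X 0) 0 \<in> pts N" by (auto simp: pts_T_mfd dest: T_dom_rep(2))
  then obtain U \<psi> where U: "(U, \<psi>) \<in> atlas N" "rep (rep X 0) 0 \<in> U" by (rule ptsE)
  note c = smooth_atlasD[OF N U(1)]
  have "rep X 0 \<in> T_dom n N U"
    using \<open>rep X 0 \<in> pts (T_mfd n N)\<close> U(2) T_dom_rep[of "rep X 0" n N "pts N"] T_domI[of N "rep (rep X 0)" U n] N
    by (simp add: pts_T_mfd)
  from smooth_near_line_eventually_in[OF smooth_atlas_T_mfd[OF N] smooth_chart_T_mfd[OF N c], of "rep X" n, OF this r(1)]
  have ev: "\<forall>\<^sub>F s in nhds 0. rep X s \<in> T_dom n N U" .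
  have ev1: "\<forall>\<^sub>F s in nhds 0. smooth_near line 0 N (rep (rep X s))"
    using ev by eventually_elim (rule T_dom_rep(1))
  have ev2: "\<forall>\<^sub>F s in nhds 0. rep X s = vel n N (rep (rep X s))"
    using ev by eventually_elim (use T_dom_rep(3)[OF _ N] in auto)
  show "smooth_family n N (\<lambda>s. rep (rep X s))"
    unfolding smooth_family_def
    using ev1 smooth_near_line_cong[OF smooth_atlas_T_mfd[OF N] r(1) ev2] by simp
  have "X = vel m (T_mfd n N) (rep X)" using r(3)[OF smooth_atlas_T_mfd[OF N]] by simp
  also have "\<dots> = dvel m n N (\<lambda>s. rep (rep X s))"
    unfolding dvel_def by (rule vel_cong_ev[OF ev2])
  finally show "X = dvel m n N (\<lambda>s. rep (rep X s))" .
qed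

lemma vv_eqI:
  assumes N: "smooth_atlas N" and c: "smooth_chart N (U, \<psi>)"
    and X: "X \<in> pts (T_mfd m (T_mfd n N))" "vv_base X \<in> U"
    and Y: "Y \<in> pts (T_mfd m (T_mfd n N))" "vv_base Y \<in> U"
    and eq: "\<And>i a b. i < mdim N \<Longrightarrow> a \<le> m \<Longrightarrow> b \<le> n \<Longrightarrow> vv_coord \<psi> X i a b = vv_coord \<psi> Y i a b"
  shows "X = Y"
proof -
  let ?T = "T_mfd n N" and ?L = "lift_coords n (mdim N) \<psi>"
  have X': "X \<in> T_dom m ?T (pts ?T)" and Y': "Y \<in> T_dom m ?T (pts ?T)" using X Y by (simp_all add: pts_T_mfd)
  have dom: "rep Z 0 \<in> T_dom n N U" if "Z \<in> T_dom m ?T (pts ?T)" "vv_base Z \<in> U" for Z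
    using T_dom_rep(2)[OF that(1)] that(2) T_dom_rep[of "rep Z 0" n N "pts N"] T_domI[of N "rep (rep Z 0)" U n] N
    by (simp add: pts_T_mfd vv_base_def)
  have sX: "smooth_near line 0 ?T (rep X)" and sY: "smooth_near line 0 ?T (rep Y)"
    using T_dom_rep(1) X' Y' by blast+
  have jets: "jet (mdim ?T) m (\<lambda>s. ?L (rep Y s)) 0 = jet (mdim ?T) m (\<lambda>s. ?L (rep X s)) 0"
    unfolding jet_eq_iff
  proof (intro allI impI)
    fix j a assume j: "j < mdim ?T" and a: "a \<le> m"
    have i: "j mod mdim N < mdim N" "j div mdim N \<le> n"
      using j by (cases "mdim N"; auto simp: T_mfd_simps less_Suc_eq_le[symmetric] less_mult_imp_div_less mult.commute)+
    have j': "j div mdim N * mdim N + j mod mdim N = j" by simp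
    have "vv_coord \<psi> Z (j mod mdim N) a (j div mdim N) = (deriv ^^ a) (\<lambda>s. ?L (rep Z s) j) 0" for Z
      unfolding vv_coord_def deriv_lift_coords[OF i] j' ..
    then show "(deriv ^^ a) (\<lambda>s. ?L (rep Y s) j) 0 = (deriv ^^ a) (\<lambda>s. ?L (rep X s) j) 0"
      using eq[OF i(1) a i(2)] by simp
  qed
  have LE: "?L J \<in> topspace (Euclidean_space (mdim ?T))" for J
    unfolding lift_coords_jet T_mfd_simps by (rule jet_topspace)
  \<comment> \<open>The part of order 0 in \<open>s\<close> contains all coordinates of the inner
    velocity at \<open>s = 0\<close>, so the base points in \<open>T_mfd n N\<close> coincide
    too.\<close>
  have "?L (rep Y 0) = ?L (rep X 0)"
    unfolding jet_low[of "\<lambda>s. ?L (rep Y s)" 0 "mdim ?T" m, OF LE, symmetric]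
      jet_low[of "\<lambda>s. ?L (rep X s)" 0 "mdim ?T" m, OF LE, symmetric] jets ..
  then have "rep Y 0 = rep X 0"
    using inj_on_lift_coords[OF N c, of n] dom[OF X' X(2)] dom[OF Y' Y(2)] by (auto dest: inj_onD)
  then have "vel m ?T (rep X) = vel m ?T (rep Y)"
    using jets vel_eq_iff[OF smooth_atlas_T_mfd[OF N] smooth_chart_T_mfd[OF N c] sX dom[OF X' X(2)] sY] by simp
  then show ?thesis
    using T_dom_rep(3)[OF X' smooth_atlas_T_mfd[OF N]] T_dom_rep(3)[OF Y' smooth_atlas_T_mfd[OF N]] by simp
qed

lemma smooth_family_compose:
  assumes N: "smooth_atlas N" and P: "smooth_atlas P" and f: "smooth_map N P f" and A: "smooth_family n N A"
  shows "smooth_family n P (\<lambda>s t. f (A s t))"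
    and "T_map m (T_mfd n P) (T_map n P f) (dvel m n N A) = dvel m n P (\<lambda>s t. f (A s t))"
proof -
  note TN = smooth_atlas_T_mfd[OF N, of n] and TP = smooth_atlas_T_mfd[OF P, of n]
  note Tf = smooth_map_T_map[OF N P f, of n]
  have ev: "\<forall>\<^sub>F s in nhds 0. T_map n P f (vel n N (A s)) = vel n P (\<lambda>t. f (A s t))"
    using smooth_familyD(2)[OF A] by eventually_elim (rule T_map_vel[OF N P f])
  have s: "smooth_near line 0 (T_mfd n P) (\<lambda>s. T_map n P f (vel n N (A s)))"
    by (rule smooth_near_compose[OF line_chart(2) TN TP smooth_familyD(3)[OF A] Tf])
  show "smooth_family n P (\<lambda>s t. f (A s t))"
    unfolding smooth_family_def
  proof
    show "\<forall>\<^sub>F s in nhds 0. smooth_near line 0 P (\<lambda>t. f (A s t))"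
      using smooth_familyD(2)[OF A] by eventually_elim (rule smooth_near_compose[OF line_chart(2) N P _ f])
    show "smooth_near line 0 (T_mfd n P) (\<lambda>s. vel n P (\<lambda>t. f (A s t)))"
      by (rule smooth_near_line_cong[OF TP s ev])
  qed
  show "T_map m (T_mfd n P) (T_map n P f) (dvel m n N A) = dvel m n P (\<lambda>s t. f (A s t))"
    unfolding dvel_def T_map_vel[OF TN TP Tf smooth_familyD(3)[OF A]] by (rule vel_cong_ev[OF ev])
qed

lemma smooth_familyI:
  assumes N: "smooth_atlas N" and c: "smooth_chart N (U, \<psi>)" and S: "open S" "0 \<in> S"
    and A: "\<And>s. s \<in> S \<Longrightarrow> smooth_near line 0 N (A s)" "\<And>s. s \<in> S \<Longrightarrow> A s 0 \<in> U"
    and sm: "\<And>i \<alpha>. i < mdim N \<Longrightarrow> \<alpha> \<le> n \<Longrightarrow> smooth_R S (\<lambda>s. (deriv ^^ \<alpha>) (\<lambda>t. \<psi> (A s t) i) 0)"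
  shows "smooth_family n N A"
  unfolding smooth_family_def
proof
  show "\<forall>\<^sub>F s in nhds 0. smooth_near line 0 N (A s)"
    using eventually_nhds_in_open[OF S] by eventually_elim (rule A(1))
  show "smooth_near line 0 (T_mfd n N) (\<lambda>s. vel n N (A s))"
  proof (rule smooth_near_T_mfdI[OF N c S])
    show "vel n N (A s) \<in> T_dom n N U" if "s \<in> S" for s by (rule T_domI[OF A(1,2)[OF that]])
    fix i \<alpha> assume i: "i < mdim N" "\<alpha> \<le> n"
    show "smooth_R S (\<lambda>s. (deriv ^^ \<alpha>) (\<lambda>t. \<psi> (rep (vel n N (A s)) t) i) 0)"
      by (rule smooth_R_cong[OF S(1) _ sm[OF i]]) (simp add: deriv_rep_vel[OF N c A i])
  qed
qed

text \<open>The lifted coordinates of order up to \<open>n\<close> are among those of order up to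
  \<open>n'\<close>; this makes truncations available.\<close>

lemma smooth_family_lower:
  assumes N: "smooth_atlas N" and A: "smooth_family n' N A" and n: "n \<le> n'"
  shows "smooth_family n N A"
proof -
  obtain U \<psi> where U: "(U, \<psi>) \<in> atlas N" "A 0 0 \<in> U" by (rule ptsE[OF smooth_near_pts[OF smooth_familyD(1)[OF A]]])
  note c = smooth_atlasD[OF N U(1)]
  have U0: "vel n' N (A 0) \<in> T_dom n' N U" by (rule T_domI[OF smooth_familyD(1)[OF A] U(2)])
  obtain S where S: "open S" "0 \<in> S" "\<And>j. j<mdim (T_mfd n' N) \<Longrightarrow> smooth_R S (\<lambda>s. lift_coords n' (mdim N) \<psi> (vel n' N (A s)) j)"
    using smooth_near_line_iff[of "T_mfd n' N" "T_dom n' N U" "lift_coords n' (mdim N) \<psi>" "\<lambda>s. vel n' N (A s)",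
        OF smooth_atlas_T_mfd[OF N] smooth_chart_T_mfd[OF N c] U0] smooth_familyD(3)[OF A] by metis
  obtain S' where S': "open S'" "0 \<in> S'" "\<And>s. s \<in> S' \<Longrightarrow> smooth_near line 0 N (A s) \<and> A s 0 \<in> U"
    using smooth_family_eventually_in[OF N c A U(2)] unfolding eventually_nhds by metis
  show ?thesis
  proof (rule smooth_familyI[OF N c, of "S \<inter> S'"])
    fix i \<alpha> assume i: "i < mdim N" "\<alpha> \<le> n"
    then have a: "\<alpha> \<le> n'" using n by simp
    have j: "\<alpha> * mdim N + i < mdim (T_mfd n' N)" using jet_index[OF i(1) a] by (simp add: T_mfd_simps)
    show "smooth_R (S \<inter> S') (\<lambda>s. (deriv ^^ \<alpha>) (\<lambda>t. \<psi> (A s t) i) 0)"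
    proof (rule smooth_R_cong[OF _ _ smooth_R_subset[OF S(3)[OF j]]])
      fix t assume "t \<in> S \<inter> S'"
      then show "lift_coords n' (mdim N) \<psi> (vel n' N (A t)) (\<alpha> * mdim N + i) = (deriv ^^ \<alpha>) (\<lambda>s. \<psi> (A t s) i) 0"
        using S'(3)[of t] by (simp add: lift_coords_vel[OF N c] jet_nth i a)
    qed (use S S' in auto)
  qed (use S S' in auto)
qed

lemma smooth_family_plane:
  assumes N: "smooth_atlas N" and \<phi>: "smooth_near plane (0, 0) N \<phi>"
  shows "smooth_family n N (\<lambda>s t. \<phi> (s, t))"
proof -
  obtain U \<psi> where U: "(U, \<psi>) \<in> atlas N" "\<phi> (0, 0) \<in> U" by (rule ptsE[OF smooth_near_pts[OF \<phi>]])
  note c = smooth_atlasD[OF N U(1)]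
  obtain W where W: "openin (Euclidean_space 2) W" "plane_coord (0, 0) \<in> W"
    "\<forall>z\<in>W. \<phi> (z 0, z (Suc 0)) \<in> U" and W4: "\<forall>i<mdim N. Cinf_on 2 W (\<lambda>z. \<psi> (\<phi> (z 0, z (Suc 0))) i)"
    using iffD1[OF smooth_near_plane_iff[of N U \<psi> \<phi>, OF N c U(2)] \<phi>] by (elim exE conjE) (rule that)
  obtain e where e: "e > 0" and eW: "\<forall>y\<in>topspace (Euclidean_space 2). (\<forall>i<2. \<bar>y i - plane_coord (0, 0) i\<bar> < e) \<longrightarrow> y \<in> W"
    using openin_Euclidean_space_boxD[OF W(1,2)] by (elim exE conjE) (rule that)
  have inW: "plane_coord (s, t) \<in> W" if "\<bar>s\<bar> < e" "\<bar>t\<bar> < e" for s t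
  proof (rule eW[rule_format])
    fix i :: nat assume "i < 2"
    then have "i = 0 \<or> i = Suc 0" by auto
    then show "\<bar>plane_coord (s, t) i - plane_coord (0, 0) i\<bar> < e" using that by auto
  qed simp
  have inU: "\<phi> (s, t) \<in> U" if "\<bar>s\<bar> < e" "\<bar>t\<bar> < e" for s t
    using W(3)[rule_format, OF inW[OF that]] by simp
  define S where "S = {-e<..<e}"
  have S: "open S" "0 \<in> S" "\<And>s. s \<in> S \<longleftrightarrow> \<bar>s\<bar> < e" using e by (auto simp: S_def)
  have d2: "(1::nat) < 2" "(0::nat) < 2" by auto
  show ?thesis
  proof (rule smooth_familyI[OF N c S(1,2)])
    fix s assume s: "s \<in> S"
    show "\<phi> (s, 0) \<in> U" using inU s S(3) e by simp
    have "smooth_R S (\<lambda>t. \<psi> (\<phi> (s, t)) i)" if i: "i < mdim N" for i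
      using smooth_R_slice[OF W(1) d2(1) W4[rule_format, OF i], of S "plane_coord (s, 0)"] inW s S(3) by simp
    then show "smooth_near line 0 N (\<lambda>t. \<phi> (s, t))"
      using inU s S e by (subst smooth_near_line_iff[of N U \<psi>, OF N c]) (simp, intro exI[of _ S], auto)
  next
    fix i \<alpha> assume i: "i < mdim N"
    let ?f = "\<lambda>z. \<psi> (\<phi> (z 0, z (Suc 0))) i"
    have "smooth_R S (\<lambda>s. (pd 1 ^^ \<alpha>) ?f (plane_coord (s, 0)))"
      using smooth_R_slice[OF W(1) d2(2) Cinf_on_pd_funpow[OF W(1) d2(1) W4[rule_format, OF i]], of S "plane_coord (0, 0)" \<alpha>] inW S(3) e
      by simp
    then show "smooth_R S (\<lambda>s. (deriv ^^ \<alpha>) (\<lambda>t. \<psi> (\<phi> (s, t)) i) 0)"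
    proof (rule smooth_R_cong[OF S(1), rotated])
      fix s assume "s \<in> S"
      then show "(pd 1 ^^ \<alpha>) ?f (plane_coord (s, 0)) = (deriv ^^ \<alpha>) (\<lambda>t. \<psi> (\<phi> (s, t)) i) 0"
        using Cinf_on_slice[OF W(1) d2(1) W4[rule_format, OF i], of "plane_coord (s, 0)" 0 \<alpha>] inW[of s 0] S(3) e by simp
    qed
  qed
qed

lemma vel2_dvel: "vel2 m n N \<phi> = dvel m n N (\<lambda>s t. \<phi> (s, t))"
  by (simp add: vel2_def dvel_def)

lemma trunc2_dvel: "trunc2 m n N X = dvel m n N (\<lambda>s. rep (rep X s))"
  by (simp add: trunc2_def vel2_dvel)

lemma trunc2_props:
  assumes N: "smooth_atlas N" and X: "X \<in> pts (T_mfd m' (T_mfd n' N))" and mn: "m \<le> m'" "n \<le> n'"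
  shows "trunc2 m n N X \<in> pts (T_mfd m (T_mfd n N))" "vv_base (trunc2 m n N X) = vv_base X"
    and "smooth_chart N (U, \<psi>) \<Longrightarrow> vv_base X \<in> U \<Longrightarrow> i < mdim N \<Longrightarrow> a \<le> m \<Longrightarrow> b \<le> n \<Longrightarrow>
      vv_coord \<psi> (trunc2 m n N X) i a b = vv_coord \<psi> X i a b"
proof -
  have s: "smooth_family n N (\<lambda>s. rep (rep X s))"
    by (rule smooth_family_lower[OF N pts_TT(1)[OF N X] mn(2)])
  show "trunc2 m n N X \<in> pts (T_mfd m (T_mfd n N))" unfolding trunc2_dvel by (rule dvel_pts[OF s])
  show "vv_base (trunc2 m n N X) = vv_base X" unfolding trunc2_dvel dvel_base[OF s] by (simp add: vv_base_def)
  show "vv_coord \<psi> (trunc2 m n N X) i a b = vv_coord \<psi> X i a b"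
    if "smooth_chart N (U, \<psi>)" "vv_base X \<in> U" "i < mdim N" "a \<le> m" "b \<le> n"
    unfolding trunc2_dvel using vv_coord_dvel[OF N that(1) s _ that(3-5)] that(2) by (simp add: vv_base_def vv_coord_def)
qed

lemma vel2_props:
  assumes N: "smooth_atlas N" and \<phi>: "smooth_near plane (0, 0) N \<phi>"
  shows "vel2 m n N \<phi> \<in> pts (T_mfd m (T_mfd n N))" "vv_base (vel2 m n N \<phi>) = \<phi> (0, 0)"
    and "smooth_chart N (U, \<psi>) \<Longrightarrow> \<phi> (0, 0) \<in> U \<Longrightarrow> i < mdim N \<Longrightarrow> a \<le> m \<Longrightarrow> b \<le> n \<Longrightarrow>
      vv_coord \<psi> (vel2 m n N \<phi>) i a b = (deriv ^^ a) (\<lambda>s. (deriv ^^ b) (\<lambda>t. \<psi> (\<phi> (s, t)) i) 0) 0"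
proof -
  note s = smooth_family_plane[OF N \<phi>, of n]
  show "vel2 m n N \<phi> \<in> pts (T_mfd m (T_mfd n N))" unfolding vel2_dvel by (rule dvel_pts[OF s])
  show "vv_base (vel2 m n N \<phi>) = \<phi> (0, 0)" unfolding vel2_dvel dvel_base[OF s] ..
  show "vv_coord \<psi> (vel2 m n N \<phi>) i a b = (deriv ^^ a) (\<lambda>s. (deriv ^^ b) (\<lambda>t. \<psi> (\<phi> (s, t)) i) 0) 0"
    if "smooth_chart N (U, \<psi>)" "\<phi> (0, 0) \<in> U" "i < mdim N" "a \<le> m" "b \<le> n"
    unfolding vel2_dvel by (rule vv_coord_dvel[OF N that(1) s that(2-5)])
qed

lemma TT_map_props:
  assumes N: "smooth_atlas N" and P: "smooth_atlas P" and f: "smooth_map N P f"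
    and X: "X \<in> pts (T_mfd m (T_mfd n N))"
  defines "Y \<equiv> T_map m (T_mfd n P) (T_map n P f) X"
  shows "Y \<in> pts (T_mfd m (T_mfd n P))" "vv_base Y = f (vv_base X)"
    and "smooth_chart P (U, \<psi>) \<Longrightarrow> f (vv_base X) \<in> U \<Longrightarrow> i < mdim P \<Longrightarrow> a \<le> m \<Longrightarrow> b \<le> n \<Longrightarrow>
      vv_coord \<psi> Y i a b = vv_coord (\<lambda>p. \<psi> (f p)) X i a b"
proof -
  note s = smooth_family_compose[OF N P f pts_TT(1)[OF N X]]
  have Y: "Y = dvel m n P (\<lambda>s t. f (rep (rep X s) t))"
    unfolding Y_def by (subst pts_TT(2)[OF N X]) (rule s(2))
  show "Y \<in> pts (T_mfd m (T_mfd n P))" unfolding Y by (rule dvel_pts[OF s(1)])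
  show "vv_base Y = f (vv_base X)" unfolding Y dvel_base[OF s(1)] by (simp add: vv_base_def)
  show "vv_coord \<psi> Y i a b = vv_coord (\<lambda>p. \<psi> (f p)) X i a b"
    if "smooth_chart P (U, \<psi>)" "f (vv_base X) \<in> U" "i < mdim P" "a \<le> m" "b \<le> n"
    unfolding Y using vv_coord_dvel[OF P that(1) s(1) _ that(3-5)] that(2) by (simp add: vv_base_def vv_coord_def)
qed

lemma TT_map_vel2:
  assumes N: "smooth_atlas N" and P: "smooth_atlas P" and f: "smooth_map N P f" and \<phi>: "smooth_near plane (0, 0) N \<phi>"
  shows "T_map m (T_mfd n P) (T_map n P f) (vel2 m n N \<phi>) = vel2 m n P (\<lambda>p. f (\<phi> p))"
  unfolding vel2_dvel by (rule smooth_family_compose(2)[OF N P f smooth_family_plane[OF N \<phi>]])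

subsection \<open>Holonomic and semi-holonomic vectors\<close>

lemma smooth_near_plane_sum:
  assumes N: "smooth_atlas N" and \<gamma>: "smooth_near line 0 N \<gamma>"
  shows "smooth_near plane (0, 0) N (\<lambda>(s, t). \<gamma> (s + t))"
proof -
  obtain U \<psi> where U: "(U, \<psi>) \<in> atlas N" "\<gamma> 0 \<in> U" by (rule ptsE[OF smooth_near_pts[OF \<gamma>]])
  note c = smooth_atlasD[OF N U(1)]
  obtain S where S: "open S" "0 \<in> S" "\<gamma> ` S \<subseteq> U" "\<And>i. i<mdim N \<Longrightarrow> smooth_R S (\<lambda>t. \<psi> (\<gamma> t) i)"
    using \<gamma> smooth_near_line_iff[of N U \<psi> \<gamma>, OF N c U(2)] by metis
  define W where "W = {z \<in> topspace (Euclidean_space 2). line_coord (z 0 + z (Suc 0)) \<in> line_coord ` S}"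
  have oS: "openin (Euclidean_space (Suc 0)) (line_coord ` S)" using S(1) by (simp add: openin_line_coord_image)
  have oW: "openin (Euclidean_space 2) W"
    unfolding W_def
  proof (rule openin_Euclidean_space_vimage[OF openin_topspace oS])
    show "continuous_on (topspace (Euclidean_space 2)) (\<lambda>z. line_coord (z 0 + z (Suc 0)) i)" if "i < Suc 0" for i
      using that by (simp add: continuous_on_add continuous_on_coord)
  qed simp
  have WS: "z 0 + z (Suc 0) \<in> S" if "z \<in> W" for z using that by (auto simp: W_def)
  have C: "Cinf_on 2 W (\<lambda>z. \<psi> (\<gamma> (z 0 + z (Suc 0))) i)" if i: "i < mdim N" for i
  proof -
    have "Cinf_on 2 W (\<lambda>z. \<psi> (\<gamma> (line_coord (z 0 + z (Suc 0)) 0)) i)"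
    proof (rule Cinf_on_compose[OF oW oS _ _ Cinf_on_smooth_R[OF S(1) S(4)[OF i]], where a = "\<lambda>z. line_coord (z 0 + z (Suc 0))"])
      show "Cinf_on 2 W (\<lambda>z. line_coord (z 0 + z (Suc 0)) l)" if "l < Suc 0" for l
        using that by (simp add: Cinf_on_add Cinf_on_coord)
    qed (use WS in auto)
    then show ?thesis by simp
  qed
  have "plane_coord (0, 0) \<in> W" using S(2) by (auto simp: W_def)
  then show ?thesis
    using oW WS S(3) C U(2)
    by (subst smooth_near_plane_iff[of N U \<psi>, OF N c]) (simp, intro exI[of _ W], auto)
qed

lemma vel_pts_eqI:
  assumes N: "smooth_atlas N" and c: "smooth_chart N (U, \<psi>)"
    and v: "v \<in> pts (T_mfd k N)" "w \<in> pts (T_mfd k N)" "rep v 0 \<in> U" "rep w 0 = rep v 0"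
    and eq: "\<And>i a. i < mdim N \<Longrightarrow> a \<le> k \<Longrightarrow> (deriv ^^ a) (\<lambda>t. \<psi> (rep v t) i) 0 = (deriv ^^ a) (\<lambda>t. \<psi> (rep w t) i) 0"
  shows "v = w"
proof -
  have v': "v \<in> T_dom k N (pts N)" "w \<in> T_dom k N (pts N)" using v by (simp_all add: pts_T_mfd)
  have "vel k N (rep v) = vel k N (rep w)"
    using vel_eq_iff[OF N c T_dom_rep(1)[OF v'(1)] v(3) T_dom_rep(1)[OF v'(2)], of k] v(4) eq by (simp add: jet_eq_iff)
  then show ?thesis using T_dom_rep(3)[OF v'(1) N] T_dom_rep(3)[OF v'(2) N] by simp
qed

text \<open>The inner derivative is the function \<open>(deriv ^^ b) f\<close> evaluated at
  \<open>s\<close>. Hence only the total order matters, which is the coordinate description of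
  holonomic vectors.\<close>

lemma higher_deriv_sum_arg:
  "(deriv ^^ a) (\<lambda>s. (deriv ^^ b) (\<lambda>t. f (s + t)) 0) 0 = (deriv ^^ (a + b)) f (0::real)"
proof -
  have "(\<lambda>s. (deriv ^^ b) (\<lambda>t. f (s + t)) 0) = (deriv ^^ b) f"
    by (rule ext) (subst higher_deriv_shift_0, simp add: o_def)
  then show ?thesis by (simp add: funpow_add)
qed

lemma holonomic_props:
  assumes M: "smooth_atlas M" and v: "v \<in> pts (T_mfd K M)"
  shows "holonomic k M v \<in> pts (T_mfd k (T_mfd k M))" "vv_base (holonomic k M v) = rep v 0"
    and "smooth_chart M (U, x) \<Longrightarrow> rep v 0 \<in> U \<Longrightarrow> i < mdim M \<Longrightarrow> a \<le> k \<Longrightarrow> b \<le> k \<Longrightarrow>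
      vv_coord x (holonomic k M v) i a b = (deriv ^^ (a + b)) (\<lambda>t. x (rep v t) i) 0"
proof -
  have v': "smooth_near line 0 M (rep v)" using v T_dom_rep(1) unfolding pts_T_mfd by metis
  note s = vel2_props[OF M smooth_near_plane_sum[OF M v'], where m = k and n = k]
  show "holonomic k M v \<in> pts (T_mfd k (T_mfd k M))" "vv_base (holonomic k M v) = rep v 0"
    using s(1,2) by (simp_all add: holonomic_def)
  show "vv_coord x (holonomic k M v) i a b = (deriv ^^ (a + b)) (\<lambda>t. x (rep v t) i) 0"
    if "smooth_chart M (U, x)" "rep v 0 \<in> U" "i < mdim M" "a \<le> k" "b \<le> k"
    using s(3)[OF that(1) _ that(3-5)] that(2) higher_deriv_sum_arg[of a b "\<lambda>t. x (rep v t) i"]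
    by (simp add: holonomic_def)
qed

text \<open>Every order up to 2k is a sum of two orders up to k, so all derivatives of the curve can
  be read off. Consequently the description in \<open>semihol_proj\<close> has at most one
  solution.\<close>

lemma holonomic_inj:
  assumes M: "smooth_atlas M" and v: "v \<in> pts (T_mfd (2 * k) M)" "w \<in> pts (T_mfd (2 * k) M)"
    and eq: "holonomic k M v = holonomic k M w"
  shows "v = w"
proof -
  have 0: "rep w 0 = rep v 0" using holonomic_props(2)[OF M v(1), where k = k] holonomic_props(2)[OF M v(2), where k = k] eq by simp
  have "rep v 0 \<in> pts M" using v(1) T_dom_rep(2) unfolding pts_T_mfd by metis
  then obtain U x where U: "(U, x) \<in> atlas M" "rep v 0 \<in> U" by (rule ptsE)
  note c = smooth_atlasD[OF M U(1)]
  show ?thesis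
  proof (rule vel_pts_eqI[OF M c v U(2) 0])
    fix i a assume i: "i < mdim M" and a: "a \<le> 2 * k"
    define a1 where "a1 = min a k"
    have a12: "a1 \<le> k" "a - a1 \<le> k" "a1 + (a - a1) = a" using a by (auto simp: a1_def)
    show "(deriv ^^ a) (\<lambda>t. x (rep v t) i) 0 = (deriv ^^ a) (\<lambda>t. x (rep w t) i) 0"
      using holonomic_props(3)[OF M v(1) c U(2) i a12(1,2)] holonomic_props(3)[OF M v(2) c _ i a12(1,2)] eq 0 U(2) a12(3)
      by simp
  qed
qed

lemma vector_bundleD:
  assumes "vector_bundle B"
  shows "smooth_atlas (total B)" "smooth_atlas (base B)" "smooth_map (total B) (base B) (vproj B)"
    "mdim (base B) \<le> mdim (total B)"
  using assms by (auto simp: vector_bundle_def manifold_smooth_atlas)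

lemma T_vb_simps:
  "total (T_vb k B) = T_mfd k (total B)" "base (T_vb k B) = T_mfd k (base B)"
  "vproj (T_vb k B) = T_map k (base B) (vproj B)"
  by (simp_all add: T_vb_def)

lemma vb_chartD:
  assumes "vb_chart B U x \<psi>"
  shows "smooth_chart (base B) (U, x)" "smooth_chart (total B) (over B U, \<psi>)"
    "\<And>e i. e \<in> over B U \<Longrightarrow> i < mdim (base B) \<Longrightarrow> \<psi> e i = x (vproj B e) i"
  using assms by (auto simp: vb_chart_def)

lemma vector_bundle_chart:
  assumes "vector_bundle B" "p \<in> pts (base B)"
  obtains U x \<psi> where "p \<in> U" "vb_chart B U x \<psi>"
  using assms unfolding vector_bundle_def by metis

lemma over_iff: "e \<in> over B U \<longleftrightarrow> e \<in> pts (total B) \<and> vproj B e \<in> U"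
  by (simp add: over_def)

lemma vv_base_pts: "X \<in> pts (T_mfd m (T_mfd n N)) \<Longrightarrow> vv_base X \<in> pts N"
  unfolding vv_base_def by (metis pts_T_mfd T_dom_rep(2))

lemma semihol_proj_eqI:
  assumes B: "vector_bundle B" and v: "v \<in> pts (T_mfd (2 * k) (base B))"
    and eq: "holonomic k (base B) v = vproj (T_vb k (T_vb k B)) X"
  shows "semihol_proj k B X = v"
  unfolding semihol_proj_def
proof (rule the_equality)
  fix w assume "w \<in> pts (T_mfd (2 * k) (base B)) \<and> holonomic k (base B) w = vproj (T_vb k (T_vb k B)) X"
  then show "w = v" using holonomic_inj[OF vector_bundleD(2)[OF B] _ v, of w] eq by simp
qed (use v eq in simp)

lemma semihol_setD:
  assumes B: "vector_bundle B" and X: "X \<in> semihol_set k B"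
  shows "X \<in> pts (T_mfd k (T_mfd k (total B)))"
    "semihol_proj k B X \<in> pts (T_mfd (2 * k) (base B))"
    "vproj B (vv_base X) = rep (semihol_proj k B X) 0"
    "smooth_chart (base B) (U, x) \<Longrightarrow> rep (semihol_proj k B X) 0 \<in> U \<Longrightarrow> i < mdim (base B) \<Longrightarrow> a \<le> k \<Longrightarrow> b \<le> k \<Longrightarrow>
      vv_coord (\<lambda>e. x (vproj B e)) X i a b = (deriv ^^ (a + b)) (\<lambda>t. x (rep (semihol_proj k B X) t) i) 0"
proof -
  note b = vector_bundleD[OF B]
  show 1: "X \<in> pts (T_mfd k (T_mfd k (total B)))" using X by (simp add: semihol_set_def T_vb_simps)
  obtain v where v: "v \<in> pts (T_mfd (2 * k) (base B))" "holonomic k (base B) v = vproj (T_vb k (T_vb k B)) X"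
    using X by (auto simp: semihol_set_def)
  have pv: "semihol_proj k B X = v" by (rule semihol_proj_eqI[OF B v])
  show "semihol_proj k B X \<in> pts (T_mfd (2 * k) (base B))" using v(1) by (simp add: pv)
  note h = holonomic_props[OF b(2) v(1), where k = k]
  have P: "vproj (T_vb k (T_vb k B)) X = T_map k (T_mfd k (base B)) (T_map k (base B) (vproj B)) X"
    by (simp add: T_vb_simps)
  note t = TT_map_props[OF b(1) b(2) b(3) 1]
  show 3: "vproj B (vv_base X) = rep (semihol_proj k B X) 0" using h(2) t(2) v(2) P by (simp add: pv)
  show "vv_coord (\<lambda>e. x (vproj B e)) X i a b = (deriv ^^ (a + b)) (\<lambda>t. x (rep (semihol_proj k B X) t) i) 0"
    if "smooth_chart (base B) (U, x)" "rep (semihol_proj k B X) 0 \<in> U" "i < mdim (base B)" "a \<le> k" "b \<le> k"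
    using h(3)[OF that(1) _ that(3-5)] t(3)[OF that(1) _ that(3-5)] that(2) v(2) P 3 by (simp add: pv)
qed

text \<open>The criterion used in practice: it is enough to exhibit a curve whose derivatives of
  order a + b are the base coordinates of order (a, b), and the projection is then its
  2k-velocity.\<close>

lemma semihol_setI:
  assumes B: "vector_bundle B" and X: "X \<in> pts (T_mfd k (T_mfd k (total B)))"
    and \<gamma>: "smooth_near line 0 (base B) \<gamma>" "vproj B (vv_base X) = \<gamma> 0"
    and c: "smooth_chart (base B) (U, x)" "\<gamma> 0 \<in> U"
    and eq: "\<And>i a b. i < mdim (base B) \<Longrightarrow> a \<le> k \<Longrightarrow> b \<le> k \<Longrightarrow>
      vv_coord (\<lambda>e. x (vproj B e)) X i a b = (deriv ^^ (a + b)) (\<lambda>t. x (\<gamma> t) i) 0"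
  shows "X \<in> semihol_set k B" "semihol_proj k B X = vel (2 * k) (base B) \<gamma>"
proof -
  note b = vector_bundleD[OF B]
  let ?v = "vel (2 * k) (base B) \<gamma>"
  have v: "?v \<in> pts (T_mfd (2 * k) (base B))"
    unfolding pts_T_mfd using \<gamma>(1) smooth_near_pts[OF \<gamma>(1)] by (rule T_domI)
  note h = holonomic_props[OF b(2) v, where k = k]
  note t = TT_map_props[OF b(1) b(2) b(3) X]
  have r0: "rep ?v 0 = \<gamma> 0" by (rule rep_vel_0[OF \<gamma>(1)])
  have "holonomic k (base B) ?v = T_map k (T_mfd k (base B)) (T_map k (base B) (vproj B)) X"
  proof (rule vv_eqI[OF b(2) c(1) h(1) _ t(1)])
    show "vv_base (holonomic k (base B) ?v) \<in> U" using h(2) r0 c(2) by simp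
    show "vv_base (T_map k (T_mfd k (base B)) (T_map k (base B) (vproj B)) X) \<in> U" using t(2) \<gamma>(2) c(2) by simp
    fix i a b' assume i: "i < mdim (base B)" "a \<le> k" "b' \<le> k"
    have "vv_coord x (holonomic k (base B) ?v) i a b' = (deriv ^^ (a + b')) (\<lambda>t. x (rep ?v t) i) 0"
      using h(3)[OF c(1) _ i] r0 c(2) by simp
    also have "\<dots> = (deriv ^^ (a + b')) (\<lambda>t. x (\<gamma> t) i) 0"
      by (rule deriv_rep_vel[OF b(2) c(1) \<gamma>(1) c(2) i(1)]) (use i in simp)
    also have "\<dots> = vv_coord x (T_map k (T_mfd k (base B)) (T_map k (base B) (vproj B)) X) i a b'"
      using t(3)[OF c(1) _ i] \<gamma>(2) c(2) eq[OF i] by simp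
    finally show "vv_coord x (holonomic k (base B) ?v) i a b' =
       vv_coord x (T_map k (T_mfd k (base B)) (T_map k (base B) (vproj B)) X) i a b'" .
  qed
  then have e: "holonomic k (base B) ?v = vproj (T_vb k (T_vb k B)) X" by (simp add: T_vb_simps)
  show "X \<in> semihol_set k B" using X v e by (auto simp: semihol_set_def T_vb_simps)
  show "semihol_proj k B X = ?v" by (rule semihol_proj_eqI[OF B v e])
qed

lemma pts_semihol:
  assumes B: "vector_bundle B"
  shows "pts (total (semihol k B)) = semihol_set k B"
proof (intro equalityI subsetI)
  fix X assume X: "X \<in> semihol_set k B"
  have "rep (semihol_proj k B X) 0 \<in> pts (base B)"
    using semihol_setD(2)[OF B X] T_dom_rep(2) unfolding pts_T_mfd by metis
  from vector_bundle_chart[OF B this] obtain U x \<psi> where "rep (semihol_proj k B X) 0 \<in> U" "vb_chart B U x \<psi>" .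
  then have "({X \<in> semihol_set k B. rep (semihol_proj k B X) 0 \<in> U}, semihol_coords k B x \<psi>) \<in> atlas (total (semihol k B))"
    by (auto simp: semihol_def)
  then show "X \<in> pts (total (semihol k B))"
    unfolding pts_def using X \<open>rep (semihol_proj k B X) 0 \<in> U\<close> by (intro UN_I) auto
qed (auto simp: semihol_def pts_def)

lemma vv_coord_vproj:
  assumes B: "vector_bundle B" and c: "vb_chart B U x \<psi>" and X: "X \<in> pts (T_mfd m (T_mfd n (total B)))"
    and 0: "vproj B (vv_base X) \<in> U" and i: "i < mdim (base B)"
  shows "vv_coord \<psi> X i a b = vv_coord (\<lambda>e. x (vproj B e)) X i a b"
proof -
  note v = vb_chartD[OF c] and bb = vector_bundleD[OF B]
  have ov: "rep (rep X 0) 0 \<in> over B U" using vv_base_pts[OF X] 0 by (simp add: over_iff vv_base_def)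
  show ?thesis
    unfolding vv_coord_def
  proof (rule higher_deriv_cong_ev[OF eventually_mono[OF smooth_family_eventually_in[OF bb(1) v(2) pts_TT(1)[OF bb(1) X] ov]] refl])
    fix s assume "smooth_near line 0 (total B) (rep (rep X s)) \<and> rep (rep X s) 0 \<in> over B U"
    then have "\<forall>\<^sub>F t in nhds 0. rep (rep X s) t \<in> over B U"
      using smooth_near_line_eventually_in[OF bb(1) v(2), of "rep (rep X s)"] by simp
    then show "(deriv ^^ b) (\<lambda>t. \<psi> (rep (rep X s) t) i) 0 = (deriv ^^ b) (\<lambda>t. x (vproj B (rep (rep X s) t)) i) 0"
      by (intro higher_deriv_cong_ev refl) (auto elim!: eventually_mono simp: v(3) i)
  qed
qed

text \<open>Truncation leaves the remaining coordinates unchanged, so any curve representing the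
  2k-velocity below \<open>X\<close> also represents the 2l-velocity below \<open>Y\<close>.\<close>

lemma trunc2_semihol:
  assumes B: "vector_bundle B" and X: "X \<in> semihol_set k B" and l: "l \<le> k"
  defines "Y \<equiv> trunc2 l l (total B) X"
  shows "Y \<in> semihol_set l B" "semihol_proj l B Y = vel (2 * l) (base B) (rep (semihol_proj k B X))"
    "rep (semihol_proj l B Y) 0 = rep (semihol_proj k B X) 0"
proof -
  note bb = vector_bundleD[OF B] and d = semihol_setD[OF B X]
  define v where "v = semihol_proj k B X"
  have v0: "rep v 0 \<in> pts (base B)" and vs: "smooth_near line 0 (base B) (rep v)"
    using d(2) T_dom_rep(1,2) unfolding pts_T_mfd v_def by metis+
  obtain U x \<psi> where U: "rep v 0 \<in> U" "vb_chart B U x \<psi>" using vector_bundle_chart[OF B v0] .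
  note c = vb_chartD[OF U(2)]
  note t = trunc2_props[OF bb(1) d(1) l l]
  have b0: "vproj B (vv_base Y) = rep v 0" using t(2) d(3) by (simp add: Y_def v_def)
  have XU: "vv_base X \<in> over B U" using vv_base_pts[OF d(1)] d(3) U(1) by (simp add: over_iff v_def)
  have eq: "vv_coord (\<lambda>e. x (vproj B e)) Y i a b = (deriv ^^ (a + b)) (\<lambda>t. x (rep v t) i) 0"
    if i: "i < mdim (base B)" "a \<le> l" "b \<le> l" for i a b
  proof -
    have "vv_coord (\<lambda>e. x (vproj B e)) Y i a b = vv_coord \<psi> Y i a b"
      by (rule vv_coord_vproj[OF B U(2) t(1)[folded Y_def] _ i(1), symmetric]) (simp add: b0 U(1))
    also have "\<dots> = vv_coord \<psi> X i a b"
      unfolding Y_def using i bb(4) by (intro t(3)[OF c(2) XU]) auto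
    also have "\<dots> = vv_coord (\<lambda>e. x (vproj B e)) X i a b"
      by (rule vv_coord_vproj[OF B U(2) d(1) _ i(1)]) (use d(3) U(1) in \<open>simp add: v_def\<close>)
    also have "\<dots> = (deriv ^^ (a + b)) (\<lambda>t. x (rep v t) i) 0"
      unfolding v_def by (rule d(4)[OF c(1)]) (use i l U(1) in \<open>auto simp: v_def\<close>)
    finally show ?thesis .
  qed
  note s = semihol_setI[OF B t(1)[folded Y_def] vs b0 c(1) U(1) eq]
  show "Y \<in> semihol_set l B" by (rule s(1))
  show "semihol_proj l B Y = vel (2 * l) (base B) (rep (semihol_proj k B X))" using s(2) by (simp add: v_def)
  then show "rep (semihol_proj l B Y) 0 = rep (semihol_proj k B X) 0" using rep_vel_0[OF vs] by (simp add: v_def)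
qed

section \<open>The coordinate formula for the canonical morphisms\<close>

subsection \<open>Mixed derivatives\<close>

lemma pd_pd_funpow:
  assumes U: "openin (Euclidean_space n) U" and ij: "i < n" "j < n" and f: "Cinf_on n U f"
  shows "z \<in> U \<Longrightarrow> pd i ((pd j ^^ b) f) z = (pd j ^^ b) (pd i f) z"
proof (induction b arbitrary: z)
  case (Suc b)
  have "pd i ((pd j ^^ Suc b) f) z = pd j (pd i ((pd j ^^ b) f)) z"
    using pd_commute[OF U Suc.prems ij Cinf_on_pd_funpow[OF U ij(2) f]] by simp
  also have "\<dots> = pd j ((pd j ^^ b) (pd i f)) z"
    by (rule pd_cong[OF U Suc.prems ij(2) Suc.IH])
  finally show ?case by simp
qed simp

lemma pd_funpow_commute:
  assumes U: "openin (Euclidean_space n) U" and ij: "i < n" "j < n"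
  shows "Cinf_on n U f \<Longrightarrow> z \<in> U \<Longrightarrow> (pd i ^^ a) ((pd j ^^ b) f) z = (pd j ^^ b) ((pd i ^^ a) f) z"
proof (induction a arbitrary: z)
  case (Suc a)
  have "(pd i ^^ Suc a) ((pd j ^^ b) f) z = pd i ((pd j ^^ b) ((pd i ^^ a) f)) z"
    unfolding funpow.simps o_def by (rule pd_cong[OF U Suc.prems(2) ij(1) Suc.IH[OF Suc.prems(1)]])
  also have "\<dots> = (pd j ^^ b) (pd i ((pd i ^^ a) f)) z"
    by (rule pd_pd_funpow[OF U ij Cinf_on_pd_funpow[OF U ij(1) Suc.prems(1)] Suc.prems(2)])
  finally show ?case by simp
qed simp

lemma Cinf_on_double_slice:
  assumes W: "openin (Euclidean_space 2) W" "plane_coord (0, 0) \<in> W" and f: "Cinf_on 2 W f"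
  shows "(deriv ^^ a) (\<lambda>s. (deriv ^^ b) (\<lambda>t. f (plane_coord (s, t))) 0) 0 = (pd 0 ^^ a) ((pd (Suc 0) ^^ b) f) (plane_coord (0, 0))"
proof -
  have d2: "Suc 0 < 2" "0 < (2::nat)" by auto
  have ev: "\<forall>\<^sub>F s in nhds 0. plane_coord (s, 0) \<in> W"
    using eventually_update_in[OF W d2(2)] by simp
  have "(deriv ^^ a) (\<lambda>s. (deriv ^^ b) (\<lambda>t. f (plane_coord (s, t))) 0) 0
      = (deriv ^^ a) (\<lambda>s. (pd (Suc 0) ^^ b) f (plane_coord (s, 0))) 0"
  proof (rule higher_deriv_cong_ev[OF eventually_mono[OF ev] refl])
    fix s assume "plane_coord (s, 0) \<in> W"
    then show "(deriv ^^ b) (\<lambda>t. f (plane_coord (s, t))) 0 = (pd (Suc 0) ^^ b) f (plane_coord (s, 0))"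
      using Cinf_on_slice[OF W(1) d2(1) f, of "plane_coord (s, 0)" 0 b] by simp
  qed
  also have "\<dots> = (pd 0 ^^ a) ((pd (Suc 0) ^^ b) f) (plane_coord (0, 0))"
    using Cinf_on_slice[OF W(1) d2(2) Cinf_on_pd_funpow[OF W(1) d2(1) f], of "plane_coord (0, 0)" 0 a b] W(2) by simp
  finally show ?thesis .
qed

text \<open>In the summand with index \<open>j\<close> each variable enters exactly one of the two
  arguments: the first if its index is below \<open>j\<close>, the second otherwise. The l-fold
  mixed derivative therefore becomes a derivative of order \<open>j\<close> in the first and
  \<open>l - j\<close> in the second argument.\<close>

lemma mixed_deriv_sum:
  fixes f :: "nat \<Rightarrow> (nat \<Rightarrow> real) \<Rightarrow> real"
  assumes W: "openin (Euclidean_space 2) W" and e: "e > 0" "\<And>s t. \<bar>s\<bar> < e \<Longrightarrow> \<bar>t\<bar> < e \<Longrightarrow> plane_coord (s, t) \<in> W"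
    and f: "\<And>j. j \<le> l \<Longrightarrow> Cinf_on 2 W (f j)"
    and G: "\<And>s. (\<Sum>i<l. \<bar>s i\<bar>) < e \<Longrightarrow> G s = (\<Sum>j\<le>l. c j * f j (plane_coord (\<Sum>i<j. s i, \<Sum>i=j..<l. s i)))"
  shows "mixed_deriv l G (\<lambda>_. 0) = (\<Sum>j\<le>l. c j * (deriv ^^ j) (\<lambda>s. (deriv ^^ (l - j)) (\<lambda>t. f j (plane_coord (s, t))) 0) 0)"
proof -
  have d2: "Suc 0 < 2" "0 < (2::nat)" by auto
  let ?p = "\<lambda>j s. plane_coord (\<Sum>i<j. s i, \<Sum>i=j..<l. s i)"
  have inW: "?p j s \<in> W" if s: "(\<Sum>i<l. \<bar>s i\<bar>) < e" and j: "j \<le> l" for j s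
  proof (rule e(2))
    have "\<bar>\<Sum>i<j. s i\<bar> \<le> (\<Sum>i<j. \<bar>s i\<bar>)" by (rule sum_abs)
    also have "\<dots> \<le> (\<Sum>i<l. \<bar>s i\<bar>)" using j by (intro sum_mono2) auto
    finally show "\<bar>\<Sum>i<j. s i\<bar> < e" using s by simp
    have "\<bar>\<Sum>i=j..<l. s i\<bar> \<le> (\<Sum>i=j..<l. \<bar>s i\<bar>)" by (rule sum_abs)
    also have "\<dots> \<le> (\<Sum>i<l. \<bar>s i\<bar>)" by (intro sum_mono2) auto
    finally show "\<bar>\<Sum>i=j..<l. s i\<bar> < e" using s by simp
  qed
  \<comment> \<open>The state after differentiating in the first \<open>m\<close> variables:
    \<open>min m j\<close> of them acted on the first argument and the truncated difference
    \<open>m - j\<close> on the second.\<close>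
  define D where "D m j = (pd (Suc 0) ^^ (m - j)) ((pd 0 ^^ (min m j)) (f j))" for m j
  have DC: "Cinf_on 2 W (D m j)" if "j \<le> l" for m j
    unfolding D_def by (intro Cinf_on_pd_funpow W d2 f that)
  have main: "mixed_deriv m G s = (\<Sum>j\<le>l. c j * D m j (?p j s))" if "m \<le> l" "(\<Sum>i<l. \<bar>s i\<bar>) < e" for m s
    using that
  proof (induction m arbitrary: s)
    case 0
    then show ?case using G by (simp add: D_def)
  next
    case (Suc m)
    have m: "m < l" using Suc.prems by simp
    let ?R = "\<Sum>i\<in>{..<l} - {m}. \<bar>s i\<bar>"
    have split: "(\<Sum>i<l. \<bar>(s(m := h)) i\<bar>) = \<bar>h\<bar> + ?R" for h
    proof -
      have "(\<Sum>i<l. \<bar>(s(m := h)) i\<bar>) = \<bar>(s(m := h)) m\<bar> + (\<Sum>i\<in>{..<l} - {m}. \<bar>(s(m := h)) i\<bar>)"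
        using m by (intro sum.remove) auto
      moreover have "(\<Sum>i\<in>{..<l} - {m}. \<bar>(s(m := h)) i\<bar>) = ?R" by (intro sum.cong) auto
      ultimately show ?thesis by simp
    qed
    have "\<bar>s m\<bar> + ?R < e" using split[of "s m"] Suc.prems(2) by simp
    then have "\<forall>\<^sub>F h in nhds (s m). \<bar>h\<bar> + ?R < e"
      by (intro eventually_nhds_in_open[of "{h. \<bar>h\<bar> + ?R < e}", simplified] open_Collect_less continuous_intros) auto
    then have ev: "\<forall>\<^sub>F h in nhds (s m). mixed_deriv m G (s(m := h)) = (\<Sum>j\<le>l. c j * D m j (?p j (s(m := h))))"
      by eventually_elim (rule Suc.IH, use m split in auto)
    have der: "((\<lambda>h. D m j (?p j (s(m := h)))) has_real_derivative D (Suc m) j (?p j s)) (at (s m))" if j: "j \<le> l" for j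
    proof (cases "m < j")
      case True
      have s1: "(\<Sum>i<j. (s(m := h)) i) = h + (\<Sum>i\<in>{..<j} - {m}. s i)" for h
      proof -
        have "(\<Sum>i<j. (s(m := h)) i) = (s(m := h)) m + (\<Sum>i\<in>{..<j} - {m}. (s(m := h)) i)"
          using True by (intro sum.remove) auto
        moreover have "(\<Sum>i\<in>{..<j} - {m}. (s(m := h)) i) = (\<Sum>i\<in>{..<j} - {m}. s i)" by (intro sum.cong) auto
        ultimately show ?thesis by simp
      qed
      have s2: "(\<Sum>i=j..<l. (s(m := h)) i) = (\<Sum>i=j..<l. s i)" for h
        using True by (intro sum.cong) auto
      have DS: "D (Suc m) j = pd 0 (D m j)" using True by (simp add: D_def min_def)
      have s0: "(\<Sum>i<j. s i) = s m + (\<Sum>i\<in>{..<j} - {m}. s i)" using s1[of "s m"] by simp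
      have "((\<lambda>h. D m j ((?p j s)(0 := h))) has_real_derivative pd 0 (D m j) (?p j s)) (at (?p j s 0))"
        by (rule Cinf_on_partial[OF W inW[OF Suc.prems(2) j] d2(2) DC[OF j]])
      then have "((\<lambda>h. D m j (plane_coord (h, \<Sum>i=j..<l. s i))) has_real_derivative D (Suc m) j (?p j s)) (at (s m + (\<Sum>i\<in>{..<j} - {m}. s i)))"
        by (simp add: DS s0)
      moreover have "((\<lambda>h. h + (\<Sum>i\<in>{..<j} - {m}. s i)) has_real_derivative 1) (at (s m))"
        by (auto intro!: derivative_eq_intros)
      ultimately have "((\<lambda>h. D m j (plane_coord (h + (\<Sum>i\<in>{..<j} - {m}. s i), \<Sum>i=j..<l. s i))) has_real_derivative
         D (Suc m) j (?p j s) * 1) (at (s m))"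
        by (rule DERIV_chain2)
      then show ?thesis by (simp only: s1 s2 mult_1_right)
    next
      case False
      have s1: "(\<Sum>i=j..<l. (s(m := h)) i) = h + (\<Sum>i\<in>{j..<l} - {m}. s i)" for h
      proof -
        have "(\<Sum>i=j..<l. (s(m := h)) i) = (s(m := h)) m + (\<Sum>i\<in>{j..<l} - {m}. (s(m := h)) i)"
          using False m by (intro sum.remove) auto
        moreover have "(\<Sum>i\<in>{j..<l} - {m}. (s(m := h)) i) = (\<Sum>i\<in>{j..<l} - {m}. s i)" by (intro sum.cong) auto
        ultimately show ?thesis by simp
      qed
      have s2: "(\<Sum>i<j. (s(m := h)) i) = (\<Sum>i<j. s i)" for h
        using False by (intro sum.cong) auto
      have DS: "D (Suc m) j = pd (Suc 0) (D m j)" using False by (simp add: D_def min_def Suc_diff_le)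
      have s0: "(\<Sum>i=j..<l. s i) = s m + (\<Sum>i\<in>{j..<l} - {m}. s i)" using s1[of "s m"] by simp
      have "((\<lambda>h. D m j ((?p j s)(Suc 0 := h))) has_real_derivative pd (Suc 0) (D m j) (?p j s)) (at (?p j s (Suc 0)))"
        by (rule Cinf_on_partial[OF W inW[OF Suc.prems(2) j] d2(1) DC[OF j]])
      then have "((\<lambda>h. D m j (plane_coord (\<Sum>i<j. s i, h))) has_real_derivative D (Suc m) j (?p j s)) (at (s m + (\<Sum>i\<in>{j..<l} - {m}. s i)))"
        by (simp add: DS s0)
      moreover have "((\<lambda>h. h + (\<Sum>i\<in>{j..<l} - {m}. s i)) has_real_derivative 1) (at (s m))"
        by (auto intro!: derivative_eq_intros)
      ultimately have "((\<lambda>h. D m j (plane_coord (\<Sum>i<j. s i, h + (\<Sum>i\<in>{j..<l} - {m}. s i)))) has_real_derivative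
         D (Suc m) j (?p j s) * 1) (at (s m))"
        by (rule DERIV_chain2)
      then show ?thesis by (simp only: s1 s2 mult_1_right)
    qed
    have "mixed_deriv (Suc m) G s = deriv (\<lambda>h. \<Sum>j\<le>l. c j * D m j (?p j (s(m := h)))) (s m)"
      unfolding mixed_deriv.simps by (rule deriv_cong_ev[OF ev refl])
    also have "\<dots> = (\<Sum>j\<le>l. c j * D (Suc m) j (?p j s))"
      by (rule DERIV_imp_deriv[OF DERIV_sum]) (use der in \<open>auto intro: DERIV_cmult\<close>)
    finally show ?case .
  qed
  have p0: "?p j (\<lambda>_. 0) = plane_coord (0, 0)" for j by simp
  have 0: "plane_coord (0, 0) \<in> W" using e by simp
  have "mixed_deriv l G (\<lambda>_. 0) = (\<Sum>j\<le>l. c j * D l j (plane_coord (0, 0)))"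
    using main[of l "\<lambda>_. 0"] e(1) by simp
  also have "\<dots> = (\<Sum>j\<le>l. c j * (deriv ^^ j) (\<lambda>s. (deriv ^^ (l - j)) (\<lambda>t. f j (plane_coord (s, t))) 0) 0)"
  proof (intro sum.cong refl arg_cong2[where f = times])
    fix j assume "j \<in> {..l}"
    then have j: "j \<le> l" by simp
    \<comment> \<open>\<open>D\<close> differentiates in the first argument before the second, the
      iterated \<open>deriv\<close> the other way round; partial derivatives commute.\<close>
    show "D l j (plane_coord (0, 0)) = (deriv ^^ j) (\<lambda>s. (deriv ^^ (l - j)) (\<lambda>t. f j (plane_coord (s, t))) 0) 0"
      unfolding Cinf_on_double_slice[OF W 0 f[OF j]] D_def using j pd_funpow_commute[OF W d2 f[OF j] 0, of "l - j" j]
      by (simp add: min_def)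
  qed
  finally show ?thesis .
qed

text \<open>The Leibniz rule is applied in \<open>t\<close> for fixed \<open>s\<close> and then in
  \<open>s\<close>. Both variables act on \<open>z (s + t)\<close> by the same derivative, so its
  order is what remains of a + b.\<close>

lemma leibniz_plane:
  assumes W: "openin (Euclidean_space 2) W" and e: "e > 0" "\<And>s t. \<bar>s\<bar> < e \<Longrightarrow> \<bar>t\<bar> < e \<Longrightarrow> plane_coord (s, t) \<in> W"
    and y: "Cinf_on 2 W y" and z: "smooth_R {-e<..<e} z"
  shows "(deriv ^^ a) (\<lambda>s. (deriv ^^ b) (\<lambda>t. y (plane_coord (s, t)) * z (s + t)) 0) 0 =
    (\<Sum>p\<le>a. \<Sum>q\<le>b. real (a choose p) * real (b choose q) *
      (deriv ^^ p) (\<lambda>s. (deriv ^^ q) (\<lambda>t. y (plane_coord (s, t))) 0) 0 * (deriv ^^ (a + b - p - q)) z 0)"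
proof -
  have d2: "Suc 0 < 2" "0 < (2::nat)" by auto
  define S where "S = {-e<..<e}"
  have S: "open S" "0 \<in> S" "\<And>s. s \<in> S \<longleftrightarrow> \<bar>s\<bar> < e" using e(1) by (auto simp: S_def)
  define Y where "Y q s = (deriv ^^ q) (\<lambda>t. y (plane_coord (s, t))) 0" for q s
  have Ysm: "smooth_R S (Y q)" for q
  proof (rule smooth_R_cong[OF S(1)])
    show "smooth_R S (\<lambda>s. (pd (Suc 0) ^^ q) y (plane_coord (s, 0)))"
      using smooth_R_slice[OF W d2(2) Cinf_on_pd_funpow[OF W d2(1) y], of S "plane_coord (0, 0)" q] e S(3) by simp
    show "(pd (Suc 0) ^^ q) y (plane_coord (s, 0)) = Y q s" if "s \<in> S" for s
      using Cinf_on_slice[OF W d2(1) y, of "plane_coord (s, 0)" 0 q] e that S(3) by (simp add: Y_def)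
  qed
  have zsm: "smooth_R S ((deriv ^^ q) z)" for q using z unfolding S_def by (rule smooth_R_deriv)
  have inner: "(deriv ^^ b) (\<lambda>t. y (plane_coord (s, t)) * z (s + t)) 0
      = (\<Sum>q\<le>b. real (b choose q) * (Y q s * (deriv ^^ (b - q)) z s))" if s: "s \<in> S" for s
  proof -
    \<comment> \<open>For \<open>t\<close> in (-d, d) the sum s + t stays in (-e, e), where
      \<open>z\<close> is known to be smooth.\<close>
    define d where "d = e - \<bar>s\<bar>"
    have d: "d > 0" "d \<le> e" using s S(3)[of s] by (auto simp: d_def)
    have y1: "smooth_R {-d<..<d} (\<lambda>t. y (plane_coord (s, t)))"
    proof -
      have "plane_coord (s, t) \<in> W" if "t \<in> {-d<..<d}" for t
      proof (rule e(2))
        show "\<bar>s\<bar> < e" using s S(3)[of s] by simp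
        show "\<bar>t\<bar> < e" using that d by auto
      qed
      then show ?thesis using smooth_R_slice[OF W d2(1) y, of "{-d<..<d}" "plane_coord (s, 0)"] by simp
    qed
    have z1: "smooth_R {-d<..<d} (\<lambda>t. z (s + t))"
      unfolding smooth_R_def
    proof (intro allI ballI)
      fix m t assume t: "t \<in> {-d<..<d}"
      have eq: "(deriv ^^ m) (\<lambda>t. z (s + t)) = (\<lambda>t. (deriv ^^ m) z (s + t))"
        by (rule ext) (subst (1 2) higher_deriv_shift_0, simp add: o_def add.assoc)
      have "s + t \<in> {-e<..<e}" using t by (auto simp: d_def abs_if split: if_splits)
      from smooth_R_DERIV[OF z this, of m]
      have "((deriv ^^ m) z has_real_derivative (deriv ^^ Suc m) z (s + t)) (at (s + t))" .
      moreover have "((\<lambda>t. s + t) has_real_derivative 1) (at t)" by (auto intro!: derivative_eq_intros)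
      ultimately have "((\<lambda>t. (deriv ^^ m) z (s + t)) has_real_derivative (deriv ^^ Suc m) z (s + t) * 1) (at t)"
        by (rule DERIV_chain2)
      then show "(deriv ^^ m) (\<lambda>t. z (s + t)) differentiable at t" unfolding eq real_differentiable_def by blast
    qed
    have zs: "(deriv ^^ q) (\<lambda>t. z (s + t)) 0 = (deriv ^^ q) z s" for q
      by (subst (2) higher_deriv_shift_0) (simp add: o_def)
    have "0 \<in> {-d<..<d}" using d by simp
    from higher_deriv_mult[OF open_greaterThanLessThan y1 z1 this, of b]
    show ?thesis by (simp add: zs Y_def mult.assoc)
  qed
  have "(deriv ^^ a) (\<lambda>s. (deriv ^^ b) (\<lambda>t. y (plane_coord (s, t)) * z (s + t)) 0) 0
      = (deriv ^^ a) (\<lambda>s. \<Sum>q\<le>b. real (b choose q) * (Y q s * (deriv ^^ (b - q)) z s)) 0"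
    by (rule higher_deriv_cong_ev[OF eventually_mono[OF eventually_nhds_in_open[OF S(1,2)]] refl]) (rule inner)
  also have "\<dots> = (\<Sum>q\<le>b. (deriv ^^ a) (\<lambda>s. real (b choose q) * (Y q s * (deriv ^^ (b - q)) z s)) 0)"
    by (rule higher_deriv_sum[OF _ S(1) _ S(2)]) (intro finite_atMost smooth_R_mult S(1) Ysm zsm smooth_R_const)+
  also have "\<dots> = (\<Sum>q\<le>b. \<Sum>p\<le>a. real (a choose p) * real (b choose q) * (deriv ^^ p) (Y q) 0 * (deriv ^^ (a + b - p - q)) z 0)"
  proof (rule sum.cong[OF refl])
    fix q assume "q \<in> {..b}"
    then have q: "q \<le> b" by simp
    have c0: "(deriv ^^ a) (\<lambda>s. real (b choose q) * (Y q s * (deriv ^^ (b - q)) z s)) 0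
        = real (b choose q) * (deriv ^^ a) (\<lambda>s. Y q s * (deriv ^^ (b - q)) z s) 0"
    proof -
      have "(deriv ^^ a) (\<lambda>s. real (b choose q) * (Y q s * (deriv ^^ (b - q)) z s)) 0
        = (\<Sum>j\<le>a. real (a choose j) * (if j = 0 then real (b choose q) else 0) * (deriv ^^ (a - j)) (\<lambda>s. Y q s * (deriv ^^ (b - q)) z s) 0)"
        using higher_deriv_mult[OF S(1) smooth_R_const[of S "real (b choose q)"] smooth_R_mult[OF S(1) Ysm zsm] S(2), of a q "b - q"]
        by (simp add: higher_deriv_const_fun)
      also have "\<dots> = (\<Sum>j\<le>a. if j = 0 then real (b choose q) * (deriv ^^ a) (\<lambda>s. Y q s * (deriv ^^ (b - q)) z s) 0 else 0)"
        by (intro sum.cong) auto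
      finally show ?thesis by simp
    qed
    have "(deriv ^^ a) (\<lambda>s. Y q s * (deriv ^^ (b - q)) z s) 0 =
        (\<Sum>p\<le>a. real (a choose p) * (deriv ^^ p) (Y q) 0 * (deriv ^^ (a + b - p - q)) z 0)"
    proof (subst higher_deriv_mult[OF S(1) Ysm zsm S(2)], rule sum.cong[OF refl])
      fix p assume "p \<in> {..a}"
      then have eq: "a - p + (b - q) = a + b - p - q" using q by simp
      have "(deriv ^^ (a - p)) ((deriv ^^ (b - q)) z) = (deriv ^^ (a - p + (b - q))) z"
        by (simp only: funpow_add o_apply)
      then have "(deriv ^^ (a - p)) ((deriv ^^ (b - q)) z) = (deriv ^^ (a + b - p - q)) z"
        unfolding eq .
      then show "real (a choose p) * (deriv ^^ p) (Y q) 0 * (deriv ^^ (a - p)) ((deriv ^^ (b - q)) z) 0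
        = real (a choose p) * (deriv ^^ p) (Y q) 0 * (deriv ^^ (a + b - p - q)) z 0" by simp
    qed
    then show "(deriv ^^ a) (\<lambda>s. real (b choose q) * (Y q s * (deriv ^^ (b - q)) z s)) 0
      = (\<Sum>p\<le>a. real (a choose p) * real (b choose q) * (deriv ^^ p) (Y q) 0 * (deriv ^^ (a + b - p - q)) z 0)"
      unfolding c0 by (simp add: sum_distrib_left algebra_simps)
  qed
  finally show ?thesis unfolding Y_def[abs_def] by (subst sum.swap) 
qed

text \<open>Both sides are the multinomial coefficient l! / (p! q! (j - p)! (l - j - q)!). On the
  right, \<open>j\<close> occurs in a single binomial coefficient, ready for an alternating sum over
  \<open>j\<close>.\<close>

lemma choose_triple:
  fixes j l p q :: nat
  assumes "p \<le> j" "j \<le> l" "q \<le> l - j"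
  shows "real (l choose j) * real (j choose p) * real ((l - j) choose q)
    = real (l choose p) * real ((l - p) choose q) * real ((l - p - q) choose (j - p))"
proof -
  have h: "l - p - (j - p) = l - j" "l - p - q - (j - p) = l - j - q" using assms by auto
  show ?thesis
    using assms by (simp add: binomial_fact h add.commute)
qed

text \<open>Only the terms without a derivative of \<open>Z\<close> survive: this is \<open>(\<partial>\<^sub>t - \<partial>\<^sub>s)\<^sup>l\<close> annihilating
  functions of \<open>s + t\<close>.\<close>

lemma alternating_leibniz:
  fixes Y :: "nat \<Rightarrow> nat \<Rightarrow> real" and Z :: "nat \<Rightarrow> real"
  shows "(\<Sum>j\<le>l. (-1) ^ j * real (l choose j) * (\<Sum>p\<le>j. \<Sum>q\<le>l - j. real (j choose p) * real ((l - j) choose q) * Y p q * Z (l - p - q)))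
    = Z 0 * (\<Sum>j\<le>l. (-1) ^ j * real (l choose j) * Y j (l - j))"
proof -
  define g where "g p q = real (l choose p) * real ((l - p) choose q) * Y p q * Z (l - p - q)" for p q
  have "(\<Sum>j\<le>l. (-1) ^ j * real (l choose j) * (\<Sum>p\<le>j. \<Sum>q\<le>l - j. real (j choose p) * real ((l - j) choose q) * Y p q * Z (l - p - q)))
    = (\<Sum>j\<le>l. \<Sum>p\<le>l. \<Sum>q\<le>l. if p \<le> j \<and> q \<le> l - j then (-1) ^ j * real ((l - p - q) choose (j - p)) * g p q else 0)"
  proof (rule sum.cong[OF refl])
    fix j assume "j \<in> {..l}"
    then have j: "j \<le> l" by simp
    have "(\<Sum>p\<le>l. \<Sum>q\<le>l. if p \<le> j \<and> q \<le> l - j then (-1) ^ j * real ((l - p - q) choose (j - p)) * g p q else 0)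
      = (\<Sum>p\<le>j. \<Sum>q\<le>l - j. (-1) ^ j * real ((l - p - q) choose (j - p)) * g p q)"
    proof -
      have "(\<Sum>p\<le>l. \<Sum>q\<le>l. if p \<le> j \<and> q \<le> l - j then (-1) ^ j * real ((l - p - q) choose (j - p)) * g p q else 0)
        = (\<Sum>p\<le>j. \<Sum>q\<le>l. if p \<le> j \<and> q \<le> l - j then (-1) ^ j * real ((l - p - q) choose (j - p)) * g p q else 0)"
        by (rule sum.mono_neutral_right) (use j in auto)
      also have "\<dots> = (\<Sum>p\<le>j. \<Sum>q\<le>l - j. if p \<le> j \<and> q \<le> l - j then (-1) ^ j * real ((l - p - q) choose (j - p)) * g p q else 0)"
        by (intro sum.cong refl sum.mono_neutral_right) auto
      finally show ?thesis by simp
    qed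
    also have "\<dots> = (\<Sum>p\<le>j. \<Sum>q\<le>l - j. (-1) ^ j * real (l choose j) * (real (j choose p) * real ((l - j) choose q) * Y p q * Z (l - p - q)))"
    proof (intro sum.cong refl)
      fix p q assume "p \<in> {..j}" "q \<in> {..l - j}"
      then have h: "real (l choose j) * real (j choose p) * real ((l - j) choose q)
        = real (l choose p) * real ((l - p) choose q) * real ((l - p - q) choose (j - p))"
        using j by (intro choose_triple) auto
      have "(-1) ^ j * real ((l - p - q) choose (j - p)) * g p q
        = (-1) ^ j * (real (l choose p) * real ((l - p) choose q) * real ((l - p - q) choose (j - p))) * Y p q * Z (l - p - q)"
        by (simp only: g_def mult_ac)
      also have "\<dots> = (-1) ^ j * real (l choose j) * (real (j choose p) * real ((l - j) choose q) * Y p q * Z (l - p - q))"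
        unfolding h[symmetric] by (simp only: mult_ac)
      finally show "(-1) ^ j * real ((l - p - q) choose (j - p)) * g p q
        = (-1) ^ j * real (l choose j) * (real (j choose p) * real ((l - j) choose q) * Y p q * Z (l - p - q))" .
    qed
    finally show "(-1) ^ j * real (l choose j) * (\<Sum>p\<le>j. \<Sum>q\<le>l - j. real (j choose p) * real ((l - j) choose q) * Y p q * Z (l - p - q))
      = (\<Sum>p\<le>l. \<Sum>q\<le>l. if p \<le> j \<and> q \<le> l - j then (-1) ^ j * real ((l - p - q) choose (j - p)) * g p q else 0)"
      by (simp add: sum_distrib_left)
  qed
  also have "\<dots> = (\<Sum>p\<le>l. \<Sum>j\<le>l. \<Sum>q\<le>l. if p \<le> j \<and> q \<le> l - j then (-1) ^ j * real ((l - p - q) choose (j - p)) * g p q else 0)"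
    by (rule sum.swap)
  also have "\<dots> = (\<Sum>p\<le>l. \<Sum>q\<le>l. \<Sum>j\<le>l. if p \<le> j \<and> q \<le> l - j then (-1) ^ j * real ((l - p - q) choose (j - p)) * g p q else 0)"
    by (intro sum.cong refl sum.swap)
  also have "\<dots> = (\<Sum>p\<le>l. \<Sum>q\<le>l. if q = l - p then (-1) ^ p * g p q else 0)"
  proof (intro sum.cong refl)
    fix p q assume pq: "p \<in> {..l}" "q \<in> {..l}"
    show "(\<Sum>j\<le>l. if p \<le> j \<and> q \<le> l - j then (-1) ^ j * real ((l - p - q) choose (j - p)) * g p q else 0)
      = (if q = l - p then (-1) ^ p * g p q else 0)"
    proof (cases "p + q \<le> l")
      case False
      then have "(\<Sum>j\<le>l. if p \<le> j \<and> q \<le> l - j then (-1) ^ j * real ((l - p - q) choose (j - p)) * g p q else 0) = 0"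
        by (intro sum.neutral) auto
      then show ?thesis using False pq by auto
    next
      case True
      \<comment> \<open>For fixed p and q the index \<open>j\<close> runs from p to p + m, and the
        sum is a multiple of (1 - 1)^m. It vanishes unless m = 0, that is unless p + q = l and
        \<open>Z\<close> is not differentiated.\<close>
      define m where "m = l - p - q"
      have "(\<Sum>j\<le>l. if p \<le> j \<and> q \<le> l - j then (-1) ^ j * real ((l - p - q) choose (j - p)) * g p q else 0)
        = (\<Sum>j\<in>{p..p + m}. (-1) ^ j * real (m choose (j - p)) * g p q)"
        by (rule sum.mono_neutral_cong_right) (use True in \<open>auto simp: m_def\<close>)
      also have "\<dots> = (\<Sum>i\<le>m. (-1) ^ (i + p) * real (m choose i) * g p q)"
        using sum.shift_bounds_cl_nat_ivl[of "\<lambda>j. (-1) ^ j * real (m choose (j - p)) * g p q" 0 p m]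
        by (simp add: atMost_atLeast0 add.commute)
      also have "\<dots> = (-1) ^ p * g p q * (\<Sum>i\<le>m. (-1) ^ i * real (m choose i))"
        by (simp add: sum_distrib_left power_add algebra_simps)
      also have "\<dots> = (if q = l - p then (-1) ^ p * g p q else 0)"
      proof (cases "m = 0")
        case False
        then have "(\<Sum>i\<le>m. (-1) ^ i * real (m choose i)) = 0" by (intro choose_alternating_sum) simp
        then show ?thesis using False by (auto simp: m_def)
      next
        case m0: True
        then have "q = l - p" using True by (simp add: m_def)
        then show ?thesis using m0 by simp
      qed
      finally show ?thesis .
    qed
  qed
  also have "\<dots> = (\<Sum>p\<le>l. (-1) ^ p * g p (l - p))"
    by (simp add: sum.delta)
  also have "\<dots> = Z 0 * (\<Sum>j\<le>l. (-1) ^ j * real (l choose j) * Y j (l - j))"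
    by (simp add: g_def sum_distrib_left algebra_simps)
  finally show ?thesis .
qed

subsection \<open>Fibre coordinates\<close>

text \<open>Obtained from the definition alone, for use with \<open>dual_mfd B\<close>:
  compatibility of the charts of that manifold is not established, so
  \<open>smooth_near_line_iff\<close> does not apply to it.\<close>

lemma smooth_near_line_chartE:
  assumes "smooth_near line 0 P f"
  obtains V \<psi> S where "(V, \<psi>) \<in> atlas P" "open S" "0 \<in> S" "f ` S \<subseteq> V" "\<forall>j<mdim P. smooth_R S (\<lambda>t. \<psi> (f t) j)"
proof -
  obtain W where W: "0 \<in> W" "smooth_on line W P f" using assms by (auto simp: smooth_near_def)
  then obtain c d S where S: "c \<in> atlas line" "d \<in> atlas P" "0 \<in> S" "smooth_in_charts line P S c d f"
    unfolding smooth_on_iff by metis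
  obtain V \<psi> where d: "d = (V, \<psi>)" by (cases d)
  have c: "c = (UNIV, line_coord)" using S(1) by (simp add: line_def line_coord_def[abs_def])
  have o: "open S" "f ` S \<subseteq> V" and C: "\<And>i. i < mdim P \<Longrightarrow> Cinf_on (Suc 0) (line_coord ` S) (\<lambda>z. \<psi> (f (inv_into UNIV line_coord z)) i)"
    using S(4) by (auto simp: smooth_in_charts_def line_chart c d)
  have "smooth_R S (\<lambda>t. \<psi> (f t) i)" if "i < mdim P" for i
    using smooth_R_line_coord[OF _ C[OF that], of S] o(1) by (simp add: openin_line_coord_image inj_line_coord)
  then show thesis using S(2,3) o d by (intro that) auto
qed

lemma smooth_near_line_chartI:
  assumes "(V, \<psi>) \<in> atlas P" "open S" "0 \<in> S" "f ` S \<subseteq> V" "\<And>j. j<mdim P \<Longrightarrow> smooth_R S (\<lambda>t. \<psi> (f t) j)"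
  shows "smooth_near line 0 P f"
proof -
  have o: "openin (Euclidean_space (Suc 0)) (line_coord ` S)" using assms(2) by (simp add: openin_line_coord_image)
  have "Cinf_on (Suc 0) (line_coord ` S) (\<lambda>z. \<psi> (f (inv_into UNIV line_coord z)) i)" if "i < mdim P" for i
    by (rule Cinf_on_eq[OF o Cinf_on_smooth_R[OF assms(2) assms(5)[OF that]]]) (auto simp: inj_line_coord)
  then have s: "smooth_in_charts line P S (UNIV, line_coord) (V, \<psi>) f"
    using assms(2,4) by (simp add: smooth_in_charts_def line_chart)
  have c: "(UNIV, line_coord) \<in> atlas line" by (simp add: line_def line_coord_def[abs_def])
  have "smooth_on line S P f"
    unfolding smooth_on_iff
  proof (intro conjI ballI)
    show "open_in line S" using assms(2) by (simp add: line_chart)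
    fix p assume "p \<in> S"
    then show "\<exists>c\<in>atlas line. \<exists>d\<in>atlas P. \<exists>W'\<subseteq>S. p \<in> W' \<and> smooth_in_charts line P W' c d f"
      using s by (intro bexI[OF _ c] bexI[OF _ assms(1)] exI[of _ S]) simp
  qed
  then show ?thesis using assms(3) by (auto simp: smooth_near_def)
qed

text \<open>\<open>w\<close> is indexed like the coordinates of the total space: only the entries
  from \<open>mdim (base B)\<close> up to \<open>mdim (total B) - 1\<close> count.\<close>

definition vb_point :: "('m, 'e) vbundle \<Rightarrow> 'm set \<Rightarrow> ('m \<Rightarrow> nat \<Rightarrow> real) \<Rightarrow> ('e \<Rightarrow> nat \<Rightarrow> real)
    \<Rightarrow> 'm \<Rightarrow> (nat \<Rightarrow> real) \<Rightarrow> 'e" where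
  "vb_point B U x \<psi> p w = inv_into (over B U) \<psi>
     (\<lambda>i. if i < mdim (base B) then x p i else if i < mdim (total B) then w i else 0)"

lemma over_subset: "U \<subseteq> V \<Longrightarrow> over B U \<subseteq> over B V"
  by (auto simp: over_def)

lemma vb_point_props:
  assumes B: "vector_bundle B" and c: "vb_chart B U x \<psi>" and p: "p \<in> U"
  shows "vb_point B U x \<psi> p w \<in> over B {p}"
    and "\<psi> (vb_point B U x \<psi> p w) = (\<lambda>i. if i < mdim (base B) then x p i else if i < mdim (total B) then w i else 0)"
proof -
  let ?z = "\<lambda>i. if i < mdim (base B) then x p i else if i < mdim (total B) then w i else 0"
  have "?z \<in> topspace (Euclidean_space (mdim (total B)))"
    using vector_bundleD(4)[OF B] by (auto simp: topspace_Euclidean_space)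
  then have "?z \<in> {z \<in> topspace (Euclidean_space (mdim (total B))). \<exists>p \<in> U. \<forall>i < mdim (base B). z i = x p i}"
    using p by auto
  then have z: "?z \<in> \<psi> ` over B U" using c by (simp add: vb_chart_def)
  show \<psi>: "\<psi> (vb_point B U x \<psi> p w) = ?z" unfolding vb_point_def by (rule f_inv_into_f[OF z])
  have o: "vb_point B U x \<psi> p w \<in> over B U" unfolding vb_point_def by (rule inv_into_into[OF z])
  note d = vb_chartD[OF c]
  let ?q = "vproj B (vb_point B U x \<psi> p w)"
  have q: "?q \<in> U" using o by (simp add: over_iff)
  have "x ?q = x p"
  proof
    fix i show "x ?q i = x p i"
    proof (cases "i < mdim (base B)")
      case True then show ?thesis using d(3)[OF o True] \<psi> by simp
    next
      case False
      then show ?thesis using chart_topspace[OF d(1) q] chart_topspace[OF d(1) p] by (simp add: topspace_Euclidean_space)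
    qed
  qed
  then have "?q = p" using smooth_chartD(2)[OF d(1)] q p by (auto dest: inj_onD)
  then show "vb_point B U x \<psi> p w \<in> over B {p}" using o by (simp add: over_iff)
qed

lemma fibre_eqI:
  assumes B: "vector_bundle B" and c: "vb_chart B U x \<psi>" and p: "p \<in> U"
    and e: "e \<in> over B {p}" "e' \<in> over B {p}"
    and eq: "\<And>i. mdim (base B) \<le> i \<Longrightarrow> i < mdim (total B) \<Longrightarrow> \<psi> e i = \<psi> e' i"
  shows "e = e'"
proof -
  note d = vb_chartD[OF c]
  have eU: "e \<in> over B U" "e' \<in> over B U" using e p by (auto simp: over_iff)
  have pe: "vproj B e = p" "vproj B e' = p" using e by (auto simp: over_iff)
  have "\<psi> e = \<psi> e'"
  proof
    fix i
    consider "i < mdim (base B)" | "mdim (base B) \<le> i" "i < mdim (total B)" | "mdim (total B) \<le> i" by linarith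
    then show "\<psi> e i = \<psi> e' i"
    proof cases
      case 1 then show ?thesis using d(3)[OF eU(1) 1] d(3)[OF eU(2) 1] pe by simp
    next
      case 2 then show ?thesis by (rule eq)
    next
      case 3 then show ?thesis using chart_topspace[OF d(2) eU(1)] chart_topspace[OF d(2) eU(2)] by (simp add: topspace_Euclidean_space)
    qed
  qed
  then show ?thesis using smooth_chartD(2)[OF d(2)] eU by (auto dest: inj_onD)
qed

lemma fibre_ops:
  assumes B: "vector_bundle B"
  shows "e \<in> over B {p} \<Longrightarrow> e' \<in> over B {p} \<Longrightarrow> vadd B e e' \<in> over B {p}"
    and "e \<in> over B {p} \<Longrightarrow> vscale B r e \<in> over B {p}"
  using B by (auto simp: vector_bundle_def over_iff)

lemma fibre_ops_coord:
  assumes c: "vb_chart B U x \<psi>" and p: "p \<in> U" and i: "mdim (base B) \<le> i"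
  shows "e \<in> over B {p} \<Longrightarrow> e' \<in> over B {p} \<Longrightarrow> \<psi> (vadd B e e') i = \<psi> e i + \<psi> e' i"
    and "e \<in> over B {p} \<Longrightarrow> \<psi> (vscale B r e) i = r * \<psi> e i"
  using c p i by (auto simp: vb_chart_def over_iff)

lemma fibre_sum_over:
  assumes B: "vector_bundle B" and a: "\<And>j. j \<le> l \<Longrightarrow> a j \<in> over B {p}"
  shows "fibre_sum B a l \<in> over B {p}"
  using a by (induction l) (auto intro: fibre_ops(1)[OF B])

lemma fibre_sum_coord:
  assumes B: "vector_bundle B" and c: "vb_chart B U x \<psi>" and p: "p \<in> U" and i: "mdim (base B) \<le> i"
    and a: "\<And>j. j \<le> l \<Longrightarrow> a j \<in> over B {p}"
  shows "\<psi> (fibre_sum B a l) i = (\<Sum>j\<le>l. \<psi> (a j) i)"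
  using a
proof (induction l)
  case (Suc l)
  have "fibre_sum B a l \<in> over B {p}" by (rule fibre_sum_over[OF B]) (use Suc.prems in auto)
  then show ?case using Suc fibre_ops_coord(1)[OF c p i, of "fibre_sum B a l" "a (Suc l)"] by simp
qed simp

abbreviation frame :: "('m, 'e) vbundle \<Rightarrow> 'm set \<Rightarrow> ('m \<Rightarrow> nat \<Rightarrow> real) \<Rightarrow> ('e \<Rightarrow> nat \<Rightarrow> real) \<Rightarrow> nat \<Rightarrow> 'm \<Rightarrow> 'e" where
  "frame B U x \<psi> j p \<equiv> vb_point B U x \<psi> p (\<lambda>i. if i = j then 1 else 0)"

lemma covector_expand:
  assumes B: "vector_bundle B" and c: "vb_chart B U x \<psi>" and p: "p \<in> U" and \<xi>: "\<xi> \<in> covectors B p"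
    and e: "e \<in> over B {p}"
  shows "\<xi> e = (\<Sum>i=mdim (base B)..<mdim (total B). \<psi> e i * \<xi> (frame B U x \<psi> i p))"
proof -
  let ?n = "mdim (base B)" and ?N = "mdim (total B)"
  note P = vb_point_props[OF B c p]
  have add: "\<xi> (vadd B a b) = \<xi> a + \<xi> b" if "a \<in> over B {p}" "b \<in> over B {p}" for a b
    using \<xi> that by (auto simp: covectors_def)
  have scale: "\<xi> (vscale B r a) = r * \<xi> a" if "a \<in> over B {p}" for a r
    using \<xi> that by (auto simp: covectors_def)
  \<comment> \<open>\<open>E m\<close> keeps the fibre coordinates of \<open>e\<close> with index
    below \<open>m\<close>. It leads from the zero vector (\<open>m = ?n\<close>) to
    \<open>e\<close> itself (\<open>m = ?N\<close>), adding one frame vector at a time.\<close>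
  define E where "E m = vb_point B U x \<psi> p (\<lambda>i. if i < m then \<psi> e i else 0)" for m
  have E: "E m \<in> over B {p}" for m unfolding E_def by (rule P(1))
  have "\<xi> (E (?n + m)) = (\<Sum>i=?n..<?n + m. \<psi> e i * \<xi> (frame B U x \<psi> i p))" if "?n + m \<le> ?N" for m
    using that
  proof (induction m)
    case 0
    \<comment> \<open>A bundle carries no named zero vector; being its own multiple by 0 identifies
      \<open>E ?n\<close> as one.\<close>
    have "E ?n = vscale B 0 (E ?n)"
      by (rule fibre_eqI[OF B c p E fibre_ops(2)[OF B E]]) (simp add: fibre_ops_coord(2)[OF c p _ E], simp add: E_def P(2))
    then have "\<xi> (E ?n) = 0 * \<xi> (E ?n)" using scale[OF E, of 0 ?n] by simp
    then show ?case by simp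
  next
    case (Suc m)
    let ?j = "?n + m"
    have f: "vscale B (\<psi> e ?j) (frame B U x \<psi> ?j p) \<in> over B {p}" by (rule fibre_ops(2)[OF B P(1)])
    have "E (Suc ?j) = vadd B (E ?j) (vscale B (\<psi> e ?j) (frame B U x \<psi> ?j p))"
    proof (rule fibre_eqI[OF B c p E fibre_ops(1)[OF B E f]])
      fix i assume i: "?n \<le> i" "i < ?N"
      show "\<psi> (E (Suc ?j)) i = \<psi> (vadd B (E ?j) (vscale B (\<psi> e ?j) (frame B U x \<psi> ?j p))) i"
        unfolding fibre_ops_coord(1)[OF c p i(1) E f] fibre_ops_coord(2)[OF c p i(1) P(1)]
        using i by (cases "i = ?j") (auto simp: E_def P(2) less_Suc_eq)
    qed
    then have "\<xi> (E (Suc ?j)) = \<xi> (E ?j) + \<psi> e ?j * \<xi> (frame B U x \<psi> ?j p)"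
      using add[OF E f] scale[OF P(1)] by simp
    then show ?case using Suc by simp
  qed
  from this[of "?N - ?n"] have "\<xi> (E ?N) = (\<Sum>i=?n..<?N. \<psi> e i * \<xi> (frame B U x \<psi> i p))"
    using vector_bundleD(4)[OF B] by simp
  moreover have "E ?N = e"
    by (rule fibre_eqI[OF B c p E e]) (simp add: E_def P(2))
  ultimately show ?thesis by simp
qed

lemma dual_coords_frame:
  assumes "mdim (base B) \<le> j" "j < mdim (total B)"
  shows "dual_coords B U x \<psi> (p, \<xi>) j = \<xi> (frame B U x \<psi> j p)"
proof -
  have "(\<lambda>i. if i < mdim (base B) then x p i else if i = j then 1 else 0)
    = (\<lambda>i. if i < mdim (base B) then x p i else if i < mdim (total B) then if i = j then 1 else 0 else 0)"
    using assms by (auto simp: fun_eq_iff)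
  then show ?thesis using assms by (simp add: dual_coords_def vb_point_def)
qed

lemma smooth_near_vb_point:
  assumes B: "vector_bundle B" and c: "vb_chart B U x \<psi>" and S: "open S" "0 \<in> S"
    and \<gamma>: "\<And>t. t \<in> S \<Longrightarrow> \<gamma> t \<in> U" "\<And>i. i < mdim (base B) \<Longrightarrow> smooth_R S (\<lambda>t. x (\<gamma> t) i)"
    and w: "\<And>i. i < mdim (total B) \<Longrightarrow> smooth_R S (\<lambda>t. w t i)"
  shows "smooth_near line 0 (total B) (\<lambda>t. vb_point B U x \<psi> (\<gamma> t) (w t))"
proof -
  note d = vb_chartD[OF c] and P = vb_point_props[OF B c]
  have o: "vb_point B U x \<psi> (\<gamma> t) (w t) \<in> over B U" if "t \<in> S" for t
    using P(1)[OF \<gamma>(1)[OF that]] \<gamma>(1)[OF that] over_subset[of "{\<gamma> t}" U B] by blast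
  have "smooth_R S (\<lambda>t. \<psi> (vb_point B U x \<psi> (\<gamma> t) (w t)) i)" if i: "i < mdim (total B)" for i
  proof (rule smooth_R_cong[OF S(1)])
    show "smooth_R S (\<lambda>t. if i < mdim (base B) then x (\<gamma> t) i else w t i)"
      using \<gamma>(2)[of i] w[OF i] by (cases "i < mdim (base B)") simp_all
    show "(if i < mdim (base B) then x (\<gamma> t) i else w t i) = \<psi> (vb_point B U x \<psi> (\<gamma> t) (w t)) i" if "t \<in> S" for t
      using P(2)[OF \<gamma>(1)[OF that], of "w t"] i by simp
  qed
  then show ?thesis
    using o S
    by (subst smooth_near_line_iff[of "total B" "over B U" \<psi> "\<lambda>t. vb_point B U x \<psi> (\<gamma> t) (w t)", OF vector_bundleD(1)[OF B] d(2) o[OF S(2)]])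
      (intro exI[of _ S], auto)
qed

text \<open>The coordinates of \<open>\<zeta>\<close> in the given chart are obtained from those in the chart supplied by
  smoothness by expanding the frame vectors.\<close>

lemma dual_curve_coord:
  assumes B: "vector_bundle B" and c: "vb_chart B U x \<psi>" and \<gamma>: "smooth_near line 0 (base B) \<gamma>" "\<gamma> 0 \<in> U"
    and \<zeta>: "smooth_near line 0 (dual_mfd B) \<zeta>" "\<forall>\<^sub>F t in nhds 0. fst (\<zeta> t) = \<gamma> t"
  obtains S where "open S" "0 \<in> S" "\<And>t. t \<in> S \<Longrightarrow> \<gamma> t \<in> U"
    "\<And>t. t \<in> S \<Longrightarrow> snd (\<zeta> t) \<in> covectors B (\<gamma> t)"
    "\<And>j. mdim (base B) \<le> j \<Longrightarrow> j < mdim (total B) \<Longrightarrow> smooth_R S (\<lambda>t. snd (\<zeta> t) (frame B U x \<psi> j (\<gamma> t)))"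
proof -
  let ?n = "mdim (base B)" and ?N = "mdim (total B)"
  note d = vb_chartD[OF c] and bb = vector_bundleD[OF B]
  obtain V \<eta> S1 where S1: "(V, \<eta>) \<in> atlas (dual_mfd B)" "open S1" "0 \<in> S1" "\<zeta> ` S1 \<subseteq> V"
     "\<forall>j<mdim (dual_mfd B). smooth_R S1 (\<lambda>t. \<eta> (\<zeta> t) j)"
    by (rule smooth_near_line_chartE[OF \<zeta>(1)])
  obtain U' x' \<psi>' where c': "vb_chart B U' x' \<psi>'" and V: "V = {(p, \<xi>). p \<in> U' \<and> \<xi> \<in> covectors B p}"
    and \<eta>: "\<eta> = dual_coords B U' x' \<psi>'"
    using S1(1) by (auto simp: dual_mfd_def)
  note d' = vb_chartD[OF c']
  obtain S2 where S2: "open S2" "0 \<in> S2" "\<And>t. t \<in> S2 \<Longrightarrow> fst (\<zeta> t) = \<gamma> t" using \<zeta>(2) unfolding eventually_nhds by metis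
  obtain S3 where S3: "open S3" "0 \<in> S3" "\<gamma> ` S3 \<subseteq> U" "\<And>i. i<?n \<Longrightarrow> smooth_R S3 (\<lambda>t. x (\<gamma> t) i)"
    using \<gamma> smooth_near_line_iff[of "base B" U x \<gamma>, OF bb(2) d(1)] by metis
  define F where "F j t = frame B U x \<psi> j (\<gamma> t)" for j t
  have zV: "\<zeta> t \<in> V" if "t \<in> S1" for t using S1(4) that by auto
  have \<gamma>U': "\<gamma> t \<in> U' \<and> snd (\<zeta> t) \<in> covectors B (\<gamma> t)" if "t \<in> S1" "t \<in> S2" for t
    using zV[OF that(1)] S2(3)[OF that(2)] by (auto simp: V)
  have Fsm: "smooth_near line 0 (total B) (F j)" for j
    unfolding F_def by (rule smooth_near_vb_point[OF B c S3(1,2)]) (use S3 smooth_R_const in auto)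
  have Fo: "F j t \<in> over B {\<gamma> t}" if "t \<in> S3" for j t
    unfolding F_def by (rule vb_point_props(1)[OF B c]) (use S3(3) that in auto)
  have F0: "F j 0 \<in> over B U'" for j
    using Fo[OF S3(2), of j] \<gamma>U'[OF S1(3) S2(2)] by (simp add: over_iff)
  have "\<exists>S. open S \<and> 0 \<in> S \<and> (\<forall>i<?N. smooth_R S (\<lambda>t. \<psi>' (F j t) i))" for j
    using Fsm[of j] smooth_near_line_iff[of "total B" "over B U'" \<psi>' "F j", OF bb(1) d'(2) F0] by metis
  then obtain T where T: "\<And>j. open (T j)" "\<And>j. 0 \<in> T j" "\<And>j i. i < ?N \<Longrightarrow> smooth_R (T j) (\<lambda>t. \<psi>' (F j t) i)" by metis
  define S where "S = S1 \<inter> S2 \<inter> S3 \<inter> (\<Inter>j\<in>{..<?N}. T j)"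
  have S: "open S" "0 \<in> S" using S1(2,3) S2(1,2) S3(1,2) T(1,2) by (auto simp: S_def)
  show thesis
  proof (rule that[OF S])
    show "\<gamma> t \<in> U" if "t \<in> S" for t using S3(3) that by (auto simp: S_def)
    show "snd (\<zeta> t) \<in> covectors B (\<gamma> t)" if "t \<in> S" for t using \<gamma>U' that by (auto simp: S_def)
    fix j assume j: "?n \<le> j" "j < ?N"
    show "smooth_R S (\<lambda>t. snd (\<zeta> t) (frame B U x \<psi> j (\<gamma> t)))"
    proof (rule smooth_R_cong[OF S(1)])
      show "smooth_R S (\<lambda>t. \<Sum>i=?n..<?N. \<psi>' (F j t) i * \<eta> (\<zeta> t) i)"
      proof (intro smooth_R_sum smooth_R_mult S(1))
        fix i assume i: "i \<in> {?n..<?N}"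
        show "smooth_R S (\<lambda>t. \<psi>' (F j t) i)"
          by (rule smooth_R_subset[OF T(3)[of i j]]) (use i j in \<open>auto simp: S_def\<close>)
        show "smooth_R S (\<lambda>t. \<eta> (\<zeta> t) i)"
          by (rule smooth_R_subset[OF S1(5)[rule_format, of i]]) (use i in \<open>auto simp: S_def dual_mfd_def\<close>)
      qed simp
      fix t assume t: "t \<in> S"
      then have tt: "t \<in> S1" "t \<in> S2" "t \<in> S3" by (auto simp: S_def)
      have \<zeta>t: "\<zeta> t = (\<gamma> t, snd (\<zeta> t))" using S2(3)[OF tt(2)] by (simp add: prod_eq_iff)
      have "snd (\<zeta> t) (F j t) = (\<Sum>i=?n..<?N. \<psi>' (F j t) i * snd (\<zeta> t) (frame B U' x' \<psi>' i (\<gamma> t)))"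
        using \<gamma>U'[OF tt(1,2)] by (intro covector_expand[OF B c' _ _ Fo[OF tt(3)]]) auto
      also have "\<dots> = (\<Sum>i=?n..<?N. \<psi>' (F j t) i * \<eta> (\<zeta> t) i)"
        by (intro sum.cong refl arg_cong2[where f = times]) (subst \<zeta>t, simp add: \<eta> dual_coords_frame)
      finally show "(\<Sum>i=?n..<?N. \<psi>' (F j t) i * \<eta> (\<zeta> t) i) = snd (\<zeta> t) (frame B U x \<psi> j (\<gamma> t))"
        by (simp add: F_def)
    qed
  qed
qed

subsection \<open>The canonical morphisms in coordinates\<close>

lemma smooth_R_slice_deriv:
  assumes W: "openin (Euclidean_space 2) W" and e: "\<And>s. s \<in> S \<Longrightarrow> plane_coord (s, 0) \<in> W"
    and S: "open S" and y: "Cinf_on 2 W y"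
  shows "smooth_R S (\<lambda>s. (deriv ^^ q) (\<lambda>t. y (plane_coord (s, t))) 0)"
proof (rule smooth_R_cong[OF S])
  have d2: "Suc 0 < 2" "0 < (2::nat)" by auto
  show "smooth_R S (\<lambda>s. (pd (Suc 0) ^^ q) y (plane_coord (s, 0)))"
    using smooth_R_slice[OF W d2(2) Cinf_on_pd_funpow[OF W d2(1) y], of S "plane_coord (0, 0)" q] e by simp
  show "(pd (Suc 0) ^^ q) y (plane_coord (s, 0)) = (deriv ^^ q) (\<lambda>t. y (plane_coord (s, t))) 0" if "s \<in> S" for s
    using Cinf_on_slice[OF W d2(1) y, of "plane_coord (s, 0)" 0 q] e[OF that] by simp
qed

lemma double_deriv_sum:
  assumes W: "openin (Euclidean_space 2) W" and e: "e > 0" "\<And>s t. \<bar>s\<bar> < e \<Longrightarrow> \<bar>t\<bar> < e \<Longrightarrow> plane_coord (s, t) \<in> W"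
    and I: "finite I" and g: "\<And>i. i \<in> I \<Longrightarrow> Cinf_on 2 W (g i)"
  shows "(deriv ^^ a) (\<lambda>s. (deriv ^^ b) (\<lambda>t. \<Sum>i\<in>I. g i (plane_coord (s, t))) 0) 0
    = (\<Sum>i\<in>I. (deriv ^^ a) (\<lambda>s. (deriv ^^ b) (\<lambda>t. g i (plane_coord (s, t))) 0) 0)"
proof -
  have d2: "Suc 0 < 2" "0 < (2::nat)" by auto
  define S where "S = {-e<..<e}"
  have S: "open S" "0 \<in> S" using e(1) by (auto simp: S_def)
  have inW: "plane_coord (s, t) \<in> W" if "s \<in> S" "t \<in> S" for s t
    using that by (intro e(2)) (auto simp: S_def)
  have inner: "(deriv ^^ b) (\<lambda>t. \<Sum>i\<in>I. g i (plane_coord (s, t))) 0 = (\<Sum>i\<in>I. (deriv ^^ b) (\<lambda>t. g i (plane_coord (s, t))) 0)"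
    if s: "s \<in> S" for s
  proof (rule higher_deriv_sum[OF I S(1) _ S(2)])
    fix i assume "i \<in> I"
    from smooth_R_slice[OF W d2(1) g[OF this], of S "plane_coord (s, 0)"]
    show "smooth_R S (\<lambda>t. g i (plane_coord (s, t)))" using inW[OF s] by simp
  qed
  have "(deriv ^^ a) (\<lambda>s. (deriv ^^ b) (\<lambda>t. \<Sum>i\<in>I. g i (plane_coord (s, t))) 0) 0
    = (deriv ^^ a) (\<lambda>s. \<Sum>i\<in>I. (deriv ^^ b) (\<lambda>t. g i (plane_coord (s, t))) 0) 0"
    by (rule higher_deriv_cong_ev[OF eventually_mono[OF eventually_nhds_in_open[OF S]] refl]) (rule inner)
  also have "\<dots> = (\<Sum>i\<in>I. (deriv ^^ a) (\<lambda>s. (deriv ^^ b) (\<lambda>t. g i (plane_coord (s, t))) 0) 0)"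
    by (rule higher_deriv_sum[OF I S(1) _ S(2)]) (rule smooth_R_slice_deriv[OF W inW[OF _ S(2)] S(1) g])
  finally show ?thesis .
qed

lemma Cinf_on_sum_arg:
  assumes W: "openin (Euclidean_space 2) W" and S: "open S" and z: "smooth_R S z"
    and WS: "\<And>w. w \<in> W \<Longrightarrow> w 0 + w (Suc 0) \<in> S"
  shows "Cinf_on 2 W (\<lambda>w. z (w 0 + w (Suc 0)))"
proof -
  have oS: "openin (Euclidean_space (Suc 0)) (line_coord ` S)" using S by (simp add: openin_line_coord_image)
  have "Cinf_on 2 W (\<lambda>w. z (line_coord (w 0 + w (Suc 0)) 0))"
  proof (rule Cinf_on_compose[OF W oS _ _ Cinf_on_smooth_R[OF S z], where a = "\<lambda>w. line_coord (w 0 + w (Suc 0))"])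
    show "Cinf_on 2 W (\<lambda>w. line_coord (w 0 + w (Suc 0)) l)" if "l < Suc 0" for l
      using that by (simp add: Cinf_on_add Cinf_on_coord)
  qed (use WS in auto)
  then show ?thesis by simp
qed

lemma plane_nhd:
  assumes W: "openin (Euclidean_space 2) W" "plane_coord (0, 0) \<in> W"
  obtains e where "e > 0" "\<And>s t. \<bar>s\<bar> < e \<Longrightarrow> \<bar>t\<bar> < e \<Longrightarrow> plane_coord (s, t) \<in> W"
proof -
  obtain e where e: "e > 0" and eW: "\<forall>y\<in>topspace (Euclidean_space 2). (\<forall>i<2. \<bar>y i - plane_coord (0, 0) i\<bar> < e) \<longrightarrow> y \<in> W"
    using openin_Euclidean_space_boxD[OF W] by (elim exE conjE) (rule that)
  show thesis
  proof (rule that[OF e])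
    fix s t :: real assume "\<bar>s\<bar> < e" "\<bar>t\<bar> < e"
    show "plane_coord (s, t) \<in> W"
    proof (rule eW[rule_format])
      fix i :: nat assume "i < 2"
      then have "i = 0 \<or> i = Suc 0" by auto
      then show "\<bar>plane_coord (s, t) i - plane_coord (0, 0) i\<bar> < e" using \<open>\<bar>s\<bar> < e\<close> \<open>\<bar>t\<bar> < e\<close> by auto
    qed simp
  qed
qed

lemma eventually_nhds_00:
  fixes P :: "real \<Rightarrow> real \<Rightarrow> bool"
  assumes "\<forall>\<^sub>F (s, t) in nhds (0, 0). P s t"
  obtains e where "e > 0" "\<And>s t. \<bar>s\<bar> < e \<Longrightarrow> \<bar>t\<bar> < e \<Longrightarrow> P s t"
proof -
  obtain Q where Q: "open Q" "(0, 0) \<in> Q" "\<And>s t. (s, t) \<in> Q \<Longrightarrow> P s t"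
    using assms unfolding eventually_nhds by auto
  obtain A C where AC: "open A" "open C" "(0, 0) \<in> A \<times> C" "A \<times> C \<subseteq> Q"
    using open_prod_elim[OF Q(1,2)] by metis
  obtain d where d: "d > 0" "\<And>s. \<bar>s\<bar> < d \<Longrightarrow> s \<in> A"
    using AC(1,3) unfolding open_dist by (auto simp: dist_real_def)
  obtain d' where d': "d' > 0" "\<And>s. \<bar>s\<bar> < d' \<Longrightarrow> s \<in> C"
    using AC(2,3) unfolding open_dist by (auto simp: dist_real_def)
  show thesis
  proof (rule that[of "min d d'"])
    fix s t assume "\<bar>s\<bar> < min d d'" "\<bar>t\<bar> < min d d'"
    then have "(s, t) \<in> A \<times> C" using d(2)[of s] d'(2)[of t] by simp
    then show "P s t" using AC(4) Q(3) by blast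
  qed (use d d' in simp)
qed

text \<open>In coordinates the pairing is a sum over i of y_i(s, t) z_i(s + t), where y_i are the
  fibre coordinates of \<open>\<phi> j\<close> and z_i the components of \<open>\<zeta>\<close>.
  After the mixed derivative, the alternating sum over \<open>j\<close> cancels every term that
  contains a derivative of z_i. The value thus depends on \<open>\<zeta>\<close> only through
  \<open>\<zeta> 0\<close>, which is the independence of the choice of lift.\<close>

lemma lifted_pairing_coord:
  assumes B: "vector_bundle B" and \<Phi>: "\<Phi> \<in> semihol_set l B" and c: "vb_chart B U x \<psi>"
    and \<gamma>: "smooth_near line 0 (base B) \<gamma>" "\<gamma> 0 \<in> U" "vproj B (vv_base \<Phi>) = \<gamma> 0"
    and \<phi>: "\<And>j. j \<le> l \<Longrightarrow> smooth_near plane (0, 0) (total B) (\<phi> j)"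
      "\<And>j. j \<le> l \<Longrightarrow> vel2 j (l - j) (total B) (\<phi> j) = trunc2 j (l - j) (total B) \<Phi>"
      "\<And>j. j \<le> l \<Longrightarrow> \<forall>\<^sub>F (s, t) in nhds (0, 0). vproj B (\<phi> j (s, t)) = \<gamma> (s + t)"
    and \<zeta>: "smooth_near line 0 (dual_mfd B) \<zeta>" "\<forall>\<^sub>F t in nhds 0. fst (\<zeta> t) = \<gamma> t"
  shows "snd (\<zeta> 0) \<in> covectors B (\<gamma> 0)"
    and "lifted_pairing l (\<lambda>s. fibre_sum B (\<lambda>j. vscale B ((-1) ^ j * real (l choose j)) (incl2 l j (\<phi> j) s)) l) (incl1 l \<zeta>)
      = (\<Sum>i=mdim (base B)..<mdim (total B). (\<Sum>j\<le>l. (-1) ^ j * real (l choose j) * vv_coord \<psi> \<Phi> i j (l - j)) *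
          snd (\<zeta> 0) (frame B U x \<psi> i (\<gamma> 0)))"
proof -
  let ?n = "mdim (base B)" and ?N = "mdim (total B)" and ?I = "{mdim (base B)..<mdim (total B)}"
  note d = vb_chartD[OF c] and bb = vector_bundleD[OF B] and \<Phi>p = semihol_setD(1)[OF B \<Phi>]
  obtain S where S: "open S" "0 \<in> S" "\<And>t. t \<in> S \<Longrightarrow> \<gamma> t \<in> U"
    "\<And>t. t \<in> S \<Longrightarrow> snd (\<zeta> t) \<in> covectors B (\<gamma> t)"
    "\<And>j. ?n \<le> j \<Longrightarrow> j < ?N \<Longrightarrow> smooth_R S (\<lambda>t. snd (\<zeta> t) (frame B U x \<psi> j (\<gamma> t)))"
    by (rule dual_curve_coord[OF B c \<gamma>(1,2) \<zeta>]) (rule that)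
  show "snd (\<zeta> 0) \<in> covectors B (\<gamma> 0)" by (rule S(4)[OF S(2)])
  define z where "z i t = snd (\<zeta> t) (frame B U x \<psi> i (\<gamma> t))" for i t
  have zsm: "smooth_R S (z i)" if "i \<in> ?I" for i unfolding z_def by (rule S(5)) (use that in auto)
  have \<phi>0: "\<phi> j (0, 0) \<in> over B U" if "j \<le> l" for j
    using eventually_nhds_x_imp_x[OF \<phi>(3)[OF that]] smooth_near_pts[OF \<phi>(1)[OF that]] \<gamma>(2) by (simp add: over_iff)
  have "\<exists>e>0. \<forall>s t. \<bar>s\<bar> < e \<longrightarrow> \<bar>t\<bar> < e \<longrightarrow> vproj B (\<phi> j (s, t)) = \<gamma> (s + t)" if "j \<le> l" for j
    using eventually_nhds_00[OF \<phi>(3)[OF that]] by metis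
  then obtain e1 where e1: "\<And>j. j \<le> l \<Longrightarrow> e1 j > 0"
     "\<And>j s t. j \<le> l \<Longrightarrow> \<bar>s\<bar> < e1 j \<Longrightarrow> \<bar>t\<bar> < e1 j \<Longrightarrow> vproj B (\<phi> j (s, t)) = \<gamma> (s + t)" by metis
  have "\<exists>W. openin (Euclidean_space 2) W \<and> plane_coord (0, 0) \<in> W \<and>
      (\<forall>z\<in>W. \<phi> j (z 0, z (Suc 0)) \<in> over B U) \<and> (\<forall>i<?N. Cinf_on 2 W (\<lambda>z. \<psi> (\<phi> j (z 0, z (Suc 0))) i))" if "j \<le> l" for j
    using smooth_near_plane_iff[of "total B" "over B U" \<psi> "\<phi> j", OF bb(1) d(2) \<phi>0[OF that]] \<phi>(1)[OF that] by simp
  then have "\<forall>j. \<exists>W. j \<le> l \<longrightarrow> openin (Euclidean_space 2) W \<and> plane_coord (0, 0) \<in> W \<and>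
      (\<forall>z\<in>W. \<phi> j (z 0, z (Suc 0)) \<in> over B U) \<and> (\<forall>i<?N. Cinf_on 2 W (\<lambda>z. \<psi> (\<phi> j (z 0, z (Suc 0))) i))" by blast
  from choice[OF this] obtain W where W: "\<And>j. j \<le> l \<Longrightarrow> openin (Euclidean_space 2) (W j)" "\<And>j. j \<le> l \<Longrightarrow> plane_coord (0, 0) \<in> W j"
      "\<And>j z. j \<le> l \<Longrightarrow> z \<in> W j \<Longrightarrow> \<phi> j (z 0, z (Suc 0)) \<in> over B U"
      "\<And>j i. j \<le> l \<Longrightarrow> i < ?N \<Longrightarrow> Cinf_on 2 (W j) (\<lambda>z. \<psi> (\<phi> j (z 0, z (Suc 0))) i)" by auto
  have "\<exists>e>0. \<forall>s t. \<bar>s\<bar> < e \<longrightarrow> \<bar>t\<bar> < e \<longrightarrow> plane_coord (s, t) \<in> W j" if "j \<le> l" for j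
    using plane_nhd[OF W(1,2)[OF that]] by metis
  then obtain e2 where e2: "\<And>j. j \<le> l \<Longrightarrow> e2 j > 0"
     "\<And>j s t. j \<le> l \<Longrightarrow> \<bar>s\<bar> < e2 j \<Longrightarrow> \<bar>t\<bar> < e2 j \<Longrightarrow> plane_coord (s, t) \<in> W j" by metis
  obtain e3 where e3: "e3 > 0" "\<And>t. \<bar>t\<bar> < e3 \<Longrightarrow> t \<in> S"
    using S(1,2) unfolding open_dist by (auto simp: dist_real_def)
  \<comment> \<open>One radius for all \<open>j\<close>. Half of \<open>e3\<close> is taken because
    \<open>\<zeta>\<close> is evaluated at the sum of two arguments, each smaller than
    \<open>e\<close>.\<close>
  define e where "e = Min (insert (e3 / 2) (e1 ` {..l} \<union> e2 ` {..l}))"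
  have e: "e > 0" "2 * e \<le> e3" "\<And>j. j \<le> l \<Longrightarrow> e \<le> e1 j" "\<And>j. j \<le> l \<Longrightarrow> e \<le> e2 j"
  proof -
    have fin: "finite (insert (e3 / 2) (e1 ` {..l} \<union> e2 ` {..l}))" by simp
    show "e > 0" unfolding e_def using e1(1) e2(1) e3(1) by (subst Min_gr_iff[OF fin]) auto
    have "e \<le> e3 / 2" unfolding e_def by (rule Min_le[OF fin]) simp
    then show "2 * e \<le> e3" by simp
    show "e \<le> e1 j" "e \<le> e2 j" if "j \<le> l" for j unfolding e_def by (rule Min_le[OF fin]; use that in simp)+
  qed
  define V where "V = {w \<in> topspace (Euclidean_space 2). \<forall>i<2. \<bar>w i - 0\<bar> < e}"
  have oV: "openin (Euclidean_space 2) V" unfolding V_def by (rule openin_Euclidean_space_box)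
  have Vw: "\<bar>w 0\<bar> < e" "\<bar>w (Suc 0)\<bar> < e" "w = plane_coord (w 0, w (Suc 0))" if "w \<in> V" for w
    using that plane_coord_of[of w] by (auto simp: V_def)
  have pV: "plane_coord (s, t) \<in> V" if "\<bar>s\<bar> < e" "\<bar>t\<bar> < e" for s t
  proof -
    have "\<bar>plane_coord (s, t) i - 0\<bar> < e" if "i < 2" for i
    proof -
      have "i = 0 \<or> i = Suc 0" using that by auto
      then show ?thesis using \<open>\<bar>s\<bar> < e\<close> \<open>\<bar>t\<bar> < e\<close> by auto
    qed
    then show ?thesis by (simp add: V_def)
  qed
  have VW: "V \<subseteq> W j" if "j \<le> l" for j
  proof
    fix w assume w: "w \<in> V"
    have "plane_coord (w 0, w (Suc 0)) \<in> W j"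
      by (rule e2(2)[OF that]) (use Vw(1,2)[OF w] e(4)[OF that] in auto)
    then show "w \<in> W j" using Vw(3)[OF w] by simp
  qed
  have VS: "w 0 + w (Suc 0) \<in> S" if "w \<in> V" for w
    by (rule e3(2)) (use Vw(1,2)[OF that] e(2) in auto)
  define y where "y j i w = \<psi> (\<phi> j (w 0, w (Suc 0))) i" for j i and w :: "nat \<Rightarrow> real"
  have yC: "Cinf_on 2 V (y j i)" if "j \<le> l" "i \<in> ?I" for i j
    unfolding y_def by (rule Cinf_on_subset[OF W(4)[OF that(1)] VW[OF that(1)]]) (use that in auto)
  have zC: "Cinf_on 2 V (\<lambda>w. z i (w 0 + w (Suc 0)))" if "i \<in> ?I" for i
    by (rule Cinf_on_sum_arg[OF oV S(1) zsm[OF that] VS])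
  define f where "f j w = (\<Sum>i\<in>?I. y j i w * z i (w 0 + w (Suc 0)))" for j and w :: "nat \<Rightarrow> real"
  have fC: "Cinf_on 2 V (f j)" if "j \<le> l" for j
    unfolding f_def by (intro Cinf_on_sum Cinf_on_mult yC zC that) auto
  define G where "G s = pairing (fibre_sum B (\<lambda>j. vscale B ((-1) ^ j * real (l choose j)) (incl2 l j (\<phi> j) s)) l) (incl1 l \<zeta> s)" for s
  have G: "G s = (\<Sum>j\<le>l. ((-1) ^ j * real (l choose j)) * f j (plane_coord (\<Sum>i<j. s i, \<Sum>i=j..<l. s i)))"
    if s: "(\<Sum>i<l. \<bar>s i\<bar>) < e" for s
  proof -
    \<comment> \<open>For every \<open>j\<close> the two arguments of \<open>\<phi> j\<close> add up
      to \<open>\<tau>\<close>, so all summands lie in the fibre over \<open>\<gamma> \<tau>\<close>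
      and the fibrewise sum makes sense.\<close>
    define \<tau> where "\<tau> = (\<Sum>i<l. s i)"
    have "\<bar>\<tau>\<bar> \<le> (\<Sum>i<l. \<bar>s i\<bar>)" unfolding \<tau>_def by (rule sum_abs)
    then have \<tau>S: "\<tau> \<in> S" using s e(1,2) by (intro e3(2)) simp
    have b: "\<bar>\<Sum>i<j. s i\<bar> < e" "\<bar>\<Sum>i=j..<l. s i\<bar> < e" "(\<Sum>i<j. s i) + (\<Sum>i=j..<l. s i) = \<tau>" if j: "j \<le> l" for j
    proof -
      have "\<bar>\<Sum>i<j. s i\<bar> \<le> (\<Sum>i<j. \<bar>s i\<bar>)" by (rule sum_abs)
      also have "\<dots> \<le> (\<Sum>i<l. \<bar>s i\<bar>)" using j by (intro sum_mono2) auto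
      finally show "\<bar>\<Sum>i<j. s i\<bar> < e" using s by simp
      have "\<bar>\<Sum>i=j..<l. s i\<bar> \<le> (\<Sum>i=j..<l. \<bar>s i\<bar>)" by (rule sum_abs)
      also have "\<dots> \<le> (\<Sum>i<l. \<bar>s i\<bar>)" by (intro sum_mono2) auto
      finally show "\<bar>\<Sum>i=j..<l. s i\<bar> < e" using s by simp
      have "(\<Sum>i=0..<j. s i) + (\<Sum>i=j..<l. s i) = (\<Sum>i=0..<l. s i)"
        by (rule sum.atLeastLessThan_concat) (use j in auto)
      then show "(\<Sum>i<j. s i) + (\<Sum>i=j..<l. s i) = \<tau>" by (simp add: \<tau>_def atLeast0LessThan)
    qed
    have in_over: "incl2 l j (\<phi> j) s \<in> over B {\<gamma> \<tau>}" if j: "j \<le> l" for j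
    proof -
      have "vproj B (\<phi> j (\<Sum>i<j. s i, \<Sum>i=j..<l. s i)) = \<gamma> \<tau>"
        using e1(2)[OF j] b[OF j] e(3)[OF j] by (metis less_le_trans)
      moreover have "\<phi> j (\<Sum>i<j. s i, \<Sum>i=j..<l. s i) \<in> over B U"
        using W(3)[OF j, of "plane_coord (\<Sum>i<j. s i, \<Sum>i=j..<l. s i)"] VW[OF j] pV[OF b(1,2)[OF j]] by auto
      ultimately show ?thesis by (simp add: incl2_def over_iff)
    qed
    have \<gamma>U: "\<gamma> \<tau> \<in> U" by (rule S(3)[OF \<tau>S])
    have "G s = (\<Sum>i\<in>?I. \<psi> (fibre_sum B (\<lambda>j. vscale B ((-1) ^ j * real (l choose j)) (incl2 l j (\<phi> j) s)) l) i * z i \<tau>)"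
      unfolding G_def pairing_def incl1_def z_def \<tau>_def[symmetric]
      by (rule covector_expand[OF B c \<gamma>U S(4)[OF \<tau>S] fibre_sum_over[OF B fibre_ops(2)[OF B in_over]]])
    also have "\<dots> = (\<Sum>i\<in>?I. (\<Sum>j\<le>l. (-1) ^ j * real (l choose j) * y j i (plane_coord (\<Sum>i<j. s i, \<Sum>i=j..<l. s i))) * z i \<tau>)"
    proof (intro sum.cong refl arg_cong2[where f = times])
      fix i assume "i \<in> ?I"
      then have i: "?n \<le> i" by simp
      have "\<psi> (fibre_sum B (\<lambda>j. vscale B ((-1) ^ j * real (l choose j)) (incl2 l j (\<phi> j) s)) l) i
        = (\<Sum>j\<le>l. \<psi> (vscale B ((-1) ^ j * real (l choose j)) (incl2 l j (\<phi> j) s)) i)"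
        by (rule fibre_sum_coord[OF B c \<gamma>U i fibre_ops(2)[OF B in_over]])
      also have "\<dots> = (\<Sum>j\<le>l. (-1) ^ j * real (l choose j) * y j i (plane_coord (\<Sum>i<j. s i, \<Sum>i=j..<l. s i)))"
        by (rule sum.cong[OF refl], subst fibre_ops_coord(2)[OF c \<gamma>U i in_over]) (simp_all add: y_def incl2_def)
      finally show "\<psi> (fibre_sum B (\<lambda>j. vscale B ((-1) ^ j * real (l choose j)) (incl2 l j (\<phi> j) s)) l) i
        = (\<Sum>j\<le>l. (-1) ^ j * real (l choose j) * y j i (plane_coord (\<Sum>i<j. s i, \<Sum>i=j..<l. s i)))" .
    qed
    also have "\<dots> = (\<Sum>j\<le>l. \<Sum>i\<in>?I. (-1) ^ j * real (l choose j) * y j i (plane_coord (\<Sum>i<j. s i, \<Sum>i=j..<l. s i)) * z i \<tau>)"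
      by (subst sum.swap) (simp add: sum_distrib_right)
    also have "\<dots> = (\<Sum>j\<le>l. ((-1) ^ j * real (l choose j)) * f j (plane_coord (\<Sum>i<j. s i, \<Sum>i=j..<l. s i)))"
    proof (rule sum.cong[OF refl])
      fix j assume "j \<in> {..l}"
      then have "(\<Sum>i<j. s i) + (\<Sum>i=j..<l. s i) = \<tau>" using b(3) by simp
      then show "(\<Sum>i\<in>?I. (-1) ^ j * real (l choose j) * y j i (plane_coord (\<Sum>i<j. s i, \<Sum>i=j..<l. s i)) * z i \<tau>)
        = ((-1) ^ j * real (l choose j)) * f j (plane_coord (\<Sum>i<j. s i, \<Sum>i=j..<l. s i))"
        by (simp add: f_def sum_distrib_left mult.assoc)
    qed
    finally show ?thesis .
  qed
  \<comment> \<open>\<open>\<phi> j\<close> agrees with \<open>\<Phi>\<close> only up to order (j, l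
    - j); these are exactly the orders that occur in the Leibniz expansion for this
    \<open>j\<close>.\<close>
  have Ycoord: "(deriv ^^ p) (\<lambda>s. (deriv ^^ q) (\<lambda>t. y j i (plane_coord (s, t))) 0) 0 = vv_coord \<psi> \<Phi> i p q"
    if "j \<le> l" "i \<in> ?I" "p \<le> j" "q \<le> l - j" for i j p q
  proof -
    have i: "i < ?N" using that by simp
    have \<Phi>U: "vv_base \<Phi> \<in> over B U" using vv_base_pts[OF \<Phi>p] \<gamma>(2,3) by (simp add: over_iff)
    have "(deriv ^^ p) (\<lambda>s. (deriv ^^ q) (\<lambda>t. y j i (plane_coord (s, t))) 0) 0 = vv_coord \<psi> (vel2 j (l - j) (total B) (\<phi> j)) i p q"
      using vel2_props(3)[OF bb(1) \<phi>(1)[OF that(1)] d(2) \<phi>0[OF that(1)] i that(3,4)] by (simp add: y_def)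
    also have "\<dots> = vv_coord \<psi> \<Phi> i p q"
      unfolding \<phi>(2)[OF that(1)]
      by (rule trunc2_props(3)[OF bb(1) \<Phi>p that(1) _ d(2) \<Phi>U i that(3,4)]) simp
    finally show ?thesis .
  qed
  have z': "smooth_R {-e<..<e} (z i)" if "i \<in> ?I" for i
    by (rule smooth_R_subset[OF zsm[OF that]]) (use e(1,2) e3(2) in auto)
  have DD: "(deriv ^^ j) (\<lambda>s. (deriv ^^ (l - j)) (\<lambda>t. f j (plane_coord (s, t))) 0) 0
    = (\<Sum>i\<in>?I. \<Sum>p\<le>j. \<Sum>q\<le>l - j. real (j choose p) * real ((l - j) choose q) * vv_coord \<psi> \<Phi> i p q * (deriv ^^ (l - p - q)) (z i) 0)"
    if j: "j \<le> l" for j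
  proof -
    have "(deriv ^^ j) (\<lambda>s. (deriv ^^ (l - j)) (\<lambda>t. f j (plane_coord (s, t))) 0) 0
      = (\<Sum>i\<in>?I. (deriv ^^ j) (\<lambda>s. (deriv ^^ (l - j)) (\<lambda>t. y j i (plane_coord (s, t)) * z i (s + t)) 0) 0)"
      using double_deriv_sum[OF oV e(1) pV, of ?I "\<lambda>i w. y j i w * z i (w 0 + w (Suc 0))" j "l - j"] Cinf_on_mult[OF yC[OF j] zC]
      by (simp add: f_def)
    also have "\<dots> = (\<Sum>i\<in>?I. \<Sum>p\<le>j. \<Sum>q\<le>l - j. real (j choose p) * real ((l - j) choose q) * vv_coord \<psi> \<Phi> i p q * (deriv ^^ (l - p - q)) (z i) 0)"
    proof (rule sum.cong[OF refl])
      fix i assume i: "i \<in> ?I"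
      have jl: "j + (l - j) = l" using j by simp
      have "(deriv ^^ j) (\<lambda>s. (deriv ^^ (l - j)) (\<lambda>t. y j i (plane_coord (s, t)) * z i (s + t)) 0) 0
        = (\<Sum>p\<le>j. \<Sum>q\<le>l - j. real (j choose p) * real ((l - j) choose q) *
            (deriv ^^ p) (\<lambda>s. (deriv ^^ q) (\<lambda>t. y j i (plane_coord (s, t))) 0) 0 * (deriv ^^ (j + (l - j) - p - q)) (z i) 0)"
        by (rule leibniz_plane[OF oV e(1) pV yC[OF j i] z'[OF i]])
      also have "\<dots> = (\<Sum>p\<le>j. \<Sum>q\<le>l - j. real (j choose p) * real ((l - j) choose q) * vv_coord \<psi> \<Phi> i p q * (deriv ^^ (l - p - q)) (z i) 0)"
        by (intro sum.cong refl) (simp only: Ycoord[OF j i] jl atMost_iff)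
      finally show "(deriv ^^ j) (\<lambda>s. (deriv ^^ (l - j)) (\<lambda>t. y j i (plane_coord (s, t)) * z i (s + t)) 0) 0
        = (\<Sum>p\<le>j. \<Sum>q\<le>l - j. real (j choose p) * real ((l - j) choose q) * vv_coord \<psi> \<Phi> i p q * (deriv ^^ (l - p - q)) (z i) 0)" .
    qed
    finally show ?thesis .
  qed
  have "mixed_deriv l G (\<lambda>_. 0) = (\<Sum>j\<le>l. ((-1) ^ j * real (l choose j)) * (deriv ^^ j) (\<lambda>s. (deriv ^^ (l - j)) (\<lambda>t. f j (plane_coord (s, t))) 0) 0)"
    by (rule mixed_deriv_sum[OF oV e(1) pV fC G])
  also have "\<dots> = (\<Sum>j\<le>l. \<Sum>i\<in>?I. (-1) ^ j * real (l choose j) *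
      (\<Sum>p\<le>j. \<Sum>q\<le>l - j. real (j choose p) * real ((l - j) choose q) * vv_coord \<psi> \<Phi> i p q * (deriv ^^ (l - p - q)) (z i) 0))"
    by (intro sum.cong refl) (simp add: DD sum_distrib_left)
  also have "\<dots> = (\<Sum>i\<in>?I. \<Sum>j\<le>l. (-1) ^ j * real (l choose j) *
      (\<Sum>p\<le>j. \<Sum>q\<le>l - j. real (j choose p) * real ((l - j) choose q) * vv_coord \<psi> \<Phi> i p q * (deriv ^^ (l - p - q)) (z i) 0))"
    by (rule sum.swap)
  also have "\<dots> = (\<Sum>i\<in>?I. (deriv ^^ 0) (z i) 0 * (\<Sum>j\<le>l. (-1) ^ j * real (l choose j) * vv_coord \<psi> \<Phi> i j (l - j)))"
    by (rule sum.cong[OF refl]) (rule alternating_leibniz)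
  finally have m: "mixed_deriv l G (\<lambda>_. 0) = (\<Sum>i\<in>?I. (deriv ^^ 0) (z i) 0 * (\<Sum>j\<le>l. (-1) ^ j * real (l choose j) * vv_coord \<psi> \<Phi> i j (l - j)))" .
  have "lifted_pairing l (\<lambda>s. fibre_sum B (\<lambda>j. vscale B ((-1) ^ j * real (l choose j)) (incl2 l j (\<phi> j) s)) l) (incl1 l \<zeta>)
      = mixed_deriv l G (\<lambda>_. 0)"
    unfolding lifted_pairing_def G_def ..
  then show "lifted_pairing l (\<lambda>s. fibre_sum B (\<lambda>j. vscale B ((-1) ^ j * real (l choose j)) (incl2 l j (\<phi> j) s)) l) (incl1 l \<zeta>)
      = (\<Sum>i\<in>?I. (\<Sum>j\<le>l. (-1) ^ j * real (l choose j) * vv_coord \<psi> \<Phi> i j (l - j)) * snd (\<zeta> 0) (frame B U x \<psi> i (\<gamma> 0)))"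
    unfolding m by (simp add: z_def mult.commute)
qed

lemma smooth_near_plane_vb_point:
  assumes B: "vector_bundle B" and c: "vb_chart B U x \<psi>" and S: "open S" "0 \<in> S"
    and \<gamma>: "\<And>t. t \<in> S \<Longrightarrow> \<gamma> t \<in> U" "\<And>i. i < mdim (base B) \<Longrightarrow> smooth_R S (\<lambda>t. x (\<gamma> t) i)"
    and w: "\<And>i. i < mdim (total B) \<Longrightarrow> Cinf_on 2 (topspace (Euclidean_space 2)) (\<lambda>z. w (z 0, z (Suc 0)) i)"
  shows "smooth_near plane (0, 0) (total B) (\<lambda>(s, t). vb_point B U x \<psi> (\<gamma> (s + t)) (w (s, t)))"
proof -
  note d = vb_chartD[OF c] and P = vb_point_props[OF B c]
  define W where "W = {z \<in> topspace (Euclidean_space 2). line_coord (z 0 + z (Suc 0)) \<in> line_coord ` S}"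
  have oS: "openin (Euclidean_space (Suc 0)) (line_coord ` S)" using S(1) by (simp add: openin_line_coord_image)
  have oW: "openin (Euclidean_space 2) W"
    unfolding W_def
  proof (rule openin_Euclidean_space_vimage[OF openin_topspace oS])
    show "continuous_on (topspace (Euclidean_space 2)) (\<lambda>z. line_coord (z 0 + z (Suc 0)) i)" if "i < Suc 0" for i
      using that by (simp add: continuous_on_add continuous_on_coord)
  qed simp
  have WS: "z 0 + z (Suc 0) \<in> S" if "z \<in> W" for z using that by (auto simp: W_def)
  let ?f = "\<lambda>(s, t). vb_point B U x \<psi> (\<gamma> (s + t)) (w (s, t))"
  have f: "?f (z 0, z (Suc 0)) \<in> over B U" if "z \<in> W" for z
    using P(1)[OF \<gamma>(1)[OF WS[OF that]]] \<gamma>(1)[OF WS[OF that]] over_subset[of "{\<gamma> (z 0 + z (Suc 0))}" U B] by auto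
  have C: "Cinf_on 2 W (\<lambda>z. \<psi> (?f (z 0, z (Suc 0))) i)" if i: "i < mdim (total B)" for i
  proof (rule Cinf_on_eq[OF oW])
    show "Cinf_on 2 W (\<lambda>z. if i < mdim (base B) then x (\<gamma> (z 0 + z (Suc 0))) i else w (z 0, z (Suc 0)) i)"
    proof (cases "i < mdim (base B)")
      case True
      then show ?thesis using Cinf_on_sum_arg[OF oW S(1) \<gamma>(2)[OF True] WS] by simp
    next
      case False
      have "W \<subseteq> topspace (Euclidean_space 2)" by (auto simp: W_def)
      then show ?thesis using False Cinf_on_subset[OF w[OF i]] by simp
    qed
    show "(if i < mdim (base B) then x (\<gamma> (z 0 + z (Suc 0))) i else w (z 0, z (Suc 0)) i) = \<psi> (?f (z 0, z (Suc 0))) i"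
      if "z \<in> W" for z using P(2)[OF \<gamma>(1)[OF WS[OF that]]] i by simp
  qed
  have 0: "plane_coord (0, 0) \<in> W" using S(2) by (auto simp: W_def)
  have f0: "?f (0, 0) \<in> over B U" using f[OF 0] by simp
  show ?thesis
    unfolding smooth_near_plane_iff[of "total B" "over B U" \<psi> ?f, OF vector_bundleD(1)[OF B] d(2) f0]
    using oW 0 f C by (intro exI[of _ W] conjI ballI allI impI)
qed

text \<open>The fibre coordinate with index \<open>i\<close>, restricted to the fibres along
  \<open>\<gamma>\<close>, is a curve of covectors whose components in the dual chart are constant.
  These curves detect each fibre coordinate of \<open>Upsilon\<close>.\<close>

lemma coordinate_covector_curve:
  assumes B: "vector_bundle B" and c: "vb_chart B U x \<psi>" and S: "open S" "0 \<in> S"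
    and \<gamma>: "\<And>t. t \<in> S \<Longrightarrow> \<gamma> t \<in> U" "\<And>i. i < mdim (base B) \<Longrightarrow> smooth_R S (\<lambda>t. x (\<gamma> t) i)"
    and i: "mdim (base B) \<le> i" "i < mdim (total B)"
  shows "smooth_near line 0 (dual_mfd B) (\<lambda>t. (\<gamma> t, \<lambda>e. if e \<in> over B {\<gamma> t} then \<psi> e i else 0))"
proof -
  let ?\<zeta> = "\<lambda>t. (\<gamma> t, \<lambda>e. if e \<in> over B {\<gamma> t} then \<psi> e i else 0)"
  have cov: "(\<lambda>e. if e \<in> over B {p} then \<psi> e i else 0) \<in> covectors B p" if p: "p \<in> U" for p
    using fibre_ops[OF B] fibre_ops_coord[OF c p i(1)] by (auto simp: covectors_def)
  show ?thesis
  proof (rule smooth_near_line_chartI[OF _ S])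
    show "({(p, \<xi>). p \<in> U \<and> \<xi> \<in> covectors B p}, dual_coords B U x \<psi>) \<in> atlas (dual_mfd B)"
      using c by (auto simp: dual_mfd_def)
    show "?\<zeta> ` S \<subseteq> {(p, \<xi>). p \<in> U \<and> \<xi> \<in> covectors B p}" using cov \<gamma>(1) by auto
    fix j assume "j < mdim (dual_mfd B)"
    then have j: "j < mdim (total B)" by (simp add: dual_mfd_def)
    show "smooth_R S (\<lambda>t. dual_coords B U x \<psi> (?\<zeta> t) j)"
    proof (cases "j < mdim (base B)")
      case True
      then show ?thesis using \<gamma>(2)[OF True] by (simp add: dual_coords_def)
    next
      case False
      then have j': "mdim (base B) \<le> j" by simp
      show ?thesis
      proof (rule smooth_R_cong[OF S(1) _ smooth_R_const])
        fix t assume "t \<in> S"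
        then have t: "\<gamma> t \<in> U" by (rule \<gamma>(1))
        show "(if i = j then 1 else 0) = dual_coords B U x \<psi> (?\<zeta> t) j"
          unfolding dual_coords_frame[OF j' j] using vb_point_props[OF B c t] i by simp
      qed
    qed
  qed
qed

text \<open>The definite description is resolved in two steps. \<open>ok\<close>: the vector
  \<open>e0\<close> with the asserted coordinates satisfies the condition for all admissible data.
  \<open>ex\<close>: for each fibre coordinate there are admissible data whose covector reads that
  coordinate, so the condition is not vacuous and has no other solution.\<close>

lemma Upsilon_coord:
  assumes B: "vector_bundle B" and \<Phi>: "\<Phi> \<in> semihol_set l B" and c: "vb_chart B U x \<psi>"
    and U: "rep (semihol_proj l B \<Phi>) 0 \<in> U"
  shows "Upsilon l B \<Phi> \<in> over B {rep (semihol_proj l B \<Phi>) 0}"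
    and "\<And>i. mdim (base B) \<le> i \<Longrightarrow> i < mdim (total B) \<Longrightarrow>
      \<psi> (Upsilon l B \<Phi>) i = (\<Sum>j\<le>l. (-1) ^ j * real (l choose j) * vv_coord \<psi> \<Phi> i j (l - j))"
proof -
  let ?n = "mdim (base B)" and ?N = "mdim (total B)" and ?M = "base B"
  define v where "v = semihol_proj l B \<Phi>"
  define p where "p = rep v 0"
  note d = vb_chartD[OF c] and bb = vector_bundleD[OF B] and sD = semihol_setD[OF B \<Phi>]
  have pU: "p \<in> U" using U by (simp add: p_def v_def)
  have vpts: "v \<in> T_dom (2 * l) ?M (pts ?M)" using sD(2) by (simp add: v_def pts_T_mfd)
  note rv = T_dom_rep[OF vpts]
  have base: "vproj B (vv_base \<Phi>) = p" using sD(3) by (simp add: p_def v_def)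
  have \<gamma>v: "smooth_near line 0 ?M \<gamma>" "\<gamma> 0 = p" if "\<gamma> \<in> v" for \<gamma>
    using that rv(3)[OF bb(2)] vel_memD[of \<gamma> "2 * l" ?M "rep v"] by (auto simp: p_def)
  define Y where "Y i = (\<Sum>j\<le>l. (-1) ^ j * real (l choose j) * vv_coord \<psi> \<Phi> i j (l - j))" for i
  define e0 where "e0 = vb_point B U x \<psi> p Y"
  have e0: "e0 \<in> over B {p}" "\<And>i. ?n \<le> i \<Longrightarrow> i < ?N \<Longrightarrow> \<psi> e0 i = Y i"
    using vb_point_props[OF B c pU] by (simp_all add: e0_def)
  define valid where "valid \<gamma> \<phi> \<zeta> \<longleftrightarrow> \<gamma> \<in> v \<and>
        (\<forall>j\<le>l. smooth_near plane (0, 0) (total B) (\<phi> j) \<and>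
           vel2 j (l - j) (total B) (\<phi> j) = trunc2 j (l - j) (total B) \<Phi> \<and>
           (\<forall>\<^sub>F (s, t) in nhds (0, 0). vproj B (\<phi> j (s, t)) = \<gamma> (s + t))) \<and>
        smooth_near line 0 (dual_mfd B) \<zeta> \<and> (\<forall>\<^sub>F t in nhds 0. fst (\<zeta> t) = \<gamma> t)" for \<gamma> \<phi> \<zeta>
  let ?LP = "\<lambda>\<phi> \<zeta>. lifted_pairing l
            (\<lambda>s. fibre_sum B (\<lambda>j. vscale B ((-1) ^ j * real (l choose j)) (incl2 l j (\<phi> j) s)) l)
            (incl1 l \<zeta>)"
  have ok: "pairing e0 (\<zeta> 0) = ?LP \<phi> \<zeta>" if v: "valid \<gamma> \<phi> \<zeta>" for \<gamma> \<phi> \<zeta>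
  proof -
    have \<gamma>: "\<gamma> \<in> v" and \<phi>: "\<And>j. j \<le> l \<Longrightarrow> smooth_near plane (0, 0) (total B) (\<phi> j)"
      "\<And>j. j \<le> l \<Longrightarrow> vel2 j (l - j) (total B) (\<phi> j) = trunc2 j (l - j) (total B) \<Phi>"
      "\<And>j. j \<le> l \<Longrightarrow> \<forall>\<^sub>F (s, t) in nhds (0, 0). vproj B (\<phi> j (s, t)) = \<gamma> (s + t)"
      and \<zeta>: "smooth_near line 0 (dual_mfd B) \<zeta>" "\<forall>\<^sub>F t in nhds 0. fst (\<zeta> t) = \<gamma> t"
      using v unfolding valid_def by blast+
    have \<gamma>U: "\<gamma> 0 \<in> U" "vproj B (vv_base \<Phi>) = \<gamma> 0" using \<gamma>v(2)[OF \<gamma>] pU base by simp_all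
    note L = lifted_pairing_coord[OF B \<Phi> c \<gamma>v(1)[OF \<gamma>] \<gamma>U \<phi> \<zeta>]
    have "pairing e0 (\<zeta> 0) = (\<Sum>i=?n..<?N. \<psi> e0 i * snd (\<zeta> 0) (frame B U x \<psi> i p))"
      unfolding pairing_def using L(1) \<gamma>v(2)[OF \<gamma>] by (intro covector_expand[OF B c pU _ e0(1)]) simp
    also have "\<dots> = (\<Sum>i=?n..<?N. Y i * snd (\<zeta> 0) (frame B U x \<psi> i (\<gamma> 0)))"
      by (intro sum.cong refl) (simp add: e0(2) \<gamma>v(2)[OF \<gamma>])
    finally show ?thesis using L(2) by (simp add: Y_def)
  qed
  have ex: "\<exists>\<gamma> \<phi> \<zeta>. valid \<gamma> \<phi> \<zeta> \<and> (\<forall>e\<in>over B {p}. pairing e (\<zeta> 0) = \<psi> e i0)" if i0: "?n \<le> i0" "i0 < ?N" for i0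
  proof -
    define \<gamma> where "\<gamma> = rep v"
    have \<gamma>in: "\<gamma> \<in> v" unfolding \<gamma>_def using rv(3)[OF bb(2)] vel_self[OF rv(1), of "2 * l"] by simp
    have \<gamma>0: "\<gamma> 0 = p" by (rule \<gamma>v(2)[OF \<gamma>in])
    have \<gamma>U: "\<gamma> 0 \<in> U" using \<gamma>0 pU by simp
    obtain S where S: "open S" "0 \<in> S" "\<gamma> ` S \<subseteq> U" "\<And>i. i<?n \<Longrightarrow> smooth_R S (\<lambda>t. x (\<gamma> t) i)"
      using \<gamma>v(1)[OF \<gamma>in] smooth_near_line_iff[of ?M U x \<gamma>, OF bb(2) d(1) \<gamma>U] by metis
    have SU: "\<gamma> t \<in> U" if "t \<in> S" for t using S(3) that by auto
    \<comment> \<open>The polynomial of order \<open>j\<close> in \<open>s\<close> and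
      \<open>l - j\<close> in \<open>t\<close> with the derivatives at the origin prescribed by
      \<open>\<Phi>\<close>; \<open>Suc\<close> because \<open>taylor\<close> counts terms.\<close>
    define w where "w j = (\<lambda>(s, t) i. taylor (Suc (l - j)) (\<lambda>q. taylor (Suc j) (\<lambda>p. vv_coord \<psi> \<Phi> i p q) s) t)" for j
    define \<phi> where "\<phi> j = (\<lambda>(s, t). vb_point B U x \<psi> (\<gamma> (s + t)) (w j (s, t)))" for j
    define \<zeta> where "\<zeta> = (\<lambda>t. (\<gamma> t, \<lambda>e. if e \<in> over B {\<gamma> t} then \<psi> e i0 else 0))"
    have wC: "Cinf_on 2 (topspace (Euclidean_space 2)) (\<lambda>z. w j (z 0, z (Suc 0)) i)" for i j
      unfolding w_def taylor_def prod.case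
      by (intro Cinf_on_sum Cinf_on_mult Cinf_on_divide Cinf_on_power Cinf_on_coord Cinf_on_const) auto
    have \<phi>sm: "smooth_near plane (0, 0) (total B) (\<phi> j)" for j
      unfolding \<phi>_def by (rule smooth_near_plane_vb_point[OF B c S(1,2) SU S(4) wC])
    obtain e where e: "e > 0" "\<And>t. \<bar>t\<bar> < e \<Longrightarrow> t \<in> S"
      using S(1,2) unfolding open_dist by (auto simp: dist_real_def)
    have oe: "open {-(e/2)<..<e/2}" "0 \<in> {-(e/2)<..<e/2}" using e(1) by auto
    have st: "s + t \<in> S" if "s \<in> {-(e/2)<..<e/2}" "t \<in> {-(e/2)<..<e/2}" for s t
      by (rule e(2)) (use that in auto)
    have ev\<phi>: "\<forall>\<^sub>F (s, t) in nhds (0, 0). vproj B (\<phi> j (s, t)) = \<gamma> (s + t)" for j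
    proof (rule eventually_mono[OF eventually_nhds_in_open[OF open_Times[OF oe(1) oe(1)], of "(0, 0)"]])
      fix z :: "real \<times> real" assume "z \<in> {-(e/2)<..<e/2} \<times> {-(e/2)<..<e/2}"
      then show "case z of (s, t) \<Rightarrow> vproj B (\<phi> j (s, t)) = \<gamma> (s + t)"
        using vb_point_props(1)[OF B c SU[OF st]] by (auto simp: \<phi>_def over_iff)
    qed (use oe(2) in simp)
    have \<phi>0: "\<phi> j (0, 0) \<in> over B U" for j
      using vb_point_props(1)[OF B c \<gamma>U, of "w j (0, 0)"] \<gamma>U by (simp add: \<phi>_def over_iff)
    have \<Phi>U: "vv_base \<Phi> \<in> over B U" using vv_base_pts[OF sD(1)] base pU by (simp add: over_iff)
    have eq: "vel2 j (l - j) (total B) (\<phi> j) = trunc2 j (l - j) (total B) \<Phi>" if j: "j \<le> l" for j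
    proof -
      note v2 = vel2_props[OF bb(1) \<phi>sm[of j], where m = j and n = "l - j"]
      have t2: "trunc2 j (l - j) (total B) \<Phi> \<in> pts (T_mfd j (T_mfd (l - j) (total B)))"
        "vv_base (trunc2 j (l - j) (total B) \<Phi>) = vv_base \<Phi>"
        "\<And>i a b. i < ?N \<Longrightarrow> a \<le> j \<Longrightarrow> b \<le> l - j \<Longrightarrow> vv_coord \<psi> (trunc2 j (l - j) (total B) \<Phi>) i a b = vv_coord \<psi> \<Phi> i a b"
        using trunc2_props[OF bb(1) sD(1) j, of "l - j"] d(2) \<Phi>U by simp_all
      show ?thesis
      proof (rule vv_eqI[OF bb(1) d(2) v2(1) _ t2(1)])
        show "vv_base (vel2 j (l - j) (total B) (\<phi> j)) \<in> over B U" using v2(2) \<phi>0 by simp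
        show "vv_base (trunc2 j (l - j) (total B) \<Phi>) \<in> over B U" using t2(2) \<Phi>U by simp
        fix i a b assume i: "i < ?N" "a \<le> j" "b \<le> l - j"
        have 1: "vv_coord \<psi> (vel2 j (l - j) (total B) (\<phi> j)) i a b
          = (deriv ^^ a) (\<lambda>s. (deriv ^^ b) (\<lambda>t. \<psi> (\<phi> j (s, t)) i) 0) 0"
          by (rule v2(3)[OF d(2) \<phi>0 i])
        have 2: "\<dots> = (deriv ^^ a) (\<lambda>s. (deriv ^^ b) (\<lambda>t. if i < ?n then x (\<gamma> (s + t)) i else w j (s, t) i) 0) 0"
        proof (rule higher_deriv_cong_ev[OF eventually_mono[OF eventually_nhds_in_open[OF oe]] refl])
          fix s assume s: "s \<in> {-(e/2)<..<e/2}"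
          show "(deriv ^^ b) (\<lambda>t. \<psi> (\<phi> j (s, t)) i) 0 = (deriv ^^ b) (\<lambda>t. if i < ?n then x (\<gamma> (s + t)) i else w j (s, t) i) 0"
            by (rule higher_deriv_cong_ev[OF eventually_mono[OF eventually_nhds_in_open[OF oe]] refl])
              (use vb_point_props(2)[OF B c SU[OF st[OF s]]] i(1) in \<open>simp add: \<phi>_def\<close>)
        qed
        show "vv_coord \<psi> (vel2 j (l - j) (total B) (\<phi> j)) i a b = vv_coord \<psi> (trunc2 j (l - j) (total B) \<Phi>) i a b"
        proof (cases "i < ?n")
          case True
          have "vv_coord \<psi> \<Phi> i a b = vv_coord (\<lambda>e. x (vproj B e)) \<Phi> i a b"
            by (rule vv_coord_vproj[OF B c sD(1) _ True]) (simp add: base pU)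
          also have "\<dots> = (deriv ^^ (a + b)) (\<lambda>t. x (\<gamma> t) i) 0"
            unfolding \<gamma>_def v_def by (rule sD(4)[OF d(1) U True]) (use i j in auto)
          finally show ?thesis unfolding 1 2 t2(3)[OF i] using True higher_deriv_sum_arg[of a b "\<lambda>t. x (\<gamma> t) i"] by simp
        next
          case False
          have "(\<lambda>s. (deriv ^^ b) (\<lambda>t. w j (s, t) i) 0) = taylor (Suc j) (\<lambda>p. vv_coord \<psi> \<Phi> i p b)"
          proof
            fix s
            have "(\<lambda>t. w j (s, t) i) = taylor (Suc (l - j)) (\<lambda>q. taylor (Suc j) (\<lambda>p. vv_coord \<psi> \<Phi> i p q) s)"
              by (simp add: w_def)
            then show "(deriv ^^ b) (\<lambda>t. w j (s, t) i) 0 = taylor (Suc j) (\<lambda>p. vv_coord \<psi> \<Phi> i p b) s"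
              using i(3) by (simp add: higher_deriv_taylor_0)
          qed
          then show ?thesis unfolding 1 2 t2(3)[OF i] using False i(2) by (simp add: higher_deriv_taylor_0)
        qed
      qed
    qed
    have \<zeta>sm: "smooth_near line 0 (dual_mfd B) \<zeta>"
      unfolding \<zeta>_def by (rule coordinate_covector_curve[OF B c S(1,2) SU S(4) i0])
    have "valid \<gamma> \<phi> \<zeta>"
      unfolding valid_def using \<gamma>in \<phi>sm eq ev\<phi> \<zeta>sm by (simp add: \<zeta>_def)
    moreover have "\<forall>e\<in>over B {p}. pairing e (\<zeta> 0) = \<psi> e i0"
      by (simp add: pairing_def \<zeta>_def \<gamma>0)
    ultimately show ?thesis by blast
  qed
  have "Upsilon l B \<Phi> = (THE e. e \<in> over B {p} \<and> (\<forall>\<gamma> \<phi> \<zeta>. valid \<gamma> \<phi> \<zeta> \<longrightarrow> pairing e (\<zeta> 0) = ?LP \<phi> \<zeta>))"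
    unfolding Upsilon_def valid_def p_def v_def ..
  also have "\<dots> = e0"
  proof (rule the_equality)
    show "e0 \<in> over B {p} \<and> (\<forall>\<gamma> \<phi> \<zeta>. valid \<gamma> \<phi> \<zeta> \<longrightarrow> pairing e0 (\<zeta> 0) = ?LP \<phi> \<zeta>)"
      using e0(1) ok by blast
    fix e assume e: "e \<in> over B {p} \<and> (\<forall>\<gamma> \<phi> \<zeta>. valid \<gamma> \<phi> \<zeta> \<longrightarrow> pairing e (\<zeta> 0) = ?LP \<phi> \<zeta>)"
    show "e = e0"
    proof (rule fibre_eqI[OF B c pU _ e0(1)])
      show "e \<in> over B {p}" using e by blast
      fix i assume "?n \<le> i" "i < ?N"
      then obtain \<gamma> \<phi> \<zeta> where *: "valid \<gamma> \<phi> \<zeta>" "\<forall>e\<in>over B {p}. pairing e (\<zeta> 0) = \<psi> e i" using ex by blast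
      have "pairing e (\<zeta> 0) = pairing e0 (\<zeta> 0)" using e *(1) ok by simp
      then show "\<psi> e i = \<psi> e0 i" using *(2) e e0(1) by simp
    qed
  qed
  finally have "Upsilon l B \<Phi> = e0" .
  then show "Upsilon l B \<Phi> \<in> over B {rep (semihol_proj l B \<Phi>) 0}"
    "\<And>i. ?n \<le> i \<Longrightarrow> i < ?N \<Longrightarrow> \<psi> (Upsilon l B \<Phi>) i = (\<Sum>j\<le>l. (-1) ^ j * real (l choose j) * vv_coord \<psi> \<Phi> i j (l - j))"
    using e0 by (simp_all add: p_def v_def Y_def)
qed

section \<open>The universal vector and the consequences of naturality\<close>

subsection \<open>The model bundles\<close>

lemma second_countable_Euclidean_space: "second_countable (Euclidean_space n)"
proof -
  obtain B :: "(nat \<Rightarrow> real) set set" where B: "countable B" "\<And>C. C \<in> B \<Longrightarrow> open C" "\<And>S. open S \<Longrightarrow> \<exists>U. U \<subseteq> B \<and> S = \<Union>U"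
    using univ_second_countable by metis
  have "second_countable (euclidean :: (nat \<Rightarrow> real) topology)"
    unfolding second_countable_def
  proof (intro exI[of _ B] conjI allI impI ballI)
    fix U and x :: "nat \<Rightarrow> real" assume "openin euclidean U \<and> x \<in> U"
    then obtain U' where "U' \<subseteq> B" "U = \<Union>U'" "x \<in> U" using B(3)[of U] by auto
    then show "\<exists>V\<in>B. x \<in> V \<and> V \<subseteq> U" by blast
  qed (use B in auto)
  then show ?thesis
    unfolding Euclidean_space_def by (simp add: euclidean_product_topology second_countable_subtopology)
qed

text \<open>The chart is a homeomorphism from \<open>mtop N\<close> onto the full coordinate space,
  whose separation and countability properties are inherited.\<close>

lemma single_chart_manifold:
  assumes N: "N = \<lparr>mdim = d, atlas = {(A, \<kappa>)}\<rparr>" and bij: "bij_betw \<kappa> A (topspace (Euclidean_space d))"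
  shows "manifold N"
proof -
  have inj: "inj_on \<kappa> A" and im: "\<kappa> ` A = topspace (Euclidean_space d)"
    using bij by (auto simp: bij_betw_def)
  have o: "openin (Euclidean_space d) (\<kappa> ` A)" by (simp add: im)
  note s = single_chart[OF N inj o]
  have "istopology (open_in N)"
    unfolding istopology_def
  proof (intro conjI allI impI)
    fix S T assume "open_in N S" "open_in N T"
    then show "open_in N (S \<inter> T)" using s(4) inj by (auto simp: inj_on_image_Int)
  next
    fix K assume "\<forall>S\<in>K. open_in N S"
    then show "open_in N (\<Union>K)" using s(4) by (auto simp: image_Union intro!: openin_Union)
  qed
  then have oi: "openin (mtop N) W \<longleftrightarrow> W \<subseteq> A \<and> openin (Euclidean_space d) (\<kappa> ` W)" for W
    using s(4) by (simp add: mtop_def)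
  have "topspace (mtop N) \<subseteq> A" using oi[of "topspace (mtop N)"] openin_topspace by blast
  moreover have "A \<subseteq> topspace (mtop N)" using oi[of A] o openin_subset by blast
  ultimately have ts: "topspace (mtop N) = A" by blast
  have "homeomorphic_map (mtop N) (Euclidean_space d) \<kappa>"
  proof (rule bijective_open_imp_homeomorphic_map)
    show "continuous_map (mtop N) (Euclidean_space d) \<kappa>"
      unfolding continuous_map_def ts
    proof (intro conjI allI impI)
      show "\<kappa> \<in> A \<rightarrow> topspace (Euclidean_space d)" using im by auto
      fix U assume U: "openin (Euclidean_space d) U"
      have "\<kappa> ` {x \<in> A. \<kappa> x \<in> U} = U" using im openin_subset[OF U] by auto
      then show "openin (mtop N) {x \<in> A. \<kappa> x \<in> U}" using oi U by simp
    qed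
    show "open_map (mtop N) (Euclidean_space d) \<kappa>" using oi by (simp add: open_map_def)
  qed (simp_all add: ts im inj)
  then have "mtop N homeomorphic_space Euclidean_space d" by (rule homeomorphic_map_imp_homeomorphic_space)
  then have "Hausdorff_space (mtop N)" "second_countable (mtop N)"
    using homeomorphic_Hausdorff_space Hausdorff_Euclidean_space homeomorphic_space_second_countability second_countable_Euclidean_space
    by blast+
  then show ?thesis using s(2) by (simp add: manifold_def smooth_atlas_def)
qed

lemma Cinf_on_smooth_R_coord:
  assumes W: "openin (Euclidean_space n) W" and h: "smooth_R UNIV h"
  shows "Cinf_on n W (\<lambda>z. h (z i))"
proof -
  have o: "openin (Euclidean_space (Suc 0)) (line_coord ` UNIV)" by (simp add: openin_line_coord_image)
  have "Cinf_on n W (\<lambda>z. h (line_coord (z i) 0))"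
  proof (rule Cinf_on_compose[OF W o _ _ Cinf_on_smooth_R[OF open_UNIV h], where a = "\<lambda>z. line_coord (z i)"])
    show "Cinf_on n W (\<lambda>z. line_coord (z i) l)" if "l < Suc 0" for l using that by (simp add: Cinf_on_coord)
  qed auto
  then show ?thesis by simp
qed

text \<open>
  The trivial bundle \<open>\<real> \<times> \<real>\<^sup>m \<rightarrow> \<real>\<close>, transported into the type \<open>'a\<close> along \<open>\<iota>\<close>.  Both the total space
  and the base consist of images of coordinate vectors, the base being \<open>\<real> \<times> {0}\<close>.
\<close>

locale model_bundle =
  fixes m :: nat and \<iota> :: "(nat \<Rightarrow> real) \<Rightarrow> 'a"
  assumes inj_\<iota>: "inj_on \<iota> (topspace (Euclidean_space (Suc m)))"
begin

definition \<kappa> :: "'a \<Rightarrow> nat \<Rightarrow> real" where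
  "\<kappa> = inv_into (topspace (Euclidean_space (Suc m))) \<iota>"

text \<open>Index 0 is the base coordinate, common to both summands of \<open>vadd\<close>; the
  fibre coordinates start at index 1. Since the base lies inside the total space, the single map
  \<open>\<kappa>\<close> is the chart of both.\<close>

definition model :: "('a, 'a) vbundle" where
  "model = \<lparr>total = \<lparr>mdim = Suc m, atlas = {(\<iota> ` topspace (Euclidean_space (Suc m)), \<kappa>)}\<rparr>,
     base = \<lparr>mdim = Suc 0, atlas = {(\<iota> ` topspace (Euclidean_space (Suc 0)), \<kappa>)}\<rparr>,
     vproj = (\<lambda>e. \<iota> (line_coord (\<kappa> e 0))),
     vadd = (\<lambda>e e'. \<iota> (\<lambda>i. if i = 0 then \<kappa> e 0 else \<kappa> e i + \<kappa> e' i)),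
     vscale = (\<lambda>r e. \<iota> (\<lambda>i. if i = 0 then \<kappa> e 0 else r * \<kappa> e i))\<rparr>"

lemma model_simps:
  "total model = \<lparr>mdim = Suc m, atlas = {(\<iota> ` topspace (Euclidean_space (Suc m)), \<kappa>)}\<rparr>"
  "base model = \<lparr>mdim = Suc 0, atlas = {(\<iota> ` topspace (Euclidean_space (Suc 0)), \<kappa>)}\<rparr>"
  "vproj model e = \<iota> (line_coord (\<kappa> e 0))"
  "vadd model e e' = \<iota> (\<lambda>i. if i = 0 then \<kappa> e 0 else \<kappa> e i + \<kappa> e' i)"
  "vscale model r e = \<iota> (\<lambda>i. if i = 0 then \<kappa> e 0 else r * \<kappa> e i)"
  by (simp_all add: model_def)

lemma mdim_model: "mdim (total model) = Suc m" "mdim (base model) = Suc 0"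
  by (simp_all add: model_simps)

lemma \<kappa>_\<iota>: "z \<in> topspace (Euclidean_space (Suc m)) \<Longrightarrow> \<kappa> (\<iota> z) = z"
  by (simp add: \<kappa>_def inj_\<iota>)

lemma sub1: "topspace (Euclidean_space (Suc 0)) \<subseteq> topspace (Euclidean_space (Suc m))"
  by simp

lemma \<kappa>_line: "\<kappa> (\<iota> (line_coord t)) = line_coord t"
  by (rule \<kappa>_\<iota>[OF subsetD[OF sub1]]) simp

lemma \<kappa>_bij: "bij_betw \<kappa> (\<iota> ` topspace (Euclidean_space (Suc m))) (topspace (Euclidean_space (Suc m)))"
  "bij_betw \<kappa> (\<iota> ` topspace (Euclidean_space (Suc 0))) (topspace (Euclidean_space (Suc 0)))"
  by (rule bij_betw_byWitness[where f' = \<iota>]; use \<kappa>_\<iota> sub1 in fastforce)+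

lemma manifold_model: "manifold (total model)" "manifold (base model)"
  by (rule single_chart_manifold[OF model_simps(1) \<kappa>_bij(1)], rule single_chart_manifold[OF model_simps(2) \<kappa>_bij(2)])

lemma model_charts:
  "smooth_chart (total model) (\<iota> ` topspace (Euclidean_space (Suc m)), \<kappa>)"
  "smooth_atlas (total model)" "pts (total model) = \<iota> ` topspace (Euclidean_space (Suc m))"
  "smooth_chart (base model) (\<iota> ` topspace (Euclidean_space (Suc 0)), \<kappa>)"
  "smooth_atlas (base model)" "pts (base model) = \<iota> ` topspace (Euclidean_space (Suc 0))"
proof -
  have o: "openin (Euclidean_space (Suc m)) (\<kappa> ` \<iota> ` topspace (Euclidean_space (Suc m)))"
    "openin (Euclidean_space (Suc 0)) (\<kappa> ` \<iota> ` topspace (Euclidean_space (Suc 0)))"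
    using \<kappa>_bij[THEN bij_betw_imp_surj_on] by (simp_all del: image_image)
  note s = single_chart[OF model_simps(1) \<kappa>_bij(1)[THEN bij_betw_imp_inj_on] o(1)]
    and t = single_chart[OF model_simps(2) \<kappa>_bij(2)[THEN bij_betw_imp_inj_on] o(2)]
  show "smooth_chart (total model) (\<iota> ` topspace (Euclidean_space (Suc m)), \<kappa>)"
    "smooth_atlas (total model)" "pts (total model) = \<iota> ` topspace (Euclidean_space (Suc m))"
    by (rule s)+
  show "smooth_chart (base model) (\<iota> ` topspace (Euclidean_space (Suc 0)), \<kappa>)"
    "smooth_atlas (base model)" "pts (base model) = \<iota> ` topspace (Euclidean_space (Suc 0))"
    by (rule t)+
qed

lemma \<kappa>_topspace: "e \<in> pts (total model) \<Longrightarrow> \<kappa> e \<in> topspace (Euclidean_space (Suc m))" "e \<in> pts (total model) \<Longrightarrow> \<iota> (\<kappa> e) = e"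
  unfolding model_charts(3) using \<kappa>_\<iota> by auto

lemma vproj_model: "vproj model e \<in> pts (base model)" "\<kappa> (vproj model e) = line_coord (\<kappa> e 0)"
  by (simp_all add: model_simps(3) \<kappa>_line model_charts(6))

lemma vproj_model_eq: "vproj model e = vproj model e' \<longleftrightarrow> \<kappa> e 0 = \<kappa> e' 0"
  by (metis vproj_model(2) line_coord_simps(1) model_simps(3))

lemma over_model: "over model (pts (base model)) = pts (total model)"
  using vproj_model(1) by (auto simp: over_def)

lemma \<kappa>_vadd:
  assumes "e \<in> pts (total model)" "e' \<in> pts (total model)"
  shows "\<kappa> (vadd model e e') = (\<lambda>i. if i = 0 then \<kappa> e 0 else \<kappa> e i + \<kappa> e' i)"
  unfolding model_simps(4)
  by (rule \<kappa>_\<iota>) (use \<kappa>_topspace(1)[OF assms(1)] \<kappa>_topspace(1)[OF assms(2)] in \<open>auto simp: topspace_Euclidean_space\<close>)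

lemma \<kappa>_vscale:
  assumes "e \<in> pts (total model)"
  shows "\<kappa> (vscale model r e) = (\<lambda>i. if i = 0 then \<kappa> e 0 else r * \<kappa> e i)"
  unfolding model_simps(5)
  by (rule \<kappa>_\<iota>) (use \<kappa>_topspace(1)[OF assms] in \<open>auto simp: topspace_Euclidean_space\<close>)

lemma pts_vadd: "e \<in> pts (total model) \<Longrightarrow> e' \<in> pts (total model) \<Longrightarrow> vadd model e e' \<in> pts (total model)"
  unfolding model_charts(3) model_simps(4)
  by (rule imageI) (use \<kappa>_topspace(1)[of e] \<kappa>_topspace(1)[of e'] in \<open>auto simp: topspace_Euclidean_space model_charts(3)\<close>)

lemma pts_vscale: "e \<in> pts (total model) \<Longrightarrow> vscale model r e \<in> pts (total model)"
  unfolding model_charts(3) model_simps(5)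
  by (rule imageI) (use \<kappa>_topspace(1)[of e] in \<open>auto simp: topspace_Euclidean_space model_charts(3)\<close>)

lemma smooth_map_vproj: "smooth_map (total model) (base model) (vproj model)"
  unfolding smooth_map_def
proof (rule smooth_onI[OF model_charts(2,5) open_in_pts[OF model_charts(2)]])
  let ?A = "\<iota> ` topspace (Euclidean_space (Suc m))" and ?B = "\<iota> ` topspace (Euclidean_space (Suc 0))"
  fix p assume p: "p \<in> pts (total model)"
  have o: "openin (Euclidean_space (Suc m)) (\<kappa> ` ?A)" using smooth_chartD(3)[OF model_charts(1)] by (simp only: mdim_model)
  have "Cinf_on (Suc m) (\<kappa> ` ?A) (\<lambda>z. \<kappa> (vproj model (inv_into ?A \<kappa> z)) j)" if "j < Suc 0" for j
  proof (rule Cinf_on_eq[OF o Cinf_on_coord[of _ _ 0]])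
    fix z assume "z \<in> \<kappa> ` ?A"
    then obtain e where e: "e \<in> ?A" "z = \<kappa> e" by blast
    then have "inv_into ?A \<kappa> z = e" using chart_inv[OF model_charts(1)] by simp
    then show "z 0 = \<kappa> (vproj model (inv_into ?A \<kappa> z)) j" using that e(2) by (simp add: vproj_model(2))
  qed
  then have "smooth_in_charts (total model) (base model) ?A (?A, \<kappa>) (?B, \<kappa>) (vproj model)"
    using open_in_chart_dom[OF model_charts(2,1)] vproj_model(1)
    by (auto simp: smooth_in_charts_def mdim_model model_charts(6))
  then show "\<exists>U \<phi> V \<psi> W'. smooth_chart (total model) (U, \<phi>) \<and> smooth_chart (base model) (V, \<psi>) \<and> p \<in> W' \<and>
      smooth_in_charts (total model) (base model) W' (U, \<phi>) (V, \<psi>) (vproj model)"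
    using model_charts(1,4) p unfolding model_charts(3)
    by (intro exI[of _ ?A] exI[of _ \<kappa>] exI[of _ ?B] exI[of _ \<kappa>] exI[of _ ?A] conjI)
qed

lemma vb_chart_model: "vb_chart model (pts (base model)) \<kappa> \<kappa>"
  unfolding vb_chart_def over_model
proof (intro conjI ballI allI impI)
  show "smooth_chart (base model) (pts (base model), \<kappa>)" using model_charts(4) by (simp only: model_charts(6))
  show "smooth_chart (total model) (pts (total model), \<kappa>)" using model_charts(1) by (simp only: model_charts(3))
  show "\<kappa> e i = \<kappa> (vproj model e) i" if "i < mdim (base model)" for e i
    using that by (simp add: mdim_model vproj_model(2))
  show "\<kappa> (vadd model e e') i = \<kappa> e i + \<kappa> e' i"
    if "e \<in> pts (total model)" "e' \<in> pts (total model)" "mdim (base model) \<le> i" for e e' i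
    using that by (simp add: \<kappa>_vadd mdim_model)
  show "\<kappa> (vscale model r e) i = r * \<kappa> e i" if "e \<in> pts (total model)" "mdim (base model) \<le> i" for r e i
    using that by (simp add: \<kappa>_vscale mdim_model)
  have "\<exists>p\<in>pts (base model). \<forall>i<Suc 0. z i = \<kappa> p i" for z
    by (rule bexI[of _ "\<iota> (line_coord (z 0))"]) (auto simp: \<kappa>_line model_charts(6))
  then show "\<kappa> ` pts (total model) = {z \<in> topspace (Euclidean_space (mdim (total model))). \<exists>p\<in>pts (base model). \<forall>i<mdim (base model). z i = \<kappa> p i}"
    using \<kappa>_bij(1)[THEN bij_betw_imp_surj_on] unfolding model_charts(3) mdim_model by blast
qed

lemma vector_bundle_model: "vector_bundle model"
  unfolding vector_bundle_def
proof (intro conjI ballI allI impI)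
  show "\<exists>U x \<psi>. p \<in> U \<and> vb_chart model U x \<psi>" if "p \<in> pts (base model)" for p
    using vb_chart_model that by blast
  show "vproj model (vadd model e e') = vproj model e" if "e \<in> pts (total model)" "e' \<in> pts (total model)" for e e'
    unfolding vproj_model_eq \<kappa>_vadd[OF that] by simp
  show "vproj model (vscale model r e) = vproj model e" if "e \<in> pts (total model)" for r e
    unfolding vproj_model_eq \<kappa>_vscale[OF that] by simp
  show "mdim (base model) \<le> mdim (total model)" by (simp add: mdim_model)
qed (simp_all add: manifold_model smooth_map_vproj pts_vadd pts_vscale)

text \<open>\<open>a i c u\<close> is the matrix entry, at the base point \<open>u\<close>, from the \<open>c\<close>-th fibre coordinate of the
  model to the \<open>i\<close>-th coordinate of \<open>B\<close>, and \<open>g\<close> is the map of bases.\<close>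

definition model_map :: "('m, 'e) vbundle \<Rightarrow> 'm set \<Rightarrow> ('m \<Rightarrow> nat \<Rightarrow> real) \<Rightarrow> ('e \<Rightarrow> nat \<Rightarrow> real) \<Rightarrow> (real \<Rightarrow> 'm) \<Rightarrow>
    (nat \<Rightarrow> nat \<Rightarrow> real \<Rightarrow> real) \<Rightarrow> 'a \<Rightarrow> 'e" where
  "model_map B U x \<psi> g a e = vb_point B U x \<psi> (g (\<kappa> e 0)) (\<lambda>i. \<Sum>c<m. a i c (\<kappa> e 0) * \<kappa> e (Suc c))"

lemma vb_morphism_model_map:
  assumes B: "vector_bundle B" and c: "vb_chart B U x \<psi>"
    and g: "\<And>u. g u \<in> U" "\<And>i. i < mdim (base B) \<Longrightarrow> smooth_R UNIV (\<lambda>u. x (g u) i)"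
    and a: "\<And>i c. smooth_R UNIV (a i c)"
  shows "vb_morphism model B (model_map B U x \<psi> g a)"
proof -
  let ?f = "model_map B U x \<psi> g a" and ?n = "mdim (base B)"
  let ?A = "\<iota> ` topspace (Euclidean_space (Suc m))" and ?B = "\<iota> ` topspace (Euclidean_space (Suc 0))"
  note d = vb_chartD[OF c] and bb = vector_bundleD[OF B] and P = vb_point_props[OF B c g(1)]
  have fo: "?f e \<in> over B {g (\<kappa> e 0)}" for e unfolding model_map_def by (rule P(1))
  have fU: "?f e \<in> over B U" for e using fo[of e] g(1) by (auto simp: over_iff)
  have fc: "\<psi> (?f e) i = (\<Sum>c<m. a i c (\<kappa> e 0) * \<kappa> e (Suc c))" if "?n \<le> i" "i < mdim (total B)" for e i
    using that by (simp add: model_map_def P(2))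
  have fb: "\<psi> (?f e) i = x (g (\<kappa> e 0)) i" if "i < ?n" for e i
    using that by (simp add: model_map_def P(2))
  have sm: "smooth_map (total model) (total B) ?f"
    unfolding smooth_map_def
  proof (rule smooth_onI[OF model_charts(2) bb(1) open_in_pts[OF model_charts(2)]])
    fix p assume p: "p \<in> pts (total model)"
    have o: "openin (Euclidean_space (Suc m)) (\<kappa> ` ?A)" using smooth_chartD(3)[OF model_charts(1)] by (simp only: mdim_model)
    have inv: "inv_into ?A \<kappa> z \<in> pts (total model) \<and> \<kappa> (inv_into ?A \<kappa> z) = z" if "z \<in> \<kappa> ` ?A" for z
      using f_inv_into_f[OF that] inv_into_into[OF that] by (simp only: model_charts(3))
    have "Cinf_on (Suc m) (\<kappa> ` ?A) (\<lambda>z. \<psi> (?f (inv_into ?A \<kappa> z)) j)" if j: "j < mdim (total B)" for j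
    proof (cases "j < ?n")
      case True
      show ?thesis
        by (rule Cinf_on_eq[OF o Cinf_on_smooth_R_coord[OF o g(2)[OF True], of 0]]) (simp add: fb[OF True] inv)
    next
      case False
      have "Cinf_on (Suc m) (\<kappa> ` ?A) (\<lambda>z. \<Sum>c<m. a j c (z 0) * z (Suc c))"
        by (intro Cinf_on_sum Cinf_on_mult Cinf_on_coord Cinf_on_smooth_R_coord[OF o a]) simp
      then show ?thesis by (rule Cinf_on_eq[OF o]) (use False j in \<open>simp add: fc inv\<close>)
    qed
    then have "smooth_in_charts (total model) (total B) ?A (?A, \<kappa>) (over B U, \<psi>) ?f"
      using open_in_chart_dom[OF model_charts(2,1)] fU by (auto simp: smooth_in_charts_def mdim_model)
    then show "\<exists>U \<phi> V \<psi> W'. smooth_chart (total model) (U, \<phi>) \<and> smooth_chart (total B) (V, \<psi>) \<and> p \<in> W' \<and>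
        smooth_in_charts (total model) (total B) W' (U, \<phi>) (V, \<psi>) ?f"
      using model_charts(1) d(2) p unfolding model_charts(3)
      by (intro exI[of _ ?A] exI[of _ \<kappa>] exI[of _ "over B U"] exI[of _ \<psi>] exI[of _ ?A] conjI)
  qed
  define h where "h p = g (\<kappa> p 0)" for p
  have sh: "smooth_map (base model) (base B) h"
    unfolding smooth_map_def
  proof (rule smooth_onI[OF model_charts(5) bb(2) open_in_pts[OF model_charts(5)]])
    fix p assume p: "p \<in> pts (base model)"
    have o: "openin (Euclidean_space (Suc 0)) (\<kappa> ` ?B)" using smooth_chartD(3)[OF model_charts(4)] by (simp only: mdim_model)
    have "Cinf_on (Suc 0) (\<kappa> ` ?B) (\<lambda>z. x (h (inv_into ?B \<kappa> z)) j)" if j: "j < ?n" for j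
      by (rule Cinf_on_eq[OF o Cinf_on_smooth_R_coord[OF o g(2)[OF j], of 0]]) (simp add: h_def f_inv_into_f)
    then have "smooth_in_charts (base model) (base B) ?B (?B, \<kappa>) (U, x) h"
      using open_in_chart_dom[OF model_charts(5,4)] g(1) by (auto simp: smooth_in_charts_def mdim_model h_def)
    then show "\<exists>U \<phi> V \<psi> W'. smooth_chart (base model) (U, \<phi>) \<and> smooth_chart (base B) (V, \<psi>) \<and> p \<in> W' \<and>
        smooth_in_charts (base model) (base B) W' (U, \<phi>) (V, \<psi>) h"
      using model_charts(4) d(1) p unfolding model_charts(6)
      by (intro exI[of _ ?B] exI[of _ \<kappa>] exI[of _ U] exI[of _ x] exI[of _ ?B] conjI)
  qed
  show ?thesis
    unfolding vb_morphism_def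
  proof (intro conjI exI[of _ h] ballI allI impI)
    show "vproj B (?f e) = h (vproj model e)" for e
      using fo[of e] by (simp add: over_iff h_def vproj_model(2))
    show "?f (vadd model e e') = vadd B (?f e) (?f e')"
      if e: "e \<in> pts (total model)" "e' \<in> pts (total model)" "vproj model e = vproj model e'" for e e'
    proof (rule fibre_eqI[OF B c g(1)])
      have e0: "\<kappa> e' 0 = \<kappa> e 0" using e(3) by (simp add: vproj_model_eq)
      have k0: "\<kappa> (vadd model e e') 0 = \<kappa> e 0" by (simp add: \<kappa>_vadd[OF e(1,2)])
      show "?f (vadd model e e') \<in> over B {g (\<kappa> e 0)}" using fo[of "vadd model e e'"] by (simp add: k0)
      have fe': "?f e' \<in> over B {g (\<kappa> e 0)}" using fo[of e'] by (simp add: e0)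
      show "vadd B (?f e) (?f e') \<in> over B {g (\<kappa> e 0)}" by (rule fibre_ops(1)[OF B fo fe'])
      fix i assume i: "?n \<le> i" "i < mdim (total B)"
      show "\<psi> (?f (vadd model e e')) i = \<psi> (vadd B (?f e) (?f e')) i"
        unfolding fibre_ops_coord(1)[OF c g(1) i(1) fo fe'] fc[OF i] k0 e0
        by (simp add: \<kappa>_vadd[OF e(1,2)] algebra_simps sum.distrib)
    qed
    show "?f (vscale model r e) = vscale B r (?f e)" if e: "e \<in> pts (total model)" for e r
    proof (rule fibre_eqI[OF B c g(1)])
      have k0: "\<kappa> (vscale model r e) 0 = \<kappa> e 0" by (simp add: \<kappa>_vscale[OF e])
      show "?f (vscale model r e) \<in> over B {g (\<kappa> e 0)}" using fo[of "vscale model r e"] by (simp add: k0)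
      show "vscale B r (?f e) \<in> over B {g (\<kappa> e 0)}" by (rule fibre_ops(2)[OF B fo])
      fix i assume i: "?n \<le> i" "i < mdim (total B)"
      show "\<psi> (?f (vscale model r e)) i = \<psi> (vscale B r (?f e)) i"
        unfolding fibre_ops_coord(2)[OF c g(1) i(1) fo] fc[OF i] k0
        by (simp add: \<kappa>_vscale[OF e] sum_distrib_left algebra_simps)
    qed
  qed (rule sm, rule sh)
qed

end

subsection \<open>Reparametrizations\<close>

lemma higher_deriv_power_0:
  assumes "j < K"
  shows "(deriv ^^ j) (\<lambda>u::real. u ^ K) 0 = 0"
proof -
  have "(\<lambda>u::real. u ^ K) = taylor (Suc K) (\<lambda>c. if c = K then fact K else 0)"
    by (rule ext) (simp add: taylor_def)
  then show ?thesis using assms by (simp add: higher_deriv_taylor_0)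
qed

lemma smooth_R_ident: "smooth_R UNIV (\<lambda>u. u)"
  by (rule smooth_R_from_Cinf[OF open_UNIV]) (rule Cinf_on_coord)

lemma smooth_R_power: "open S \<Longrightarrow> smooth_R S f \<Longrightarrow> smooth_R S (\<lambda>u. f u ^ K)"
  by (induction K) (auto intro: smooth_R_const smooth_R_mult)

text \<open>The inner function agrees with the identity in all derivatives of order below
  \<open>K\<close> at 0. With K = 2k + 1 this serves both to locate the base point of
  \<open>F model X0\<close> and to extend a curve germ to the whole line.\<close>

lemma higher_deriv_reparam:
  assumes f: "open S" "smooth_R S f" "0 \<in> S" and h: "smooth_R UNIV h" and \<alpha>: "\<alpha> < K"
  shows "(deriv ^^ \<alpha>) (\<lambda>u. f (u + u ^ K * h u)) 0 = (deriv ^^ \<alpha>) f 0"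
proof -
  let ?r = "\<lambda>u. u + u ^ K * h u"
  have sp: "smooth_R UNIV (\<lambda>u. u ^ K * h u)"
    by (intro smooth_R_mult open_UNIV smooth_R_power smooth_R_ident h)
  have sr: "smooth_R UNIV ?r" by (intro smooth_R_add open_UNIV smooth_R_ident sp)
  have dr: "(deriv ^^ j) ?r 0 = (deriv ^^ j) (\<lambda>u. u) 0" if "j < K" for j
  proof -
    have "(deriv ^^ j) (\<lambda>u. u ^ K * h u) 0 = 0"
      unfolding higher_deriv_mult[OF open_UNIV smooth_R_power[OF open_UNIV smooth_R_ident] h UNIV_I]
      by (rule sum.neutral) (use that in \<open>simp add: higher_deriv_power_0\<close>)
    then show ?thesis
      using higher_deriv_add[OF open_UNIV smooth_R_ident sp UNIV_I, of j 0] by simp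
  qed
  have oV: "openin (Euclidean_space (Suc 0)) (line_coord ` S)" using f(1) by (simp add: openin_line_coord_image)
  have C: "Cinf_on (Suc 0) (line_coord ` S) (\<lambda>z. f (z 0))" by (rule Cinf_on_smooth_R[OF f(1,2)])
  have K: "K > 0" using \<alpha> by simp
  have "\<forall>\<^sub>F u in nhds 0. ?r u \<in> S"
  proof (rule topological_tendstoD[OF _ f(1)])
    have "isCont ?r 0" using DERIV_isCont[OF smooth_R_DERIV[OF sr UNIV_I[of 0], of 0]] by simp
    then show "(?r \<longlongrightarrow> ?r 0) (nhds 0)" by (simp add: isCont_def tendsto_nhds_iff)
    show "?r 0 \<in> S" using f(3) K by (simp add: zero_power)
  qed
  then obtain T where T: "open T" "0 \<in> T" "\<And>u. u \<in> T \<Longrightarrow> ?r u \<in> S" unfolding eventually_nhds by metis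
  have sub: "a t \<in> line_coord ` S" if "a t 0 \<in> S" "a t = line_coord (a t 0)" for a :: "real \<Rightarrow> nat \<Rightarrow> real" and t
    using that by auto
  show ?thesis
  \<comment> \<open>The jet of a composite is a function of the jet of the inner curve, so the
    reparametrization and the identity give the same result.\<close>
  proof (rule jet_transform[of "Suc 0" "line_coord ` S" "Suc 0" "\<lambda>z i. f (z 0)" \<alpha>, OF oV C])
    fix H :: "(nat \<Rightarrow> real) \<Rightarrow> nat \<Rightarrow> real"
    assume H: "\<And>Q a t. open Q \<Longrightarrow> (\<And>i. i < Suc 0 \<Longrightarrow> smooth_R Q (\<lambda>t. a t i)) \<Longrightarrow>
      (\<And>t. t \<in> Q \<Longrightarrow> a t \<in> line_coord ` S) \<Longrightarrow> t \<in> Q \<Longrightarrow>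
      jet (Suc 0) \<alpha> (\<lambda>t i. f (a t 0)) t = H (jet (Suc 0) \<alpha> a t)"
    have 1: "jet (Suc 0) \<alpha> (\<lambda>t i. f (line_coord (?r t) 0)) 0 = H (jet (Suc 0) \<alpha> (\<lambda>t. line_coord (?r t)) 0)"
      by (rule H[of T "\<lambda>t. line_coord (?r t)"]) (use T smooth_R_subset[OF sr] in auto)
    have 2: "jet (Suc 0) \<alpha> (\<lambda>t i. f (line_coord t 0)) 0 = H (jet (Suc 0) \<alpha> (\<lambda>t. line_coord t) 0)"
      by (rule H[of S "\<lambda>t. line_coord t"]) (use f smooth_R_subset[OF smooth_R_ident] in auto)
    have "jet (Suc 0) \<alpha> (\<lambda>t. line_coord (?r t)) 0 = jet (Suc 0) \<alpha> (\<lambda>t. line_coord t) 0"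
      unfolding jet_eq_iff using dr \<alpha> by auto
    then have "jet (Suc 0) \<alpha> (\<lambda>t i. f (line_coord (?r t) 0)) 0 = jet (Suc 0) \<alpha> (\<lambda>t i. f (line_coord t 0)) 0"
      using 1 2 by simp
    then show ?thesis unfolding jet_eq_iff by auto
  qed
qed

text \<open>\<open>h\<close> is chosen so that u + u^(2k+1) h(u) = u / (1 + (u/e)^(2k+2)). The
  exponent is even, so the denominator is positive; it exceeds |u/e|, which gives the bound. The
  deviation from u has order 2k + 3, which leaves the factor u^2 in \<open>h\<close>.\<close>

lemma bounded_reparam:
  fixes e :: real
  assumes e: "e > 0"
  obtains h where "smooth_R UNIV h" "\<And>u. \<bar>u + u ^ Suc (2 * k) * h u\<bar> < e"
proof
  let ?D = "\<lambda>u::real. 1 + (u / e) ^ (2 * k + 2)"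
  have D: "?D u > 0" for u
    using zero_le_even_power[of "2 * k + 2" "u / e"] by simp
  then have D0: "?D u \<noteq> 0" for u by (metis less_irrefl)
  let ?h = "\<lambda>u. (-1 / e ^ (2 * k + 2)) * u\<^sup>2 / ?D u"
  show "smooth_R UNIV ?h"
    by (rule smooth_R_from_Cinf[OF open_UNIV], intro Cinf_on_divide Cinf_on_mult Cinf_on_add Cinf_on_power Cinf_on_coord Cinf_on_const)
      (use D0 e in auto)
  fix u :: real
  have "u ^ Suc (2 * k) * u\<^sup>2 = u * u ^ (2 * k + 2)" by (simp add: power_add power2_eq_square)
  then have "u ^ Suc (2 * k) * ?h u = - u * (u / e) ^ (2 * k + 2) / ?D u"
    by (simp add: power_divide)
  then have "u + u ^ Suc (2 * k) * ?h u = u / ?D u"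
  proof -
    have "u + - u * q / (1 + q) = u / (1 + q)" if "1 + q \<noteq> 0" for q
      using that by (simp add: field_simps)
    from this[OF D0[of u]] show ?thesis using \<open>u ^ Suc (2 * k) * ?h u = - u * (u / e) ^ (2 * k + 2) / ?D u\<close> by simp
  qed
  moreover have "\<bar>u / ?D u\<bar> < e"
  proof -
    have "\<bar>u / e\<bar> < 1 + \<bar>u / e\<bar> ^ (2 * k + 2)"
    proof (cases "\<bar>u / e\<bar> < 1")
      case True
      then show ?thesis using zero_le_power[OF abs_ge_zero, of "u / e" "2 * k + 2"] by linarith
    next
      case False
      then have "\<bar>u / e\<bar> ^ 1 \<le> \<bar>u / e\<bar> ^ (2 * k + 2)" by (intro power_increasing) auto
      then show ?thesis by simp
    qed
    moreover have "\<bar>u / e\<bar> ^ (2 * k + 2) = (u / e) ^ (2 * k + 2)" by (rule power_even_abs) simp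
    ultimately have "\<bar>u / e\<bar> < ?D u" by (simp only:)
    moreover have "\<bar>u / e\<bar> = \<bar>u\<bar> / e" using e by simp
    ultimately have "\<bar>u\<bar> / e < ?D u" by (simp only:)
    then have "\<bar>u\<bar> < ?D u * e" by (simp only: pos_divide_less_eq[OF e])
    moreover have "\<bar>u / ?D u\<bar> = \<bar>u\<bar> / ?D u" by (simp only: abs_divide abs_of_pos[OF D[of u]])
    ultimately show ?thesis by (simp only: pos_divide_less_eq[OF D[of u]] mult.commute[of _ e])
  qed
  ultimately show "\<bar>u + u ^ Suc (2 * k) * ?h u\<bar> < e" by simp
qed

subsection \<open>The universal semi-holonomic vector\<close>

text \<open>Normalised so that the mixed derivative of order (p, q) at the origin is 1 and all
  others vanish: the basis dual to the lifted fibre coordinates.\<close>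

definition monom2 :: "nat \<Rightarrow> nat \<Rightarrow> real \<Rightarrow> real \<Rightarrow> real" where
  "monom2 p q s t = s ^ p / fact p * (t ^ q / fact q)"

lemma double_deriv_monom2:
  "(deriv ^^ a) (\<lambda>s. (deriv ^^ b) (\<lambda>t. r * monom2 p q s t) 0) 0 = (if a = p \<and> b = q then r else 0)"
proof -
  have "(deriv ^^ b) (\<lambda>t. r * monom2 p q s t) 0 = taylor (Suc p) (\<lambda>c. if c = p \<and> b = q then r else 0) s" for s
  proof -
    have "(\<lambda>t. r * monom2 p q s t) = taylor (Suc q) (\<lambda>c. if c = q then r * s ^ p / fact p else 0)"
      by (rule ext) (simp add: taylor_def monom2_def)
    then show ?thesis by (simp add: higher_deriv_taylor_0) (simp add: taylor_def)
  qed
  then show ?thesis by (simp add: higher_deriv_taylor_0)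
qed

lemma Cinf_on_monom2: "Cinf_on 2 W (\<lambda>z. monom2 p q (z 0) (z (Suc 0)))"
  unfolding monom2_def by (intro Cinf_on_mult Cinf_on_divide Cinf_on_power Cinf_on_coord Cinf_on_const) auto

lemma double_deriv_monom2_sum:
  assumes "finite I"
  shows "(deriv ^^ a) (\<lambda>s. (deriv ^^ b) (\<lambda>t. \<Sum>i\<in>I. r i * monom2 (p i) (q i) s t) 0) 0
    = (\<Sum>i\<in>I. if a = p i \<and> b = q i then r i else 0)"
  using double_deriv_sum[OF openin_topspace zero_less_one _ assms, of "\<lambda>i z. r i * monom2 (p i) (q i) (z 0) (z (Suc 0))" a b]
    Cinf_on_mult[OF Cinf_on_const Cinf_on_monom2]
  by (simp add: double_deriv_monom2)

lemma monom2_sum_arg: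
  "(s + t) * monom2 p q s t = real (Suc p) * monom2 (Suc p) q s t + real (Suc q) * monom2 p (Suc q) s t"
proof -
  have "real (Suc p) * monom2 (Suc p) q s t = s * monom2 p q s t"
    by (simp add: monom2_def divide_simps)
  moreover have "real (Suc q) * monom2 p (Suc q) s t = t * monom2 p q s t"
    by (simp add: monom2_def divide_simps)
  ultimately show ?thesis by (simp add: algebra_simps)
qed

text \<open>The fibre coordinates are numbered by a pair of orders up to \<open>k\<close>: the pair
  (beta, gamma) has number \<open>\<beta> * Suc k + \<gamma>\<close>, recovered by
  \<open>div\<close> and \<open>mod\<close>, and sits at index one higher because of the base
  coordinate.\<close>

locale universal_vector = model_bundle m \<iota> for m and \<iota> :: "(nat \<Rightarrow> real) \<Rightarrow> 'a" +
  fixes k :: nat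
  assumes m: "m = Suc k * Suc k"
begin

definition curve0 :: "real \<Rightarrow> 'a" where
  "curve0 t = \<iota> (line_coord t)"

definition plane0 :: "real \<times> real \<Rightarrow> 'a" where
  "plane0 = (\<lambda>(s, t). vb_point model (pts (base model)) \<kappa> \<kappa> (curve0 (s + t))
     ((\<lambda>(s, t) i. monom2 ((i - 1) div Suc k) ((i - 1) mod Suc k) s t) (s, t)))"

definition X0 :: "'a vv" where
  "X0 = vel2 k k (total model) plane0"

lemma curve0: "curve0 t \<in> pts (base model)" "\<kappa> (curve0 t) = line_coord t"
  by (auto simp: curve0_def model_charts(6) \<kappa>_line)

lemma smooth_R_curve0: "i < mdim (base model) \<Longrightarrow> smooth_R UNIV (\<lambda>t. \<kappa> (curve0 t) i)"
  by (simp add: curve0 mdim_model smooth_R_ident)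

lemma smooth_plane0: "smooth_near plane (0, 0) (total model) plane0"
  unfolding plane0_def
proof (rule smooth_near_plane_vb_point[OF vector_bundle_model vb_chart_model open_UNIV UNIV_I curve0(1) smooth_R_curve0])
  fix i
  show "Cinf_on 2 (topspace (Euclidean_space 2)) (\<lambda>z. (\<lambda>(s, t) i. monom2 ((i - 1) div Suc k) ((i - 1) mod Suc k) s t) (z 0, z (Suc 0)) i)"
    unfolding prod.case by (rule Cinf_on_monom2)
qed

lemma \<kappa>_plane0: "\<kappa> (plane0 (s, t)) 0 = s + t"
  "c < m \<Longrightarrow> \<kappa> (plane0 (s, t)) (Suc c) = monom2 (c div Suc k) (c mod Suc k) s t"
  using vb_point_props(2)[OF vector_bundle_model vb_chart_model curve0(1)]
  by (simp_all add: plane0_def mdim_model curve0)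

lemma X0_semihol: "X0 \<in> pts (total (semihol k model))"
proof -
  note bb = vector_bundleD[OF vector_bundle_model]
  note v = vel2_props[OF bb(1) smooth_plane0, where m = k and n = k, folded X0_def]
  note d = vb_chartD[OF vb_chart_model]
  have c0: "smooth_near line 0 (base model) curve0"
    using curve0(1) smooth_R_curve0 by (subst smooth_near_line_iff[of "base model" "pts (base model)" \<kappa> curve0, OF bb(2) d(1) curve0(1)])
      (intro exI[of _ UNIV], auto)
  have vp: "vproj model (vv_base X0) = curve0 0"
    by (simp add: v(2) model_simps(3) \<kappa>_plane0 curve0_def)
  have "X0 \<in> semihol_set k model"
  proof (rule semihol_setI(1)[OF vector_bundle_model v(1) c0 vp d(1) curve0(1)])
    fix i a b assume i: "i < mdim (base model)" "a \<le> k" "b \<le> k"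
    then have i0: "i = 0" by (simp add: mdim_model)
    have "vv_coord (\<lambda>e. \<kappa> (vproj model e)) X0 i a b = vv_coord \<kappa> X0 i a b"
      by (rule vv_coord_vproj[OF vector_bundle_model vb_chart_model v(1) _ i(1), symmetric]) (simp add: vp curve0)
    also have "\<dots> = (deriv ^^ a) (\<lambda>s. (deriv ^^ b) (\<lambda>t. \<kappa> (plane0 (s, t)) i) 0) 0"
      by (rule v(3)[OF model_charts(1)]) (use smooth_near_pts[OF smooth_plane0] i in \<open>auto simp: model_charts(3) mdim_model\<close>)
    also have "\<dots> = (deriv ^^ (a + b)) (\<lambda>t. \<kappa> (curve0 t) i) 0"
      using higher_deriv_sum_arg[of a b "\<lambda>t. t"] by (simp add: i0 \<kappa>_plane0 curve0)
    finally show "vv_coord (\<lambda>e. \<kappa> (vproj model e)) X0 i a b = (deriv ^^ (a + b)) (\<lambda>t. \<kappa> (curve0 t) i) 0" .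
  qed
  then show ?thesis using pts_semihol[OF vector_bundle_model] by simp
qed

text \<open>Along \<open>plane0\<close> the base coordinate is s + t, hence the matrix entries are
  evaluated there, and the base part of the image is the holonomic vector of
  \<open>g\<close>.\<close>

lemma model_map_X0:
  assumes B: "vector_bundle B" and c: "vb_chart B U x \<psi>"
    and g: "\<And>u. g u \<in> U" "\<And>i. i < mdim (base B) \<Longrightarrow> smooth_R UNIV (\<lambda>u. x (g u) i)"
    and a: "\<And>i c. smooth_R UNIV (a i c)"
  defines "Y \<equiv> semihol_map k B (model_map B U x \<psi> g a) X0"
  shows "Y \<in> pts (T_mfd k (T_mfd k (total B)))" "vv_base Y \<in> over B U"
    and "\<And>i p q. i < mdim (base B) \<Longrightarrow> p \<le> k \<Longrightarrow> q \<le> k \<Longrightarrow> vv_coord \<psi> Y i p q = (deriv ^^ (p + q)) (\<lambda>u. x (g u) i) 0"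
    and "\<And>i p q. mdim (base B) \<le> i \<Longrightarrow> i < mdim (total B) \<Longrightarrow> p \<le> k \<Longrightarrow> q \<le> k \<Longrightarrow> vv_coord \<psi> Y i p q =
      (deriv ^^ p) (\<lambda>s. (deriv ^^ q) (\<lambda>t. \<Sum>c<m. a i c (s + t) * monom2 (c div Suc k) (c mod Suc k) s t) 0) 0"
proof -
  let ?f = "model_map B U x \<psi> g a"
  note bb = vector_bundleD[OF B] and bm = vector_bundleD[OF vector_bundle_model] and d = vb_chartD[OF c]
  have sf: "smooth_map (total model) (total B) ?f"
    using vb_morphism_model_map[OF B c g a] by (simp add: vb_morphism_def)
  have sp: "smooth_near plane (0, 0) (total B) (\<lambda>p. ?f (plane0 p))"
    by (rule smooth_near_compose[OF plane_chart(2) bm(1) bb(1) smooth_plane0 sf])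
  have Y: "Y = vel2 k k (total B) (\<lambda>p. ?f (plane0 p))"
    unfolding Y_def semihol_map_def X0_def by (rule TT_map_vel2[OF bm(1) bb(1) sf smooth_plane0])
  note v = vel2_props[OF bb(1) sp, where m = k and n = k, folded Y]
  show "Y \<in> pts (T_mfd k (T_mfd k (total B)))" by (rule v(1))
  have fU: "?f e \<in> over B U" for e
    using vb_point_props(1)[OF B c g(1)] g(1) by (auto simp: model_map_def over_iff)
  show "vv_base Y \<in> over B U" unfolding v(2) by (rule fU)
  have co: "\<psi> (?f (plane0 (s, t))) i = (if i < mdim (base B) then x (g (s + t)) i
      else \<Sum>c<m. a i c (s + t) * monom2 (c div Suc k) (c mod Suc k) s t)" if "i < mdim (total B)" for s t i
    using that vb_point_props(2)[OF B c g(1)] by (simp add: model_map_def \<kappa>_plane0)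
  have vc: "vv_coord \<psi> Y i p q = (deriv ^^ p) (\<lambda>s. (deriv ^^ q) (\<lambda>t. \<psi> (?f (plane0 (s, t))) i) 0) 0"
    if "i < mdim (total B)" "p \<le> k" "q \<le> k" for i p q
    by (rule v(3)[OF d(2) fU that])
  show "vv_coord \<psi> Y i p q = (deriv ^^ (p + q)) (\<lambda>u. x (g u) i) 0" if "i < mdim (base B)" "p \<le> k" "q \<le> k" for i p q
  proof -
    have i: "i < mdim (total B)" using that(1) bb(4) by simp
    show ?thesis using that(1) higher_deriv_sum_arg[of p q "\<lambda>u. x (g u) i"] unfolding vc[OF i that(2,3)] co[OF i] by simp
  qed
  show "vv_coord \<psi> Y i p q =
      (deriv ^^ p) (\<lambda>s. (deriv ^^ q) (\<lambda>t. \<Sum>c<m. a i c (s + t) * monom2 (c div Suc k) (c mod Suc k) s t) 0) 0"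
    if "mdim (base B) \<le> i" "i < mdim (total B)" "p \<le> k" "q \<le> k" for i p q
    using that(1) unfolding vc[OF that(2-4)] co[OF that(2)] by simp
qed

lemma index_lt: "p \<le> k \<Longrightarrow> q \<le> k \<Longrightarrow> p * Suc k + q < m"
  using jet_index[of q "Suc k" p k] unfolding m by simp

lemma index_eq_iff: "q \<le> k \<Longrightarrow> p = c div Suc k \<and> q = c mod Suc k \<longleftrightarrow> c = p * Suc k + q"
proof
  assume "q \<le> k" "c = p * Suc k + q"
  then show "p = c div Suc k \<and> q = c mod Suc k"
    by (simp del: mult_Suc_right)
qed (simp add: div_mult_mod_eq del: mult_Suc_right)

text \<open>With constant coefficients \<open>r\<close> any array of lifted fibre coordinates can be
  attained. This is the universality of \<open>X0\<close> in the fibre direction.\<close>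

lemma double_deriv_index:
  assumes "p \<le> k" "q \<le> k"
  shows "(deriv ^^ p) (\<lambda>s. (deriv ^^ q) (\<lambda>t. \<Sum>c<m. r c * monom2 (c div Suc k) (c mod Suc k) s t) 0) 0
    = r (p * Suc k + q)"
proof -
  have "(\<Sum>c<m. if p = c div Suc k \<and> q = c mod Suc k then r c else 0)
    = (\<Sum>c<m. if c = p * Suc k + q then r c else 0)"
    by (intro sum.cong refl if_cong) (use index_eq_iff assms in auto)
  also have "\<dots> = r (p * Suc k + q)" using index_lt[OF assms] by (subst sum.delta) auto
  finally show ?thesis using double_deriv_monom2_sum[of "{..<m}"] by simp
qed

end

lemma sum_div_mod:
  fixes G :: "nat \<Rightarrow> nat \<Rightarrow> real"
  shows "(\<Sum>c<Suc k * Suc k. G (c div Suc k) (c mod Suc k)) = (\<Sum>p\<le>k. \<Sum>q\<le>k. G p q)"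
proof -
  let ?g = "\<lambda>c. G (c div Suc k) (c mod Suc k)"
  have "(\<Sum>c<Suc k * Suc k. ?g c) = (\<Sum>p<Suc k. sum ?g {p * Suc k..<p * Suc k + Suc k})"
    by (rule sum.nat_group[symmetric])
  also have "\<dots> = (\<Sum>p<Suc k. \<Sum>q<Suc k. G p q)"
  proof (rule sum.cong[OF refl])
    fix p
    have "sum ?g {p * Suc k..<p * Suc k + Suc k} = (\<Sum>q=0..<Suc k. ?g (q + p * Suc k))"
      using sum.shift_bounds_nat_ivl[of ?g 0 "p * Suc k" "Suc k"] by (simp only: add_0 add.commute)
    also have "\<dots> = (\<Sum>q=0..<Suc k. G p q)"
      by (rule sum.cong[OF refl]) (simp del: mult_Suc_right)
    finally show "sum ?g {p * Suc k..<p * Suc k + Suc k} = (\<Sum>q<Suc k. G p q)" by (simp only: atLeast0LessThan)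
  qed
  finally show ?thesis by (simp only: lessThan_Suc_atMost)
qed

lemma sum_square_triangle:
  fixes G :: "nat \<Rightarrow> nat \<Rightarrow> real"
  assumes "\<And>p q. p + q > k \<Longrightarrow> G p q = 0"
  shows "(\<Sum>p\<le>k. \<Sum>q\<le>k. G p q) = (\<Sum>l\<le>k. \<Sum>j\<le>l. G j (l - j))"
proof -
  have "(\<Sum>p\<le>k. \<Sum>q\<le>k. G p q) = (\<Sum>(p, q)\<in>{..k} \<times> {..k}. G p q)" by (rule sum.cartesian_product)
  also have "\<dots> = (\<Sum>(p, q)\<in>{(p, q). p + q \<le> k}. G p q)"
  proof (rule sum.mono_neutral_right)
    show "\<forall>i\<in>{..k} \<times> {..k} - {(p, q). p + q \<le> k}. (case i of (p, q) \<Rightarrow> G p q) = 0"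
      by clarsimp (metis assms linorder_not_le)
  qed auto
  also have "\<dots> = (\<Sum>l\<le>k. \<Sum>j\<le>l. G j (l - j))" by (rule sum.triangle_reindex_eq)
  finally show ?thesis .
qed

text \<open>Each step exchanges one order in the first index for one in the second at the cost of
  the factor -(q + 1)/(p + 1); the product of these factors is a signed binomial
  coefficient.\<close>

lemma antisymmetric_recursion:
  fixes C :: "nat \<Rightarrow> nat \<Rightarrow> real"
  assumes "\<And>p q. real (Suc p) * C (Suc p) q + real (Suc q) * C p (Suc q) = 0"
  shows "C p q = (-1) ^ p * real ((p + q) choose p) * C 0 (p + q)"
proof (induction p arbitrary: q)
  case (Suc p)
  have "real (Suc p) * C (Suc p) q = - (real (Suc q) * C p (Suc q))" using assms[of p q] by simp
  also have "\<dots> = - (real (Suc q) * ((-1) ^ p * real ((p + Suc q) choose p) * C 0 (p + Suc q)))"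
    by (simp only: Suc.IH)
  also have "\<dots> = (-1) ^ Suc p * (real (Suc q) * real (Suc (p + q) choose p)) * C 0 (Suc p + q)" by simp
  also have "real (Suc q) * real (Suc (p + q) choose p) = real (Suc p) * real (Suc (p + q) choose Suc p)"
    using Suc_times_binomial_add[of p q] by (metis of_nat_mult)
  finally have "real (Suc p) * C (Suc p) q = real (Suc p) * ((-1) ^ Suc p * real ((Suc p + q) choose Suc p) * C 0 (Suc p + q))"
    by (simp only: mult_ac add_Suc)
  then show ?case using mult_cancel_left[of "real (Suc p)"] of_nat_neq_0 by metis
qed simp

subsection \<open>The coefficients\<close>

context universal_vector
begin

lemma index_inj: "q \<le> k \<Longrightarrow> q' \<le> k \<Longrightarrow> p * Suc k + q = p' * Suc k + q' \<longleftrightarrow> p = p' \<and> q = q'"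
proof
  assume q: "q \<le> k" "q' \<le> k" and eq: "p * Suc k + q = p' * Suc k + q'"
  have "(p * Suc k + q) div Suc k = p" "(p * Suc k + q) mod Suc k = q" "(p' * Suc k + q') div Suc k = p'" "(p' * Suc k + q') mod Suc k = q'"
    using q by (simp_all del: mult_Suc_right)
  then show "p = p' \<and> q = q'" using eq by metis
qed simp

lemma F_naturality:
  assumes F: "functorial_morphism k F" and B: "vector_bundle B" and f: "vb_morphism model B f"
  shows "F B (semihol_map k B f X0) = f (F model X0)"
  using F vector_bundle_model B f X0_semihol unfolding functorial_morphism_def by blast

text \<open>The source of all equations for \<open>F model X0\<close>: two morphisms with the same
  effect on \<open>X0\<close> must agree on \<open>F model X0\<close>, although they may differ
  elsewhere. Base derivatives are compared up to order 2k because p + q can be that large.\<close>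

lemma model_map_agree:
  fixes B :: "('a, 'a) vbundle"
  assumes F: "functorial_morphism k F" and B: "vector_bundle B" and c: "vb_chart B U x \<psi>"
    and g: "\<And>u. g u \<in> U" "\<And>i. i < mdim (base B) \<Longrightarrow> smooth_R UNIV (\<lambda>u. x (g u) i)" and a: "\<And>i c. smooth_R UNIV (a i c)"
    and g': "\<And>u. g' u \<in> U" "\<And>i. i < mdim (base B) \<Longrightarrow> smooth_R UNIV (\<lambda>u. x (g' u) i)" and a': "\<And>i c. smooth_R UNIV (a' i c)"
    and e1: "\<And>i \<alpha>. i < mdim (base B) \<Longrightarrow> \<alpha> \<le> 2 * k \<Longrightarrow> (deriv ^^ \<alpha>) (\<lambda>u. x (g u) i) 0 = (deriv ^^ \<alpha>) (\<lambda>u. x (g' u) i) 0"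
    and e2: "\<And>i p q. mdim (base B) \<le> i \<Longrightarrow> i < mdim (total B) \<Longrightarrow> p \<le> k \<Longrightarrow> q \<le> k \<Longrightarrow>
      (deriv ^^ p) (\<lambda>s. (deriv ^^ q) (\<lambda>t. \<Sum>c<m. a i c (s + t) * monom2 (c div Suc k) (c mod Suc k) s t) 0) 0
      = (deriv ^^ p) (\<lambda>s. (deriv ^^ q) (\<lambda>t. \<Sum>c<m. a' i c (s + t) * monom2 (c div Suc k) (c mod Suc k) s t) 0) 0"
  shows "model_map B U x \<psi> g a (F model X0) = model_map B U x \<psi> g' a' (F model X0)"
proof -
  note M = model_map_X0[where a = a, OF B c g a] and M' = model_map_X0[where a = a', OF B c g' a']
  have "semihol_map k B (model_map B U x \<psi> g a) X0 = semihol_map k B (model_map B U x \<psi> g' a') X0"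
  proof (rule vv_eqI[OF vector_bundleD(1)[OF B] vb_chartD(2)[OF c] M(1,2) M'(1,2)])
    fix i p q assume i: "i < mdim (total B)" "p \<le> k" "q \<le> k"
    show "vv_coord \<psi> (semihol_map k B (model_map B U x \<psi> g a) X0) i p q = vv_coord \<psi> (semihol_map k B (model_map B U x \<psi> g' a') X0) i p q"
    proof (cases "i < mdim (base B)")
      case True
      then show ?thesis using M(3)[OF _ True i(2,3)] M'(3)[OF _ True i(2,3)] e1[OF True, of "p + q"] i by simp
    next
      case False
      then have n: "mdim (base B) \<le> i" by simp
      show ?thesis by (rule trans[OF M(4)[OF _ n i] trans[OF e2[OF n i] M'(4)[OF _ n i, symmetric]]])
    qed
  qed
  moreover have "vb_morphism model B (model_map B U x \<psi> g a)" by (rule vb_morphism_model_map[OF B c g a])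
  moreover have "vb_morphism model B (model_map B U x \<psi> g' a')" by (rule vb_morphism_model_map[OF B c g' a'])
  ultimately show ?thesis using F_naturality[OF F B] by metis
qed

lemma \<kappa>_model_map:
  assumes "\<And>u. g u \<in> pts (base model)"
  shows "\<kappa> (model_map model (pts (base model)) \<kappa> \<kappa> g a e) 0 = \<kappa> (g (\<kappa> e 0)) 0"
    "c < m \<Longrightarrow> \<kappa> (model_map model (pts (base model)) \<kappa> \<kappa> g a e) (Suc c) = (\<Sum>c'<m. a (Suc c) c' (\<kappa> e 0) * \<kappa> e (Suc c'))"
  using vb_point_props(2)[OF vector_bundle_model vb_chart_model assms] by (simp_all add: model_map_def mdim_model)

lemma F_X0_base:
  assumes F: "functorial_morphism k F"
  shows "\<kappa> (F model X0) 0 = 0"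
proof -
  \<comment> \<open>2k + 1 is the first exponent that leaves the 2k-jet untouched. The matrices are
    taken to be zero, so the resulting equation concerns base points only.\<close>
  let ?g = "\<lambda>u. curve0 (u + u ^ Suc (2 * k) * 1)"
  have sm: "smooth_R UNIV (\<lambda>u. \<kappa> (?g u) i)" if "i < mdim (base model)" for i
    using that smooth_R_add[OF open_UNIV smooth_R_ident smooth_R_power[OF open_UNIV smooth_R_ident]]
    by (simp add: mdim_model curve0 del: power_Suc)
  have "model_map model (pts (base model)) \<kappa> \<kappa> ?g (\<lambda>_ _ _. 0) (F model X0)
    = model_map model (pts (base model)) \<kappa> \<kappa> curve0 (\<lambda>_ _ _. 0) (F model X0)"
  proof (rule model_map_agree[OF F vector_bundle_model vb_chart_model])
    fix i \<alpha> assume i: "i < mdim (base model)" "\<alpha> \<le> 2 * k"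
    show "(deriv ^^ \<alpha>) (\<lambda>u. \<kappa> (?g u) i) 0 = (deriv ^^ \<alpha>) (\<lambda>u. \<kappa> (curve0 u) i) 0"
      by (rule higher_deriv_reparam[OF open_UNIV smooth_R_curve0[OF i(1)] UNIV_I smooth_R_const]) (use i in simp)
  qed (rule curve0(1) sm smooth_R_curve0 smooth_R_const refl | assumption)+
  from arg_cong[OF this, where f = "\<lambda>e. \<kappa> e 0"]
  have "\<kappa> (?g (\<kappa> (F model X0) 0)) 0 = \<kappa> (curve0 (\<kappa> (F model X0) 0)) 0"
    unfolding \<kappa>_model_map(1)[OF curve0(1)] .
  then have "\<kappa> (F model X0) 0 ^ Suc (2 * k) = 0" by (simp add: curve0 del: power_Suc)
  then show ?thesis by (simp del: power_Suc)
qed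

text \<open>Extended by 0 outside the square of indices, so that the recursion holds without
  restriction. The closed formula then makes \<open>coeff F p q\<close> a multiple of
  \<open>coeff F 0 (p + q)\<close>, which is 0 for p + q > k.\<close>

definition coeff :: "(('a, 'a) vbundle \<Rightarrow> 'a vv \<Rightarrow> 'a) \<Rightarrow> nat \<Rightarrow> nat \<Rightarrow> real" where
  "coeff F p q = (if p \<le> k \<and> q \<le> k then \<kappa> (F model X0) (Suc (p * Suc k + q)) else 0)"

text \<open>The two sides come from the two bundle maps \<open>(u, w) \<mapsto> u w\<^sub>\<beta>\<^sub>\<gamma>\<close> and
  \<open>(u, w) \<mapsto> (\<beta> + 1) w\<^sub>\<beta>\<^sub>+\<^sub>1\<^sub>,\<^sub>\<gamma> + (\<gamma> + 1) w\<^sub>\<beta>\<^sub>,\<^sub>\<gamma>\<^sub>+\<^sub>1\<close>, which agree on the universal vector.\<close>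

lemma coeff_recursion:
  assumes F: "functorial_morphism k F"
  shows "real (Suc \<beta>) * coeff F (Suc \<beta>) \<gamma> + real (Suc \<gamma>) * coeff F \<beta> (Suc \<gamma>) = 0"
proof (cases "\<beta> \<le> k \<and> \<gamma> \<le> k")
  case False
  then show ?thesis by (auto simp: coeff_def)
next
  case True
  then have \<beta>: "\<beta> \<le> k" and \<gamma>: "\<gamma> \<le> k" by auto
  let ?V = "pts (base model)" and ?F0 = "F model X0"
  have m1: "0 < m" by (simp add: m)
  \<comment> \<open>Both endomorphisms map into the first fibre coordinate, at index
    \<open>Suc 0\<close>, and send everything else to 0: one scalar equation is all that is
    wanted.\<close>
  define a :: "nat \<Rightarrow> nat \<Rightarrow> real \<Rightarrow> real" where "a i c u = (if i = Suc 0 \<and> c = \<beta> * Suc k + \<gamma> then u else 0)" for i c u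
  \<comment> \<open>The guards drop a monomial with exponent k + 1. Derivatives of order at most k
    in each variable do not see it, and \<open>coeff\<close> vanishes there.\<close>
  define r :: "nat \<Rightarrow> real" where "r c = (if \<beta> < k \<and> c = Suc \<beta> * Suc k + \<gamma> then real (Suc \<beta>) else 0)
      + (if \<gamma> < k \<and> c = \<beta> * Suc k + Suc \<gamma> then real (Suc \<gamma>) else 0)" for c
  define a' :: "nat \<Rightarrow> nat \<Rightarrow> real \<Rightarrow> real" where "a' i c u = (if i = Suc 0 then r c else 0)" for i c u
  have sa: "smooth_R UNIV (a i c)" for i c
    using smooth_R_ident smooth_R_const[of UNIV 0] by (cases "i = Suc 0 \<and> c = \<beta> * Suc k + \<gamma>") (auto simp: a_def[abs_def] simp del: mult_Suc_right)
  have sa': "smooth_R UNIV (a' i c)" for i c unfolding a'_def by (rule smooth_R_const)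
  have "model_map model ?V \<kappa> \<kappa> curve0 a ?F0 = model_map model ?V \<kappa> \<kappa> curve0 a' ?F0"
  proof (rule model_map_agree[OF F vector_bundle_model vb_chart_model])
    fix i p q assume i: "mdim (base model) \<le> i" "i < mdim (total model)" and p: "p \<le> k" and q: "q \<le> k"
    show "(deriv ^^ p) (\<lambda>s. (deriv ^^ q) (\<lambda>t. \<Sum>c<m. a i c (s + t) * monom2 (c div Suc k) (c mod Suc k) s t) 0) 0
      = (deriv ^^ p) (\<lambda>s. (deriv ^^ q) (\<lambda>t. \<Sum>c<m. a' i c (s + t) * monom2 (c div Suc k) (c mod Suc k) s t) 0) 0"
    proof (cases "i = Suc 0")
      case False then show ?thesis by (simp add: a_def a'_def)
    next
      case i1: True
      have "(\<Sum>c<m. a i c (s + t) * monom2 (c div Suc k) (c mod Suc k) s t)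
         = (\<Sum>j\<in>{0, 1::nat}. (if j = 0 then real (Suc \<beta>) else real (Suc \<gamma>)) * monom2 (if j = 0 then Suc \<beta> else \<beta>) (if j = 0 then \<gamma> else Suc \<gamma>) s t)" for s t
      proof -
        have "(\<Sum>c<m. a i c (s + t) * monom2 (c div Suc k) (c mod Suc k) s t)
          = (\<Sum>c<m. if c = \<beta> * Suc k + \<gamma> then (s + t) * monom2 \<beta> \<gamma> s t else 0)"
          by (rule sum.cong[OF refl]) (use \<gamma> in \<open>auto simp: a_def i1 simp del: mult_Suc_right\<close>)
        also have "\<dots> = (s + t) * monom2 \<beta> \<gamma> s t"
          using index_lt[OF \<beta> \<gamma>] by (subst sum.delta) auto
        finally show ?thesis by (simp add: monom2_sum_arg del: of_nat_Suc)
      qed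
      then have "(deriv ^^ p) (\<lambda>s. (deriv ^^ q) (\<lambda>t. \<Sum>c<m. a i c (s + t) * monom2 (c div Suc k) (c mod Suc k) s t) 0) 0
        = (\<Sum>j\<in>{0, 1::nat}. if p = (if j = 0 then Suc \<beta> else \<beta>) \<and> q = (if j = 0 then \<gamma> else Suc \<gamma>)
            then (if j = 0 then real (Suc \<beta>) else real (Suc \<gamma>)) else 0)"
        by (simp only:) (rule double_deriv_monom2_sum, simp)
      also have "\<dots> = r (p * Suc k + q)"
      proof -
        have "\<beta> < k \<and> p * Suc k + q = Suc \<beta> * Suc k + \<gamma> \<longleftrightarrow> p = Suc \<beta> \<and> q = \<gamma>"
          using index_inj[OF q \<gamma>, of p "Suc \<beta>"] p by auto
        moreover have "\<gamma> < k \<and> p * Suc k + q = \<beta> * Suc k + Suc \<gamma> \<longleftrightarrow> p = \<beta> \<and> q = Suc \<gamma>"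
          using index_inj[OF q, of "Suc \<gamma>" p \<beta>] q by (cases "\<gamma> < k") auto
        ultimately show ?thesis unfolding r_def by simp
      qed
      also have "\<dots> = (deriv ^^ p) (\<lambda>s. (deriv ^^ q) (\<lambda>t. \<Sum>c<m. a' i c (s + t) * monom2 (c div Suc k) (c mod Suc k) s t) 0) 0"
        using double_deriv_index[OF p q, of r] by (simp add: a'_def i1)
      finally show ?thesis .
    qed
  qed (rule curve0(1) smooth_R_curve0 sa sa' refl | assumption)+
  from arg_cong[OF this, where f = "\<lambda>e. \<kappa> e (Suc 0)"]
  have E1: "(\<Sum>c<m. a (Suc 0) c (\<kappa> ?F0 0) * \<kappa> ?F0 (Suc c)) = (\<Sum>c<m. a' (Suc 0) c (\<kappa> ?F0 0) * \<kappa> ?F0 (Suc c))"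
    unfolding \<kappa>_model_map(2)[OF curve0(1) m1] .
  \<comment> \<open>The matrix entry is multiplication by the base coordinate, which is 0 at
    \<open>F model X0\<close>.\<close>
  have E2: "(\<Sum>c<m. a (Suc 0) c (\<kappa> ?F0 0) * \<kappa> ?F0 (Suc c)) = 0"
    by (simp add: a_def F_X0_base[OF F])
  have E3: "(\<Sum>c<m. a' (Suc 0) c (\<kappa> ?F0 0) * \<kappa> ?F0 (Suc c)) = real (Suc \<beta>) * coeff F (Suc \<beta>) \<gamma> + real (Suc \<gamma>) * coeff F \<beta> (Suc \<gamma>)"
  proof -
    have "(\<Sum>c<m. a' (Suc 0) c (\<kappa> ?F0 0) * \<kappa> ?F0 (Suc c))
      = (\<Sum>c<m. if c = Suc \<beta> * Suc k + \<gamma> then real (Suc \<beta>) * coeff F (Suc \<beta>) \<gamma> else 0)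
        + (\<Sum>c<m. if c = \<beta> * Suc k + Suc \<gamma> then real (Suc \<gamma>) * coeff F \<beta> (Suc \<gamma>) else 0)"
      unfolding sum.distrib[symmetric]
    proof (rule sum.cong[OF refl])
      fix c
      show "a' (Suc 0) c (\<kappa> ?F0 0) * \<kappa> ?F0 (Suc c)
        = (if c = Suc \<beta> * Suc k + \<gamma> then real (Suc \<beta>) * coeff F (Suc \<beta>) \<gamma> else 0)
        + (if c = \<beta> * Suc k + Suc \<gamma> then real (Suc \<gamma>) * coeff F \<beta> (Suc \<gamma>) else 0)"
        using \<beta> \<gamma> by (auto simp: a'_def r_def coeff_def distrib_right simp del: mult_Suc mult_Suc_right of_nat_Suc)
    qed
    also have "(\<Sum>c<m. if c = Suc \<beta> * Suc k + \<gamma> then real (Suc \<beta>) * coeff F (Suc \<beta>) \<gamma> else 0) = real (Suc \<beta>) * coeff F (Suc \<beta>) \<gamma>"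
      using index_lt[of "Suc \<beta>" \<gamma>] \<gamma> by (subst sum.delta) (auto simp: coeff_def simp del: mult_Suc mult_Suc_right)
    also have "(\<Sum>c<m. if c = \<beta> * Suc k + Suc \<gamma> then real (Suc \<gamma>) * coeff F \<beta> (Suc \<gamma>) else 0) = real (Suc \<gamma>) * coeff F \<beta> (Suc \<gamma>)"
      using index_lt[of \<beta> "Suc \<gamma>"] \<beta> by (subst sum.delta) (auto simp: coeff_def simp del: mult_Suc mult_Suc_right)
    finally show ?thesis .
  qed
  show ?thesis by (rule trans[OF E3[symmetric] trans[OF E1[symmetric] E2]])
qed

text \<open>A morphism \<open>?f\<close> with \<open>semihol_map k B ?f X0 = X\<close> reduces
  \<open>F B X\<close> to \<open>?f (F model X0)\<close>. Its base map is a global extension of the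
  curve germ below \<open>X\<close>, and its matrix entries are the lifted fibre coordinates of
  \<open>X\<close>. As \<open>F model X0\<close> lies over 0, the base point of \<open>F B X\<close>
  is the value of that curve at 0; the closed form of the coefficients turns the fibre coordinates
  into the alternating sums.\<close>

lemma F_coord:
  assumes F: "functorial_morphism k F" and B: "vector_bundle B" and X: "X \<in> semihol_set k B"
    and c: "vb_chart B U x \<psi>" and U: "rep (semihol_proj k B X) 0 \<in> U"
  shows "F B X \<in> over B {rep (semihol_proj k B X) 0}"
    and "\<And>i. mdim (base B) \<le> i \<Longrightarrow> i < mdim (total B) \<Longrightarrow>
      \<psi> (F B X) i = (\<Sum>l\<le>k. coeff F 0 l * (\<Sum>j\<le>l. (-1) ^ j * real (l choose j) * vv_coord \<psi> X i j (l - j)))"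
proof -
  let ?M = "base B" and ?F0 = "F model X0"
  define v where "v = semihol_proj k B X"
  define \<gamma> where "\<gamma> = rep v"
  note d = vb_chartD[OF c] and bb = vector_bundleD[OF B] and sD = semihol_setD[OF B X]
  have \<gamma>U: "\<gamma> 0 \<in> U" using U by (simp add: \<gamma>_def v_def)
  have \<gamma>s: "smooth_near line 0 ?M \<gamma>" using sD(2) T_dom_rep(1) unfolding pts_T_mfd \<gamma>_def v_def by metis
  obtain S where S: "open S" "0 \<in> S" "\<gamma> ` S \<subseteq> U" "\<And>i. i<mdim ?M \<Longrightarrow> smooth_R S (\<lambda>t. x (\<gamma> t) i)"
    using \<gamma>s smooth_near_line_iff[of ?M U x \<gamma>, OF bb(2) d(1) \<gamma>U] by metis
  obtain e where e: "e > 0" "\<And>t. \<bar>t\<bar> < e \<Longrightarrow> t \<in> S"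
    using S(1,2) unfolding open_dist by (auto simp: dist_real_def)
  obtain h where h: "smooth_R UNIV h" "\<And>u. \<bar>u + u ^ Suc (2 * k) * h u\<bar> < e" by (rule bounded_reparam[OF e(1)]) (rule that)
  define \<rho> where "\<rho> u = u + u ^ Suc (2 * k) * h u" for u
  have \<rho>S: "\<rho> u \<in> S" for u unfolding \<rho>_def by (rule e(2)[OF h(2)])
  have \<rho>s: "smooth_R UNIV \<rho>"
    unfolding \<rho>_def by (intro smooth_R_add smooth_R_mult smooth_R_power smooth_R_ident open_UNIV h(1))
  \<comment> \<open>Defined on the whole line with values in \<open>U\<close>, and with the same
    derivatives at 0 as \<open>\<gamma>\<close> up to order 2k, which is all that is needed to
    recover the base part of \<open>X\<close>.\<close>
  define g where "g u = \<gamma> (\<rho> u)" for u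
  define a :: "nat \<Rightarrow> nat \<Rightarrow> real \<Rightarrow> real" where "a i c u = vv_coord \<psi> X i (c div Suc k) (c mod Suc k)" for i c u
  have g: "g u \<in> U" for u using \<rho>S S(3) by (auto simp: g_def)
  have gs: "smooth_R UNIV (\<lambda>u. x (g u) i)" if i: "i < mdim ?M" for i
  proof -
    have o: "openin (Euclidean_space (Suc 0)) (line_coord ` S)" using S(1) by (simp add: openin_line_coord_image)
    have "smooth_R UNIV (\<lambda>u. x (\<gamma> (line_coord (\<rho> u) 0)) i)"
      by (rule smooth_R_compose[OF open_UNIV o Cinf_on_smooth_R[OF S(1) S(4)[OF i]], where a = "\<lambda>u. line_coord (\<rho> u)"])
        (use \<rho>s \<rho>S in auto)
    then show ?thesis by (simp add: g_def)
  qed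
  have as: "smooth_R UNIV (a i c)" for i c unfolding a_def by (rule smooth_R_const)
  note M = model_map_X0[where a = a, OF B c g gs as]
  let ?f = "model_map B U x \<psi> g a"
  have XU: "vv_base X \<in> over B U" using vv_base_pts[OF sD(1)] sD(3) U by (simp add: over_iff)
  have "semihol_map k B ?f X0 = X"
  proof (rule vv_eqI[OF bb(1) d(2) M(1,2) sD(1) XU])
    fix i p q assume i: "i < mdim (total B)" "p \<le> k" "q \<le> k"
    show "vv_coord \<psi> (semihol_map k B ?f X0) i p q = vv_coord \<psi> X i p q"
    proof (cases "i < mdim ?M")
      case True
      have "vv_coord \<psi> (semihol_map k B ?f X0) i p q = (deriv ^^ (p + q)) (\<lambda>u. x (g u) i) 0" by (rule M(3)[OF _ True i(2,3)])
      also have "\<dots> = (deriv ^^ (p + q)) (\<lambda>u. x (\<gamma> u) i) 0"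
        unfolding g_def \<rho>_def
        by (rule higher_deriv_reparam[OF S(1) S(4)[OF True] S(2) h(1)]) (use i in simp)
      also have "\<dots> = vv_coord (\<lambda>e. x (vproj B e)) X i p q"
        unfolding \<gamma>_def v_def by (rule sD(4)[OF d(1) U True i(2,3), symmetric])
      also have "\<dots> = vv_coord \<psi> X i p q"
        by (rule vv_coord_vproj[OF B c sD(1) _ True, symmetric]) (simp add: sD(3) U)
      finally show ?thesis .
    next
      case False
      then have n: "mdim ?M \<le> i" by simp
      have pq: "(p * Suc k + q) div Suc k = p" "(p * Suc k + q) mod Suc k = q" using i(3) by (simp_all del: mult_Suc_right)
      show ?thesis by (rule trans[OF M(4)[OF _ n i]]) (simp_all only: a_def double_deriv_index[OF i(2,3)] pq)
    qed
  qed
  moreover have "vb_morphism model B ?f" by (rule vb_morphism_model_map[OF B c g gs as])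
  ultimately have FX: "F B X = ?f ?F0" using F_naturality[OF F B] by metis
  have g0: "g (\<kappa> ?F0 0) = rep (semihol_proj k B X) 0" by (simp add: F_X0_base[OF F] g_def \<rho>_def \<gamma>_def v_def)
  show "F B X \<in> over B {rep (semihol_proj k B X) 0}"
    using vb_point_props(1)[OF B c g] unfolding FX model_map_def g0[symmetric] .
  fix i assume i: "mdim ?M \<le> i" "i < mdim (total B)"
  let ?V = "\<lambda>p q. vv_coord \<psi> X i p q"
  have C: "coeff F p q = (-1) ^ p * real ((p + q) choose p) * coeff F 0 (p + q)" for p q
    by (rule antisymmetric_recursion) (rule coeff_recursion[OF F])
  have "\<psi> (F B X) i = (\<Sum>c<m. a i c (\<kappa> ?F0 0) * \<kappa> ?F0 (Suc c))"
    unfolding FX model_map_def vb_point_props(2)[OF B c g] using i by simp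
  also have "\<dots> = (\<Sum>c<m. ?V (c div Suc k) (c mod Suc k) * coeff F (c div Suc k) (c mod Suc k))"
  proof (rule sum.cong[OF refl])
    fix c assume "c \<in> {..<m}"
    then have "c div Suc k \<le> k" "c mod Suc k \<le> k"
      unfolding m by (auto simp: less_mult_imp_div_less less_Suc_eq_le[symmetric] simp del: mult_Suc mult_Suc_right)
    moreover have "c div Suc k * Suc k + c mod Suc k = c" by (rule div_mult_mod_eq)
    ultimately show "a i c (\<kappa> ?F0 0) * \<kappa> ?F0 (Suc c) = ?V (c div Suc k) (c mod Suc k) * coeff F (c div Suc k) (c mod Suc k)"
      by (simp add: a_def coeff_def del: mult_Suc_right)
  qed
  also have "\<dots> = (\<Sum>p\<le>k. \<Sum>q\<le>k. ?V p q * coeff F p q)" unfolding m by (rule sum_div_mod)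
  also have "\<dots> = (\<Sum>l\<le>k. \<Sum>j\<le>l. ?V j (l - j) * coeff F j (l - j))"
  proof (rule sum_square_triangle)
    \<comment> \<open>\<open>coeff F p q\<close> is proportional to
      \<open>coeff F 0 (p + q)\<close>, whose second index lies outside the square; this leaves only
      the triangle of total order at most k.\<close>
    fix p q assume "p + q > k"
    then show "?V p q * coeff F p q = 0" by (subst C) (simp add: coeff_def)
  qed
  also have "\<dots> = (\<Sum>l\<le>k. coeff F 0 l * (\<Sum>j\<le>l. (-1) ^ j * real (l choose j) * ?V j (l - j)))"
    unfolding sum_distrib_left
  proof (intro sum.cong refl)
    fix l j :: nat assume "j \<in> {..l}"
    then have "j + (l - j) = l" by simp
    then show "?V j (l - j) * coeff F j (l - j) = coeff F 0 l * ((-1) ^ j * real (l choose j) * ?V j (l - j))"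
      by (subst C) (simp add: mult_ac)
  qed
  finally show "\<psi> (F B X) i = (\<Sum>l\<le>k. coeff F 0 l * (\<Sum>j\<le>l. (-1) ^ j * real (l choose j) * ?V j (l - j)))" .
qed

end

lemma Upsilon_combination_coord:
  fixes r :: "nat \<Rightarrow> real"
  assumes B: "vector_bundle B" and X: "X \<in> semihol_set k B" and c: "vb_chart B U x \<psi>"
    and U: "rep (semihol_proj k B X) 0 \<in> U"
  defines "R \<equiv> fibre_sum B (\<lambda>l. vscale B (r l) (Upsilon l B (trunc2 l l (total B) X))) k"
  shows "R \<in> over B {rep (semihol_proj k B X) 0}"
    and "\<And>i. mdim (base B) \<le> i \<Longrightarrow> i < mdim (total B) \<Longrightarrow>
      \<psi> R i = (\<Sum>l\<le>k. r l * (\<Sum>j\<le>l. (-1) ^ j * real (l choose j) * vv_coord \<psi> X i j (l - j)))"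
proof -
  let ?p = "rep (semihol_proj k B X) 0"
  note d = vb_chartD[OF c] and bb = vector_bundleD[OF B] and sD = semihol_setD[OF B X]
  have XU: "vv_base X \<in> over B U" using vv_base_pts[OF sD(1)] sD(3) U by (simp add: over_iff)
  have Y: "Upsilon l B (trunc2 l l (total B) X) \<in> over B {?p}"
    "\<And>i. mdim (base B) \<le> i \<Longrightarrow> i < mdim (total B) \<Longrightarrow> \<psi> (Upsilon l B (trunc2 l l (total B) X)) i
      = (\<Sum>j\<le>l. (-1) ^ j * real (l choose j) * vv_coord \<psi> X i j (l - j))" if l: "l \<le> k" for l
  proof -
    note t = trunc2_semihol[OF B X l]
    note u = Upsilon_coord[OF B t(1) c, unfolded t(3), OF U]
    show "Upsilon l B (trunc2 l l (total B) X) \<in> over B {?p}" by (rule u(1))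
    fix i assume i: "mdim (base B) \<le> i" "i < mdim (total B)"
    show "\<psi> (Upsilon l B (trunc2 l l (total B) X)) i = (\<Sum>j\<le>l. (-1) ^ j * real (l choose j) * vv_coord \<psi> X i j (l - j))"
      unfolding u(2)[OF i]
      by (intro sum.cong refl arg_cong2[where f = times] trunc2_props(3)[OF bb(1) sD(1) l l d(2) XU i(2)]) auto
  qed
  have o: "vscale B (r l) (Upsilon l B (trunc2 l l (total B) X)) \<in> over B {?p}" if "l \<le> k" for l
    by (rule fibre_ops(2)[OF B Y(1)[OF that]])
  show "R \<in> over B {?p}" unfolding R_def by (rule fibre_sum_over[OF B o])
  fix i assume i: "mdim (base B) \<le> i" "i < mdim (total B)"
  show "\<psi> R i = (\<Sum>l\<le>k. r l * (\<Sum>j\<le>l. (-1) ^ j * real (l choose j) * vv_coord \<psi> X i j (l - j)))"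
    unfolding R_def
    by (rule trans[OF fibre_sum_coord[OF B c U i(1) o] sum.cong[OF refl]]) (simp_all add: fibre_ops_coord(2)[OF c U i(1) Y(1)] Y(2)[OF _ i])
qed

section \<open>Small ambient types and the conclusion\<close>

subsection \<open>The ambient type\<close>

text \<open>The real plane and the real line are equinumerous. Hence a type can carry the model as
  soon as it contains a copy of the reals.\<close>

lemma ex_inj_Euclidean_space: "\<exists>\<iota> :: (nat \<Rightarrow> real) \<Rightarrow> real. inj_on \<iota> (topspace (Euclidean_space n))"
proof (induction n)
  case 0
  have "inj_on (\<lambda>_. 0 :: real) (topspace (Euclidean_space 0))"
    by (auto simp: inj_on_def topspace_Euclidean_space fun_eq_iff)
  then show ?case by blast
next
  case (Suc n)
  then obtain \<iota> :: "(nat \<Rightarrow> real) \<Rightarrow> real" where \<iota>: "inj_on \<iota> (topspace (Euclidean_space n))" by blast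
  have "(card_of (UNIV \<times> UNIV :: (real \<times> real) set), card_of (UNIV :: real set)) \<in> ordIso"
    by (rule card_of_Times_same_infinite) (rule infinite_UNIV_char_0)
  then obtain h :: "real \<times> real \<Rightarrow> real" where h: "bij_betw h (UNIV \<times> UNIV) UNIV"
    using card_of_ordIso by blast
  have "inj_on (\<lambda>x. h (\<iota> (x(n := 0)), x n)) (topspace (Euclidean_space (Suc n)))"
  proof (rule inj_onI)
    fix x y assume x: "x \<in> topspace (Euclidean_space (Suc n))" and y: "y \<in> topspace (Euclidean_space (Suc n))"
      and eq: "h (\<iota> (x(n := 0)), x n) = h (\<iota> (y(n := 0)), y n)"
    have "inj h" using h by (simp add: bij_betw_def)
    then have "\<iota> (x(n := 0)) = \<iota> (y(n := 0))" and n: "x n = y n" using eq by (auto dest: injD)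
    moreover have "x(n := 0) \<in> topspace (Euclidean_space n)" "y(n := 0) \<in> topspace (Euclidean_space n)"
      using x y by (auto simp: topspace_Euclidean_space)
    ultimately have "x(n := 0) = y(n := 0)" using \<iota> by (auto dest: inj_onD)
    then show "x = y" using n by (metis fun_upd_triv fun_upd_upd)
  qed
  then show ?case by blast
qed

text \<open>A chart image of positive dimension contains a segment, hence a copy of the reals.
  Contrapositively, in a type without such a copy every nonempty manifold has dimension 0.\<close>

lemma chart_inj_real:
  fixes N :: "'a mfd"
  assumes c: "smooth_chart N (U, \<psi>)" and p: "p \<in> U" and n: "mdim N > 0"
  shows "\<exists>\<theta> :: real \<Rightarrow> 'a. inj \<theta>"
proof -
  have z: "\<psi> p \<in> \<psi> ` U" using p by simp
  obtain e where e: "e > 0"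
    "\<forall>y \<in> topspace (Euclidean_space (mdim N)). (\<forall>i<mdim N. \<bar>y i - \<psi> p i\<bar> < e) \<longrightarrow> y \<in> \<psi> ` U"
    using openin_Euclidean_space_boxD[OF smooth_chartD(3)[OF c] z] by (elim exE conjE) (rule that)
  \<comment> \<open>\<open>arctan\<close> compresses the line into an interval; since its values are
    smaller than 2 in modulus, the factor e/2 keeps the first coordinate inside the box.\<close>
  define y where "y t = (\<psi> p)(0 := \<psi> p 0 + e / 2 * arctan t)" for t
  have yU: "y t \<in> \<psi> ` U" for t
  proof (rule e(2)[rule_format])
    show "y t \<in> topspace (Euclidean_space (mdim N))"
      using chart_topspace[OF c p] n by (auto simp: y_def topspace_Euclidean_space)
    have "\<bar>arctan t\<bar> < 2" using arctan_bounded[of t] pi_less_4 by (simp add: abs_less_iff)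
    then have "\<bar>e / 2 * arctan t\<bar> < e" using e(1) by (simp add: abs_mult)
    then show "\<bar>y t i - \<psi> p i\<bar> < e" for i using e(1) by (simp add: y_def)
  qed
  have "inj (\<lambda>t. inv_into U \<psi> (y t))"
  proof (rule injI)
    fix s t assume "inv_into U \<psi> (y s) = inv_into U \<psi> (y t)"
    then have "y s = y t" using inv_into_injective[OF _ yU yU] by blast
    then have "y s 0 = y t 0" by simp
    then show "s = t" using e(1) by (simp add: y_def arctan_eq_iff)
  qed
  then show ?thesis by blast
qed

lemma smooth_map_const_mdim_0:
  assumes N: "smooth_atlas N" and P: "smooth_atlas P" and q: "q \<in> pts P" and d: "mdim P = 0"
  shows "smooth_map N P (\<lambda>_. q)"
  unfolding smooth_map_def
proof (rule smooth_onI[OF N P open_in_pts[OF N]])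
  fix p assume "p \<in> pts N"
  then obtain U \<phi> where U: "(U, \<phi>) \<in> atlas N" "p \<in> U" by (rule ptsE)
  obtain V \<psi> where V: "(V, \<psi>) \<in> atlas P" "q \<in> V" by (rule ptsE[OF q])
  note c = smooth_atlasD[OF N U(1)] and c' = smooth_atlasD[OF P V(1)]
  have "smooth_in_charts N P U (U, \<phi>) (V, \<psi>) (\<lambda>_. q)"
    using open_in_chart_dom[OF N c] V(2) d by (auto simp: smooth_in_charts_def)
  then show "\<exists>U \<phi> V \<psi> W'. smooth_chart N (U, \<phi>) \<and> smooth_chart P (V, \<psi>) \<and> p \<in> W' \<and>
      smooth_in_charts N P W' (U, \<phi>) (V, \<psi>) (\<lambda>_. q)"
    using c c' U(2) by blast
qed

lemma semihol_base_pts: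
  assumes E: "vector_bundle E" and X: "X \<in> semihol_set k E"
  shows "rep (semihol_proj k E X) 0 \<in> pts (base E)"
  using smooth_map_image[OF vector_bundleD(3)[OF E] vv_base_pts[OF semihol_setD(1)[OF E X]]] semihol_setD(3)[OF E X]
  by simp

text \<open>The fibre through the base point of \<open>X\<close> consists of that point alone, so
  the constant map to it is a morphism. It fixes \<open>X\<close>, as there are no coordinates to
  compare, and naturality forces \<open>F E X\<close> to be its value.\<close>

lemma F_mdim_0:
  fixes E :: "('a, 'a) vbundle"
  assumes F: "functorial_morphism k F" and E: "vector_bundle E" and X: "X \<in> semihol_set k E"
    and d: "mdim (total E) = 0"
  shows "F E X \<in> over E {rep (semihol_proj k E X) 0}"
proof -
  note bb = vector_bundleD[OF E] and sD = semihol_setD[OF E X]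
  let ?p = "rep (semihol_proj k E X) 0" and ?e = "vv_base X"
  have d0: "mdim (base E) = 0" using bb(4) d by simp
  have ep: "?e \<in> pts (total E)" by (rule vv_base_pts[OF sD(1)])
  have pp: "?p \<in> pts (base E)" by (rule semihol_base_pts[OF E X])
  obtain U x \<psi> where U: "?p \<in> U" and c: "vb_chart E U x \<psi>" by (rule vector_bundle_chart[OF E pp])
  have e: "?e \<in> over E {?p}" using ep sD(3) by (simp add: over_iff)
  have eq: "e' = ?e" if "e' \<in> over E {?p}" for e'
    by (rule fibre_eqI[OF E c U that e]) (use d in simp)
  let ?f = "\<lambda>_. ?e"
  have sf: "smooth_map (total E) (total E) ?f" by (rule smooth_map_const_mdim_0[OF bb(1,1) ep d])
  have f: "vb_morphism E E ?f"
    unfolding vb_morphism_def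
  proof (intro conjI ballI impI allI exI[of _ "\<lambda>_. ?p"])
    show "smooth_map (base E) (base E) (\<lambda>_. ?p)" by (rule smooth_map_const_mdim_0[OF bb(2,2) pp d0])
    show "?e = vadd E ?e ?e" by (rule eq[symmetric]) (rule fibre_ops(1)[OF E e e])
    show "?e = vscale E r ?e" for r by (rule eq[symmetric]) (rule fibre_ops(2)[OF E e])
  qed (rule sf sD(3))+
  note t = TT_map_props[OF bb(1,1) sf sD(1)]
  have eU: "?e \<in> over E U" using ep U sD(3) by (simp add: over_iff)
  have "semihol_map k E ?f X = X"
    unfolding semihol_map_def
    by (rule vv_eqI[OF bb(1) vb_chartD(2)[OF c] t(1) _ sD(1) eU]) (use t(2) eU d in simp_all)
  moreover have "F E (semihol_map k E ?f X) = ?e"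
    using F E f X pts_semihol[OF E] unfolding functorial_morphism_def by blast
  ultimately show ?thesis using e by simp
qed

theorem lemma3p4:
  fixes k :: nat
    and F :: "('a, 'a) vbundle \<Rightarrow> 'a vv \<Rightarrow> 'a"
    and E :: "('a, 'a) vbundle"
  assumes "functorial_morphism k F"
    and "vector_bundle E"
    and "connected_space (mtop (base E))"
  shows "\<exists>c :: nat \<Rightarrow> real. \<forall>X \<in> pts (total (semihol k E)).
    F E X = fibre_sum E (\<lambda>l. vscale E (c l) (Upsilon l E (trunc2 l l (total E) X))) k"
proof (rule exE)
  note F = assms(1) and E = assms(2)
  note bb = vector_bundleD[OF E]
  \<comment> \<open>The coefficients are first found in coordinates, with a formula valid in every
    chart; the comparison with the combination of the morphisms \<open>Upsilon\<close> is then made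
    once for both cases.\<close>
  show "\<exists>c :: nat \<Rightarrow> real. \<forall>X \<in> semihol_set k E. F E X \<in> over E {rep (semihol_proj k E X) 0} \<and>
    (\<forall>U x \<psi> i. vb_chart E U x \<psi> \<and> rep (semihol_proj k E X) 0 \<in> U \<and> mdim (base E) \<le> i \<and> i < mdim (total E) \<longrightarrow>
      \<psi> (F E X) i = (\<Sum>l\<le>k. c l * (\<Sum>j\<le>l. (-1) ^ j * real (l choose j) * vv_coord \<psi> X i j (l - j))))"
  proof (cases "\<exists>\<theta> :: real \<Rightarrow> 'a. inj \<theta>")
    case True
    then obtain \<theta> :: "real \<Rightarrow> 'a" where \<theta>: "inj \<theta>" ..
    obtain \<iota> :: "(nat \<Rightarrow> real) \<Rightarrow> real" where \<iota>: "inj_on \<iota> (topspace (Euclidean_space (Suc (Suc k * Suc k))))"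
      using ex_inj_Euclidean_space by blast
    interpret universal_vector "Suc k * Suc k" "\<theta> \<circ> \<iota>" k
    proof
      show "inj_on (\<theta> \<circ> \<iota>) (topspace (Euclidean_space (Suc (Suc k * Suc k))))"
        by (rule comp_inj_on[OF \<iota>]) (rule inj_on_subset[OF \<theta> subset_UNIV])
    qed (rule refl)
    show ?thesis
    \<comment> \<open>These coefficients are read off from \<open>F\<close> on the model, so they
      involve neither \<open>E\<close> nor \<open>X\<close>.\<close>
    proof (intro exI[of _ "coeff F 0"] ballI conjI allI impI; (elim conjE)?)
      fix X assume X: "X \<in> semihol_set k E"
      obtain U x \<psi> where U: "rep (semihol_proj k E X) 0 \<in> U" and ch: "vb_chart E U x \<psi>"
        by (rule vector_bundle_chart[OF E semihol_base_pts[OF E X]])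
      show "F E X \<in> over E {rep (semihol_proj k E X) 0}" by (rule F_coord(1)[OF F E X ch U])
    qed (rule F_coord(2)[OF F E]; assumption)
  next
    case False
    have "mdim (total E) = 0" if X: "X \<in> semihol_set k E" for X
    proof (rule ccontr)
      assume "mdim (total E) \<noteq> 0"
      then have n: "mdim (total E) > 0" by simp
      obtain U \<psi> where "(U, \<psi>) \<in> atlas (total E)" "vv_base X \<in> U"
        by (rule ptsE[OF vv_base_pts[OF semihol_setD(1)[OF E X]]])
      from chart_inj_real[OF smooth_atlasD[OF bb(1) this(1)] this(2) n] False show False by contradiction
    qed
    \<comment> \<open>In dimension 0 there are no fibre coordinates and the formula says nothing;
      any coefficients would do, and 0 is taken.\<close>
    then show ?thesis using F_mdim_0[OF F E] by (intro exI[of _ "\<lambda>_. 0"]) auto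
  qed
next
  note F = assms(1) and E = assms(2)
  fix c :: "nat \<Rightarrow> real"
  assume c: "\<forall>X \<in> semihol_set k E. F E X \<in> over E {rep (semihol_proj k E X) 0} \<and>
    (\<forall>U x \<psi> i. vb_chart E U x \<psi> \<and> rep (semihol_proj k E X) 0 \<in> U \<and> mdim (base E) \<le> i \<and> i < mdim (total E) \<longrightarrow>
      \<psi> (F E X) i = (\<Sum>l\<le>k. c l * (\<Sum>j\<le>l. (-1) ^ j * real (l choose j) * vv_coord \<psi> X i j (l - j))))"
  show "\<exists>c :: nat \<Rightarrow> real. \<forall>X \<in> pts (total (semihol k E)).
    F E X = fibre_sum E (\<lambda>l. vscale E (c l) (Upsilon l E (trunc2 l l (total E) X))) k"
    unfolding pts_semihol[OF E]
  proof (intro exI[of _ c] ballI)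
    fix X assume X: "X \<in> semihol_set k E"
    note c = bspec[OF c X]
    obtain U x \<psi> where U: "rep (semihol_proj k E X) 0 \<in> U" and ch: "vb_chart E U x \<psi>"
      by (rule vector_bundle_chart[OF E semihol_base_pts[OF E X]])
    note R = Upsilon_combination_coord[where r = c, OF E X ch U]
    show "F E X = fibre_sum E (\<lambda>l. vscale E (c l) (Upsilon l E (trunc2 l l (total E) X))) k"
    proof (rule fibre_eqI[OF E ch U conjunct1[OF c] R(1)])
      fix i assume i: "mdim (base E) \<le> i" "i < mdim (total E)"
      show "\<psi> (F E X) i = \<psi> (fibre_sum E (\<lambda>l. vscale E (c l) (Upsilon l E (trunc2 l l (total E) X))) k) i"
        unfolding R(2)[OF i] by (rule conjunct2[OF c, rule_format, OF conjI[OF ch conjI[OF U conjI[OF i]]]])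
    qed
  qed
qed

end
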